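(* Let $\xi$ be a non-arithmetic real Lévy process with no positive jumps, with $0<m:=\mathbb{E}(\xi_1)\le\mathbb{E}|\xi_1|<\infty$; let $X^{(x)}$, $x\ge0$, be the associated positive self-similar Markov process (index $1$) started from $x$, and let $J^{(x)}_t=\inf_{s\ge t}X^{(x)}_s$ be its future infimum. Suppose that $\limsup_{t\to0}\frac{X^{(0)}_t}{\Lambda(t)}=1$ almost surely, where $\Lambda$ is a positive function such that $\Lambda(0)=0$. Then $$\limsup_{t\to0}\frac{J^{(0)}_t}{\Lambda(t)}=1\quad\text{and}\quad\limsup_{t\to0}\frac{X^{(0)}_t-J^{(0)}_t}{\Lambda(t)}=1\quad\text{almost surely.}$$ Moreover, if for all $x\ge0$, $\limsup_{t\to+\infty}\frac{X^{(x)}_t}{\Lambda(t)}=1$ almost surely, where $\Lambda$ is a positive function such that $\lim_{t\to+\infty}\Lambda(t)=+\infty$, then for all $x\ge0$ $$\limsup_{t\to+\infty}\frac{J^{(x)}_t}{\Lambda(t)}=1\quad\text{and}\quad\limsup_{t\to+\infty}\frac{X^{(x)}_t-J^{(x)}_t}{\Lambda(t)}=1\quad\text{almost surely.}$$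
   Context: Lamperti representation (index 1): for $x>0$, $X^{(x)}_t=x\exp\{\xi_{\tau(t/x)}\}$, $t\ge0$, where $\tau(t)=\inf\{s\ge0: I_s(\xi)>t\}$ and $I_s(\xi)=\int_0^s e^{\xi_u}du$. Here $\xi_0=0$. Under the stated assumptions on $\xi$, $X^{(x)}$ converges weakly on the Skorokhod space of càdlàg paths as $x\downarrow0$; the limit is denoted $X^{(0)}$. It is a Feller process on $[0,\infty)$ started from $0$, with the same transition function as $X^{(x)}$, $x>0$, and satisfies the scaling property $(kX^{(0)}_{t/k})_{t\ge0}\overset{(d)}{=}(X^{(0)}_t)_{t\ge0}$ for $k>0$.
   Formalization: The two claims about X−J are stated only when ξ is not a deterministic drift: for ξ_t = mt one has X^(x)_t = x+mt = J^(x)_t, so with Λ(t) = mt all assumptions hold but X−J = 0; the claims about J keep this case. *)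

theory Defs
  imports "HOL-Probability.Probability"
begin

text \<open>Time runs through \<open>[0,\<infinity>)\<close>; paths and processes are indexed by all reals and their values at
  negative times are never used.\<close>

definition cadlag :: "(real \<Rightarrow> real) \<Rightarrow> bool" where
  "cadlag w \<longleftrightarrow>
     (\<forall>t\<ge>0. (w \<longlongrightarrow> w t) (at_right t)) \<and> (\<forall>t>0. \<exists>l. (w \<longlongrightarrow> l) (at_left t))"

definition cadlag_process :: "'a measure \<Rightarrow> (real \<Rightarrow> 'a \<Rightarrow> real) \<Rightarrow> bool" where
  "cadlag_process M X \<longleftrightarrow>
     prob_space M \<and> (\<forall>t\<ge>0. X t \<in> borel_measurable M) \<and> (AE \<omega> in M. cadlag (\<lambda>t. X t \<omega>))"

definition levy_process :: "'a measure \<Rightarrow> (real \<Rightarrow> 'a \<Rightarrow> real) \<Rightarrow> bool" where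
  "levy_process M \<xi> \<longleftrightarrow>
     cadlag_process M \<xi> \<and>
     (AE \<omega> in M. \<xi> 0 \<omega> = 0) \<and>
     (\<forall>s\<ge>0. \<forall>t\<ge>0. distr M borel (\<lambda>\<omega>. \<xi> (s + t) \<omega> - \<xi> s \<omega>) = distr M borel (\<xi> t)) \<and>
     (\<forall>(t :: nat \<Rightarrow> real) n. 0 \<le> t 0 \<longrightarrow> mono t \<longrightarrow>
        prob_space.indep_vars M (\<lambda>_. borel) (\<lambda>i \<omega>. \<xi> (t (Suc i)) \<omega> - \<xi> (t i) \<omega>) {..<n})"

definition no_positive_jumps :: "'a measure \<Rightarrow> (real \<Rightarrow> 'a \<Rightarrow> real) \<Rightarrow> bool" where
  "no_positive_jumps M \<xi> \<longleftrightarrow>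
     (AE \<omega> in M. \<forall>t>0. \<xi> t \<omega> \<le> Lim (at_left t) (\<lambda>s. \<xi> s \<omega>))"

definition arithmetic_process :: "'a measure \<Rightarrow> (real \<Rightarrow> 'a \<Rightarrow> real) \<Rightarrow> bool" where
  "arithmetic_process M \<xi> \<longleftrightarrow>
     (\<exists>r>0. \<forall>t\<ge>0. AE \<omega> in M. \<exists>k::int. \<xi> t \<omega> = of_int k * r)"

text \<open>The degenerate case that is usually excluded from the class of Levy processes with no positive
  jumps (Bertoin, Levy Processes, Chapter VII). If \<open>\<xi>\<close> is the drift \<open>m * t\<close>, then the associated
  self-similar process is \<open>x + m * t\<close>, which coincides with its future infimum.\<close>

definition deterministic_drift :: "'a measure \<Rightarrow> (real \<Rightarrow> 'a \<Rightarrow> real) \<Rightarrow> bool" where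
  "deterministic_drift M \<xi> \<longleftrightarrow> (\<exists>c. \<forall>t\<ge>0. AE \<omega> in M. \<xi> t \<omega> = c * t)"

definition exp_functional :: "(real \<Rightarrow> real) \<Rightarrow> real \<Rightarrow> real" where
  "exp_functional w s = (LBINT u:{0..s}. exp (w u))"

text \<open>The set below is nonempty for almost every path of a Levy process with positive mean, since
  then \<open>exp_functional w s\<close> tends to infinity with \<open>s\<close>.\<close>

definition time_change :: "(real \<Rightarrow> real) \<Rightarrow> real \<Rightarrow> real" where
  "time_change w t = Inf {s. 0 \<le> s \<and> exp_functional w s > t}"

definition lamperti :: "(real \<Rightarrow> 'a \<Rightarrow> real) \<Rightarrow> real \<Rightarrow> real \<Rightarrow> 'a \<Rightarrow> real" where
  "lamperti \<xi> x t \<omega> = x * exp (\<xi> (time_change (\<lambda>s. \<xi> s \<omega>) (t / x)) \<omega>)"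

definition future_infimum :: "(real \<Rightarrow> 'a \<Rightarrow> real) \<Rightarrow> real \<Rightarrow> 'a \<Rightarrow> real" where
  "future_infimum X t \<omega> = (INF s\<in>{t..}. X s \<omega>)"

text \<open>Convergence of sequences in the Skorokhod (J1) topology on the cadlag paths over \<open>[0,\<infinity>)\<close>, in the
  form of Jacod and Shiryaev, Theorem VI.1.14. A strictly increasing map of \<open>[0,\<infinity>)\<close> onto itself is a
  homeomorphism. The topology is metrizable, so continuity of a functional is sequential
  continuity; a continuous functional in particular ignores values at negative times.\<close>

definition skorokhod_tendsto :: "(nat \<Rightarrow> real \<Rightarrow> real) \<Rightarrow> (real \<Rightarrow> real) \<Rightarrow> bool" where
  "skorokhod_tendsto w v \<longleftrightarrow>
     (\<exists>\<theta> :: nat \<Rightarrow> real \<Rightarrow> real.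
        (\<forall>n. strict_mono_on {0..} (\<theta> n) \<and> \<theta> n ` {0..} = {0..}) \<and>
        uniform_limit {0..} \<theta> (\<lambda>s. s) sequentially \<and>
        (\<forall>T. uniform_limit {0..T} (\<lambda>n s. w n (\<theta> n s)) v sequentially))"

definition skorokhod_continuous :: "((real \<Rightarrow> real) \<Rightarrow> real) \<Rightarrow> bool" where
  "skorokhod_continuous F \<longleftrightarrow>
     (\<forall>w v. (\<forall>n. cadlag (w n)) \<longrightarrow> cadlag v \<longrightarrow> skorokhod_tendsto w v \<longrightarrow>
        (\<lambda>n. F (w n)) \<longlonglongrightarrow> F v)"

text \<open>Weak convergence on the Skorokhod space of a family of processes, along the filter \<open>G\<close>, to a
  process on a possibly different probability space. Expectations are taken with respect to the
  completed measures because the paths are cadlag only almost surely, and a functional is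
  unconstrained on paths that are not cadlag; on the cadlag paths, continuous functionals are
  measurable for the sigma-algebra generated by the coordinates.\<close>

definition skorokhod_weak_limit ::
  "'a measure \<Rightarrow> ('i \<Rightarrow> real \<Rightarrow> 'a \<Rightarrow> real) \<Rightarrow> 'i filter \<Rightarrow> 'b measure \<Rightarrow> (real \<Rightarrow> 'b \<Rightarrow> real) \<Rightarrow> bool"
where
  "skorokhod_weak_limit M Y G N Z \<longleftrightarrow>
     (\<forall>F. skorokhod_continuous F \<longrightarrow> bounded (range F) \<longrightarrow>
        ((\<lambda>i. \<integral>\<omega>. F (\<lambda>t. Y i t \<omega>) \<partial>completion M) \<longlongrightarrow>
           (\<integral>\<omega>. F (\<lambda>t. Z t \<omega>) \<partial>completion N)) G)"

end

theory Submission
  imports Defs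
begin

text \<open>If \<open>X s \<ge> a * X t\<close> for all \<open>s \<ge> t\<close>, then \<open>J t \<ge> a * X t\<close>, and if some \<open>X s\<close>, \<open>s \<ge> t\<close>, is below
  \<open>a * X t\<close>, then \<open>X t - J t \<ge> (1 - a) * X t\<close>. In the Lamperti representation both events concern the
  increments of \<open>\<xi>\<close> after a stopping time, so their conditional probabilities given the past are bounded
  below: the first for every \<open>a < 1\<close>, because the drift of \<open>\<xi>\<close> is positive, and the second for every
  \<open>a > 0\<close>, because without positive jumps a Levy process that never becomes negative is a drift. These
  bounds are inherited by the weak limit \<open>X0\<close>. By assumption there are times \<open>t\<close> with
  \<open>X t > (1 - e) * \<Lambda> t\<close> arbitrarily late, respectively arbitrarily early. Stopping at the first such time
  within a finite set shows that the event also happens at such a time with conditional probability bounded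
  below, hence almost surely infinitely often. Now let \<open>a\<close> tend to 1, respectively to 0.\<close>

section \<open>Right-continuous paths and hitting probabilities\<close>

text \<open>The obstacle is \<open>X0\<close>: it is given only as a weak limit on another
  probability space, without a Lamperti representation, and evaluation at a fixed time is not
  Skorokhod continuous. Conditional information is therefore kept in the form
  \<open>c * P(C) \<le> P(C \<inter> G)\<close> for all events \<open>C\<close> of the past up to
  \<open>t\<close>. Such inequalities can be tested with continuous functionals and survive limits,
  and an event that keeps a fixed proportion of every past event has probability 1. The event
  \<open>G\<close> is written as the zero set of a functional \<open>defect\<close>, built from an
  integral over a time window whose length is proportional to the present value. This is the unit of
  time dictated by self-similarity of index 1, and it makes \<open>c\<close> a probability about
  \<xi> that does not involve the starting point \<open>x\<close>. Since \<Lambda> is arbitrary, a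
  countable set of times is constructed on which \<Lambda> is approximated from the right; all
  events then become countable unions. The null sets on which paths are irregular are removed at the
  end, by passing to modifications.\<close>

definition right_cont_path :: "(real \<Rightarrow> real) \<Rightarrow> bool" where
  "right_cont_path w \<longleftrightarrow> (\<forall>t\<ge>0. (w \<longlongrightarrow> w t) (at_right t))"

lemma right_cont_pathD: "right_cont_path w \<Longrightarrow> 0 \<le> t \<Longrightarrow> (w \<longlongrightarrow> w t) (at_right t)"
  by (simp add: right_cont_path_def)

lemma cadlag_imp_right_cont_path: "cadlag w \<Longrightarrow> right_cont_path w"
  by (simp add: right_cont_path_def cadlag_def)

lemma right_cont_path_sequentially:
  assumes "right_cont_path w" "0 \<le> t" "\<And>n. t < s n" "s \<longlonglongrightarrow> t"
  shows "(\<lambda>n. w (s n)) \<longlonglongrightarrow> w t"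
proof -
  have "filterlim s (at_right t) sequentially"
    using assms(3,4) by (auto simp: filterlim_at less_imp_neq[THEN not_sym] intro!: always_eventually)
  from filterlim_compose[OF right_cont_pathD[OF assms(1,2)] this] show ?thesis .
qed

text \<open>Bisection: boundedness passes to adjoining intervals, and it holds near every point
  because both one-sided limits exist. The left end \<open>max 0 a\<close> cuts off negative times,
  at which a path is unconstrained.\<close>

lemma cadlag_bounded_on:
  assumes "cadlag w" and "0 \<le> T"
  shows "\<exists>B. \<forall>t\<in>{0..T}. \<bar>w t\<bar> \<le> B"
proof -
  have "\<exists>B. \<forall>t\<in>{max 0 0..T}. \<bar>w t\<bar> \<le> B"
    using \<open>0 \<le> T\<close>
  proof (induction rule: Bolzano[where P="\<lambda>a b. \<exists>B. \<forall>t\<in>{max 0 a..b}. \<bar>w t\<bar> \<le> B"])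
    case (trans a b c)
    then obtain B1 B2 where B: "\<forall>t\<in>{max 0 a..b}. \<bar>w t\<bar> \<le> B1" "\<forall>t\<in>{max 0 b..c}. \<bar>w t\<bar> \<le> B2"
      by blast
    have "\<bar>w t\<bar> \<le> max B1 B2" if "t \<in> {max 0 a..c}" for t
      using B[rule_format, of t] that by (cases "t \<le> b") (auto simp: le_max_iff_disj)
    then show ?case by blast
  next
    case (local x)
    have "(w \<longlongrightarrow> w x) (at_right x)"
      using assms(1) local by (auto simp: cadlag_def)
    then have "eventually (\<lambda>s. dist (w s) (w x) < 1) (at_right x)"
      by (rule tendstoD) simp
    then obtain u where u: "u > x" "\<And>s. x < s \<Longrightarrow> s < u \<Longrightarrow> dist (w s) (w x) < 1"
      by (auto simp: eventually_at_right_field)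
    obtain l B where l: "l < x" "\<And>s. 0 \<le> s \<Longrightarrow> l < s \<Longrightarrow> s < x \<Longrightarrow> \<bar>w s\<bar> \<le> B"
    proof (cases "x > 0")
      case True
      then obtain c where "(w \<longlongrightarrow> c) (at_left x)"
        using assms(1) by (auto simp: cadlag_def)
      then have "eventually (\<lambda>s. dist (w s) c < 1) (at_left x)"
        by (rule tendstoD) simp
      then obtain l where "l < x" "\<And>s. l < s \<Longrightarrow> s < x \<Longrightarrow> dist (w s) c < 1"
        by (auto simp: eventually_at_left_field)
      then show ?thesis
        by (intro that[of l "\<bar>c\<bar> + 1"]) (fastforce simp: dist_real_def)+
    next
      case False
      then show ?thesis by (intro that[of "x - 1" 0]) auto
    qed
    show ?case
    proof (rule exI[of _ "min (u - x) (x - l)"], intro conjI allI impI)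
      fix a b assume ab: "a \<le> x \<and> x \<le> b \<and> b - a < min (u - x) (x - l)"
      have "\<bar>w t\<bar> \<le> max B (\<bar>w x\<bar> + 1)" if t: "t \<in> {max 0 a..b}" for t
      proof -
        consider "t < x" | "t = x" | "t > x" by linarith
        then show ?thesis
        proof cases
          case 1
          then have "\<bar>w t\<bar> \<le> B" using l(2)[of t] t ab by auto
          then show ?thesis by simp
        next
          case 3
          then have "dist (w t) (w x) < 1" using u(2)[of t] t ab by auto
          then show ?thesis by (auto simp: dist_real_def)
        qed auto
      qed
      then show "\<exists>B. \<forall>t\<in>{max 0 a..b}. \<bar>w t\<bar> \<le> B" by blast
    qed (use u l in auto)
  qed
  then show ?thesis by simp
qed

text \<open>Jumps above a fixed size are isolated from the right, since just after each time the
  path is nearly constant. Choosing for each such time \<open>t\<close> a rational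
  \<open>q t > t\<close> with no further large jump in between is injective.\<close>

lemma cadlag_countable_discontinuities:
  assumes "cadlag w"
  shows "countable {t. 0 < t \<and> \<not> isCont w t}"
proof -
  define D where "D k = {t. 0 < t \<and> (\<exists>l. (w \<longlongrightarrow> l) (at_left t) \<and> \<bar>w t - l\<bar> > 1 / real (Suc k))}" for k
  have cD: "countable (D k)" for k
  proof -
    \<comment> \<open>The value and the left limit at a later time \<open>s\<close> both lie within
      \<open>e\<close> of \<open>w t\<close>, so the jump at \<open>s\<close> is at most
      \<open>2 * e\<close>, half of the threshold \<open>1 / real (Suc k)\<close>.\<close>
    define e where "e = 1 / (4 * real (Suc k))"
    have e: "e > 0" by (simp add: e_def)
    have "\<exists>q\<in>\<rat>. q > t \<and> (\<forall>s. t < s \<and> s < q \<longrightarrow> s \<notin> D k)" if "t \<in> D k" for t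
    proof -
      have "(w \<longlongrightarrow> w t) (at_right t)"
        using assms that by (auto simp: cadlag_def D_def)
      then have "eventually (\<lambda>s. dist (w s) (w t) < e) (at_right t)"
        by (rule tendstoD) (rule e)
      then obtain u where u: "u > t" "\<And>s. t < s \<Longrightarrow> s < u \<Longrightarrow> dist (w s) (w t) < e"
        by (auto simp: eventually_at_right_field)
      obtain q where q: "q \<in> \<rat>" "t < q" "q < u"
        using Rats_dense_in_real[OF u(1)] by blast
      have "s \<notin> D k" if s: "t < s" "s < q" for s
      proof
        assume "s \<in> D k"
        then obtain l where l: "(w \<longlongrightarrow> l) (at_left s)" "\<bar>w s - l\<bar> > 1 / real (Suc k)"
          by (auto simp: D_def)
        have "eventually (\<lambda>r. \<bar>w r - w t\<bar> \<le> e) (at_left s)"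
          unfolding eventually_at_left_field
          using u(2) s q by (intro exI[of _ t]) (force simp: dist_real_def)
        moreover have "((\<lambda>r. \<bar>w r - w t\<bar>) \<longlongrightarrow> \<bar>l - w t\<bar>) (at_left s)"
          by (intro tendsto_intros l)
        ultimately have "\<bar>l - w t\<bar> \<le> e"
          by (intro tendsto_upperbound[where F="at_left s"]) auto
        moreover have "\<bar>w s - w t\<bar> < e"
          using u(2)[of s] s q by (auto simp: dist_real_def)
        ultimately have "\<bar>w s - l\<bar> \<le> 2 * e" by linarith
        also have "\<dots> \<le> 1 / real (Suc k)" by (simp add: e_def field_simps)
        finally show False using l(2) by simp
      qed
      then show ?thesis using q by blast
    qed
    then obtain q where q: "\<And>t. t \<in> D k \<Longrightarrow> q t \<in> \<rat>" "\<And>t. t \<in> D k \<Longrightarrow> q t > t"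
      "\<And>t s. t \<in> D k \<Longrightarrow> t < s \<Longrightarrow> s < q t \<Longrightarrow> s \<notin> D k"
      by metis
    have "inj_on q (D k)"
    proof (rule linorder_inj_onI')
      fix s t assume "s \<in> D k" "t \<in> D k" "s < t"
      then have "\<not> t < q s" using q(3) by blast
      then show "q s \<noteq> q t" using q(2)[OF \<open>t \<in> D k\<close>] by simp
    qed
    moreover have "countable (q ` D k)"
      by (rule countable_subset[OF _ countable_rat]) (use q(1) in auto)
    ultimately show ?thesis by (rule countable_image_inj_on[rotated])
  qed
  have "{t. 0 < t \<and> \<not> isCont w t} \<subseteq> (\<Union>k. D k)"
  proof safe
    fix t assume t: "0 < t" "\<not> isCont w t"
    obtain l where l: "(w \<longlongrightarrow> l) (at_left t)" using assms t by (auto simp: cadlag_def)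
    have "(w \<longlongrightarrow> w t) (at_right t)" using assms t by (auto simp: cadlag_def)
    then have "l \<noteq> w t"
      using t l filterlim_split_at[of w "nhds (w t)" t] by (auto simp: isCont_def)
    then obtain k where "inverse (real (Suc k)) < \<bar>w t - l\<bar>"
      using reals_Archimedean[of "\<bar>w t - l\<bar>"] by auto
    then show "t \<in> (\<Union>k. D k)" using t l by (auto simp: D_def inverse_eq_divide)
  qed
  then show ?thesis by (rule countable_subset) (use cD in blast)
qed

text \<open>Skorokhod convergence is uniform only after a change of time. Pulling the times
  \<open>r n\<close> back through \<open>\<theta> n\<close> gives times \<open>\<sigma> n\<close>
  that still tend to \<open>s\<close>, and continuity of the limit at \<open>s\<close> absorbs the
  displacement.\<close>

lemma skorokhod_tendsto_at_isCont:
  assumes conv: "skorokhod_tendsto w v" and cont: "isCont v s" and "0 < s" and r: "r \<longlonglongrightarrow> s"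
  shows "(\<lambda>n. w n (r n)) \<longlonglongrightarrow> v s"
proof -
  obtain \<theta> :: "nat \<Rightarrow> real \<Rightarrow> real" where
    \<theta>: "\<And>n. \<theta> n ` {0..} = {0..}"
    and u1: "uniform_limit {0..} \<theta> (\<lambda>s. s) sequentially"
    and u2: "\<And>T. uniform_limit {0..T} (\<lambda>n s. w n (\<theta> n s)) v sequentially"
    using conv by (auto simp: skorokhod_tendsto_def)
  \<comment> \<open>\<open>\<theta> n\<close> maps onto \<open>{0..}\<close> only; the truncation
    \<open>max 0 (r n)\<close> is harmless because \<open>r n\<close> is eventually
    positive.\<close>
  define \<sigma> where "\<sigma> n = (SOME u. 0 \<le> u \<and> \<theta> n u = max 0 (r n))" for n
  have "\<exists>u. 0 \<le> u \<and> \<theta> n u = max 0 (r n)" for n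
  proof -
    have "max 0 (r n) \<in> \<theta> n ` {0..}" using \<theta>[of n] by auto
    then show ?thesis by auto
  qed
  then have \<sigma>: "0 \<le> \<sigma> n" "\<theta> n (\<sigma> n) = max 0 (r n)" for n
    by (metis (mono_tags, lifting) \<sigma>_def someI_ex)+
  have r0: "eventually (\<lambda>n. 0 < r n) sequentially"
    using order_tendstoD(1)[OF r \<open>0 < s\<close>] .
  have d: "(\<lambda>n. dist (\<theta> n (\<sigma> n)) (\<sigma> n)) \<longlonglongrightarrow> 0"
  proof (rule tendstoI)
    fix e :: real assume "0 < e"
    then have "eventually (\<lambda>n. \<forall>x\<in>{0..}. dist (\<theta> n x) x < e) sequentially"
      by (rule uniform_limitD[OF u1])
    then show "eventually (\<lambda>n. dist (dist (\<theta> n (\<sigma> n)) (\<sigma> n)) 0 < e) sequentially"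
    proof eventually_elim
      case (elim n)
      then have "dist (\<theta> n (\<sigma> n)) (\<sigma> n) < e" using \<sigma>(1)[of n] by blast
      then show ?case by (simp add: dist_real_def)
    qed
  qed
  have m: "(\<lambda>n. max 0 (r n)) \<longlonglongrightarrow> s"
    using tendsto_max[OF tendsto_const[of 0] r] \<open>0 < s\<close> by (simp add: max_def)
  have "(\<lambda>n. \<theta> n (\<sigma> n) - \<sigma> n) \<longlonglongrightarrow> 0"
    using d by (simp add: dist_real_def tendsto_rabs_zero_iff)
  from tendsto_diff[OF m this] have \<sigma>s: "\<sigma> \<longlonglongrightarrow> s" by (simp add: \<sigma>)
  have v: "(\<lambda>n. v (\<sigma> n)) \<longlonglongrightarrow> v s"
    by (rule isCont_tendsto_compose[OF cont \<sigma>s])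
  have "(\<lambda>n. dist (w n (\<theta> n (\<sigma> n))) (v (\<sigma> n))) \<longlonglongrightarrow> 0"
  proof (rule tendstoI)
    fix e :: real assume "0 < e"
    then have "eventually (\<lambda>n. \<forall>x\<in>{0..s+1}. dist (w n (\<theta> n x)) (v x) < e) sequentially"
      by (rule uniform_limitD[OF u2])
    moreover have "eventually (\<lambda>n. \<sigma> n < s + 1) sequentially"
      by (rule order_tendstoD(2)[OF \<sigma>s]) simp
    ultimately show "eventually (\<lambda>n. dist (dist (w n (\<theta> n (\<sigma> n))) (v (\<sigma> n))) 0 < e) sequentially"
    proof eventually_elim
      case (elim n)
      then have "dist (w n (\<theta> n (\<sigma> n))) (v (\<sigma> n)) < e" using \<sigma>(1)[of n] by auto
      then show ?case by (simp add: dist_real_def)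
    qed
  qed
  then have "(\<lambda>n. w n (\<theta> n (\<sigma> n)) - v (\<sigma> n)) \<longlonglongrightarrow> 0"
    by (simp add: dist_real_def tendsto_rabs_zero_iff)
  from tendsto_add[OF this v] have "(\<lambda>n. w n (\<theta> n (\<sigma> n))) \<longlonglongrightarrow> v s" by simp
  then show ?thesis
    by (rule Lim_transform_eventually) (use r0 in eventually_elim, simp add: \<sigma>)
qed

text \<open>The process is the limit of its values at the grid point strictly to the right of the
  present time, and these approximations depend on time through countably many values. The argument
  \<open>max 0 t\<close> extends the process to all reals.\<close>

lemma right_cont_measurable_pair:
  fixes Y :: "real \<Rightarrow> 'a \<Rightarrow> real"
  assumes meas: "\<And>t. 0 \<le> t \<Longrightarrow> Y t \<in> borel_measurable M"
    and rc: "\<And>\<omega>. \<omega> \<in> space M \<Longrightarrow> right_cont_path (\<lambda>t. Y t \<omega>)"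
  shows "(\<lambda>(t::real, \<omega>). Y (max 0 t) \<omega>) \<in> borel_measurable (borel \<Otimes>\<^sub>M M)"
proof (rule borel_measurable_LIMSEQ_real)
  define u where "u n t = (real_of_int \<lfloor>real (Suc n) * max 0 t\<rfloor> + 1) / real (Suc n)" for n :: nat and t :: real
  fix x assume x: "x \<in> space ((borel :: real measure) \<Otimes>\<^sub>M M)"
  obtain t \<omega> where [simp]: "x = (t, \<omega>)" and \<omega>: "\<omega> \<in> space M"
    using x by (cases x) (auto simp: space_pair_measure)
  have u1: "max 0 t < u n t" "u n t \<le> max 0 t + inverse (real (Suc n))" for n
  proof -
    define y where "y = real (Suc n) * max 0 t"
    have m: "max 0 t = y / real (Suc n)" by (simp add: y_def)
    have "y < real_of_int \<lfloor>y\<rfloor> + 1" "real_of_int \<lfloor>y\<rfloor> + 1 \<le> y + 1" by linarith+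
    then have "y / real (Suc n) < (real_of_int \<lfloor>y\<rfloor> + 1) / real (Suc n)"
      "(real_of_int \<lfloor>y\<rfloor> + 1) / real (Suc n) \<le> (y + 1) / real (Suc n)"
      by (intro divide_strict_right_mono divide_right_mono; simp)+
    then show "max 0 t < u n t" "u n t \<le> max 0 t + inverse (real (Suc n))"
      unfolding u_def y_def[symmetric] by (simp_all add: m add_divide_distrib inverse_eq_divide)
  qed
  have "(\<lambda>n. u n t) \<longlonglongrightarrow> max 0 t"
  proof (rule tendsto_sandwich[OF _ _ tendsto_const])
    show "(\<lambda>n. max 0 t + inverse (real (Suc n))) \<longlonglongrightarrow> max 0 t"
      using tendsto_add[OF tendsto_const[of "max 0 t"] LIMSEQ_inverse_real_of_nat] by simp
  qed (use u1 in \<open>auto simp: less_imp_le intro!: always_eventually\<close>)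
  then have "(\<lambda>n. Y (u n t) \<omega>) \<longlonglongrightarrow> Y (max 0 t) \<omega>"
    by (intro right_cont_path_sequentially[OF rc[OF \<omega>]] u1) auto
  then show "(\<lambda>n. (\<lambda>(t, \<omega>). Y (u n t) \<omega>) x) \<longlonglongrightarrow> (case x of (t, \<omega>) \<Rightarrow> Y (max 0 t) \<omega>)"
    by simp
next
  fix n :: nat
  let ?B = "(borel :: real measure) \<Otimes>\<^sub>M M"
  have "(\<lambda>x. Y (max 0 (real_of_int \<lfloor>real (Suc n) * max 0 (fst x)\<rfloor> + 1) / real (Suc n)) (snd x)) \<in> borel_measurable ?B"
  proof (rule measurable_compose_countable[where g="\<lambda>x. \<lfloor>real (Suc n) * max 0 (fst x)\<rfloor>"
        and f="\<lambda>i x. Y (max 0 (real_of_int i + 1) / real (Suc n)) (snd x)"])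
    show "(\<lambda>x. Y (max 0 (real_of_int i + 1) / real (Suc n)) (snd x)) \<in> borel_measurable ?B" for i
      by (rule measurable_compose[OF measurable_snd meas]) auto
  qed measurable
  moreover have "max 0 (real_of_int \<lfloor>real (Suc n) * max 0 t\<rfloor> + 1) = real_of_int \<lfloor>real (Suc n) * max 0 t\<rfloor> + 1" for t
  proof -
    have "0 \<le> \<lfloor>real (Suc n) * max 0 t\<rfloor>" by simp
    then show ?thesis by linarith
  qed
  ultimately show "(\<lambda>(t, \<omega>). Y ((real_of_int \<lfloor>real (Suc n) * max 0 t\<rfloor> + 1) / real (Suc n)) \<omega>)
      \<in> borel_measurable (borel \<Otimes>\<^sub>M M)"
    by (simp add: case_prod_unfold)
qed

text \<open>A single path is a process on a one-point space.\<close>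

lemma right_cont_path_measurable:
  assumes "right_cont_path w"
  shows "(\<lambda>t::real. w (max 0 t)) \<in> borel_measurable borel"
proof -
  have "(\<lambda>(t::real, \<omega>). (\<lambda>t _. w t) (max 0 t) \<omega>) \<in> borel_measurable (borel \<Otimes>\<^sub>M (count_space UNIV :: unit measure))"
    by (rule right_cont_measurable_pair) (use assms in auto)
  from measurable_Pair2[OF this] measurable_Pair1[OF this, of "()"] show ?thesis by simp
qed

section \<open>Approximation of events, and decomposition by the first entry\<close>

context prob_space
begin

text \<open>The events that can be approximated up to a symmetric difference of small probability
  form a sigma-algebra. For a countable union a finite part is approximated, and finitely many
  approximants lie in one common \<open>F n\<close> because the sequence is increasing.\<close>

lemma approx_by_union_of_algebras:
  assumes sub: "\<And>n :: nat. subalgebra M (F n)"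
    and mono: "\<And>m n. m \<le> n \<Longrightarrow> sets (F m) \<subseteq> sets (F n)"
    and B: "B \<in> sigma_sets (space M) (\<Union>n. sets (F n))" and "0 < e"
  shows "\<exists>n. \<exists>C\<in>sets (F n). prob ((B - C) \<union> (C - B)) < e"
  using B \<open>0 < e\<close>
proof (induction arbitrary: e rule: sigma_sets.induct)
  case (Basic a)
  then show ?case by (auto intro!: exI[of _ a] bexI[of _ a])
next
  case Empty
  then show ?case by (auto intro!: exI[of _ "{}"] bexI[of _ "{}"])
next
  case (Compl a)
  then obtain n C where C: "C \<in> sets (F n)" "prob ((a - C) \<union> (C - a)) < e" by blast
  have sp: "space (F n) = space M" using sub by (simp add: subalgebra_def)
  have "C \<subseteq> space M" using sets.sets_into_space[OF C(1)] sp by simp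
  moreover have "a \<subseteq> space M"
    using Compl(1) by (rule sigma_sets_into_sp[rotated])
      (use sub sets.sets_into_space in \<open>fastforce simp: subalgebra_def\<close>)
  ultimately have "(space M - a) - (space M - C) \<union> ((space M - C) - (space M - a)) = (a - C) \<union> (C - a)"
    by blast
  then show ?case
    using C sets.compl_sets[OF C(1)] sp by (intro exI[of _ n] bexI[of _ "space M - C"]) auto
next
  case (Union a)
  have Fm: "sets (F n) \<subseteq> events" for n using sub by (simp add: subalgebra_def)
  have am: "a i \<in> events" for i
  proof -
    have "sigma_sets (space M) (\<Union>n. sets (F n)) \<subseteq> events"
      by (rule sets.sigma_sets_subset) (use Fm in auto)
    then show ?thesis using Union(1) by auto
  qed
  have "(\<lambda>n. prob (\<Union>i\<le>n. a i)) \<longlonglongrightarrow> prob (\<Union>n. \<Union>i\<le>n. a i)"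
    by (rule finite_Lim_measure_incseq) (use am in \<open>force simp: incseq_def\<close>)+
  also have "(\<Union>n. \<Union>i\<le>n. a i) = (\<Union>i. a i)" by auto
  finally have "eventually (\<lambda>n. prob (\<Union>i. a i) - e / 2 < prob (\<Union>i\<le>n. a i)) sequentially"
    by (rule order_tendstoD) (use Union.prems in simp)
  then obtain k where k: "prob (\<Union>i. a i) - e / 2 < prob (\<Union>i\<le>k. a i)"
    by (auto simp: eventually_sequentially)
  \<comment> \<open>The tail of the union costs \<open>e / 2\<close>; each of the
    \<open>Suc k\<close> remaining pieces may cost \<open>h\<close>, again \<open>e / 2\<close> in
    total.\<close>
  define h where "h = e / (2 * real (Suc k))"
  have h: "0 < h" using Union.prems by (simp add: h_def)
  from Union.IH[OF h] obtain m C where C: "\<And>i. C i \<in> sets (F (m i))"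
    "\<And>i. prob ((a i - C i) \<union> (C i - a i)) < h" by metis
  define n where "n = Max (m ` {..k})"
  have "C i \<in> sets (F n)" if "i \<le> k" for i
    using C(1)[of i] mono[of "m i" n] that by (auto simp: n_def)
  then have CU: "(\<Union>i\<le>k. C i) \<in> sets (F n)" by auto
  have Cm: "C i \<in> events" for i using C(1) Fm by auto
  let ?D = "\<lambda>i. (a i - C i) \<union> (C i - a i)"
  have "prob (((\<Union>i. a i) - (\<Union>i\<le>k. C i)) \<union> ((\<Union>i\<le>k. C i) - (\<Union>i. a i)))
      \<le> prob (((\<Union>i. a i) - (\<Union>i\<le>k. a i)) \<union> (\<Union>i\<le>k. ?D i))"
    by (rule finite_measure_mono) (use am Cm in auto)
  also have "\<dots> \<le> prob ((\<Union>i. a i) - (\<Union>i\<le>k. a i)) + prob (\<Union>i\<le>k. ?D i)"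
    by (rule measure_Un_le) (use am Cm in auto)
  also have "prob ((\<Union>i. a i) - (\<Union>i\<le>k. a i)) = prob (\<Union>i. a i) - prob (\<Union>i\<le>k. a i)"
    by (rule finite_measure_Diff) (use am in auto)
  also have "prob (\<Union>i\<le>k. ?D i) \<le> (\<Sum>i\<le>k. prob (?D i))"
    by (rule finite_measure_subadditive_finite) (use am Cm in auto)
  also have "(\<Sum>i\<le>k. prob (?D i)) \<le> (\<Sum>i\<le>k. h)"
    by (rule sum_mono) (use C(2) in \<open>simp add: less_imp_le\<close>)
  also have "\<dots> = e / 2" by (simp add: h_def field_simps)
  finally have "prob (((\<Union>i. a i) - (\<Union>i\<le>k. C i)) \<union> ((\<Union>i\<le>k. C i) - (\<Union>i. a i))) < e"
    using k by linarith
  then show ?case using CU by blast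
qed

text \<open>An elementary substitute for Levy's upward 0-1 law: apply the hypothesis to approximations
  of the complement of \<open>B\<close>.\<close>

lemma prob_eq_1_if_prob_Int_ge:
  assumes sub: "\<And>n :: nat. subalgebra M (F n)"
    and mono: "\<And>m n. m \<le> n \<Longrightarrow> sets (F m) \<subseteq> sets (F n)"
    and B: "B \<in> sigma_sets (space M) (\<Union>n. sets (F n))"
    and "0 < c" and ge: "\<And>n C. C \<in> sets (F n) \<Longrightarrow> c * prob C \<le> prob (B \<inter> C)"
  shows "prob B = 1"
proof -
  have Fm: "sets (F n) \<subseteq> events" for n using sub by (simp add: subalgebra_def)
  have "sigma_sets (space M) (\<Union>n. sets (F n)) \<subseteq> events"
    by (rule sets.sigma_sets_subset) (use Fm in auto)
  then have Bm: "B \<in> events" using B by auto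
  have *: "c * (1 - prob B) \<le> (c + 1) * e" if "0 < e" for e
  proof -
    obtain n C where C: "C \<in> sets (F n)" "prob ((B - C) \<union> (C - B)) < e"
      using approx_by_union_of_algebras[OF sub mono B \<open>0 < e\<close>] by blast
    have sp: "space (F n) = space M" using sub by (simp add: subalgebra_def)
    have C': "space M - C \<in> sets (F n)" using sets.compl_sets[OF C(1)] sp by simp
    have Cm: "C \<in> events" using C Fm by auto
    have "c * prob (space M - C) \<le> prob (B \<inter> (space M - C))" by (rule ge[OF C'])
    also have "\<dots> \<le> prob ((B - C) \<union> (C - B))"
      by (rule finite_measure_mono) (use Bm Cm in auto)
    finally have 1: "c * (1 - prob C) \<le> e" using C(2) prob_compl[OF Cm] by simp
    have "prob C \<le> prob (B \<union> ((B - C) \<union> (C - B)))"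
      by (rule finite_measure_mono) (use Bm Cm in auto)
    also have "\<dots> \<le> prob B + prob ((B - C) \<union> (C - B))"
      by (rule measure_Un_le) (use Bm Cm in auto)
    finally have "prob C \<le> prob B + e" using C(2) by simp
    then have "c * prob C \<le> c * (prob B + e)"
      using \<open>0 < c\<close> by (intro mult_left_mono) auto
    with 1 show ?thesis by (simp add: algebra_simps)
  qed
  have le: "c * (1 - prob B) \<le> 0 + e" if "0 < e" for e
    using *[of "e / (c + 1)"] that \<open>0 < c\<close> by simp
  have "c * (1 - prob B) \<le> 0"
    using field_le_epsilon[of "c * (1 - prob B)" 0] le by simp
  then have "1 \<le> prob B" using \<open>0 < c\<close> by (simp add: mult_le_0_iff)
  then show ?thesis using prob_le_1[of B] by linarith
qed

text \<open>Splitting by the first index at which \<open>A\<close> occurs gives disjoint events,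
  each known at its own index, to which the lower bound applies separately. A first index is
  guaranteed only in a finite set, and the index sets used later are dense; so finite subsets come
  first and then exhaust \<open>V\<close>.\<close>

lemma prob_first_entry_ge:
  fixes V :: "'t::linorder set"
  assumes V: "countable V"
    and sub: "\<And>v. v \<in> V \<Longrightarrow> subalgebra M (F v)"
    and mono: "\<And>u v. u \<in> V \<Longrightarrow> v \<in> V \<Longrightarrow> u \<le> v \<Longrightarrow> sets (F u) \<subseteq> sets (F v)"
    and A: "\<And>v. v \<in> V \<Longrightarrow> A v \<in> sets (F v)" and G: "\<And>v. v \<in> V \<Longrightarrow> G v \<in> events"
    and ge: "\<And>v C. v \<in> V \<Longrightarrow> C \<in> sets (F v) \<Longrightarrow> c * prob C \<le> prob (C \<inter> G v)"
  shows "c * prob (\<Union>v\<in>V. A v) \<le> prob (\<Union>v\<in>V. A v \<inter> G v)"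
proof -
  have Am: "A v \<in> events" if "v \<in> V" for v
    using A[OF that] sub[OF that] by (auto simp: subalgebra_def)
  have fin: "c * prob (\<Union>v\<in>W. A v) \<le> prob (\<Union>v\<in>W. A v \<inter> G v)" if W: "finite W" "W \<subseteq> V" for W
  proof -
    define C where "C v = A v - (\<Union>u\<in>{u\<in>W. u < v}. A u)" for v
    have CF: "C v \<in> sets (F v)" if "v \<in> W" for v
      unfolding C_def
    proof (intro sets.Diff sets.finite_UN)
      show "A u \<in> sets (F v)" if "u \<in> {u \<in> W. u < v}" for u
        using A[of u] mono[of u v] W \<open>v \<in> W\<close> that by (auto dest: less_imp_le)
    qed (use A W that in auto)
    have Cm: "C v \<in> events" if "v \<in> W" for v
      using CF[OF that] sub[of v] W that by (auto simp: subalgebra_def)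
    have disj: "disjoint_family_on C W"
      unfolding disjoint_family_on_def
    proof (intro ballI impI)
      fix u v assume "u \<in> W" "v \<in> W" "u \<noteq> v"
      then show "C u \<inter> C v = {}" by (cases u v rule: linorder_cases) (auto simp: C_def)
    qed
    have UC: "(\<Union>v\<in>W. A v) = (\<Union>v\<in>W. C v)"
    proof (intro equalityI subsetI)
      fix x assume "x \<in> (\<Union>v\<in>W. A v)"
      then have ne: "{v\<in>W. x \<in> A v} \<noteq> {}" "finite {v\<in>W. x \<in> A v}" using W by auto
      define m where "m = Min {v\<in>W. x \<in> A v}"
      have "m \<in> {v\<in>W. x \<in> A v}" unfolding m_def by (rule Min_in[OF ne(2,1)])
      moreover have "\<not> (u < m \<and> u \<in> W \<and> x \<in> A u)" for u
        using Min_le[OF ne(2), of u] by (auto simp: m_def)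
      ultimately show "x \<in> (\<Union>v\<in>W. C v)" by (auto simp: C_def)
    qed (auto simp: C_def)
    have "c * prob (\<Union>v\<in>W. A v) = (\<Sum>v\<in>W. c * prob (C v))"
      unfolding UC using W disj Cm
      by (subst finite_measure_finite_Union) (auto simp: sum_distrib_left)
    also have "\<dots> \<le> (\<Sum>v\<in>W. prob (C v \<inter> G v))"
      using W CF by (intro sum_mono ge) auto
    also have "\<dots> = prob (\<Union>v\<in>W. C v \<inter> G v)"
      using W Cm G disj by (subst finite_measure_finite_Union) (auto simp: disjoint_family_on_def, blast)
    also have "\<dots> \<le> prob (\<Union>v\<in>W. A v \<inter> G v)"
      using W Am G by (intro finite_measure_mono sets.finite_UN) (auto simp: C_def)
    finally show ?thesis .
  qed
  show ?thesis
  proof (cases "V = {}")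
    case False
    define f where "f = from_nat_into V"
    have f: "range f = V" unfolding f_def using V False by simp
    have lim: "(\<lambda>n. prob (\<Union>v\<in>f`{..n}. H v)) \<longlonglongrightarrow> prob (\<Union>v\<in>V. H v)"
      if H: "\<And>v. v \<in> V \<Longrightarrow> H v \<in> events" for H
    proof -
      have "(\<lambda>n. prob (\<Union>v\<in>f`{..n}. H v)) \<longlonglongrightarrow> prob (\<Union>n. \<Union>v\<in>f`{..n}. H v)"
        by (rule finite_Lim_measure_incseq) (use H f in \<open>force simp: incseq_def\<close>)+
      also have "(\<Union>n. \<Union>v\<in>f`{..n}. H v) = (\<Union>v\<in>V. H v)" using f by fastforce
      finally show ?thesis .
    qed
    show ?thesis
    proof (rule LIMSEQ_le)
      show "(\<lambda>n. c * prob (\<Union>v\<in>f`{..n}. A v)) \<longlonglongrightarrow> c * prob (\<Union>v\<in>V. A v)"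
        by (intro tendsto_mult tendsto_const lim Am)
      show "(\<lambda>n. prob (\<Union>v\<in>f`{..n}. A v \<inter> G v)) \<longlonglongrightarrow> prob (\<Union>v\<in>V. A v \<inter> G v)"
        by (intro lim) (use Am G in auto)
    qed (intro exI[of _ 0] allI impI fin; use f in auto)
  qed simp
qed

end

section \<open>Levy processes\<close>

lemma Collect_in_sets:
  "f \<in> measurable M N \<Longrightarrow> A \<in> sets N \<Longrightarrow> {x \<in> space M. f x \<in> A} \<in> sets M"
  using measurable_sets[of f M N A] by (simp add: vimage_def Int_def conj_commute)

text \<open>The enumeration continues constantly beyond \<open>n\<close>, which makes it monotone on
  all naturals, the form in which independence of increments is assumed.\<close>

lemma finite_real_enum:
  fixes S :: "real set"
  assumes "finite S" "S \<noteq> {}"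
  obtains t :: "nat \<Rightarrow> real" and n where "mono t" "t ` {..n} = S" "t 0 = Min S" "t n = Max S"
proof -
  define xs where "xs = sorted_list_of_set S"
  define n where "n = length xs - 1"
  define t where "t i = xs ! (min i n)" for i
  have xs: "set xs = S" "sorted xs" "xs \<noteq> []" using assms by (auto simp: xs_def)
  then have len: "length xs = Suc n" by (cases xs) (auto simp: n_def)
  have m: "mono t"
    unfolding mono_def t_def using xs len by (auto intro!: sorted_nth_mono)
  have im: "t ` {..n} = S"
  proof -
    have "t ` {..n} = (!) xs ` {..<length xs}"
      unfolding len lessThan_Suc_atMost by (rule image_cong) (auto simp: t_def)
    also have "\<dots> = set xs" by (auto simp: set_conv_nth)
    finally show ?thesis using xs by simp
  qed
  have "t 0 = Min S"
    unfolding im[symmetric] by (rule Min_eqI[symmetric]) (auto intro: monoD[OF m])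
  moreover have "t n = Max S"
    unfolding im[symmetric] by (rule Max_eqI[symmetric]) (auto intro: monoD[OF m])
  ultimately show thesis using that m im by blast
qed

text \<open>The path properties hold here for every outcome; \<open>levy_modification\<close>
  achieves this by redefining the process on a null set.\<close>

locale levy = prob_space M for M :: "'a measure" +
  fixes \<xi> :: "real \<Rightarrow> 'a \<Rightarrow> real"
  assumes xi_measurable: "\<And>t. 0 \<le> t \<Longrightarrow> \<xi> t \<in> borel_measurable M"
    and xi_cadlag: "\<And>\<omega>. \<omega> \<in> space M \<Longrightarrow> cadlag (\<lambda>t. \<xi> t \<omega>)"
    and xi_0: "\<And>\<omega>. \<omega> \<in> space M \<Longrightarrow> \<xi> 0 \<omega> = 0"
    and stationary: "\<And>s t. 0 \<le> s \<Longrightarrow> 0 \<le> t \<Longrightarrow>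
      distr M borel (\<lambda>\<omega>. \<xi> (s + t) \<omega> - \<xi> s \<omega>) = distr M borel (\<xi> t)"
    and indep_increments: "\<And>(t :: nat \<Rightarrow> real) n. 0 \<le> t 0 \<Longrightarrow> mono t \<Longrightarrow>
      indep_vars (\<lambda>_. borel) (\<lambda>i \<omega>. \<xi> (t (Suc i)) \<omega> - \<xi> (t i) \<omega>) {..<n}"
begin

lemma xi_right_cont: "\<omega> \<in> space M \<Longrightarrow> right_cont_path (\<lambda>t. \<xi> t \<omega>)"
  using xi_cadlag cadlag_imp_right_cont_path by blast

lemma increment_measurable: "0 \<le> s \<Longrightarrow> 0 \<le> t \<Longrightarrow> (\<lambda>\<omega>. \<xi> t \<omega> - \<xi> s \<omega>) \<in> borel_measurable M"
  by (intro borel_measurable_diff xi_measurable)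

lemma future_sets:
  assumes "countable V" "V \<subseteq> {0..}" "0 \<le> s" "\<And>v. v \<in> V \<Longrightarrow> B v \<in> sets borel"
  shows "{\<omega>\<in>space M. \<forall>v\<in>V. \<xi> (s + v) \<omega> - \<xi> s \<omega> \<in> B v} \<in> events"
proof (rule sets.sets_Collect_countable_All')
  fix v assume "v \<in> V"
  then show "{\<omega> \<in> space M. \<xi> (s + v) \<omega> - \<xi> s \<omega> \<in> B v} \<in> events"
    using assms by (intro Collect_in_sets[OF increment_measurable]) auto
qed (rule assms)

lemma xi_sets:
  assumes "countable V" "V \<subseteq> {0..}" "\<And>v. v \<in> V \<Longrightarrow> B v \<in> sets borel"
  shows "{\<omega>\<in>space M. \<forall>v\<in>V. \<xi> v \<omega> \<in> B v} \<in> events"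
proof (rule sets.sets_Collect_countable_All')
  fix v assume "v \<in> V"
  then show "{\<omega> \<in> space M. \<xi> v \<omega> \<in> B v} \<in> events"
    using assms by (intro Collect_in_sets[OF xi_measurable]) auto
qed (rule assms)

text \<open>Independence makes the joint law a product, and stationarity removes \<open>s\<close>
  from each factor.\<close>

lemma distr_increments:
  assumes "0 \<le> s" "0 \<le> b 0" "mono b"
  shows "distr M (Pi\<^sub>M {..n} (\<lambda>_. borel)) (\<lambda>\<omega>. \<lambda>i\<in>{..n}. \<xi> (s + b (Suc i)) \<omega> - \<xi> (s + b i) \<omega>)
       = Pi\<^sub>M {..n} (\<lambda>i. distr M borel (\<xi> (b (Suc i) - b i)))"
proof -
  have b: "0 \<le> b i" "b i \<le> b (Suc i)" for i
    using assms monoD[OF \<open>mono b\<close>, of 0 i] monoD[OF \<open>mono b\<close>, of i "Suc i"] by auto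
  have "indep_vars (\<lambda>_. borel) (\<lambda>i \<omega>. \<xi> (s + b (Suc i)) \<omega> - \<xi> (s + b i) \<omega>) {..n}"
    using indep_increments[of "\<lambda>i. s + b i" "Suc n"] assms
    by (auto simp: mono_def lessThan_Suc_atMost)
  then have "distr M (Pi\<^sub>M {..n} (\<lambda>_. borel)) (\<lambda>\<omega>. \<lambda>i\<in>{..n}. \<xi> (s + b (Suc i)) \<omega> - \<xi> (s + b i) \<omega>)
      = Pi\<^sub>M {..n} (\<lambda>i. distr M borel (\<lambda>\<omega>. \<xi> (s + b (Suc i)) \<omega> - \<xi> (s + b i) \<omega>))"
    by (subst (asm) indep_vars_iff_distr_eq_PiM)
      (use b \<open>0 \<le> s\<close> in \<open>auto intro!: increment_measurable\<close>)
  also have "\<dots> = Pi\<^sub>M {..n} (\<lambda>i. distr M borel (\<xi> (b (Suc i) - b i)))"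
    using stationary[of "s + b i" "b (Suc i) - b i" for i] b \<open>0 \<le> s\<close>
    by (intro PiM_cong) auto
  finally show ?thesis .
qed

text \<open>Values relative to time \<open>s\<close> are partial sums of increments over a grid that
  starts at 0. Both events are thus given by the same set \<open>X\<close> of increment vectors,
  whose law does not depend on the starting time.\<close>

lemma prob_increments_shift:
  assumes V: "finite V" "V \<subseteq> {0..}" and "0 \<le> s" and B: "\<And>v. v \<in> V \<Longrightarrow> B v \<in> sets borel"
  shows "prob {\<omega>\<in>space M. \<forall>v\<in>V. \<xi> (s + v) \<omega> - \<xi> s \<omega> \<in> B v} = prob {\<omega>\<in>space M. \<forall>v\<in>V. \<xi> v \<omega> \<in> B v}"
proof -
  obtain b :: "nat \<Rightarrow> real" and q where b: "mono b" "b ` {..q} = insert 0 V" "b 0 = Min (insert 0 V)"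
    by (rule finite_real_enum[of "insert 0 V"]) (use V in auto)
  have b0: "b 0 = 0" unfolding b(3) by (rule Min_eqI) (use V in auto)
  have bn: "0 \<le> b i" for i using monoD[OF b(1), of 0 i] b0 by simp
  let ?P = "Pi\<^sub>M {..q} (\<lambda>_. borel) :: (nat \<Rightarrow> real) measure"
  define X where "X = {d \<in> space ?P. \<forall>i\<in>{i. i \<le> q \<and> b i \<in> V}. (\<Sum>j<i. d j) \<in> B (b i)}"
  have X: "X \<in> sets ?P"
    unfolding X_def
  proof (rule sets.sets_Collect_finite_All)
    fix i assume i: "i \<in> {i. i \<le> q \<and> b i \<in> V}"
    show "{d \<in> space ?P. (\<Sum>j<i. d j) \<in> B (b i)} \<in> sets ?P"
      using i B by (intro Collect_in_sets[of _ _ borel] borel_measurable_sum measurable_component_singleton) auto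
  qed auto
  have "prob {\<omega>\<in>space M. \<forall>v\<in>V. \<xi> (r + v) \<omega> - \<xi> r \<omega> \<in> B v}
      = measure (Pi\<^sub>M {..q} (\<lambda>i. distr M borel (\<xi> (b (Suc i) - b i)))) X" if "0 \<le> r" for r
  proof -
    let ?D = "\<lambda>\<omega>. \<lambda>i\<in>{..q}. \<xi> (r + b (Suc i)) \<omega> - \<xi> (r + b i) \<omega>"
    have D: "?D \<in> measurable M ?P"
      by (intro measurable_restrict increment_measurable) (use bn that in auto)
    have sum: "(\<Sum>j<i. ?D \<omega> j) = \<xi> (r + b i) \<omega> - \<xi> r \<omega>" if "i \<le> q" for i \<omega>
    proof -
      have "(\<Sum>j<i. ?D \<omega> j) = (\<Sum>j<i. \<xi> (r + b (Suc j)) \<omega> - \<xi> (r + b j) \<omega>)"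
        by (rule sum.cong) (use that in auto)
      also have "\<dots> = \<xi> (r + b i) \<omega> - \<xi> r \<omega>"
        using sum_lessThan_telescope[of "\<lambda>j. \<xi> (r + b j) \<omega>" i] b0 by simp
      finally show ?thesis .
    qed
    have "{\<omega>\<in>space M. \<forall>v\<in>V. \<xi> (r + v) \<omega> - \<xi> r \<omega> \<in> B v} = ?D -` X \<inter> space M"
    proof -
      have "(\<forall>v\<in>V. \<xi> (r + v) \<omega> - \<xi> r \<omega> \<in> B v) \<longleftrightarrow>
          (\<forall>i\<in>{i. i \<le> q \<and> b i \<in> V}. \<xi> (r + b i) \<omega> - \<xi> r \<omega> \<in> B (b i))" for \<omega>
      proof safe
        fix v assume *: "\<forall>i\<in>{i. i \<le> q \<and> b i \<in> V}. \<xi> (r + b i) \<omega> - \<xi> r \<omega> \<in> B (b i)" "v \<in> V"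
        then have "v \<in> b ` {..q}" unfolding b(2) by blast
          then obtain i where "i \<le> q" "v = b i" by auto
        then show "\<xi> (r + v) \<omega> - \<xi> r \<omega> \<in> B v" using * by auto
      qed auto
      moreover have "\<omega> \<in> ?D -` X \<longleftrightarrow> (\<forall>i\<in>{i. i \<le> q \<and> b i \<in> V}. \<xi> (r + b i) \<omega> - \<xi> r \<omega> \<in> B (b i))" 
        if "\<omega> \<in> space M" for \<omega>
        using measurable_space[OF D that] by (auto simp: X_def sum simp del: restrict_apply)
      ultimately show ?thesis by auto
    qed
    also have "prob \<dots> = measure (distr M ?P ?D) X"
      by (rule measure_distr[OF D X, symmetric])
    also have "distr M ?P ?D = Pi\<^sub>M {..q} (\<lambda>i. distr M borel (\<xi> (b (Suc i) - b i)))"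
      by (rule distr_increments[OF that]) (use b b0 in auto)
    finally show ?thesis .
  qed
  from this[of s] this[of 0] \<open>0 \<le> s\<close> show ?thesis
    by (auto simp: xi_0 cong: conj_cong intro!: arg_cong[where f=prob])
qed

text \<open>A single grid runs through \<open>U\<close> up to \<open>s\<close> and then through the
  shifted times of \<open>V\<close>. The past is a function of the increments before index
  \<open>p\<close>, the future of those from \<open>p\<close> on, and disjoint blocks of independent
  variables are independent.\<close>

lemma indep_past_future_finite:
  assumes U: "finite U" "U \<subseteq> {0..s}" and V: "finite V" "V \<subseteq> {0..}" and "0 \<le> s"
    and A: "\<And>u. u \<in> U \<Longrightarrow> A u \<in> sets borel" and B: "\<And>v. v \<in> V \<Longrightarrow> B v \<in> sets borel"
  shows "prob ({\<omega>\<in>space M. \<forall>u\<in>U. \<xi> u \<omega> \<in> A u} \<inter> {\<omega>\<in>space M. \<forall>v\<in>V. \<xi> (s + v) \<omega> - \<xi> s \<omega> \<in> B v})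
       = prob {\<omega>\<in>space M. \<forall>u\<in>U. \<xi> u \<omega> \<in> A u} * prob {\<omega>\<in>space M. \<forall>v\<in>V. \<xi> v \<omega> \<in> B v}"
proof -
  \<comment> \<open>Inserting 0 and \<open>s\<close> makes this grid start at time 0 and end exactly
    at \<open>s\<close>, so that the two grids can be joined at index \<open>p\<close>.\<close>
  obtain a :: "nat \<Rightarrow> real" and p where a: "mono a" "a ` {..p} = insert 0 (insert s U)"
    "a 0 = Min (insert 0 (insert s U))" "a p = Max (insert 0 (insert s U))"
    by (rule finite_real_enum[of "insert 0 (insert s U)"]) (use U in auto)
  have a0: "a 0 = 0" unfolding a(3) by (rule Min_eqI) (use U \<open>0 \<le> s\<close> in auto)
  have ap: "a p = s" unfolding a(4) by (rule Max_eqI) (use U \<open>0 \<le> s\<close> in auto)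
  obtain b :: "nat \<Rightarrow> real" and q where b: "mono b" "b ` {..q} = insert 0 V" "b 0 = Min (insert 0 V)"
    by (rule finite_real_enum[of "insert 0 V"]) (use V in auto)
  have b0: "b 0 = 0" unfolding b(3) by (rule Min_eqI) (use V in auto)
  have bn: "0 \<le> b i" for i using monoD[OF b(1), of 0 i] b0 by simp
  define t where "t i = (if i \<le> p then a i else s + b (i - p))" for i
  have t_mono: "mono t"
  proof (rule monoI)
    fix i j :: nat assume "i \<le> j"
    then show "t i \<le> t j"
      using monoD[OF a(1), of i j] monoD[OF a(1), of i p] monoD[OF b(1), of "i - p" "j - p"] ap bn[of "j - p"]
      by (auto simp: t_def)
  qed
  have t_add: "t (p + i) = s + b i" for i using b0 ap by (auto simp: t_def)
  have tn: "0 \<le> t i" for i using monoD[OF t_mono, of 0 i] a0 by (simp add: t_def)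
  let ?D = "\<lambda>i \<omega>. \<xi> (t (Suc i)) \<omega> - \<xi> (t i) \<omega>"
  let ?Ma = "Pi\<^sub>M {..<p} (\<lambda>_. borel) :: (nat \<Rightarrow> real) measure"
  let ?Mb = "Pi\<^sub>M {p..<p+q} (\<lambda>_. borel) :: (nat \<Rightarrow> real) measure"
  let ?Da = "\<lambda>\<omega>. restrict (\<lambda>i. ?D i \<omega>) {..<p}"
  let ?Db = "\<lambda>\<omega>. restrict (\<lambda>i. ?D i \<omega>) {p..<p+q}"
  have ind: "indep_var ?Ma ?Da ?Mb ?Db"
    by (rule indep_var_restrict[OF indep_increments[of t "p + q"]]) (use tn t_mono in auto)
  have Dam: "?Da \<in> measurable M ?Ma" and Dbm: "?Db \<in> measurable M ?Mb"
    by (intro measurable_restrict increment_measurable tn)+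
  define Xa where "Xa = {d \<in> space ?Ma. \<forall>i\<in>{i. i \<le> p \<and> a i \<in> U}. (\<Sum>j<i. d j) \<in> A (a i)}"
  define Xb where "Xb = {d \<in> space ?Mb. \<forall>i\<in>{i. i \<le> q \<and> b i \<in> V}. (\<Sum>j\<in>{p..<p+i}. d j) \<in> B (b i)}"
  have Xa: "Xa \<in> sets ?Ma"
    unfolding Xa_def
  proof (rule sets.sets_Collect_finite_All)
    fix i assume i: "i \<in> {i. i \<le> p \<and> a i \<in> U}"
    show "{d \<in> space ?Ma. (\<Sum>j<i. d j) \<in> A (a i)} \<in> sets ?Ma"
      using i A by (intro Collect_in_sets[of _ _ borel] borel_measurable_sum measurable_component_singleton) auto
  qed auto
  have Xb: "Xb \<in> sets ?Mb"
    unfolding Xb_def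
  proof (rule sets.sets_Collect_finite_All)
    fix i assume i: "i \<in> {i. i \<le> q \<and> b i \<in> V}"
    show "{d \<in> space ?Mb. (\<Sum>j\<in>{p..<p+i}. d j) \<in> B (b i)} \<in> sets ?Mb"
      using i B by (intro Collect_in_sets[of _ _ borel] borel_measurable_sum measurable_component_singleton) auto
  qed auto
  have suma: "(\<Sum>j<i. ?Da \<omega> j) = \<xi> (a i) \<omega>" if "i \<le> p" "\<omega> \<in> space M" for i \<omega>
  proof -
    have "(\<Sum>j<i. ?Da \<omega> j) = (\<Sum>j<i. ?D j \<omega>)"
      by (rule sum.cong) (use that in auto)
    also have "\<dots> = \<xi> (t i) \<omega> - \<xi> (t 0) \<omega>"
      by (rule sum_lessThan_telescope)
    finally show ?thesis using that by (simp add: t_def a0 xi_0)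
  qed
  have sumb: "(\<Sum>j\<in>{p..<p+i}. ?Db \<omega> j) = \<xi> (s + b i) \<omega> - \<xi> s \<omega>" if "i \<le> q" for i \<omega>
  proof -
    have "(\<Sum>j\<in>{p..<p+i}. ?Db \<omega> j) = (\<Sum>j\<in>{p..<p+i}. ?D j \<omega>)"
      by (rule sum.cong) (use that in auto)
    also have "\<dots> = \<xi> (t (p + i)) \<omega> - \<xi> (t p) \<omega>"
      by (rule sum_Suc_diff') simp
    finally show ?thesis using t_add[of i] t_add[of 0] b0 by simp
  qed
  have Ea: "{\<omega>\<in>space M. \<forall>u\<in>U. \<xi> u \<omega> \<in> A u} = ?Da -` Xa \<inter> space M"
  proof -
    have "(\<forall>u\<in>U. \<xi> u \<omega> \<in> A u) \<longleftrightarrow> (\<forall>i\<in>{i. i \<le> p \<and> a i \<in> U}. \<xi> (a i) \<omega> \<in> A (a i))" for \<omega>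
    proof safe
      fix u assume *: "\<forall>i\<in>{i. i \<le> p \<and> a i \<in> U}. \<xi> (a i) \<omega> \<in> A (a i)" "u \<in> U"
      then have "u \<in> a ` {..p}" unfolding a(2) by blast
      then obtain i where "i \<le> p" "u = a i" by auto
      then show "\<xi> u \<omega> \<in> A u" using * by auto
    qed auto
    moreover have "\<omega> \<in> ?Da -` Xa \<longleftrightarrow> (\<forall>i\<in>{i. i \<le> p \<and> a i \<in> U}. \<xi> (a i) \<omega> \<in> A (a i))"
      if "\<omega> \<in> space M" for \<omega>
      using measurable_space[OF Dam that] that by (auto simp: Xa_def suma simp del: restrict_apply)
    ultimately show ?thesis by auto
  qed
  have Eb: "{\<omega>\<in>space M. \<forall>v\<in>V. \<xi> (s + v) \<omega> - \<xi> s \<omega> \<in> B v} = ?Db -` Xb \<inter> space M"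
  proof -
    have "(\<forall>v\<in>V. \<xi> (s + v) \<omega> - \<xi> s \<omega> \<in> B v) \<longleftrightarrow>
        (\<forall>i\<in>{i. i \<le> q \<and> b i \<in> V}. \<xi> (s + b i) \<omega> - \<xi> s \<omega> \<in> B (b i))" for \<omega>
    proof safe
      fix v assume *: "\<forall>i\<in>{i. i \<le> q \<and> b i \<in> V}. \<xi> (s + b i) \<omega> - \<xi> s \<omega> \<in> B (b i)" "v \<in> V"
      then have "v \<in> b ` {..q}" unfolding b(2) by blast
          then obtain i where "i \<le> q" "v = b i" by auto
      then show "\<xi> (s + v) \<omega> - \<xi> s \<omega> \<in> B v" using * by auto
    qed auto
    moreover have "\<omega> \<in> ?Db -` Xb \<longleftrightarrow> (\<forall>i\<in>{i. i \<le> q \<and> b i \<in> V}. \<xi> (s + b i) \<omega> - \<xi> s \<omega> \<in> B (b i))"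
      if "\<omega> \<in> space M" for \<omega>
      using measurable_space[OF Dbm that] that by (auto simp: Xb_def sumb simp del: restrict_apply)
    ultimately show ?thesis by auto
  qed
  have "prob ((?Da -` Xa \<inter> space M) \<inter> (?Db -` Xb \<inter> space M))
      = prob ((\<lambda>x. (?Da x, ?Db x)) -` (Xa \<times> Xb) \<inter> space M)"
    by (rule arg_cong[where f=prob]) auto
  also have "\<dots> = prob (?Da -` Xa \<inter> space M) * prob (?Db -` Xb \<inter> space M)"
    by (rule indep_varD[OF ind Xa Xb])
  finally have "prob ((?Da -` Xa \<inter> space M) \<inter> (?Db -` Xb \<inter> space M))
    = prob (?Da -` Xa \<inter> space M) * prob (?Db -` Xb \<inter> space M)" .
  then have "prob ({\<omega>\<in>space M. \<forall>u\<in>U. \<xi> u \<omega> \<in> A u} \<inter> {\<omega>\<in>space M. \<forall>v\<in>V. \<xi> (s + v) \<omega> - \<xi> s \<omega> \<in> B v})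
    = prob {\<omega>\<in>space M. \<forall>u\<in>U. \<xi> u \<omega> \<in> A u} * prob {\<omega>\<in>space M. \<forall>v\<in>V. \<xi> (s + v) \<omega> - \<xi> s \<omega> \<in> B v}"
    unfolding Ea Eb .
  moreover have "prob {\<omega>\<in>space M. \<forall>v\<in>V. \<xi> (s + v) \<omega> - \<xi> s \<omega> \<in> B v} = prob {\<omega>\<in>space M. \<forall>v\<in>V. \<xi> v \<omega> \<in> B v}"
    by (rule prob_increments_shift[OF V \<open>0 \<le> s\<close> B])
  ultimately show ?thesis by (simp only:)
qed

section \<open>The sigma-algebra of the past and the Markov property\<close>

definition past_generator :: "real \<Rightarrow> 'a set set" where
  "past_generator s = {{\<omega>\<in>space M. \<forall>u\<in>U. \<xi> u \<omega> \<in> A u} | U A.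
     finite U \<and> U \<subseteq> {0..s} \<and> (\<forall>u. A u \<in> sets borel)}"

definition past :: "real \<Rightarrow> 'a measure" where
  "past s = sigma (space M) (past_generator s)"

lemma past_generator_events: "past_generator s \<subseteq> events"
proof
  fix C assume "C \<in> past_generator s"
  then obtain U A where "finite U" "U \<subseteq> {0..s}" "\<And>u. A u \<in> sets borel"
    "C = {\<omega>\<in>space M. \<forall>u\<in>U. \<xi> u \<omega> \<in> A u}"
    unfolding past_generator_def by blast
  then show "C \<in> events" using xi_sets[of U A] by (auto simp: countable_finite subset_iff)
qed

lemma past_generator_sub: "past_generator s \<subseteq> Pow (space M)"
  unfolding past_generator_def by auto

lemma space_past [simp]: "space (past s) = space M"
  by (simp add: past_def space_measure_of_conv)

lemma sets_past: "sets (past s) = sigma_sets (space M) (past_generator s)"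
  unfolding past_def by (rule sets_measure_of[OF past_generator_sub])

lemma subalgebra_past: "subalgebra M (past s)"
  unfolding subalgebra_def sets_past
  using sets.sigma_sets_subset[OF past_generator_events] by simp

lemma past_events: "C \<in> sets (past s) \<Longrightarrow> C \<in> events"
  using subalgebra_past by (auto simp: subalgebra_def)

lemma past_mono: assumes "s \<le> t" shows "sets (past s) \<subseteq> sets (past t)"
  unfolding sets_past
proof (rule sigma_sets_mono', rule subsetI)
  fix C assume "C \<in> past_generator s"
  then obtain U A where "finite U" "U \<subseteq> {0..s}" "\<And>u. A u \<in> sets borel"
    "C = {\<omega>\<in>space M. \<forall>u\<in>U. \<xi> u \<omega> \<in> A u}"
    unfolding past_generator_def by blast
  moreover from this(2) \<open>s \<le> t\<close> have "U \<subseteq> {0..t}" by auto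
  ultimately show "C \<in> past_generator t"
    unfolding past_generator_def by (intro CollectI exI[of _ U] exI[of _ A]) auto
qed

lemma xi_measurable_past: assumes "0 \<le> u" "u \<le> s" shows "\<xi> u \<in> borel_measurable (past s)"
proof (rule measurableI)
  fix A :: "real set" assume "A \<in> sets borel"
  then have "{\<omega>\<in>space M. \<forall>u\<in>{u}. \<xi> u \<omega> \<in> (\<lambda>_. A) u} \<in> past_generator s"
    unfolding past_generator_def using assms by (intro CollectI exI[of _ "{u}"] exI[of _ "\<lambda>_. A"]) auto
  then have "{\<omega>\<in>space M. \<xi> u \<omega> \<in> A} \<in> sets (past s)" by (auto simp: sets_past)
  also have "{\<omega>\<in>space M. \<xi> u \<omega> \<in> A} = \<xi> u -` A \<inter> space (past s)" by auto
  finally show "\<xi> u -` A \<inter> space (past s) \<in> sets (past s)" .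
qed simp

lemma Int_stable_past_generator: "Int_stable (past_generator s)"
proof (rule Int_stableI)
  fix a b assume "a \<in> past_generator s" "b \<in> past_generator s"
  then obtain U A V B where U: "finite U" "U \<subseteq> {0..s}" "\<And>u. A u \<in> sets borel"
    and V: "finite V" "V \<subseteq> {0..s}" "\<And>u. B u \<in> sets borel"
    and a: "a = {\<omega>\<in>space M. \<forall>u\<in>U. \<xi> u \<omega> \<in> A u}" and b: "b = {\<omega>\<in>space M. \<forall>u\<in>V. \<xi> u \<omega> \<in> B u}"
    unfolding past_generator_def by blast
  define H where "H u = (if u \<in> U then A u else UNIV) \<inter> (if u \<in> V then B u else UNIV)" for u
  have "a \<inter> b = {\<omega>\<in>space M. \<forall>u\<in>U\<union>V. \<xi> u \<omega> \<in> H u}" unfolding a b H_def by auto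
  moreover have "H u \<in> sets borel" for u using U V by (auto simp: H_def)
  ultimately show "a \<inter> b \<in> past_generator s"
    unfolding past_generator_def using U V
    by (intro CollectI exI[of _ "U \<union> V"] exI[of _ H]) auto
qed

text \<open>The simple Markov property. For finite sets of times, the events \<open>C\<close> with
  the product formula form a Dynkin system that contains the cylinders in
  \<open>past_generator s\<close>; continuity from above then reaches countable
  \<open>V\<close>.\<close>

lemma indep_past_future:
  assumes C: "C \<in> sets (past s)" and "0 \<le> s" and V: "countable V" "V \<subseteq> {0..}"
    and B: "\<And>v. v \<in> V \<Longrightarrow> B v \<in> sets borel"
  shows "prob (C \<inter> {\<omega>\<in>space M. \<forall>v\<in>V. \<xi> (s + v) \<omega> - \<xi> s \<omega> \<in> B v})
       = prob C * prob {\<omega>\<in>space M. \<forall>v\<in>V. \<xi> v \<omega> \<in> B v}"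
proof -
  have fin: "prob (C \<inter> {\<omega>\<in>space M. \<forall>v\<in>W. \<xi> (s + v) \<omega> - \<xi> s \<omega> \<in> B v})
       = prob C * prob {\<omega>\<in>space M. \<forall>v\<in>W. \<xi> v \<omega> \<in> B v}" if W: "finite W" "W \<subseteq> V" for W
  proof -
    let ?E = "{\<omega>\<in>space M. \<forall>v\<in>W. \<xi> (s + v) \<omega> - \<xi> s \<omega> \<in> B v}"
    have Em: "?E \<in> events" 
      using W V B \<open>0 \<le> s\<close> by (intro future_sets countable_finite) auto
    from Int_stable_past_generator past_generator_sub C[unfolded sets_past] show ?thesis
    proof (induction rule: sigma_sets_induct_disjoint)
      case (basic A)
      then obtain U A' where "finite U" "U \<subseteq> {0..s}" "\<And>u. A' u \<in> sets borel"
        "A = {\<omega>\<in>space M. \<forall>u\<in>U. \<xi> u \<omega> \<in> A' u}"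
        unfolding past_generator_def by blast
      then show ?case
        using indep_past_future_finite[of U s W A' B] W B \<open>0 \<le> s\<close> order_trans[OF W(2) V(2)] by blast
    next
      case empty
      then show ?case by simp
    next
      case (compl A)
      have Am: "A \<in> events" using compl(1) past_events by (simp add: sets_past)
      have "(space M - A) \<inter> ?E = ?E - A \<inter> ?E" by auto
      then have "prob ((space M - A) \<inter> ?E) = prob ?E - prob (A \<inter> ?E)"
        using Am Em by (simp add: finite_measure_Diff)
      moreover have "prob ?E = prob {\<omega>\<in>space M. \<forall>v\<in>W. \<xi> v \<omega> \<in> B v}"
        using W V B \<open>0 \<le> s\<close> by (intro prob_increments_shift) auto
      ultimately show ?case unfolding compl(2) prob_compl[OF Am] by (simp only: left_diff_distrib mult_1)
    next
      case (union A)
      have Am: "A i \<in> events" for i using union(2) past_events by (auto simp: sets_past)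
      have "(\<lambda>i. prob (A i \<inter> ?E)) sums prob (\<Union>i. A i \<inter> ?E)"
        by (rule finite_measure_UNION) (use Am Em union(1) in \<open>auto simp: disjoint_family_on_def\<close>)
      moreover have "(\<lambda>i. prob (A i)) sums prob (\<Union>i. A i)"
        by (rule finite_measure_UNION) (use Am union(1) in auto)
      then have "(\<lambda>i. prob (A i \<inter> ?E)) sums (prob (\<Union>i. A i) * prob {\<omega>\<in>space M. \<forall>v\<in>W. \<xi> v \<omega> \<in> B v})"
        unfolding union(3) by (rule sums_mult2)
      ultimately show ?case by (simp add: sums_iff)
    qed
  qed
  show ?thesis
  proof (cases "V = {}")
    case True
    then show ?thesis using fin[of "{}"] by simp
  next
    case False
    define f where "f = from_nat_into V"
    have f: "range f = V" unfolding f_def using V False by simp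
    have Cm: "C \<in> events" using C past_events by blast
    have fs: "finite (f ` {..n})" "f ` {..n} \<subseteq> V" for n using f by auto
    let ?E = "\<lambda>W. {\<omega>\<in>space M. \<forall>v\<in>W. \<xi> (s + v) \<omega> - \<xi> s \<omega> \<in> B v}"
    let ?Z = "\<lambda>W. {\<omega>\<in>space M. \<forall>v\<in>W. \<xi> v \<omega> \<in> B v}"
    have e: "?E (f ` {..n}) \<in> events" "?Z (f ` {..n}) \<in> events" for n
      using fs[of n] V B \<open>0 \<le> s\<close> by (intro future_sets xi_sets countable_finite; auto)+
    have "(\<lambda>n. prob (C \<inter> ?E (f ` {..n}))) \<longlonglongrightarrow> prob (\<Inter>n. C \<inter> ?E (f ` {..n}))"
      by (rule finite_Lim_measure_decseq) (use e Cm in \<open>auto simp: decseq_def\<close>)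
    also have "(\<Inter>n. C \<inter> ?E (f ` {..n})) = C \<inter> ?E V" using f by force
    finally have 1: "(\<lambda>n. prob (C \<inter> ?E (f ` {..n}))) \<longlonglongrightarrow> prob (C \<inter> ?E V)" .
    have "(\<lambda>n. prob (?Z (f ` {..n}))) \<longlonglongrightarrow> prob (\<Inter>n. ?Z (f ` {..n}))"
      by (rule finite_Lim_measure_decseq) (use e in \<open>auto simp: decseq_def\<close>)
    also have "(\<Inter>n. ?Z (f ` {..n})) = ?Z V" using f by force
    finally have "(\<lambda>n. prob C * prob (?Z (f ` {..n}))) \<longlonglongrightarrow> prob C * prob (?Z V)"
      by (intro tendsto_mult tendsto_const)
    with 1 show ?thesis unfolding fin[OF fs] by (rule LIMSEQ_unique)
  qed
qed

text \<open>Integrands are needed besides events because the history enters weak convergence through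
  bounded functionals. The extension is the usual induction over nonnegative measurable
  functions.\<close>

lemma nn_integral_past_future:
  fixes f :: "'a \<Rightarrow> ennreal"
  assumes f: "f \<in> borel_measurable (past s)" and "0 \<le> s" and V: "countable V" "V \<subseteq> {0..}"
    and B: "\<And>v. v \<in> V \<Longrightarrow> B v \<in> sets borel"
  shows "(\<integral>\<^sup>+\<omega>. f \<omega> * indicator {\<omega>\<in>space M. \<forall>v\<in>V. \<xi> (s + v) \<omega> - \<xi> s \<omega> \<in> B v} \<omega> \<partial>M)
       = (\<integral>\<^sup>+\<omega>. f \<omega> \<partial>M) * prob {\<omega>\<in>space M. \<forall>v\<in>V. \<xi> v \<omega> \<in> B v}"
  (is "(\<integral>\<^sup>+\<omega>. f \<omega> * indicator ?E \<omega> \<partial>M) = _ * ennreal ?p")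
  using f
proof (induction rule: borel_measurable_induct)
  have Em: "?E \<in> events" using assms by (intro future_sets)
  have meas: "g \<in> borel_measurable (past s) \<Longrightarrow> g \<in> borel_measurable M" for g :: "'a \<Rightarrow> ennreal"
    by (rule measurable_from_subalg[OF subalgebra_past])
  {
    case (cong f g)
    have "(\<integral>\<^sup>+\<omega>. f \<omega> * indicator ?E \<omega> \<partial>M) = (\<integral>\<^sup>+\<omega>. g \<omega> * indicator ?E \<omega> \<partial>M)"
      by (rule nn_integral_cong) (use cong(3) in auto)
    moreover have "(\<integral>\<^sup>+\<omega>. f \<omega> \<partial>M) = (\<integral>\<^sup>+\<omega>. g \<omega> \<partial>M)"
      by (rule nn_integral_cong) (use cong(3) in auto)
    ultimately show ?case using cong(4) by simp
  next
    case (set A)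
    have Am: "A \<in> events" using set past_events by blast
    have "(\<integral>\<^sup>+\<omega>. indicator A \<omega> * indicator ?E \<omega> \<partial>M) = emeasure M (A \<inter> ?E)"
      using Am Em by (simp flip: indicator_inter_arith)
    also have "\<dots> = ennreal (prob A * ?p)"
      unfolding emeasure_eq_measure using indep_past_future[OF set \<open>0 \<le> s\<close> V B] by simp
    also have "\<dots> = (\<integral>\<^sup>+\<omega>. indicator A \<omega> \<partial>M) * ennreal ?p"
      using Am by (simp add: ennreal_mult emeasure_eq_measure)
    finally show ?case .
  next
    case (mult u c)
    have "(\<integral>\<^sup>+\<omega>. c * u \<omega> * indicator ?E \<omega> \<partial>M) = c * (\<integral>\<^sup>+\<omega>. u \<omega> * indicator ?E \<omega> \<partial>M)"
      unfolding mult.assoc using meas[OF mult(2)] Em by (intro nn_integral_cmult) auto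
    also have "\<dots> = (\<integral>\<^sup>+\<omega>. c * u \<omega> \<partial>M) * ennreal ?p"
      unfolding mult(4) nn_integral_cmult[OF meas[OF mult(2)]] by (simp add: mult.assoc)
    finally show ?case .
  next
    case (add u v)
    have "(\<integral>\<^sup>+\<omega>. (v \<omega> + u \<omega>) * indicator ?E \<omega> \<partial>M)
        = (\<integral>\<^sup>+\<omega>. v \<omega> * indicator ?E \<omega> \<partial>M) + (\<integral>\<^sup>+\<omega>. u \<omega> * indicator ?E \<omega> \<partial>M)"
      unfolding distrib_right using meas[OF add(1)] meas[OF add(3)] Em by (intro nn_integral_add) auto
    also have "\<dots> = (\<integral>\<^sup>+\<omega>. v \<omega> + u \<omega> \<partial>M) * ennreal ?p"
      unfolding add.IH nn_integral_add[OF meas[OF add(3)] meas[OF add(1)]]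
      by (simp add: distrib_right)
    finally show ?case .
  next
    case (seq U)
    note m = meas[OF seq(1)]
    have "(\<integral>\<^sup>+\<omega>. (SUP i. U i) \<omega> * indicator ?E \<omega> \<partial>M) = (\<integral>\<^sup>+\<omega>. (SUP i. U i \<omega> * indicator ?E \<omega>) \<partial>M)"
      by (rule nn_integral_cong) (simp add: SUP_mult_right_ennreal image_comp)
    also have "\<dots> = (SUP i. \<integral>\<^sup>+\<omega>. U i \<omega> * indicator ?E \<omega> \<partial>M)"
      using m Em \<open>incseq U\<close>
      by (intro nn_integral_monotone_convergence_SUP) (auto simp: incseq_def le_fun_def mult_right_mono)
    also have "\<dots> = (SUP i. (\<integral>\<^sup>+\<omega>. U i \<omega> \<partial>M)) * ennreal ?p"
      unfolding seq.IH by (simp add: SUP_mult_right_ennreal)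
    also have "(SUP i. (\<integral>\<^sup>+\<omega>. U i \<omega> \<partial>M)) = (\<integral>\<^sup>+\<omega>. (SUP i. U i) \<omega> \<partial>M)"
      using m \<open>incseq U\<close> by (subst nn_integral_monotone_convergence_SUP[symmetric]) (auto simp: SUP_apply image_image intro!: nn_integral_cong)
    finally show ?case .
  }
qed

end

section \<open>Lower bounds on Levy processes with positive mean\<close>

definition nonneg_rats :: "real set" where
  "nonneg_rats = {q \<in> \<rat>. 0 \<le> q}"

lemma countable_nonneg_rats: "countable nonneg_rats"
  unfolding nonneg_rats_def by (rule countable_subset[OF _ countable_rat]) auto

lemma nonneg_rats_ge_0: "q \<in> nonneg_rats \<Longrightarrow> 0 \<le> q"
  by (simp add: nonneg_rats_def)

lemma nonneg_rats_subset: "nonneg_rats \<subseteq> {0..}"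
  by (auto simp: nonneg_rats_def)

lemma nonneg_rats_add: "p \<in> nonneg_rats \<Longrightarrow> q \<in> nonneg_rats \<Longrightarrow> p + q \<in> nonneg_rats"
  by (auto simp: nonneg_rats_def)

lemma range_real_subset [simp]: "range real \<subseteq> {0..}"
  by auto

lemma integrable_Max_atMost:
  fixes f :: "nat \<Rightarrow> 'a \<Rightarrow> real"
  assumes "\<And>k. integrable M (f k)"
  shows "integrable M (\<lambda>\<omega>. Max ((\<lambda>k. f k \<omega>) ` {..n}))"
  by (induction n) (use assms in \<open>auto simp: atMost_Suc intro!: integrable_max\<close>)

context levy
begin

lemma xi_at_measurable:
  assumes "f \<in> borel_measurable M" "\<And>\<omega>. \<omega> \<in> space M \<Longrightarrow> 0 \<le> f \<omega>"
  shows "(\<lambda>\<omega>. \<xi> (f \<omega>) \<omega>) \<in> borel_measurable M"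
proof -
  have "(\<lambda>(t::real, \<omega>). \<xi> (max 0 t) \<omega>) \<in> borel_measurable (borel \<Otimes>\<^sub>M M)"
    by (rule right_cont_measurable_pair[OF xi_measurable xi_right_cont])
  then have "(\<lambda>\<omega>. (\<lambda>(t::real, \<omega>). \<xi> (max 0 t) \<omega>) (f \<omega>, \<omega>)) \<in> borel_measurable M"
    by (rule measurable_compose[rotated]) (use assms in measurable)
  then show ?thesis
    by (rule measurable_cong[THEN iffD1, rotated]) (use assms in auto)
qed

lemma random_time_measurable:
  assumes "\<And>\<omega>. \<omega> \<in> space M \<Longrightarrow> 0 \<le> \<tau> \<omega>"
    and "\<And>s :: real. 0 < s \<Longrightarrow> {\<omega>\<in>space M. \<tau> \<omega> < s} \<in> sets (past s)"
  shows "\<tau> \<in> borel_measurable M"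
  unfolding borel_measurable_iff_less
proof
  fix a :: real
  have "{w \<in> space M. \<tau> w < a} = {}" if "a \<le> 0" using assms(1) that by fastforce
  then show "{w \<in> space M. \<tau> w < a} \<in> events"
  proof (cases "a \<le> 0")
    case True
    show ?thesis unfolding \<open>a \<le> 0 \<Longrightarrow> {w \<in> space M. \<tau> w < a} = {}\<close>[OF True] by (rule sets.empty_sets)
  next
    case False
    then show ?thesis by (intro past_events[OF assms(2)[of a]]) simp
  qed
qed

text \<open>A one-sided strong Markov property. When \<tau> is discretised from the right, equality
  follows from the Markov property on each grid cell. In the limit, closedness of \<open>B v\<close>
  ensures that an outcome outside the limit event is eventually outside the approximating events, so
  the reverse Fatou lemma with majorant \<open>Z\<close> gives an inequality. The hypothesis on
  \<open>Z\<close> stands for measurability with respect to the sigma-algebra of the stopping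
  time.\<close>

lemma nn_integral_random_time:
  fixes Z :: "'a \<Rightarrow> ennreal"
  assumes \<tau>0: "\<And>\<omega>. \<omega> \<in> space M \<Longrightarrow> 0 \<le> \<tau> \<omega>"
    and stop: "\<And>s. 0 < s \<Longrightarrow> {\<omega>\<in>space M. \<tau> \<omega> < s} \<in> sets (past s)"
    and Zm [measurable]: "Z \<in> borel_measurable M" and Zfin: "(\<integral>\<^sup>+\<omega>. Z \<omega> \<partial>M) < \<infinity>"
    and Zs: "\<And>s. 0 < s \<Longrightarrow> \<exists>Y\<in>borel_measurable (past s). \<forall>\<omega>\<in>space M. \<tau> \<omega> < s \<longrightarrow> Z \<omega> = Y \<omega>"
    and V: "countable V" "V \<subseteq> {0..}" and B: "\<And>v. v \<in> V \<Longrightarrow> closed (B v)"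
  shows "(\<integral>\<^sup>+\<omega>. Z \<omega> \<partial>M) * prob {\<omega>\<in>space M. \<forall>v\<in>V. \<xi> v \<omega> \<in> B v}
    \<le> (\<integral>\<^sup>+\<omega>. Z \<omega> * indicator {\<omega>\<in>space M. \<forall>v\<in>V. \<xi> (\<tau> \<omega> + v) \<omega> - \<xi> (\<tau> \<omega>) \<omega> \<in> B v} \<omega> \<partial>M)"
proof -
  have \<tau>m [measurable]: "\<tau> \<in> borel_measurable M"
    by (rule random_time_measurable[OF \<tau>0 stop])
  define p where "p = prob {\<omega>\<in>space M. \<forall>v\<in>V. \<xi> v \<omega> \<in> B v}"
  define E where "E f = {\<omega>\<in>space M. \<forall>v\<in>V. \<xi> (f \<omega> + v) \<omega> - \<xi> (f \<omega>) \<omega> \<in> B v}" for f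
  have Em: "E f \<in> events" if [measurable]: "f \<in> borel_measurable M" and f: "\<And>\<omega>. \<omega> \<in> space M \<Longrightarrow> 0 \<le> f \<omega>" for f
    unfolding E_def
  proof (rule sets.sets_Collect_countable_All')
    fix v assume v: "v \<in> V"
    have "(\<lambda>\<omega>. \<xi> (f \<omega> + v) \<omega> - \<xi> (f \<omega>) \<omega>) \<in> borel_measurable M"
      using V v f by (intro borel_measurable_diff xi_at_measurable) (auto intro!: add_nonneg_nonneg)
    then show "{\<omega> \<in> space M. \<xi> (f \<omega> + v) \<omega> - \<xi> (f \<omega>) \<omega> \<in> B v} \<in> events"
      by (rule Collect_in_sets) (use B v in auto)
  qed (rule V)
  \<comment> \<open>The next grid point, strictly after \<tau>, because right-continuity is used
    along times strictly to the right of the limit.\<close>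
  define T where "T n \<omega> = (real (nat \<lfloor>real (Suc n) * \<tau> \<omega>\<rfloor>) + 1) / real (Suc n)" for n :: nat and \<omega>
  have T: "\<tau> \<omega> < T n \<omega>" "T n \<omega> \<le> \<tau> \<omega> + inverse (real (Suc n))" if "\<omega> \<in> space M" for n \<omega>
  proof -
    define y where "y = real (Suc n) * \<tau> \<omega>"
    have y: "\<tau> \<omega> = y / real (Suc n)" "0 \<le> y" using \<tau>0[OF that] by (auto simp: y_def)
    have "y < real (nat \<lfloor>y\<rfloor>) + 1" "real (nat \<lfloor>y\<rfloor>) + 1 \<le> y + 1" using y(2) by linarith+
    then have "y / real (Suc n) < (real (nat \<lfloor>y\<rfloor>) + 1) / real (Suc n)"
      "(real (nat \<lfloor>y\<rfloor>) + 1) / real (Suc n) \<le> (y + 1) / real (Suc n)"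
      by (intro divide_strict_right_mono divide_right_mono; simp)+
    then show "\<tau> \<omega> < T n \<omega>" "T n \<omega> \<le> \<tau> \<omega> + inverse (real (Suc n))"
      unfolding T_def y_def[symmetric] by (simp_all add: y add_divide_distrib inverse_eq_divide)
  qed
  have Tm: "T n \<in> borel_measurable M" for n unfolding T_def by measurable
  have T0: "0 \<le> T n \<omega>" for n \<omega> by (simp add: T_def)
  have Tlim: "(\<lambda>n. T n \<omega>) \<longlonglongrightarrow> \<tau> \<omega>" if "\<omega> \<in> space M" for \<omega>
  proof (rule tendsto_sandwich[OF _ _ tendsto_const])
    show "(\<lambda>n. \<tau> \<omega> + inverse (real (Suc n))) \<longlonglongrightarrow> \<tau> \<omega>"
      using tendsto_add[OF tendsto_const[of "\<tau> \<omega>"] LIMSEQ_inverse_real_of_nat] by simp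
  qed (use T that in \<open>auto simp: less_imp_le intro!: always_eventually\<close>)
  have eq: "(\<integral>\<^sup>+\<omega>. Z \<omega> * indicator (E (T n)) \<omega> \<partial>M) = (\<integral>\<^sup>+\<omega>. Z \<omega> \<partial>M) * p" for n
  proof -
    define s where "s k = (real k + 1) / real (Suc n)" for k
    define A where "A k = {\<omega>\<in>space M. nat \<lfloor>real (Suc n) * \<tau> \<omega>\<rfloor> = k}" for k
    have s: "0 < s k" for k by (simp add: s_def)
    have disj: "disjoint_family A" by (auto simp: disjoint_family_on_def A_def)
    \<comment> \<open>Events of the form \<open>\<tau> \<omega> < s\<close> are the ones known to
      lie in the past, so the grid cell is written as a difference of two of them.\<close>
    have A_eq: "A k = {\<omega>\<in>space M. \<tau> \<omega> < s k} - {\<omega>\<in>space M. \<tau> \<omega> < real k / real (Suc n)}" for k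
    proof -
      have "nat \<lfloor>real (Suc n) * \<tau> \<omega>\<rfloor> = k \<longleftrightarrow> \<tau> \<omega> < s k \<and> \<not> \<tau> \<omega> < real k / real (Suc n)"
        if "\<omega> \<in> space M" for \<omega>
      proof -
        have "0 \<le> real (Suc n) * \<tau> \<omega>" using \<tau>0[OF that] by simp
        then have "nat \<lfloor>real (Suc n) * \<tau> \<omega>\<rfloor> = k \<longleftrightarrow>
            real k \<le> real (Suc n) * \<tau> \<omega> \<and> real (Suc n) * \<tau> \<omega> < real k + 1"
          by linarith
        then show ?thesis by (auto simp: s_def field_simps not_less)
      qed
      then show ?thesis unfolding A_def by auto
    qed
    have Ap: "A k \<in> sets (past (s k))" for k
      unfolding A_eq
    proof (rule sets.Diff)
      show "{\<omega>\<in>space M. \<tau> \<omega> < s k} \<in> sets (past (s k))" by (rule stop[OF s])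
      show "{\<omega> \<in> space M. \<tau> \<omega> < real k / real (Suc n)} \<in> sets (past (s k))"
      proof (cases "k = 0")
        case True
        then have "{\<omega> \<in> space M. \<tau> \<omega> < real k / real (Suc n)} = {}" using \<tau>0 by fastforce
        then show ?thesis by (simp only: sets.empty_sets)
      next
        case False
        then have "0 < real k / real (Suc n)" by simp
        from stop[OF this] past_mono[of "real k / real (Suc n)" "s k"] show ?thesis
          by (auto simp: s_def divide_right_mono)
      qed
    qed
    have Am [measurable]: "A k \<in> events" for k using Ap past_events by blast
    define S where "S k = E (\<lambda>_. s k)" for k
    have Sm [measurable]: "S k \<in> events" for k unfolding S_def using s by (intro Em) (auto simp: less_imp_le)
    have "(\<integral>\<^sup>+\<omega>. Z \<omega> * indicator (E (T n)) \<omega> \<partial>M)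
        = (\<integral>\<^sup>+\<omega>. (\<Sum>k. Z \<omega> * indicator (S k) \<omega> * indicator (A k) \<omega>) \<partial>M)"
    proof (rule nn_integral_cong)
      fix \<omega> assume \<omega>: "\<omega> \<in> space M"
      define k where "k = nat \<lfloor>real (Suc n) * \<tau> \<omega>\<rfloor>"
      have k: "\<omega> \<in> A k" "T n \<omega> = s k" using \<omega> by (auto simp: A_def k_def T_def s_def)
      have "(\<Sum>k. Z \<omega> * indicator (S k) \<omega> * indicator (A k) \<omega>) = Z \<omega> * indicator (S k) \<omega>"
        by (rule suminf_cmult_indicator[OF disj k(1)])
      also have "\<dots> = Z \<omega> * indicator (E (T n)) \<omega>"
        using k(2) by (simp add: S_def E_def indicator_def)
      finally show "Z \<omega> * indicator (E (T n)) \<omega> = (\<Sum>k. Z \<omega> * indicator (S k) \<omega> * indicator (A k) \<omega>)" ..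
    qed
    also have "\<dots> = (\<Sum>k. \<integral>\<^sup>+\<omega>. Z \<omega> * indicator (S k) \<omega> * indicator (A k) \<omega> \<partial>M)"
      by (rule nn_integral_suminf) measurable
    also have "\<dots> = (\<Sum>k. (\<integral>\<^sup>+\<omega>. Z \<omega> * indicator (A k) \<omega> \<partial>M) * ennreal p)"
    proof (rule suminf_cong)
      fix k
      obtain Y where Y: "Y \<in> borel_measurable (past (s k))"
        "\<And>\<omega>. \<omega> \<in> space M \<Longrightarrow> \<tau> \<omega> < s k \<Longrightarrow> Z \<omega> = Y \<omega>" using Zs[OF s] by blast
      have YA: "(\<lambda>\<omega>. Y \<omega> * indicator (A k) \<omega>) \<in> borel_measurable (past (s k))"
        using Y(1) Ap by (intro borel_measurable_times_ennreal borel_measurable_indicator)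
      have ZY: "Z \<omega> * indicator (A k) \<omega> = Y \<omega> * indicator (A k) \<omega>" if "\<omega> \<in> space M" for \<omega>
        using Y(2)[OF that] unfolding A_eq by (auto simp: indicator_def)
      have "(\<integral>\<^sup>+\<omega>. Z \<omega> * indicator (S k) \<omega> * indicator (A k) \<omega> \<partial>M)
          = (\<integral>\<^sup>+\<omega>. (Y \<omega> * indicator (A k) \<omega>) * indicator (S k) \<omega> \<partial>M)"
        by (rule nn_integral_cong) (simp add: ZY[symmetric] mult.assoc mult.commute mult.left_commute)
      also have "\<dots> = (\<integral>\<^sup>+\<omega>. Y \<omega> * indicator (A k) \<omega> \<partial>M) * ennreal p"
        unfolding S_def E_def p_def
        by (rule nn_integral_past_future[OF YA _ V]) (use s[of k] B in \<open>auto simp: less_imp_le\<close>)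
      also have "(\<integral>\<^sup>+\<omega>. Y \<omega> * indicator (A k) \<omega> \<partial>M) = (\<integral>\<^sup>+\<omega>. Z \<omega> * indicator (A k) \<omega> \<partial>M)"
        by (rule nn_integral_cong) (simp add: ZY)
      finally show "(\<integral>\<^sup>+\<omega>. Z \<omega> * indicator (S k) \<omega> * indicator (A k) \<omega> \<partial>M)
          = (\<integral>\<^sup>+\<omega>. Z \<omega> * indicator (A k) \<omega> \<partial>M) * ennreal p" .
    qed
    also have "\<dots> = (\<Sum>k. \<integral>\<^sup>+\<omega>. Z \<omega> * indicator (A k) \<omega> \<partial>M) * ennreal p"
      by (rule ennreal_suminf_multc)
    also have "(\<Sum>k. \<integral>\<^sup>+\<omega>. Z \<omega> * indicator (A k) \<omega> \<partial>M) = (\<integral>\<^sup>+\<omega>. (\<Sum>k. Z \<omega> * indicator (A k) \<omega>) \<partial>M)"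
      by (rule nn_integral_suminf[symmetric]) measurable
    also have "\<dots> = (\<integral>\<^sup>+\<omega>. Z \<omega> \<partial>M)"
    proof (rule nn_integral_cong)
      fix \<omega> assume \<omega>: "\<omega> \<in> space M"
      have "\<omega> \<in> A (nat \<lfloor>real (Suc n) * \<tau> \<omega>\<rfloor>)" using \<omega> by (auto simp: A_def)
      from suminf_cmult_indicator[OF disj this, of "\<lambda>_. Z \<omega>"]
      show "(\<Sum>k. Z \<omega> * indicator (A k) \<omega>) = Z \<omega>" by simp
    qed
    finally show ?thesis .
  qed
  have "(\<integral>\<^sup>+\<omega>. Z \<omega> \<partial>M) * p = limsup (\<lambda>n. \<integral>\<^sup>+\<omega>. Z \<omega> * indicator (E (T n)) \<omega> \<partial>M)"
    by (simp add: eq Limsup_const)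
  also have "\<dots> \<le> (\<integral>\<^sup>+\<omega>. limsup (\<lambda>n. Z \<omega> * indicator (E (T n)) \<omega>) \<partial>M)"
    using Em[OF Tm T0] Zfin
    by (intro nn_integral_limsup[where w=Z]) (auto simp: indicator_def intro!: AE_I2)
  also have "\<dots> \<le> (\<integral>\<^sup>+\<omega>. Z \<omega> * indicator (E \<tau>) \<omega> \<partial>M)"
  proof (rule nn_integral_mono)
    fix \<omega> assume \<omega>: "\<omega> \<in> space M"
    show "limsup (\<lambda>n. Z \<omega> * indicator (E (T n)) \<omega>) \<le> Z \<omega> * indicator (E \<tau>) \<omega>"
    proof (cases "\<omega> \<in> E \<tau>")
      case True
      then show ?thesis by (auto simp: indicator_def intro!: Limsup_bounded always_eventually)
    next
      case False
      then obtain v where v: "v \<in> V" "\<xi> (\<tau> \<omega> + v) \<omega> - \<xi> (\<tau> \<omega>) \<omega> \<notin> B v" using \<omega> by (auto simp: E_def)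
      have v0: "0 \<le> v" using V v by auto
      have "(\<lambda>n. \<xi> (T n \<omega> + v) \<omega> - \<xi> (T n \<omega>) \<omega>) \<longlonglongrightarrow> \<xi> (\<tau> \<omega> + v) \<omega> - \<xi> (\<tau> \<omega>) \<omega>"
        using \<tau>0[OF \<omega>] v0 T[OF \<omega>] Tlim[OF \<omega>] 
        by (intro tendsto_diff right_cont_path_sequentially[OF xi_right_cont[OF \<omega>]] tendsto_add tendsto_const) auto
      moreover have "open (- B v)" using B[OF v(1)] by (simp add: open_closed)
      ultimately have "eventually (\<lambda>n. \<xi> (T n \<omega> + v) \<omega> - \<xi> (T n \<omega>) \<omega> \<in> - B v) sequentially"
        using v(2) by (intro topological_tendstoD) auto
      then have "eventually (\<lambda>n. Z \<omega> * indicator (E (T n)) \<omega> = 0) sequentially"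
        by eventually_elim (use v(1) in \<open>auto simp: E_def indicator_def\<close>)
      then have "(\<lambda>n. Z \<omega> * indicator (E (T n)) \<omega>) \<longlonglongrightarrow> 0"
        by (rule tendsto_eventually)
      then have "limsup (\<lambda>n. Z \<omega> * indicator (E (T n)) \<omega>) = 0"
        by (rule lim_imp_Limsup[rotated]) simp
      then show ?thesis by simp
    qed
  qed
  finally show ?thesis unfolding E_def p_def .
qed

section \<open>Positive mean: lower bounds at integer times\<close>

lemma integrable_xi_nat:
  assumes "integrable M (\<xi> 1)"
  shows "integrable M (\<xi> (real n))"
proof (induction n)
  case 0
  have "integrable M (\<lambda>_. 0 :: real)" by simp
  then show ?case by (subst Bochner_Integration.integrable_cong[OF refl, of _ _ "\<lambda>_. 0"]) (auto simp: xi_0)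
next
  case (Suc n)
  have "integrable (distr M borel (\<xi> 1)) (\<lambda>x. x)"
    using assms by (subst integrable_distr_eq) (auto intro!: xi_measurable)
  then have "integrable (distr M borel (\<lambda>\<omega>. \<xi> (real n + 1) \<omega> - \<xi> (real n) \<omega>)) (\<lambda>x. x)"
    using stationary[of "real n" 1] by simp
  then have "integrable M (\<lambda>\<omega>. \<xi> (real n + 1) \<omega> - \<xi> (real n) \<omega>)"
    by (subst (asm) integrable_distr_eq) (auto intro!: increment_measurable)
  from Bochner_Integration.integrable_add[OF this Suc] show ?case by (simp add: add.commute)
qed

text \<open>Garsia's argument for the maximal ergodic lemma.\<close>

lemma prob_xi_nat_nonneg_pos:
  assumes int: "integrable M (\<xi> 1)" and pos: "0 < expectation (\<xi> 1)"
  shows "0 < prob {\<omega>\<in>space M. \<forall>k::nat. 0 \<le> \<xi> (real k) \<omega>}"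
proof (rule ccontr)
  assume "\<not> 0 < prob {\<omega>\<in>space M. \<forall>k::nat. 0 \<le> \<xi> (real k) \<omega>}"
  then have zero: "prob {\<omega>\<in>space M. \<forall>k::nat. 0 \<le> \<xi> (real k) \<omega>} = 0"
    using measure_nonneg[of M "{\<omega>\<in>space M. \<forall>k::nat. 0 \<le> \<xi> (real k) \<omega>}"] by linarith
  \<comment> \<open>\<open>X n\<close> is the greatest depth of the walk within \<open>n\<close>
    steps, and \<open>Y n\<close> is the same depth for the walk restarted at time 1; by
    stationarity they have the same expectation.\<close>
  define X where "X n \<omega> = Max ((\<lambda>k. - \<xi> (real k) \<omega>) ` {..n})" for n \<omega>
  define Y where "Y n \<omega> = Max ((\<lambda>k. - (\<xi> (1 + real k) \<omega> - \<xi> 1 \<omega>)) ` {..n})" for n \<omega>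
  have iX: "integrable M (X n)" for n
    unfolding X_def using integrable_xi_nat[OF int] by (intro integrable_Max_atMost) auto
  have iY: "integrable M (Y n)" for n
    unfolding Y_def
  proof (intro integrable_Max_atMost Bochner_Integration.integrable_minus Bochner_Integration.integrable_diff int)
    show "integrable M (\<xi> (1 + real k))" for k using integrable_xi_nat[OF int, of "Suc k"] by simp
  qed
  note [measurable] = borel_measurable_integrable[OF iX] borel_measurable_integrable[OF iY] borel_measurable_integrable[OF int]
  have EXY: "expectation (X n) = expectation (Y n)" for n
  proof -
    have "prob {\<omega>\<in>space M. Y n \<omega> \<le> x} = prob {\<omega>\<in>space M. X n \<omega> \<le> x}" for x
    proof -
      have "prob {\<omega>\<in>space M. \<forall>v\<in>real ` {..n}. \<xi> (1 + v) \<omega> - \<xi> 1 \<omega> \<in> {- x..}}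
          = prob {\<omega>\<in>space M. \<forall>v\<in>real ` {..n}. \<xi> v \<omega> \<in> {- x..}}"
        by (rule prob_increments_shift) auto
      then show ?thesis unfolding X_def Y_def by (simp add: minus_le_iff algebra_simps)
    qed
    then have "cdf (distr M borel (X n)) = cdf (distr M borel (Y n))"
      by (auto simp: cdf_def measure_distr fun_eq_iff vimage_def Int_def conj_commute)
    then have "distr M borel (X n) = distr M borel (Y n)"
      by (intro cdf_unique) (auto intro!: real_distribution_distr)
    then have "integral\<^sup>L (distr M borel (X n)) (\<lambda>x. x) = integral\<^sup>L (distr M borel (Y n)) (\<lambda>x. x)" by simp
    then show ?thesis by (simp add: integral_distr)
  qed
  define A where "A n = {\<omega>\<in>space M. 0 < X n \<omega>}" for n
  have [measurable]: "A n \<in> events" for n unfolding A_def by measurable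
  \<comment> \<open>Where \<open>X n\<close> is positive the deepest point comes after time 0, so
    the restarted walk visits it as well and
    \<open>X n \<omega> \<le> Y n \<omega> - \<xi> 1 \<omega>\<close>. Elsewhere
    \<open>X n \<omega> \<le> 0 \<le> Y n \<omega>\<close>.\<close>
  have le: "indicator (A n) \<omega> * \<xi> 1 \<omega> \<le> Y n \<omega> - X n \<omega>" if \<omega>: "\<omega> \<in> space M" for n \<omega>
  proof -
    have Y0: "0 \<le> Y n \<omega>"
      unfolding Y_def by (rule Max_ge) (auto intro!: image_eqI[of _ _ 0])
    show ?thesis
    proof (cases "\<omega> \<in> A n")
      case True
      have "X n \<omega> \<in> (\<lambda>k. - \<xi> (real k) \<omega>) ` {..n}" unfolding X_def by (rule Max_in) auto
      then obtain k where k: "k \<le> n" "X n \<omega> = - \<xi> (real k) \<omega>" by auto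
      have "k \<noteq> 0" using True k xi_0[OF \<omega>] by (intro notI) (simp add: A_def)
      then obtain j where j: "k = Suc j" by (cases k) auto
      have "- (\<xi> (1 + real j) \<omega> - \<xi> 1 \<omega>) \<le> Y n \<omega>"
        unfolding Y_def by (rule Max_ge) (use j k in auto)
      then show ?thesis using True k j by simp
    next
      case False
      then show ?thesis using Y0 \<omega> by (simp add: A_def)
    qed
  qed
  have iA: "integrable M (\<lambda>\<omega>. indicator (A n) \<omega> * \<xi> 1 \<omega>)" for n
    using integrable_mult_indicator[OF _ int, of "A n"] by simp
  have "expectation (\<lambda>\<omega>. indicator (A n) \<omega> * \<xi> 1 \<omega>) \<le> 0" for n
  proof -
    have "expectation (\<lambda>\<omega>. indicator (A n) \<omega> * \<xi> 1 \<omega>) \<le> expectation (\<lambda>\<omega>. Y n \<omega> - X n \<omega>)"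
      using le by (intro integral_mono iA Bochner_Integration.integrable_diff iX iY) auto
    also have "\<dots> = 0" using EXY iX iY by simp
    finally show ?thesis .
  qed
  \<comment> \<open>If almost every path became negative at some integer time, the events
    \<open>A n\<close> would exhaust the space, and the bound above would make the mean of
    \<open>\<xi> 1\<close> at most 0.\<close>
  moreover have "(\<lambda>n. expectation (\<lambda>\<omega>. indicator (A n) \<omega> * \<xi> 1 \<omega>)) \<longlonglongrightarrow> expectation (\<xi> 1)"
  proof (rule integral_dominated_convergence[where w="\<lambda>\<omega>. \<bar>\<xi> 1 \<omega>\<bar>"])
    have "AE \<omega> in M. \<omega> \<notin> {\<omega>\<in>space M. \<forall>k::nat. 0 \<le> \<xi> (real k) \<omega>}"
    proof (rule AE_not_in, rule null_setsI)
      have "{\<omega>\<in>space M. \<forall>v\<in>range real. \<xi> v \<omega> \<in> {0..}} \<in> events"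
        by (rule xi_sets) auto
      then show ev: "{\<omega>\<in>space M. \<forall>k::nat. 0 \<le> \<xi> (real k) \<omega>} \<in> events" by simp
      show "emeasure M {\<omega>\<in>space M. \<forall>k::nat. 0 \<le> \<xi> (real k) \<omega>} = 0"
        using zero by (simp add: emeasure_eq_measure)
    qed
    then show "AE \<omega> in M. (\<lambda>n. indicator (A n) \<omega> * \<xi> 1 \<omega>) \<longlonglongrightarrow> \<xi> 1 \<omega>"
    proof (rule AE_mp, intro AE_I2 impI)
      fix \<omega> assume \<omega>: "\<omega> \<in> space M" "\<omega> \<notin> {\<omega>\<in>space M. \<forall>k::nat. 0 \<le> \<xi> (real k) \<omega>}"
      then obtain k :: nat where k: "\<xi> (real k) \<omega> < 0" by (auto simp: not_le)
      have "\<omega> \<in> A n" if "k \<le> n" for n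
      proof -
        have "- \<xi> (real k) \<omega> \<le> X n \<omega>" unfolding X_def by (rule Max_ge) (use that in auto)
        then show ?thesis using k \<omega> by (auto simp: A_def)
      qed
      then have "eventually (\<lambda>n. indicator (A n) \<omega> * \<xi> 1 \<omega> = \<xi> 1 \<omega>) sequentially"
        unfolding eventually_sequentially by (intro exI[of _ k]) auto
      then show "(\<lambda>n. indicator (A n) \<omega> * \<xi> 1 \<omega>) \<longlonglongrightarrow> \<xi> 1 \<omega>"
        by (rule tendsto_eventually)
    qed
  qed (use int in \<open>auto simp: indicator_def intro!: AE_I2\<close>)
  ultimately have "expectation (\<xi> 1) \<le> 0"
    by (intro LIMSEQ_le_const2) auto
  then show False using pos by simp
qed

text \<open>Boundedness below, with an unspecified bound, is unaffected by deleting the first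
  \<open>n\<close> steps, so the event is independent of every \<open>past (real n)\<close>. It has
  positive probability and retains this proportion of every past event, hence it has probability
  1.\<close>

lemma AE_xi_nat_bounded_below:
  assumes int: "integrable M (\<xi> 1)" and pos: "0 < expectation (\<xi> 1)"
  shows "AE \<omega> in M. \<exists>K::nat. \<forall>k::nat. - real K \<le> \<xi> (real k) \<omega>"
proof -
  define D where "D K = {\<omega>\<in>space M. \<forall>k::nat. - real K \<le> \<xi> (real k) \<omega>}" for K :: nat
  define B where "B = (\<Union>K. D K)"
  have Dm: "D K \<in> events" for K
    using xi_sets[of "range real" "\<lambda>_. {- real K..}"] by (simp add: D_def)
  have D_inc: "incseq D"
  proof (rule incseq_SucI, rule subsetI)
    fix K \<omega> assume "\<omega> \<in> D K"
    then have "\<omega> \<in> space M" "\<And>k::nat. - real K \<le> \<xi> (real k) \<omega>" by (auto simp: D_def)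
    moreover from this(2) have "- real (Suc K) \<le> \<xi> (real k) \<omega>" for k
      by (rule order_trans[rotated]) simp
    ultimately show "\<omega> \<in> D (Suc K)" by (auto simp: D_def)
  qed
  have Bm: "B \<in> events" unfolding B_def using Dm by blast
  have Bsig: "B \<in> sigma_sets (space M) (\<Union>n. sets (past (real n)))"
  proof -
    interpret S: sigma_algebra "space M" "sigma_sets (space M) (\<Union>n. sets (past (real n)))"
      using sets.sets_into_space[of _ "past _"] by (intro sigma_algebra_sigma_sets) fastforce
    have "{\<omega>\<in>space M. - real K \<le> \<xi> (real k) \<omega>} \<in> sigma_sets (space M) (\<Union>n. sets (past (real n)))" for K k
    proof (rule sigma_sets.Basic, rule UN_I[of k])
      show "{\<omega>\<in>space M. - real K \<le> \<xi> (real k) \<omega>} \<in> sets (past (real k))"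
        using Collect_in_sets[OF xi_measurable_past[of "real k" "real k"], of "{- real K..}"] by simp
    qed simp
    then show ?thesis
      unfolding B_def D_def by (intro S.countable_UN image_subsetI S.sets_Collect_countable_All)
  qed
  have indep: "prob (B \<inter> C) = prob B * prob C" if C: "C \<in> sets (past (real n))" for C n
  proof -
    define D' where "D' K = {\<omega>\<in>space M. \<forall>k::nat. - real K \<le> \<xi> (real n + real k) \<omega> - \<xi> (real n) \<omega>}" for K :: nat
    have D'm: "D' K \<in> events" for K
      using future_sets[of "range real" "real n" "\<lambda>_. {- real K..}"] by (simp add: D'_def)
    \<comment> \<open>A change of origin shifts the bound by \<open>\<xi> (real n) \<omega>\<close>
      and brings in finitely many earlier values; only the union over all bounds is insensitive to
      this.\<close>
    have B': "B = (\<Union>K. D' K)"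
    proof (intro equalityI subsetI)
      fix \<omega> assume "\<omega> \<in> B"
      then obtain K where K: "\<omega> \<in> space M" "\<And>k::nat. - real K \<le> \<xi> (real k) \<omega>" by (auto simp: B_def D_def)
      obtain L :: nat where "real K + \<bar>\<xi> (real n) \<omega>\<bar> \<le> real L" using real_arch_simple by blast
      then have "- real L \<le> \<xi> (real n + real k) \<omega> - \<xi> (real n) \<omega>" for k using K(2)[of "n + k"] by simp
      then show "\<omega> \<in> (\<Union>K. D' K)" using K(1) by (auto simp: D'_def)
    next
      fix \<omega> assume "\<omega> \<in> (\<Union>K. D' K)"
      then obtain K where K: "\<omega> \<in> space M" "\<And>k::nat. - real K \<le> \<xi> (real n + real k) \<omega> - \<xi> (real n) \<omega>"
        by (auto simp: D'_def)
      obtain L :: nat where L: "real K + (\<Sum>j\<le>n. \<bar>\<xi> (real j) \<omega>\<bar>) \<le> real L" using real_arch_simple by blast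
      have "- real L \<le> \<xi> (real k) \<omega>" for k
      proof (cases "k \<le> n")
        case True
        then have "\<bar>\<xi> (real k) \<omega>\<bar> \<le> (\<Sum>j\<le>n. \<bar>\<xi> (real j) \<omega>\<bar>)" by (intro member_le_sum) auto
        then show ?thesis using L by linarith
      next
        case False
        have "\<bar>\<xi> (real n) \<omega>\<bar> \<le> (\<Sum>j\<le>n. \<bar>\<xi> (real j) \<omega>\<bar>)" by (intro member_le_sum) auto
        moreover have "- real K \<le> \<xi> (real k) \<omega> - \<xi> (real n) \<omega>"
          using K(2)[of "k - n"] False by (simp add: of_nat_diff)
        ultimately show ?thesis using L by linarith
      qed
      then show "\<omega> \<in> B" using K(1) by (auto simp: B_def D_def)
    qed
    have Cm: "C \<in> events" using C past_events by blast
    have eq: "prob (D' K \<inter> C) = prob (D K) * prob C" for K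
      using indep_past_future[OF C, of "range real" "\<lambda>_. {- real K..}"]
      by (simp add: D'_def D_def Int_commute mult.commute)
    have "(\<lambda>K. prob (D' K \<inter> C)) \<longlonglongrightarrow> prob (\<Union>K. D' K \<inter> C)"
    proof (rule finite_Lim_measure_incseq)
      show "incseq (\<lambda>K. D' K \<inter> C)"
      proof (rule incseq_SucI, rule subsetI)
        fix K \<omega> assume "\<omega> \<in> D' K \<inter> C"
        then have "\<omega> \<in> space M" "\<omega> \<in> C" "\<And>k::nat. - real K \<le> \<xi> (real n + real k) \<omega> - \<xi> (real n) \<omega>"
          by (auto simp: D'_def)
        moreover from this(3) have "- real (Suc K) \<le> \<xi> (real n + real k) \<omega> - \<xi> (real n) \<omega>" for k
          by (rule order_trans[rotated]) simp
        ultimately show "\<omega> \<in> D' (Suc K) \<inter> C" by (auto simp: D'_def)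
      qed
    qed (use D'm Cm in auto)
    moreover have "(\<lambda>K. prob (D K) * prob C) \<longlonglongrightarrow> prob B * prob C"
      unfolding B_def by (intro tendsto_mult tendsto_const finite_Lim_measure_incseq D_inc) (use Dm in auto)
    ultimately have "prob (\<Union>K. D' K \<inter> C) = prob B * prob C"
      unfolding eq by (rule LIMSEQ_unique)
    then show ?thesis unfolding B' by simp
  qed
  have "0 < prob (D 0)" using prob_xi_nat_nonneg_pos[OF int pos] by (simp add: D_def)
  also have "prob (D 0) \<le> prob B" by (rule finite_measure_mono) (use Bm in \<open>auto simp: B_def\<close>)
  finally have "0 < prob B" .
  then have "prob B = 1"
    using indep by (intro prob_eq_1_if_prob_Int_ge[OF subalgebra_past past_mono Bsig]) auto
  then have "AE \<omega> in M. \<omega> \<in> B" using Bm by (simp add: prob_eq_1)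
  then show ?thesis by (rule AE_mp) (auto simp: B_def D_def)
qed


text \<open>Ottaviani's inequality transfers the lower bound from integer times to all times.\<close>

lemma AE_xi_bounded_below:
  assumes int: "integrable M (\<xi> 1)" and pos: "0 < expectation (\<xi> 1)"
  shows "AE \<omega> in M. \<exists>K::nat. \<forall>q\<in>nonneg_rats. - real K \<le> \<xi> q \<omega>"
proof -
  \<comment> \<open>This yields \<open>K0\<close>, which bounds the rise of the path during one unit
    of time with probability above 1/2; that 1/2 is the constant of Ottaviani's inequality.\<close>
  define U where "U K = {\<omega>\<in>space M. \<forall>q\<in>nonneg_rats \<inter> {0..1}. \<xi> q \<omega> \<in> {..real K}}" for K :: nat
  have Um: "U K \<in> events" for K
    unfolding U_def by (rule xi_sets) (auto intro: countable_subset[OF _ countable_nonneg_rats])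
  have "(\<lambda>K. prob (U K)) \<longlonglongrightarrow> prob (\<Union>K. U K)"
    by (rule finite_Lim_measure_incseq) (use Um in \<open>force simp: incseq_def U_def\<close>)+
  also have "(\<Union>K. U K) = space M"
  proof -
    have "\<exists>K. \<omega> \<in> U K" if \<omega>: "\<omega> \<in> space M" for \<omega>
    proof -
      obtain b where b: "\<And>t. t \<in> {0..1} \<Longrightarrow> \<bar>\<xi> t \<omega>\<bar> \<le> b"
        using cadlag_bounded_on[OF xi_cadlag[OF \<omega>], of 1] by fastforce
      obtain K :: nat where "b \<le> real K" using real_arch_simple by blast
      then have "\<xi> t \<omega> \<le> real K" if "t \<in> {0..1}" for t using b[OF that] by linarith
      then have "\<omega> \<in> U K" using \<omega> by (auto simp: U_def)
      then show ?thesis ..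
    qed
    then show ?thesis by (auto simp: U_def)
  qed
  finally have "eventually (\<lambda>K. 1 / 2 < prob (U K)) sequentially"
    by (rule order_tendstoD) (simp add: prob_space)
  then obtain K0 where K0: "1 / 2 < prob (U K0)" by (auto simp: eventually_sequentially)
  define L where "L x = {\<omega>\<in>space M. \<exists>q\<in>nonneg_rats. \<xi> q \<omega> < - real x - real K0}" for x :: nat
  define D where "D x = {\<omega>\<in>space M. \<exists>k::nat. \<xi> (real k) \<omega> < - real x}" for x :: nat
  have Dm: "D x \<in> events" for x
  proof -
    have "{\<omega>\<in>space M. \<forall>v\<in>range real. \<xi> v \<omega> \<in> {- real x..}} \<in> events" by (rule xi_sets) auto
    moreover have "D x = space M - {\<omega>\<in>space M. \<forall>v\<in>range real. \<xi> v \<omega> \<in> {- real x..}}"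
      by (intro set_eqI) (simp add: D_def not_le[symmetric] image_def Bex_def Ball_def, blast)
    ultimately show ?thesis by auto
  qed
  have Lm: "L x \<in> events" for x
  proof -
    have "{\<omega>\<in>space M. \<forall>v\<in>nonneg_rats. \<xi> v \<omega> \<in> {- real x - real K0..}} \<in> events"
      by (rule xi_sets) (use countable_nonneg_rats nonneg_rats_subset in auto)
    moreover have "L x = space M - {\<omega>\<in>space M. \<forall>v\<in>nonneg_rats. \<xi> v \<omega> \<in> {- real x - real K0..}}"
      by (auto simp: L_def not_le)
    ultimately show ?thesis by auto
  qed
  have LD: "1 / 2 * prob (L x) \<le> prob (D x)" for x
  proof -
    define A where "A v = {\<omega>\<in>space M. \<xi> v \<omega> < - real x - real K0}" for v
    \<comment> \<open>The waiting time until the next integer. A path below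
      \<open>- real x - real K0\<close> at time \<open>v\<close> is still below
      \<open>- real x\<close> at that integer if it rises by at most \<open>K0\<close>
      meanwhile.\<close>
    define r where "r v = of_int \<lceil>v\<rceil> - v" for v :: real
    define G where "G v = {\<omega>\<in>space M. \<forall>u\<in>{r v}. \<xi> (v + u) \<omega> - \<xi> v \<omega> \<in> {..real K0}}" for v
    have r: "r v \<in> nonneg_rats \<inter> {0..1}" if "v \<in> nonneg_rats" for v
      using that unfolding r_def nonneg_rats_def by (auto, linarith)
    have L: "L x = (\<Union>v\<in>nonneg_rats. A v)" by (auto simp: L_def A_def)
    have "1 / 2 * prob (\<Union>v\<in>nonneg_rats. A v) \<le> prob (\<Union>v\<in>nonneg_rats. A v \<inter> G v)"
    proof (rule prob_first_entry_ge[where F=past])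
      fix v assume v: "v \<in> nonneg_rats"
      show "A v \<in> sets (past v)"
        using Collect_in_sets[OF xi_measurable_past[of v v], of "{..<- real x - real K0}"] nonneg_rats_ge_0[OF v]
        by (simp add: A_def)
      show "G v \<in> events"
        unfolding G_def using r[OF v] nonneg_rats_ge_0[OF v] by (intro future_sets) auto
      fix C assume C: "C \<in> sets (past v)"
      have "prob (U K0) \<le> prob {\<omega>\<in>space M. \<forall>u\<in>{r v}. \<xi> u \<omega> \<in> {..real K0}}"
        using r[OF v] by (intro finite_measure_mono xi_sets) (auto simp: U_def)
      then have "1 / 2 * prob C \<le> prob C * prob {\<omega>\<in>space M. \<forall>u\<in>{r v}. \<xi> u \<omega> \<in> {..real K0}}"
        using K0 by (subst mult.commute) (intro mult_left_mono, auto)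
      also have "\<dots> = prob (C \<inter> G v)"
        unfolding G_def using r[OF v] nonneg_rats_ge_0[OF v] C by (intro indep_past_future[symmetric]) auto
      finally show "1 / 2 * prob C \<le> prob (C \<inter> G v)" .
    qed (use countable_nonneg_rats subalgebra_past past_mono in auto)
    also have "\<dots> \<le> prob (D x)"
    proof (rule finite_measure_mono)
      show "(\<Union>v\<in>nonneg_rats. A v \<inter> G v) \<subseteq> D x"
      proof safe
        fix v \<omega> assume v: "v \<in> nonneg_rats" and \<omega>: "\<omega> \<in> A v" "\<omega> \<in> G v"
        have "0 \<le> \<lceil>v\<rceil>" using nonneg_rats_ge_0[OF v] by linarith
        then have "v + r v = real (nat \<lceil>v\<rceil>)" by (simp add: r_def)
        moreover have "\<xi> (v + r v) \<omega> < - real x" using \<omega> by (auto simp: A_def G_def)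
        ultimately show "\<omega> \<in> D x" using \<omega> by (auto simp: D_def A_def)
      qed
    qed (rule Dm)
    finally show ?thesis unfolding L .
  qed
  have "(\<lambda>x. prob (D x)) \<longlonglongrightarrow> prob (\<Inter>x. D x)"
  proof (rule finite_Lim_measure_decseq)
    show "decseq D"
    proof (rule decseq_SucI, rule subsetI)
      fix x \<omega> assume "\<omega> \<in> D (Suc x)"
      then obtain k :: nat where "\<omega> \<in> space M" "\<xi> (real k) \<omega> < - real (Suc x)" by (auto simp: D_def)
      then have "\<omega> \<in> space M \<and> \<xi> (real k) \<omega> < - real x" by simp
      then show "\<omega> \<in> D x" unfolding D_def by blast
    qed
  qed (use Dm in auto)
  also have "prob (\<Inter>x. D x) = 0"
  proof -
    have "AE \<omega> in M. \<omega> \<notin> (\<Inter>x. D x)"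
      using AE_xi_nat_bounded_below[OF int pos] by (rule AE_mp) (auto simp: D_def not_less intro!: AE_I2)
    moreover have "(\<Inter>x. D x) \<in> events" using Dm by blast
    ultimately show ?thesis by (simp add: prob_eq_0)
  qed
  finally have D0: "(\<lambda>x. prob (D x)) \<longlonglongrightarrow> 0" .
  have Lim: "(\<Inter>x. L x) \<in> events" using Lm by blast
  have "prob (\<Inter>x. L x) \<le> 2 * prob (D x)" for x
  proof -
    have "prob (\<Inter>x. L x) \<le> prob (L x)" by (rule finite_measure_mono) (use Lm in auto)
    then show ?thesis using LD[of x] by simp
  qed
  then have "prob (\<Inter>x. L x) \<le> 2 * 0"
    by (intro LIMSEQ_le_const[OF tendsto_mult[OF tendsto_const D0]]) auto
  then have "prob (\<Inter>x. L x) = 0" by (simp add: measure_le_0_iff)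
  then have "AE \<omega> in M. \<omega> \<notin> (\<Inter>x. L x)" using Lim by (simp add: prob_eq_0)
  then show ?thesis
  proof (rule AE_mp, intro AE_I2 impI)
    fix \<omega> assume "\<omega> \<in> space M" "\<omega> \<notin> (\<Inter>x. L x)"
    then obtain x where "\<And>q. q \<in> nonneg_rats \<Longrightarrow> - real (x + K0) \<le> \<xi> q \<omega>" by (force simp: L_def not_less)
    then show "\<exists>K::nat. \<forall>q\<in>nonneg_rats. - real K \<le> \<xi> q \<omega>" by blast
  qed
qed

text \<open>If the path fell below \<open>b\<close> almost surely, restarting it at the crossing
  would bring it below \<open>2 * b\<close>, then below \<open>3 * b\<close> and so on, against the
  almost sure lower bound.\<close>

lemma prob_xi_ge_pos:
  assumes int: "integrable M (\<xi> 1)" and pos: "0 < expectation (\<xi> 1)" and "b < 0"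
  shows "0 < prob {\<omega>\<in>space M. \<forall>q\<in>nonneg_rats. \<xi> q \<omega> \<in> {b..}}"
proof (rule ccontr)
  let ?H = "{\<omega>\<in>space M. \<forall>q\<in>nonneg_rats. \<xi> q \<omega> \<in> {b..}}"
  assume "\<not> 0 < prob ?H"
  then have zero: "prob ?H = 0" using measure_nonneg[of M ?H] by linarith
  define L where "L n = {\<omega>\<in>space M. \<exists>q\<in>nonneg_rats. \<xi> q \<omega> < real (Suc n) * b}" for n :: nat
  have L_eq: "L n = space M - {\<omega>\<in>space M. \<forall>v\<in>nonneg_rats. \<xi> v \<omega> \<in> {real (Suc n) * b..}}" for n
    by (auto simp: L_def not_le)
  have Lm: "L n \<in> events" for n
    unfolding L_eq by (intro sets.Diff sets.top xi_sets countable_nonneg_rats nonneg_rats_subset) auto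
  have L1: "prob (L n) = 1" for n
  proof (induction n)
    case 0
    have "?H \<in> events" by (intro xi_sets countable_nonneg_rats nonneg_rats_subset) auto
    from prob_compl[OF this] zero show ?case unfolding L_eq by simp
  next
    case (Suc n)
    define A where "A v = {\<omega>\<in>space M. \<xi> v \<omega> < real (Suc n) * b}" for v
    define N where "N v = {\<omega>\<in>space M. \<forall>u\<in>nonneg_rats. \<xi> (v + u) \<omega> - \<xi> v \<omega> \<in> {b..}}" for v
    \<comment> \<open>The constant in the first entry bound is 1, because staying above
      \<open>b\<close> relative to time \<open>v\<close> has probability 0 by assumption, also given
      the past.\<close>
    have "1 * prob (\<Union>v\<in>nonneg_rats. A v) \<le> prob (\<Union>v\<in>nonneg_rats. A v \<inter> (space M - N v))"
    proof (rule prob_first_entry_ge[where F=past])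
      fix v assume v: "v \<in> nonneg_rats"
      show "A v \<in> sets (past v)"
        using Collect_in_sets[OF xi_measurable_past[of v v], of "{..<real (Suc n) * b}"] nonneg_rats_ge_0[OF v]
        by (simp add: A_def)
      have Nm: "N v \<in> events"
        unfolding N_def using nonneg_rats_ge_0[OF v]
        by (intro future_sets countable_nonneg_rats nonneg_rats_subset) auto
      then show "space M - N v \<in> events" by auto
      fix C assume C: "C \<in> sets (past v)"
      have Cm: "C \<in> events" using C past_events by blast
      have "prob (C \<inter> N v) = prob C * prob ?H"
        unfolding N_def using nonneg_rats_ge_0[OF v]
        by (intro indep_past_future C countable_nonneg_rats nonneg_rats_subset) auto
      then have z: "prob (C \<inter> N v) = 0" using zero by simp
      have "C \<inter> (space M - N v) = C - C \<inter> N v" using sets.sets_into_space[OF Cm] by auto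
      then show "1 * prob C \<le> prob (C \<inter> (space M - N v))"
        using z Cm Nm by (simp add: finite_measure_Diff)
    qed (use countable_nonneg_rats subalgebra_past past_mono in auto)
    also have "(\<Union>v\<in>nonneg_rats. A v) = L n" by (auto simp: L_def A_def)
    also have "prob (\<Union>v\<in>nonneg_rats. A v \<inter> (space M - N v)) \<le> prob (L (Suc n))"
    proof (rule finite_measure_mono)
      show "(\<Union>v\<in>nonneg_rats. A v \<inter> (space M - N v)) \<subseteq> L (Suc n)"
      proof safe
        fix v \<omega> assume v: "v \<in> nonneg_rats" and \<omega>: "\<omega> \<in> A v" "\<omega> \<in> space M" "\<omega> \<notin> N v"
        then obtain u where u: "u \<in> nonneg_rats" "\<xi> (v + u) \<omega> - \<xi> v \<omega> < b"
          by (auto simp: N_def not_le)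
        then have "\<xi> (v + u) \<omega> < real (Suc (Suc n)) * b" using \<omega> by (simp add: A_def algebra_simps)
        then show "\<omega> \<in> L (Suc n)" using nonneg_rats_add[OF v u(1)] \<omega> by (auto simp: L_def)
      qed
    qed (rule Lm)
    finally show ?case using Suc prob_le_1[of "L (Suc n)"] by simp
  qed
  have "AE \<omega> in M. \<forall>n. \<omega> \<in> L n"
    unfolding AE_all_countable using L1 Lm by (simp add: prob_eq_1)
  with AE_xi_bounded_below[OF int pos] have "AE \<omega> in M. False"
  proof eventually_elim
    case (elim \<omega>)
    then obtain K :: nat where K: "\<And>q. q \<in> nonneg_rats \<Longrightarrow> - real K \<le> \<xi> q \<omega>" by blast
    obtain n :: nat where n: "real K / (- b) \<le> real n" using real_arch_simple by blast
    obtain q where q: "q \<in> nonneg_rats" "\<xi> q \<omega> < real (Suc n) * b" using elim by (auto simp: L_def)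
    have "real K \<le> real n * (- b)" using n \<open>b < 0\<close> by (simp add: field_simps)
    with K[OF q(1)] q(2) \<open>b < 0\<close> show False by (simp add: algebra_simps)
  qed
  then show False using AE_False by simp
qed

end

section \<open>Levy processes without negative values\<close>

text \<open>Cauchy's functional equation. Nonnegativity makes \<open>f\<close> monotone, so
  \<open>f (real (Suc n) * t)\<close> is squeezed between the values of \<open>f\<close> at
  neighbouring integers.\<close>

lemma additive_nonneg_linear:
  fixes f :: "real \<Rightarrow> real"
  assumes add: "\<And>s t. 0 \<le> s \<Longrightarrow> 0 \<le> t \<Longrightarrow> f (s + t) = f s + f t"
    and nonneg: "\<And>t. 0 \<le> t \<Longrightarrow> 0 \<le> f t" and "0 \<le> t"
  shows "f t = f 1 * t"
proof -
  have mult: "f (real n * s) = real n * f s" if "0 \<le> s" for n s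
  proof (induction n)
    case 0
    then show ?case using add[of 0 0] by simp
  next
    case (Suc n)
    have "f (real (Suc n) * s) = f (real n * s + s)" by (simp add: algebra_simps)
    also have "\<dots> = f (real n * s) + f s" by (rule add) (use that in auto)
    finally show ?case using Suc by (simp add: algebra_simps)
  qed
  have mono: "f s \<le> f u" if "0 \<le> s" "s \<le> u" for s u
    using add[of s "u - s"] nonneg[of "u - s"] that by simp
  have bound: "\<bar>f t - f 1 * t\<bar> \<le> f 1 * inverse (real (Suc n))" for n
  proof -
    define k where "k = nat \<lfloor>real (Suc n) * t\<rfloor>"
    have "0 \<le> real (Suc n) * t" using \<open>0 \<le> t\<close> by simp
    then have k: "real k \<le> real (Suc n) * t" "real (Suc n) * t \<le> real (Suc k)" unfolding k_def by linarith+
    have "real k * f 1 \<le> real (Suc n) * f t"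
      using mono[OF _ k(1)] mult[of 1 k] mult[OF \<open>0 \<le> t\<close>, of "Suc n"] by simp
    moreover have "real (Suc n) * f t \<le> real (Suc k) * f 1"
      using mono[OF _ k(2)] mult[of 1 "Suc k"] mult[OF \<open>0 \<le> t\<close>, of "Suc n"] \<open>0 \<le> t\<close> by simp
    moreover have "real k * f 1 \<le> real (Suc n) * t * f 1" "real (Suc n) * t * f 1 \<le> real (Suc k) * f 1"
      using k nonneg[of 1] by (intro mult_right_mono; simp)+
    moreover have "real (Suc k) * f 1 = real k * f 1 + f 1" by (simp add: algebra_simps)
    moreover have "real (Suc n) * (f t - f 1 * t) = real (Suc n) * f t - real (Suc n) * t * f 1"
      by (simp add: algebra_simps)
    ultimately have "\<bar>real (Suc n) * (f t - f 1 * t)\<bar> \<le> f 1" by linarith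
    then have "real (Suc n) * \<bar>f t - f 1 * t\<bar> \<le> f 1" unfolding abs_mult by simp
    then show ?thesis by (simp add: field_simps)
  qed
  have "(\<lambda>n. f 1 * inverse (real (Suc n))) \<longlonglongrightarrow> f 1 * 0"
    by (intro tendsto_mult tendsto_const LIMSEQ_inverse_real_of_nat)
  then have "\<bar>f t - f 1 * t\<bar> \<le> f 1 * 0"
    by (rule LIMSEQ_le_const) (use bound in auto)
  then show ?thesis by simp
qed

text \<open>The left limit is bounded above by monotonicity and below by the absence of positive
  jumps; at time 0 only the right limit matters.\<close>

lemma cadlag_nondecreasing_no_jumps_continuous_on:
  assumes w: "cadlag w" and mono: "\<And>s t. 0 \<le> s \<Longrightarrow> s \<le> t \<Longrightarrow> w s \<le> w t"
    and jumps: "\<And>t. 0 < t \<Longrightarrow> w t \<le> Lim (at_left t) w"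
  shows "continuous_on {0..T} w"
  unfolding continuous_on_eq_continuous_within
proof
  fix t assume t: "t \<in> {0..T}"
  have right: "(w \<longlongrightarrow> w t) (at_right t)" using w t by (auto simp: cadlag_def)
  show "continuous (at t within {0..T}) w"
  proof (cases "t = 0")
    case True
    have "at 0 within {0..T} \<le> at_right (0 :: real)" unfolding at_within_def by (rule inf_mono) auto
    then have "(w \<longlongrightarrow> w t) (at t within {0..T})"
      using right tendsto_mono unfolding True by blast
    then show ?thesis by (simp add: continuous_within)
  next
    case False
    then have "0 < t" using t by auto
    then obtain l where l: "(w \<longlongrightarrow> l) (at_left t)" using w by (auto simp: cadlag_def)
    have "Lim (at_left t) w = l" by (rule tendsto_Lim[OF _ l]) simp
    then have "w t \<le> l" using jumps[OF \<open>0 < t\<close>] by simp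
    moreover have "l \<le> w t"
    proof (rule tendsto_upperbound[OF l])
      show "eventually (\<lambda>s. w s \<le> w t) (at_left t)"
        unfolding eventually_at_left_field using \<open>0 < t\<close> mono by (intro exI[of _ 0]) auto
    qed simp
    ultimately have "isCont w t"
      using l right filterlim_split_at[of w "nhds (w t)" t] by (auto simp: isCont_def)
    then show ?thesis by (rule continuous_at_imp_continuous_at_within)
  qed
qed

text \<open>The bound \<open>K\<close> controls the clock of the Lamperti time change up to
  \<open>s1\<close>, and the bound \<open>b\<close> keeps the path low during the window from
  \<open>s0\<close> to \<open>s1\<close>. The intervals are closed because the estimate at random
  times requires closed sets.\<close>

definition tube :: "real \<Rightarrow> real \<Rightarrow> real \<Rightarrow> real \<Rightarrow> real \<Rightarrow> real set" where
  "tube s0 s1 K b q = (if q \<le> s1 then {- K..K} else UNIV) \<inter> (if s0 \<le> q \<and> q \<le> s1 then {..b} else UNIV)"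

context levy
begin

text \<open>Stationarity transfers nonnegativity to increments between the countably many pairs of
  rational times; right-continuity extends the order to all times.\<close>

lemma AE_nondecreasing:
  assumes nonneg: "\<And>t. 0 \<le> t \<Longrightarrow> AE \<omega> in M. 0 \<le> \<xi> t \<omega>"
  shows "AE \<omega> in M. \<forall>s t. 0 \<le> s \<longrightarrow> s \<le> t \<longrightarrow> \<xi> s \<omega> \<le> \<xi> t \<omega>"
proof -
  have "AE \<omega> in M. \<forall>p\<in>nonneg_rats. \<forall>q\<in>nonneg_rats. p \<le> q \<longrightarrow> \<xi> p \<omega> \<le> \<xi> q \<omega>"
  proof (intro AE_ball_countable[THEN iffD2] countable_nonneg_rats ballI)
    fix p q assume pq: "p \<in> nonneg_rats" "q \<in> nonneg_rats"
    show "AE \<omega> in M. p \<le> q \<longrightarrow> \<xi> p \<omega> \<le> \<xi> q \<omega>"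
    proof (cases "p \<le> q")
      case True
      have p0: "0 \<le> p" using pq nonneg_rats_ge_0 by auto
      have "AE x in distr M borel (\<xi> (q - p)). 0 \<le> x"
        using nonneg[of "q - p"] True by (subst AE_distr_iff) (auto intro!: xi_measurable)
      then have "AE x in distr M borel (\<lambda>\<omega>. \<xi> q \<omega> - \<xi> p \<omega>). 0 \<le> x"
        using stationary[of p "q - p"] True p0 by (simp only: diff_ge_0_iff_ge add_diff_cancel_left' le_add_diff_inverse add.commute diff_add_cancel)
      then have "AE \<omega> in M. 0 \<le> \<xi> q \<omega> - \<xi> p \<omega>"
        using True p0 by (subst (asm) AE_distr_iff) (auto intro!: increment_measurable)
      then show ?thesis by eventually_elim simp
    qed simp
  qed
  then show ?thesis
  proof (rule AE_mp, intro AE_I2 impI allI)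
    fix \<omega> and s t :: real
    assume \<omega>: "\<omega> \<in> space M" and R: "\<forall>p\<in>nonneg_rats. \<forall>q\<in>nonneg_rats. p \<le> q \<longrightarrow> \<xi> p \<omega> \<le> \<xi> q \<omega>"
      and st: "0 \<le> s" "s \<le> t"
    show "\<xi> s \<omega> \<le> \<xi> t \<omega>"
    proof (cases "s = t")
      case False
      have "\<exists>q\<in>nonneg_rats. u < q \<and> q < u + inverse (real (Suc n))" if "0 \<le> u" for u n
      proof -
        obtain q where "q \<in> \<rat>" "u < q" "q < u + inverse (real (Suc n))"
          using Rats_dense_in_real[of u "u + inverse (real (Suc n))"] by auto
        then show ?thesis using that by (auto simp: nonneg_rats_def)
      qed
      then obtain f where f: "\<And>u n. 0 \<le> u \<Longrightarrow> f u n \<in> nonneg_rats" "\<And>u n. 0 \<le> u \<Longrightarrow> u < f u n"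
        "\<And>u n. 0 \<le> u \<Longrightarrow> f u n < u + inverse (real (Suc n))" by metis
      have lim: "(\<lambda>n. f u n) \<longlonglongrightarrow> u" if "0 \<le> u" for u
      proof (rule tendsto_sandwich[OF _ _ tendsto_const])
        show "(\<lambda>n. u + inverse (real (Suc n))) \<longlonglongrightarrow> u"
          using tendsto_add[OF tendsto_const[of u] LIMSEQ_inverse_real_of_nat] by simp
      qed (use f[OF that] in \<open>auto simp: less_imp_le intro!: always_eventually\<close>)
      have xlim: "(\<lambda>n. \<xi> (f u n) \<omega>) \<longlonglongrightarrow> \<xi> u \<omega>" if "0 \<le> u" for u
        by (rule right_cont_path_sequentially[OF xi_right_cont[OF \<omega>] that f(2)[OF that] lim[OF that]])
      have t0: "0 \<le> t" using st by simp
      have "eventually (\<lambda>n. f s n < t) sequentially"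
        by (rule order_tendstoD(2)[OF lim]) (use st False in auto)
      then have "eventually (\<lambda>n. \<xi> (f s n) \<omega> \<le> \<xi> (f t n) \<omega>) sequentially"
      proof eventually_elim
        case (elim n)
        then show ?case using R f(1)[OF st(1), of n] f(1,2)[OF t0, of n] by fastforce
      qed
      then show ?thesis
        by (rule tendsto_le[OF sequentially_bot xlim[OF t0] xlim[OF st(1)]])
    qed simp
  qed
qed

text \<open>If the paths are continuous, then the increments over a fine grid are uniformly small. Comparing
  \<open>E (exp (- 2 \<Delta>))\<close> with \<open>E (exp (- \<Delta>))\<close> for a small increment \<open>\<Delta>\<close> and taking powers shows that
  \<open>exp (- \<xi> T)\<close> has variance zero.\<close>

lemma AE_const_if_nonneg_no_jumps:
  assumes nonneg: "\<And>t. 0 \<le> t \<Longrightarrow> AE \<omega> in M. 0 \<le> \<xi> t \<omega>"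
    and jumps: "AE \<omega> in M. \<forall>t>0. \<xi> t \<omega> \<le> Lim (at_left t) (\<lambda>s. \<xi> s \<omega>)"
    and T: "0 \<le> T"
  shows "\<exists>c. AE \<omega> in M. \<xi> T \<omega> = c"
proof -
  \<comment> \<open>\<open>g e\<close> agrees with \<open>exp (- x)\<close> on \<open>{0..e}\<close>
    and stays between \<open>exp (- e)\<close> and 1 on the whole line, so its moments can be
    estimated although an increment may be large with small probability.\<close>
  define g where "g e x = exp (- max 0 (min x e))" for e x :: real
  have g [measurable]: "g e \<in> borel_measurable borel" for e unfolding g_def by measurable
  have g01: "exp (- e) \<le> g e x" "g e x \<le> 1" "0 < g e x" if "0 < e" for e x
    using that by (auto simp: g_def)
  define s where "s n i = real i * (T / real (Suc n))" for n i :: nat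
  define \<Delta> where "\<Delta> n i \<omega> = \<xi> (s n (Suc i)) \<omega> - \<xi> (s n i) \<omega>" for n i \<omega>
  have s0: "0 \<le> s n i" "s n i \<le> s n (Suc i)" for n i unfolding s_def by (intro mult_nonneg_nonneg mult_right_mono; use T in simp)+
  have s_mono: "mono (s n)" for n unfolding mono_iff_le_Suc using s0 by auto
  have s_Suc: "s n (Suc i) = s n i + T / real (Suc n)" for n i
    by (simp only: s_def of_nat_Suc distrib_right mult_1 add.commute)
  have sT: "s n (Suc n) = T" and s00: "s n 0 = 0" for n by (simp_all add: s_def)
  have \<Delta>m [measurable]: "\<Delta> n i \<in> borel_measurable M" for n i
    unfolding \<Delta>_def using s0 by (intro increment_measurable) auto
  have \<xi>m [measurable]: "\<xi> (T / real (Suc n)) \<in> borel_measurable M" "\<xi> T \<in> borel_measurable M" for n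
    using T by (auto intro!: xi_measurable)
  define a where "a e n = expectation (\<lambda>\<omega>. g e (\<xi> (T / real (Suc n)) \<omega>))" for e n
  define b where "b e n = expectation (\<lambda>\<omega>. (g e (\<xi> (T / real (Suc n)) \<omega>))\<^sup>2)" for e n
  \<comment> \<open>Independence factorises the expectation and stationarity identifies the factors.
    The bounded function \<open>h\<close> will be \<open>g e\<close> and its square.\<close>
  have prod_eq: "expectation (\<lambda>\<omega>. \<Prod>i<Suc n. h (\<Delta> n i \<omega>)) = (expectation (\<lambda>\<omega>. h (\<xi> (T / real (Suc n)) \<omega>))) ^ Suc n"
    if [measurable]: "h \<in> borel_measurable borel" and h: "\<And>x. \<bar>h x\<bar> \<le> 1" for h :: "real \<Rightarrow> real" and n
  proof -
    have ind: "indep_vars (\<lambda>_. borel) (\<lambda>i \<omega>. h (\<Delta> n i \<omega>)) {..<Suc n}"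
      by (rule indep_vars_compose2[where X="\<Delta> n" and M'="\<lambda>_. borel"])
        (use indep_increments[OF s0(1) s_mono, of n "Suc n"] in \<open>simp_all add: \<Delta>_def[abs_def]\<close>)
    have "expectation (\<lambda>\<omega>. \<Prod>i<Suc n. h (\<Delta> n i \<omega>)) = (\<Prod>i<Suc n. expectation (\<lambda>\<omega>. h (\<Delta> n i \<omega>)))"
      using h by (intro indep_vars_lebesgue_integral ind integrable_const_bound[where B=1]) auto
    also have "\<dots> = (\<Prod>i<Suc n. expectation (\<lambda>\<omega>. h (\<xi> (T / real (Suc n)) \<omega>)))"
    proof (rule prod.cong[OF refl])
      fix i
      have "expectation (\<lambda>\<omega>. h (\<Delta> n i \<omega>)) = integral\<^sup>L (distr M borel (\<Delta> n i)) h"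
        by (rule integral_distr[symmetric]) measurable
      also have "distr M borel (\<Delta> n i) = distr M borel (\<xi> (T / real (Suc n)))"
        unfolding \<Delta>_def s_Suc using s0 T by (intro stationary) auto
      also have "integral\<^sup>L \<dots> h = expectation (\<lambda>\<omega>. h (\<xi> (T / real (Suc n)) \<omega>))"
        by (rule integral_distr) measurable
      finally show "expectation (\<lambda>\<omega>. h (\<Delta> n i \<omega>)) = expectation (\<lambda>\<omega>. h (\<xi> (T / real (Suc n)) \<omega>))" .
    qed
    finally show ?thesis by simp
  qed
  \<comment> \<open>Uniform continuity on \<open>{0..T}\<close> makes all grid increments smaller
    than \<open>e\<close> from some \<open>n\<close> on; then the truncation is inactive and the
    exponents telescope.\<close>
  have AE_lim: "AE \<omega> in M. (\<lambda>n. \<Prod>i<Suc n. g e (\<Delta> n i \<omega>)) \<longlonglongrightarrow> exp (- \<xi> T \<omega>)" if "0 < e" for e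
  proof -
    have "AE \<omega> in M. \<forall>s t. 0 \<le> s \<longrightarrow> s \<le> t \<longrightarrow> \<xi> s \<omega> \<le> \<xi> t \<omega>"
      by (rule AE_nondecreasing) (rule nonneg)
    from this jumps AE_space show ?thesis
    proof eventually_elim
      case (elim \<omega>)
      have cont: "continuous_on {0..T} (\<lambda>t. \<xi> t \<omega>)"
        using elim by (intro cadlag_nondecreasing_no_jumps_continuous_on xi_cadlag) auto
      then have "uniformly_continuous_on {0..T} (\<lambda>t. \<xi> t \<omega>)"
        by (rule compact_uniformly_continuous) simp
      then obtain d where d: "0 < d" "\<And>x y. x \<in> {0..T} \<Longrightarrow> y \<in> {0..T} \<Longrightarrow> dist y x < d \<Longrightarrow> dist (\<xi> y \<omega>) (\<xi> x \<omega>) < e"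
        using \<open>0 < e\<close> by (auto simp: uniformly_continuous_on_def)
      have "(\<lambda>n. T * inverse (real (Suc n))) \<longlonglongrightarrow> T * 0"
        by (intro tendsto_mult tendsto_const LIMSEQ_inverse_real_of_nat)
      then have "eventually (\<lambda>n. T * inverse (real (Suc n)) < d) sequentially"
        by (rule order_tendstoD) (use d in simp)
      then have "eventually (\<lambda>n. (\<Prod>i<Suc n. g e (\<Delta> n i \<omega>)) = exp (- \<xi> T \<omega>)) sequentially"
      proof eventually_elim
        case (elim n)
        have "g e (\<Delta> n i \<omega>) = exp (- \<Delta> n i \<omega>)" if i: "i < Suc n" for i
        proof -
          have "s n (Suc i) \<le> T" using monoD[OF s_mono, of "Suc i" "Suc n" n] sT[of n] i by simp
          moreover have "dist (s n (Suc i)) (s n i) < d"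
            using elim(1) T by (simp add: dist_real_def s_Suc inverse_eq_divide)
          ultimately have "dist (\<xi> (s n (Suc i)) \<omega>) (\<xi> (s n i) \<omega>) < e"
            using s0[of n i] by (intro d(2)) auto
          then have "\<Delta> n i \<omega> < e" by (auto simp: \<Delta>_def dist_real_def)
          moreover have "0 \<le> \<Delta> n i \<omega>"
            using \<open>\<forall>s t. 0 \<le> s \<longrightarrow> s \<le> t \<longrightarrow> \<xi> s \<omega> \<le> \<xi> t \<omega>\<close> s0[of n i] by (auto simp: \<Delta>_def)
          ultimately show ?thesis by (simp add: g_def)
        qed
        then have "(\<Prod>i<Suc n. g e (\<Delta> n i \<omega>)) = (\<Prod>i<Suc n. exp (- \<Delta> n i \<omega>))" by (intro prod.cong) auto
        also have "\<dots> = exp (- (\<Sum>i<Suc n. \<Delta> n i \<omega>))"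
          by (simp only: exp_sum[OF finite_lessThan, symmetric] sum_negf)
        also have "(\<Sum>i<Suc n. \<Delta> n i \<omega>) = \<xi> T \<omega>"
          unfolding \<Delta>_def by (subst sum_lessThan_telescope) (simp add: sT s00 xi_0 \<open>\<omega> \<in> space M\<close>)
        finally show ?case .
      qed
      then show ?case by (rule tendsto_eventually)
    qed
  qed
  have prod01: "\<bar>\<Prod>i<k. h i\<bar> \<le> 1" if "\<And>i. \<bar>h i\<bar> \<le> 1" for h :: "nat \<Rightarrow> real" and k
    unfolding abs_prod using that by (intro prod_le_1) auto
  define \<phi> where "\<phi> = expectation (\<lambda>\<omega>. exp (- \<xi> T \<omega>))"
  define \<psi> where "\<psi> = expectation (\<lambda>\<omega>. (exp (- \<xi> T \<omega>))\<^sup>2)"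
  have a_lim: "(\<lambda>n. a e n ^ Suc n) \<longlonglongrightarrow> \<phi>" if e: "0 < e" for e
  proof -
    have h1: "\<bar>g e x\<bar> \<le> 1" for x using g01[OF e, of x] by simp
    have "(\<lambda>n. expectation (\<lambda>\<omega>. \<Prod>i<Suc n. g e (\<Delta> n i \<omega>))) \<longlonglongrightarrow> \<phi>"
      unfolding \<phi>_def
    proof (rule integral_dominated_convergence[where w="\<lambda>_. 1"])
      show "AE \<omega> in M. norm (\<Prod>i<Suc n. g e (\<Delta> n i \<omega>)) \<le> 1" for n
        using prod01[OF h1] by (auto simp del: prod.lessThan_Suc intro!: AE_I2)
    qed (use AE_lim[OF e] in auto)
    then show ?thesis unfolding a_def by (subst (asm) prod_eq) (use h1 in auto)
  qed
  have b_lim: "(\<lambda>n. b e n ^ Suc n) \<longlonglongrightarrow> \<psi>" if e: "0 < e" for e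
  proof -
    have h1: "\<bar>(g e x)\<^sup>2\<bar> \<le> 1" for x using g01[OF e, of x] by (simp add: power_le_one)
    have "(\<lambda>n. expectation (\<lambda>\<omega>. \<Prod>i<Suc n. (g e (\<Delta> n i \<omega>))\<^sup>2)) \<longlonglongrightarrow> \<psi>"
      unfolding \<psi>_def
    proof (rule integral_dominated_convergence[where w="\<lambda>_. 1"])
      show "AE \<omega> in M. norm (\<Prod>i<Suc n. (g e (\<Delta> n i \<omega>))\<^sup>2) \<le> 1" for n
        using prod01[OF h1] by (auto simp del: prod.lessThan_Suc intro!: AE_I2)
      show "AE \<omega> in M. (\<lambda>n. \<Prod>i<Suc n. (g e (\<Delta> n i \<omega>))\<^sup>2) \<longlonglongrightarrow> (exp (- \<xi> T \<omega>))\<^sup>2"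
        using AE_lim[OF e]
      proof eventually_elim
        case (elim \<omega>)
        from tendsto_power[OF elim, of 2] show ?case by (simp only: prod_power_distrib)
      qed
    qed auto
    then show ?thesis unfolding b_def by (subst (asm) prod_eq) (use h1 in auto)
  qed
  have exp_le1: "AE \<omega> in M. exp (- \<xi> T \<omega>) \<le> 1"
    using nonneg[OF T] by eventually_elim simp
  have int\<phi>: "integrable M (\<lambda>\<omega>. exp (- \<xi> T \<omega>))"
    by (rule integrable_const_bound[where B=1]) (use exp_le1 in auto)
  have int\<psi>: "integrable M (\<lambda>\<omega>. (exp (- \<xi> T \<omega>))\<^sup>2)"
  proof (rule integrable_const_bound[where B=1])
    show "AE \<omega> in M. norm ((exp (- \<xi> T \<omega>))\<^sup>2) \<le> 1"
      using exp_le1 by eventually_elim (simp only: real_norm_def abs_power2 power_le_one[OF exp_ge_zero])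
  qed measurable
  have \<phi>pos: "0 < \<phi>"
  proof -
    have "\<phi> \<noteq> 0"
    proof
      assume "\<phi> = 0"
      moreover have "AE \<omega> in M. 0 \<le> exp (- \<xi> T \<omega>)" by simp
      ultimately have "AE \<omega> in M. exp (- \<xi> T \<omega>) = 0"
        using integral_nonneg_eq_0_iff_AE[OF int\<phi>] unfolding \<phi>_def by blast
      then have "AE \<omega> in M. False" by eventually_elim simp
      then show False using AE_False by simp
    qed
    moreover have "0 \<le> \<phi>" unfolding \<phi>_def by (rule integral_nonneg_AE) auto
    ultimately show ?thesis by simp
  qed
  \<comment> \<open>With \<open>\<theta> = exp (- e)\<close> the truncated factor \<open>X\<close>
    lies between \<theta> and 1, whence \<open>X^2 \<le> 1 - (1 + \<theta>) * (1 - X)\<close>. It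
    follows that \<open>b e n\<close> is at most \<open>a e n\<close> raised to the power
    \<open>(1 + \<theta>) * \<theta>\<close>, and this relation survives \<open>Suc n\<close>-th
    powers and the limit in \<open>n\<close>.\<close>
  have key: "\<psi> \<le> exp ((1 + exp (- e)) * exp (- e) * ln \<phi>)" if e: "0 < e" for e
  proof (rule LIMSEQ_le)
    define \<theta> where "\<theta> = exp (- e)"
    show "(\<lambda>n. b e n ^ Suc n) \<longlonglongrightarrow> \<psi>" by (rule b_lim[OF e])
    show "(\<lambda>n. exp ((1 + exp (- e)) * exp (- e) * ln (a e n ^ Suc n))) \<longlonglongrightarrow> exp ((1 + exp (- e)) * exp (- e) * ln \<phi>)"
      using \<phi>pos by (intro tendsto_intros a_lim[OF e]) auto
    have "b e n ^ Suc n \<le> exp ((1 + exp (- e)) * exp (- e) * ln (a e n ^ Suc n))" for n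
    proof -
      let ?X = "\<lambda>\<omega>. g e (\<xi> (T / real (Suc n)) \<omega>)"
      have X: "\<theta> \<le> ?X \<omega>" "?X \<omega> \<le> 1" "0 < ?X \<omega>" for \<omega> using g01[OF e] by (auto simp: \<theta>_def)
      have iX: "integrable M ?X" 
      proof (rule integrable_const_bound[where B=1])
        show "AE \<omega> in M. norm (?X \<omega>) \<le> 1"
          by (intro AE_I2) (simp only: real_norm_def abs_of_pos[OF X(3)] X(2))
      qed measurable
      have iX2: "integrable M (\<lambda>\<omega>. (?X \<omega>)\<^sup>2)"
      proof (rule integrable_const_bound[where B=1])
        show "AE \<omega> in M. norm ((?X \<omega>)\<^sup>2) \<le> 1"
          by (intro AE_I2) (simp only: real_norm_def abs_power2 power_le_one[OF less_imp_le[OF X(3)] X(2)])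
      qed measurable
      have \<theta>: "0 < \<theta>" by (simp add: \<theta>_def)
      have "expectation (\<lambda>_. \<theta>) \<le> a e n" unfolding a_def by (intro integral_mono iX) (use X in auto)
      then have a1: "\<theta> \<le> a e n" by (simp add: prob_space)
      have "b e n \<le> expectation (\<lambda>\<omega>. 1 - (1 + \<theta>) * (1 - ?X \<omega>))"
        unfolding b_def
      proof (intro integral_mono iX2 Bochner_Integration.integrable_diff integrable_const integrable_mult_right iX)
        fix \<omega>
        have "(1 - ?X \<omega>) * (1 + \<theta>) \<le> (1 - ?X \<omega>) * (1 + ?X \<omega>)" using X[of \<omega>] by (intro mult_left_mono) auto
        then show "(?X \<omega>)\<^sup>2 \<le> 1 - (1 + \<theta>) * (1 - ?X \<omega>)" by (simp add: power2_eq_square algebra_simps)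
      qed
      also have "\<dots> = 1 - (1 + \<theta>) * (1 - a e n)" using iX by (simp add: a_def prob_space)
      also have "\<dots> \<le> exp (- ((1 + \<theta>) * (1 - a e n)))"
        using exp_ge_add_one_self[of "- ((1 + \<theta>) * (1 - a e n))"] by simp
      also have "\<dots> \<le> exp ((1 + \<theta>) * (\<theta> * ln (a e n)))"
      proof -
        have "ln (1 / a e n) \<le> 1 / a e n - 1" using a1 \<theta> by (intro ln_le_minus_one) auto
        then have "- ln (a e n) \<le> (1 - a e n) / a e n" using a1 \<theta> by (simp add: ln_div diff_divide_distrib)
        then have 1: "- (a e n * ln (a e n)) \<le> 1 - a e n" using a1 \<theta> by (simp add: field_simps)
        have "expectation ?X \<le> expectation (\<lambda>_. 1)" by (intro integral_mono iX) (use X in auto)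
        then have "a e n \<le> 1" by (simp add: a_def prob_space)
        then have "ln (a e n) \<le> 0" using a1 \<theta> by simp
        then have "a e n * ln (a e n) \<le> \<theta> * ln (a e n)" using a1 by (rule mult_right_mono_neg[rotated])
        with 1 have "- (1 - a e n) \<le> \<theta> * ln (a e n)" by linarith
        then have "(1 + \<theta>) * (- (1 - a e n)) \<le> (1 + \<theta>) * (\<theta> * ln (a e n))"
          using \<theta> by (intro mult_left_mono) auto
        then show ?thesis by (simp only: mult_minus_right exp_le_cancel_iff)
      qed
      finally have "b e n ^ Suc n \<le> exp ((1 + \<theta>) * (\<theta> * ln (a e n))) ^ Suc n"
        by (rule power_mono) (auto simp: b_def)
      also have "\<dots> = exp ((1 + \<theta>) * \<theta> * (real (Suc n) * ln (a e n)))"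
        unfolding exp_of_nat_mult[symmetric] by (simp only: mult.assoc mult.left_commute[of "real (Suc n)"])
      also have "real (Suc n) * ln (a e n) = ln (a e n ^ Suc n)"
        using a1 \<theta> by (subst ln_realpow) auto
      finally show ?thesis by (simp add: \<theta>_def)
    qed
    then show "\<exists>N. \<forall>n\<ge>N. b e n ^ Suc n \<le> exp ((1 + exp (- e)) * exp (- e) * ln (a e n ^ Suc n))" by blast
  qed
  \<comment> \<open>As \<open>e\<close> tends to 0 the exponent becomes 2, so \<psi> is at most the
    square of \<phi>; the variance of \<open>exp (- \<xi> T \<omega>)\<close> is then not
    positive.\<close>
  have "\<psi> \<le> exp ((1 + exp (- 0)) * exp (- 0) * ln \<phi>)"
  proof (rule LIMSEQ_le_const)
    show "(\<lambda>n. exp ((1 + exp (- inverse (real (Suc n)))) * exp (- inverse (real (Suc n))) * ln \<phi>))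
        \<longlonglongrightarrow> exp ((1 + exp (- 0)) * exp (- 0) * ln \<phi>)"
      by (intro tendsto_intros LIMSEQ_inverse_real_of_nat)
  qed (use key in auto)
  also have "(1 + exp (- 0)) * exp (- 0) * ln \<phi> = ln \<phi> + ln \<phi>" by simp
  also have "exp (ln \<phi> + ln \<phi>) = \<phi>\<^sup>2" using \<phi>pos by (simp only: exp_add exp_ln power2_eq_square)
  finally have le: "\<psi> \<le> \<phi>\<^sup>2" .
  have var: "expectation (\<lambda>\<omega>. (exp (- \<xi> T \<omega>) - \<phi>)\<^sup>2) = \<psi> - \<phi>\<^sup>2"
  proof -
    have "expectation (\<lambda>\<omega>. (exp (- \<xi> T \<omega>) - \<phi>)\<^sup>2)
        = expectation (\<lambda>\<omega>. (exp (- \<xi> T \<omega>))\<^sup>2 + (\<phi>\<^sup>2 - (2 * \<phi>) * exp (- \<xi> T \<omega>)))"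
      by (rule Bochner_Integration.integral_cong) (auto simp: power2_eq_square algebra_simps)
    also have "\<dots> = \<psi> + (\<phi>\<^sup>2 - (2 * \<phi>) * \<phi>)"
    proof -
      have i: "integrable M (\<lambda>\<omega>. (2 * \<phi>) * exp (- \<xi> T \<omega>))" using int\<phi> by (rule integrable_mult_right)
      have "expectation (\<lambda>\<omega>. \<phi>\<^sup>2 - (2 * \<phi>) * exp (- \<xi> T \<omega>)) = expectation (\<lambda>_. \<phi>\<^sup>2) - expectation (\<lambda>\<omega>. (2 * \<phi>) * exp (- \<xi> T \<omega>))"
        by (rule Bochner_Integration.integral_diff[OF integrable_const i])
      also have "\<dots> = \<phi>\<^sup>2 - (2 * \<phi>) * \<phi>"
        unfolding \<phi>_def[symmetric] integral_mult_right_zero by (simp add: prob_space)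
      finally show ?thesis
        unfolding \<psi>_def using Bochner_Integration.integral_add[OF int\<psi> Bochner_Integration.integrable_diff[OF integrable_const i]] by simp
    qed
    finally show ?thesis by (simp add: power2_eq_square)
  qed
  have ivar: "integrable M (\<lambda>\<omega>. (exp (- \<xi> T \<omega>) - \<phi>)\<^sup>2)"
    unfolding power2_diff using int\<phi> int\<psi> by auto
  have "expectation (\<lambda>\<omega>. (exp (- \<xi> T \<omega>) - \<phi>)\<^sup>2) = 0"
  proof (rule antisym)
    show "0 \<le> expectation (\<lambda>\<omega>. (exp (- \<xi> T \<omega>) - \<phi>)\<^sup>2)" by (rule integral_nonneg_AE) simp
  qed (use le var in simp)
  then have "AE \<omega> in M. (exp (- \<xi> T \<omega>) - \<phi>)\<^sup>2 = 0"
    using integral_nonneg_eq_0_iff_AE[OF ivar] by simp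
  then have "AE \<omega> in M. \<xi> T \<omega> = - ln \<phi>"
  proof eventually_elim
    case (elim \<omega>)
    then have "exp (- \<xi> T \<omega>) = \<phi>" by simp
    then have "ln \<phi> = - \<xi> T \<omega>" by (metis ln_exp)
    then show ?case by simp
  qed
  then show ?thesis by blast
qed

text \<open>Each \<open>\<xi> t\<close> is almost surely a constant \<open>c t\<close>; stationarity
  makes \<open>c\<close> additive, and a nonnegative additive function is linear.\<close>

lemma drift_if_nonneg_no_jumps:
  assumes nonneg: "\<And>t. 0 \<le> t \<Longrightarrow> AE \<omega> in M. 0 \<le> \<xi> t \<omega>"
    and jumps: "AE \<omega> in M. \<forall>t>0. \<xi> t \<omega> \<le> Lim (at_left t) (\<lambda>s. \<xi> s \<omega>)"
  shows "deterministic_drift M \<xi>"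
proof -
  obtain c where c: "\<And>t. 0 \<le> t \<Longrightarrow> AE \<omega> in M. \<xi> t \<omega> = c t"
    using AE_const_if_nonneg_no_jumps[OF nonneg jumps] by metis
  have add: "c (s + t) = c s + c t" if "0 \<le> s" "0 \<le> t" for s t
  proof -
    have "AE x in distr M borel (\<xi> t). x = c t"
      using c[OF that(2)] that by (subst AE_distr_iff) (auto intro!: xi_measurable)
    then have "AE x in distr M borel (\<lambda>\<omega>. \<xi> (s + t) \<omega> - \<xi> s \<omega>). x = c t"
      by (simp only: stationary[OF that])
    then have "AE \<omega> in M. \<xi> (s + t) \<omega> - \<xi> s \<omega> = c t"
      using that by (subst (asm) AE_distr_iff) (auto intro!: increment_measurable)
    moreover have "AE \<omega> in M. \<xi> (s + t) \<omega> = c (s + t)" using c[of "s + t"] that by simp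
    ultimately have "AE \<omega> in M. c (s + t) = c s + c t" using c[OF that(1)] by eventually_elim simp
    then show ?thesis by simp
  qed
  have nn: "0 \<le> c t" if "0 \<le> t" for t
  proof -
    have "AE \<omega> in M. 0 \<le> c t" using c[OF that] nonneg[OF that] by eventually_elim simp
    then show ?thesis by simp
  qed
  have lin: "c t = c 1 * t" if "0 \<le> t" for t by (rule additive_nonneg_linear[OF add nn that])
  show ?thesis unfolding deterministic_drift_def
  proof (intro exI[of _ "c 1"] allI impI)
    fix t :: real assume "0 \<le> t"
    from c[OF this] show "AE \<omega> in M. \<xi> t \<omega> = c 1 * t" unfolding lin[OF \<open>0 \<le> t\<close>] .
  qed
qed

text \<open>If a negative value has positive probability, so has any number of independent
  repetitions of it, which reaches every level \<open>b\<close>. Right-continuity provides a whole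
  window below \<open>b\<close>, and boundedness on compact intervals provides
  \<open>K\<close>.\<close>

lemma tube_prob_pos:
  assumes t: "0 \<le> t" "0 < prob {\<omega>\<in>space M. \<xi> t \<omega> < 0}"
  shows "\<exists>s0 s1 K. 0 \<le> s0 \<and> s0 < s1 \<and> 0 < prob {\<omega>\<in>space M. \<forall>q\<in>nonneg_rats. \<xi> q \<omega> \<in> tube s0 s1 K b q}"
proof -
  have tm [measurable]: "\<xi> t \<in> borel_measurable M" using t by (intro xi_measurable)
  \<comment> \<open>Continuity from below. Each of the parameters chosen below indexes an increasing
    sequence of events whose union has positive probability.\<close>
  have pick: "\<exists>n::nat. 0 < prob (A n)" if "incseq A" "range A \<subseteq> events" "0 < prob (\<Union>n. A n)" for A :: "nat \<Rightarrow> 'a set"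
  proof -
    have "eventually (\<lambda>n. 0 < prob (A n)) sequentially"
      by (rule order_tendstoD(1)[OF finite_Lim_measure_incseq[OF that(2,1)] that(3)])
    then show ?thesis by (auto simp: eventually_sequentially)
  qed
  have "\<exists>n::nat. 0 < prob {\<omega>\<in>space M. \<xi> t \<omega> \<le> - inverse (real (Suc n))}"
  proof (rule pick)
    show "incseq (\<lambda>n. {\<omega>\<in>space M. \<xi> t \<omega> \<le> - inverse (real (Suc n))})"
    proof (intro incseq_SucI subsetI)
      fix n \<omega> assume *: "\<omega> \<in> {\<omega>\<in>space M. \<xi> t \<omega> \<le> - inverse (real (Suc n))}"
      have "inverse (real (Suc (Suc n))) \<le> inverse (real (Suc n))" by (intro le_imp_inverse_le) auto
      then show "\<omega> \<in> {\<omega>\<in>space M. \<xi> t \<omega> \<le> - inverse (real (Suc (Suc n)))}" using * by (intro CollectI conjI) (simp, simp only: mem_Collect_eq, linarith)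
    qed
    have "{\<omega>\<in>space M. \<xi> t \<omega> < 0} \<subseteq> (\<Union>n. {\<omega>\<in>space M. \<xi> t \<omega> \<le> - inverse (real (Suc n))})"
    proof
      fix \<omega> assume "\<omega> \<in> {\<omega>\<in>space M. \<xi> t \<omega> < 0}"
      moreover from this obtain n where "inverse (real (Suc n)) < - \<xi> t \<omega>"
        using reals_Archimedean[of "- \<xi> t \<omega>"] by auto
      ultimately show "\<omega> \<in> (\<Union>n. {\<omega>\<in>space M. \<xi> t \<omega> \<le> - inverse (real (Suc n))})"
        by (auto intro!: exI[of _ n])
    qed
    then show "0 < prob (\<Union>n. {\<omega>\<in>space M. \<xi> t \<omega> \<le> - inverse (real (Suc n))})"
      by (intro less_le_trans[OF t(2) finite_measure_mono]) auto
  qed auto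
  then obtain n\<^sub>0 :: nat where n\<^sub>0: "0 < prob {\<omega>\<in>space M. \<xi> t \<omega> \<le> - inverse (real (Suc n\<^sub>0))}" ..
  define \<eta> where "\<eta> = inverse (real (Suc n\<^sub>0))"
  have \<eta>: "0 < \<eta>" "0 < prob {\<omega>\<in>space M. \<xi> t \<omega> \<le> - \<eta>}" using n\<^sub>0 by (simp_all add: \<eta>_def)
  have pow: "0 < prob {\<omega>\<in>space M. \<xi> (real n * t) \<omega> \<le> - (real n * \<eta>)}" for n
  proof (induction n)
    case 0
    have "{\<omega>\<in>space M. \<xi> 0 \<omega> \<le> 0} = space M" using xi_0 by auto
    then show ?case by (simp add: prob_space)
  next
    case (Suc n)
    let ?C = "{\<omega>\<in>space M. \<xi> (real n * t) \<omega> \<le> - (real n * \<eta>)}"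
    have nt: "0 \<le> real n * t" using t by simp
    have C: "?C \<in> sets (past (real n * t))"
      using Collect_in_sets[OF xi_measurable_past[OF nt order_refl], of "{..- (real n * \<eta>)}"] by simp
    have "prob (?C \<inter> {\<omega>\<in>space M. \<forall>v\<in>{t}. \<xi> (real n * t + v) \<omega> - \<xi> (real n * t) \<omega> \<in> {..- \<eta>}})
        = prob ?C * prob {\<omega>\<in>space M. \<forall>v\<in>{t}. \<xi> v \<omega> \<in> {..- \<eta>}}"
      by (rule indep_past_future[OF C nt]) (use t in auto)
    also have "\<dots> > 0" using Suc \<eta> by simp
    also have "prob (?C \<inter> {\<omega>\<in>space M. \<forall>v\<in>{t}. \<xi> (real n * t + v) \<omega> - \<xi> (real n * t) \<omega> \<in> {..- \<eta>}})
       \<le> prob {\<omega>\<in>space M. \<xi> (real (Suc n) * t) \<omega> \<le> - (real (Suc n) * \<eta>)}"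
    proof (rule finite_measure_mono)
      show "{\<omega>\<in>space M. \<xi> (real (Suc n) * t) \<omega> \<le> - (real (Suc n) * \<eta>)} \<in> events"
        using Collect_in_sets[OF xi_measurable[of "real (Suc n) * t"], of "{..- (real (Suc n) * \<eta>)}"] t by simp
    qed (auto simp: algebra_simps)
    finally show ?case .
  qed
  \<comment> \<open>Enough repetitions for the total descent \<open>real n * \<eta>\<close> to
    exceed \<open>- b\<close>.\<close>
  obtain n :: nat where n: "(- b) / \<eta> < real n" using reals_Archimedean2 by blast
  define s0 where "s0 = real n * t"
  have s0: "0 \<le> s0" using t by (simp add: s0_def)
  have "- (real n * \<eta>) < b" using n \<eta> by (simp add: field_simps)
  then have "{\<omega>\<in>space M. \<xi> s0 \<omega> \<le> - (real n * \<eta>)} \<subseteq> {\<omega>\<in>space M. \<xi> s0 \<omega> < b}" by auto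
  moreover have sb: "{\<omega>\<in>space M. \<xi> s0 \<omega> < b} \<in> events"
    using Collect_in_sets[OF xi_measurable[OF s0], of "{..<b}"] by simp
  ultimately have p0: "0 < prob {\<omega>\<in>space M. \<xi> s0 \<omega> < b}"
    using pow[of n] unfolding s0_def[symmetric] by (rule less_le_trans[OF _ finite_measure_mono, rotated 1]) 
  define A where "A k = {\<omega>\<in>space M. \<forall>q\<in>nonneg_rats \<inter> {s0..s0 + inverse (real (Suc k))}. \<xi> q \<omega> \<in> {..b}}" for k :: nat
  have Am: "A k \<in> events" for k
    unfolding A_def by (rule xi_sets) (auto intro: countable_subset[OF _ countable_nonneg_rats] simp: nonneg_rats_def)
  have "\<exists>k. 0 < prob (A k)"
  proof (rule pick)
    show "incseq A"
    proof (intro incseq_SucI subsetI)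
      fix k \<omega> assume *: "\<omega> \<in> A k"
      have "inverse (real (Suc (Suc k))) \<le> inverse (real (Suc k))" by (intro le_imp_inverse_le) auto
      then have "{s0..s0 + inverse (real (Suc (Suc k)))} \<subseteq> {s0..s0 + inverse (real (Suc k))}"
        by (metis add_left_mono atLeastatMost_subset_iff order_refl)
      then show "\<omega> \<in> A (Suc k)" using * unfolding A_def by blast
    qed
    have "{\<omega>\<in>space M. \<xi> s0 \<omega> < b} \<subseteq> (\<Union>k. A k)"
    proof
      fix \<omega> assume \<omega>: "\<omega> \<in> {\<omega>\<in>space M. \<xi> s0 \<omega> < b}"
      have "((\<lambda>t. \<xi> t \<omega>) \<longlongrightarrow> \<xi> s0 \<omega>) (at_right s0)"
        using \<omega> by (intro right_cont_pathD xi_right_cont s0) auto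
      then have "eventually (\<lambda>t. \<xi> t \<omega> < b) (at_right s0)"
        by (rule order_tendstoD) (use \<omega> in auto)
      then obtain u where u: "u > s0" "\<And>y. s0 < y \<Longrightarrow> y < u \<Longrightarrow> \<xi> y \<omega> < b"
        by (auto simp: eventually_at_right_field)
      obtain k where k: "inverse (real (Suc k)) < u - s0" using reals_Archimedean[of "u - s0"] u by auto
      have "\<xi> q \<omega> \<le> b" if "q \<in> {s0..s0 + inverse (real (Suc k))}" for q
        using u(2)[of q] \<omega> that k by (cases "q = s0") auto
      then have "\<omega> \<in> A k" using \<omega> by (auto simp: A_def)
      then show "\<omega> \<in> (\<Union>k. A k)" by blast
    qed
    then show "0 < prob (\<Union>k. A k)"
      using p0 Am by (intro less_le_trans[OF p0 finite_measure_mono]) auto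
  qed (use Am in auto)
  then obtain k where k: "0 < prob (A k)" by blast
  define s1 where "s1 = s0 + inverse (real (Suc k))"
  define E where "E K = {\<omega>\<in>space M. \<forall>q\<in>nonneg_rats. \<xi> q \<omega> \<in> tube s0 s1 (real K) b q}" for K :: nat
  have "\<exists>K. 0 < prob (E K)"
  proof (rule pick)
    show "incseq E"
    proof (intro incseq_SucI subsetI)
      fix K \<omega> assume "\<omega> \<in> E K"
      moreover have "tube s0 s1 (real K) b q \<subseteq> tube s0 s1 (real (Suc K)) b q" for q
        by (auto simp: tube_def)
      ultimately show "\<omega> \<in> E (Suc K)" unfolding E_def by blast
    qed
    have Em: "E K \<in> events" for K
      unfolding E_def by (rule xi_sets[OF countable_nonneg_rats nonneg_rats_subset]) (auto simp: tube_def)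
    then show "range E \<subseteq> events" by auto
    have "A k \<subseteq> (\<Union>K. E K)"
    proof
      fix \<omega> assume \<omega>: "\<omega> \<in> A k"
      have "0 \<le> s1" using s0 by (simp add: s1_def)
      then obtain B where B: "\<forall>t\<in>{0..s1}. \<bar>\<xi> t \<omega>\<bar> \<le> B"
        using cadlag_bounded_on[OF xi_cadlag, of \<omega> s1] \<omega> by (auto simp: A_def)
      obtain K :: nat where K: "B \<le> real K" using real_arch_simple by blast
      have "\<xi> q \<omega> \<in> tube s0 s1 (real K) b q" if "q \<in> nonneg_rats" for q
      proof -
        have "\<bar>\<xi> q \<omega>\<bar> \<le> real K" if "q \<le> s1" using B[rule_format, of q] K that nonneg_rats_ge_0[OF \<open>q \<in> nonneg_rats\<close>] by auto
        moreover have "\<xi> q \<omega> \<le> b" if "s0 \<le> q" "q \<le> s1" using \<omega> that \<open>q \<in> nonneg_rats\<close> by (auto simp: A_def s1_def)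
        ultimately show ?thesis by (auto simp: tube_def abs_le_iff)
      qed
      then show "\<omega> \<in> (\<Union>K. E K)" using \<omega> by (auto simp: E_def A_def)
    qed
    then show "0 < prob (\<Union>K. E K)" using Em by (intro less_le_trans[OF k finite_measure_mono]) auto
  qed
  then obtain K where "0 < prob (E K)" by blast
  moreover have "s0 < s1" by (simp add: s1_def)
  ultimately show ?thesis using s0 unfolding E_def by blast
qed

end

section \<open>The Lamperti transformation\<close>

locale cadlag_path =
  fixes w :: "real \<Rightarrow> real"
  assumes cadlag_w: "cadlag w"
begin

abbreviation "I \<equiv> exp_functional w"

lemma exp_set_integrable:
  assumes "A \<in> sets borel" "A \<subseteq> {0..s}" shows "set_integrable lborel A (\<lambda>u. exp (w u))"
proof (cases "0 \<le> s")
  case True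
  obtain B where B: "\<And>t. t \<in> {0..s} \<Longrightarrow> \<bar>w t\<bar> \<le> B"
    using cadlag_bounded_on[OF cadlag_w True] by blast
  have [measurable]: "(\<lambda>t::real. w (max 0 t)) \<in> borel_measurable borel"
    by (rule right_cont_path_measurable[OF cadlag_imp_right_cont_path[OF cadlag_w]])
  have eq: "indicator A u *\<^sub>R exp (w u) = indicator A u *\<^sub>R exp (w (max 0 u))" for u
    using assms(2) by (auto simp: indicator_def max_def)
  have [measurable]: "A \<in> sets borel" by fact
  show ?thesis
    unfolding set_integrable_def
  proof (rule Bochner_Integration.integrable_bound)
    show "integrable lborel (\<lambda>u. indicator {0..s} u *\<^sub>R exp B)"
      by (rule integrable_real_indicator[THEN integrable_scaleR_left]) (auto simp: emeasure_lborel_Icc_eq)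
    show "(\<lambda>u. indicator A u *\<^sub>R exp (w u)) \<in> borel_measurable lborel"
      unfolding eq by measurable
    show "AE u in lborel. norm (indicator A u *\<^sub>R exp (w u)) \<le> norm (indicator {0..s} u *\<^sub>R exp B)"
      using assms(2) B by (intro AE_I2) (auto simp: indicator_def abs_le_iff)
  qed
next
  case False
  then have "A = {}" using assms by auto
  then show ?thesis by (simp add: set_integrable_def)
qed

lemma exp_functional_0 [simp]: "I 0 = 0"
  by (simp add: exp_functional_def set_lebesgue_integral_def indicator_def if_distrib[of "\<lambda>x. x * _"] cong: if_cong)
     (rule integral_eq_zero_AE, rule AE_mp[OF AE_lborel_singleton[of 0]], auto)

text \<open>Bounds on the path become bounds on the speed of the clock. Strict monotonicity,
  Lipschitz continuity and the location of the window in \<open>dip_ge_if_path_in_tube\<close> all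
  come from here.\<close>

lemma exp_functional_diff_bounds:
  assumes "0 \<le> a" "a \<le> b" and bd: "\<And>u. u \<in> {a..b} \<Longrightarrow> m \<le> w u" "\<And>u. u \<in> {a..b} \<Longrightarrow> w u \<le> k"
  shows "(b - a) * exp m \<le> I b - I a" "I b - I a \<le> (b - a) * exp k"
proof -
  have split: "{0..b} = {0..a} \<union> {a<..b}" using assms by auto
  have eq: "I b = I a + (LBINT u:{a<..b}. exp (w u))"
    unfolding exp_functional_def split
    by (rule set_integral_Un) (use assms in \<open>auto intro!: exp_set_integrable[of _ b]\<close>)
  have const: "set_integrable lborel {a<..b} (\<lambda>_. c)" "(LBINT u:{a<..b}. c) = (b - a) * c" for c :: real
    using assms by (auto simp: set_integrable_def set_lebesgue_integral_def)
  have int: "set_integrable lborel {a<..b} (\<lambda>u. exp (w u))"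
    using assms by (intro exp_set_integrable[of _ b]) auto
  have "(LBINT u:{a<..b}. exp m) \<le> (LBINT u:{a<..b}. exp (w u))"
    using bd by (intro set_integral_mono const int) auto
  moreover have "(LBINT u:{a<..b}. exp (w u)) \<le> (LBINT u:{a<..b}. exp k)"
    using bd by (intro set_integral_mono const int) auto
  ultimately show "(b - a) * exp m \<le> I b - I a" "I b - I a \<le> (b - a) * exp k"
    unfolding eq const(2) by simp_all
qed

lemma exp_functional_strict_mono:
  assumes "0 \<le> a" "a < b" shows "I a < I b"
proof -
  obtain B where B: "\<And>t. t \<in> {0..b} \<Longrightarrow> \<bar>w t\<bar> \<le> B"
    using cadlag_bounded_on[OF cadlag_w, of b] assms by fastforce
  have "(b - a) * exp (- B) \<le> I b - I a"
  proof (rule exp_functional_diff_bounds(1))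
    fix u assume "u \<in> {a..b}"
    then show "- B \<le> w u" "w u \<le> B" using B[of u] assms by (auto simp: abs_le_iff)
  qed (use assms in auto)
  moreover have "0 < (b - a) * exp (- B)" using assms by simp
  ultimately show ?thesis by linarith
qed

lemma exp_functional_less_iff: "0 \<le> a \<Longrightarrow> 0 \<le> b \<Longrightarrow> I a < I b \<longleftrightarrow> a < b"
  using exp_functional_strict_mono[of a b] exp_functional_strict_mono[of b a]
  by (cases a b rule: linorder_cases) auto

lemma exp_functional_le_iff: "0 \<le> a \<Longrightarrow> 0 \<le> b \<Longrightarrow> I a \<le> I b \<longleftrightarrow> a \<le> b"
  using exp_functional_less_iff[of b a] by (simp flip: not_less)

lemma exp_functional_continuous_on: "continuous_on {0..T} I"
proof (cases "0 \<le> T")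
  case True
  obtain B where B: "\<And>t. t \<in> {0..T} \<Longrightarrow> \<bar>w t\<bar> \<le> B"
    using cadlag_bounded_on[OF cadlag_w True] by fastforce
  have 1: "\<bar>I b - I a\<bar> \<le> exp B * \<bar>b - a\<bar>" if "a \<in> {0..T}" "b \<in> {0..T}" "a \<le> b" for a b
  proof -
    have "I b - I a \<le> (b - a) * exp B"
    proof (rule exp_functional_diff_bounds(2))
      fix u assume "u \<in> {a..b}"
      then show "- B \<le> w u" "w u \<le> B" using B[of u] that by (auto simp: abs_le_iff)
    qed (use that in auto)
    moreover have "I a \<le> I b" using that exp_functional_le_iff by auto
    ultimately show ?thesis using that by (simp add: mult.commute)
  qed
  have "(exp B)-lipschitz_on {0..T} I"
  proof (rule lipschitz_onI)
    fix a b assume "a \<in> {0..T}" "b \<in> {0..T}"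
    then show "dist (I a) (I b) \<le> exp B * dist a b"
      using 1[of a b] 1[of b a] by (cases "a \<le> b") (auto simp: dist_real_def abs_minus_commute)
  qed simp
  then show ?thesis by (rule lipschitz_on_continuous_on)
qed simp

end

text \<open>Unboundedness makes \<open>time_change w\<close> a genuine inverse of the increasing
  continuous clock on \<open>{0..}\<close>; without it the infimum could be taken over the empty
  set.\<close>

locale lamperti_path = cadlag_path +
  assumes unbounded: "\<And>t. \<exists>s\<ge>0. t < exp_functional w s"
begin

abbreviation "\<tau> \<equiv> time_change w"

lemma exp_functional_surj:
  assumes "0 \<le> t" shows "\<exists>s\<ge>0. I s = t"
proof -
  obtain S where S: "0 \<le> S" "t < I S" using unbounded by blast
  have "\<exists>s\<ge>0. s \<le> S \<and> I s = t"
    by (rule IVT'[OF _ _ _ exp_functional_continuous_on]) (use S assms in auto)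
  then show ?thesis by blast
qed

lemma time_change_exp_functional:
  assumes "0 \<le> s" shows "\<tau> (I s) = s"
proof -
  have "{r. 0 \<le> r \<and> I s < I r} = {s<..}"
    using exp_functional_less_iff[OF assms] assms by auto
  then show ?thesis unfolding time_change_def by simp
qed

lemma exp_functional_time_change: "0 \<le> t \<Longrightarrow> I (\<tau> t) = t"
  using exp_functional_surj time_change_exp_functional by metis

lemma time_change_nonneg: "0 \<le> t \<Longrightarrow> 0 \<le> \<tau> t"
  using exp_functional_surj time_change_exp_functional by metis

text \<open>This equivalence makes the time change a stopping time: whether it is below
  \<open>s\<close> is decided by the clock at \<open>s\<close>.\<close>

lemma time_change_less_iff: "0 \<le> t \<Longrightarrow> 0 \<le> s \<Longrightarrow> \<tau> t < s \<longleftrightarrow> t < I s"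
  using exp_functional_less_iff[OF time_change_nonneg, of t s] exp_functional_time_change by simp

lemma time_change_0 [simp]: "\<tau> 0 = 0"
  using time_change_exp_functional[of 0] by simp

lemma time_change_strict_mono: "0 \<le> s \<Longrightarrow> s < t \<Longrightarrow> \<tau> s < \<tau> t"
  using time_change_less_iff[of s "\<tau> t"] exp_functional_time_change[of t] time_change_nonneg[of t] by simp

lemma time_change_mono: "0 \<le> s \<Longrightarrow> s \<le> t \<Longrightarrow> \<tau> s \<le> \<tau> t"
  using time_change_strict_mono[of s t] by (cases "s = t") auto

text \<open>The finer target filter \<open>at_right (\<tau> t)\<close>, supplied by strict
  monotonicity, is what allows composition with a path that is only right-continuous.\<close>

lemma time_change_right_cont:
  assumes "0 \<le> t" shows "filterlim \<tau> (at_right (\<tau> t)) (at_right t)"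
proof -
  have gt: "eventually (\<lambda>u. \<tau> t < \<tau> u) (at_right t)"
    using time_change_strict_mono[OF assms] by (auto simp: eventually_at_right_field intro: exI[of _ "t + 1"])
  have "(\<tau> \<longlongrightarrow> \<tau> t) (at_right t)"
  proof (rule order_tendstoI)
    fix a assume "a < \<tau> t"
    then show "eventually (\<lambda>u. a < \<tau> u) (at_right t)" using gt by (auto elim: eventually_mono)
  next
    fix a assume a: "\<tau> t < a"
    then have a0: "0 \<le> a" "t < I a"
      using time_change_nonneg[OF assms] time_change_less_iff[OF assms, of a] by auto
    then show "eventually (\<lambda>u. \<tau> u < a) (at_right t)"
      unfolding eventually_at_right_field using time_change_less_iff[of _ a] assms
      by (intro exI[of _ "I a"]) auto
  qed
  then show ?thesis using gt by (auto simp: filterlim_at elim: eventually_mono)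
qed

lemma lamperti_right_cont:
  assumes "0 < x" shows "right_cont_path (\<lambda>t. x * exp (w (\<tau> (t / x))))"
  unfolding right_cont_path_def
proof (intro allI impI)
  fix t :: real assume t: "0 \<le> t"
  have "filterlim (\<lambda>u. u / x) (at_right (t / x)) (at_right t)"
    unfolding filterlim_at using assms
    by (auto intro!: tendsto_intros simp: eventually_at_right_field divide_strict_right_mono intro: exI[of _ "t + 1"])
  then have "filterlim (\<lambda>u. \<tau> (u / x)) (at_right (\<tau> (t / x))) (at_right t)"
    by (rule filterlim_compose[rotated]) (use t assms in \<open>intro time_change_right_cont, auto\<close>)
  then have "((\<lambda>u. w (\<tau> (u / x))) \<longlongrightarrow> w (\<tau> (t / x))) (at_right t)"
    by (rule filterlim_compose[rotated])
      (use t assms in \<open>intro right_cont_pathD cadlag_imp_right_cont_path cadlag_w time_change_nonneg, auto\<close>)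
  then show "((\<lambda>u. x * exp (w (\<tau> (u / x)))) \<longlongrightarrow> x * exp (w (\<tau> (t / x)))) (at_right t)"
    by (intro tendsto_intros)
qed

lemma stopped_path:
  assumes s: "0 \<le> s"
  shows "lamperti_path (\<lambda>u. w (min u s))"
    and "\<And>r. r \<le> s \<Longrightarrow> exp_functional (\<lambda>u. w (min u s)) r = I r"
    and "\<And>t. 0 \<le> t \<Longrightarrow> \<tau> t \<le> s \<Longrightarrow> time_change (\<lambda>u. w (min u s)) t = \<tau> t"
proof -
  have cad: "cadlag (\<lambda>u. w (min u s))"
    unfolding cadlag_def
  proof (intro conjI allI impI)
    fix t :: real assume t: "0 \<le> t"
    show "((\<lambda>u. w (min u s)) \<longlongrightarrow> w (min t s)) (at_right t)"
    proof (cases "t < s")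
      case True
      then have "eventually (\<lambda>u. w u = w (min u s)) (at_right t)"
        by (auto simp: eventually_at_right_field intro!: exI[of _ s])
      moreover have "(w \<longlongrightarrow> w (min t s)) (at_right t)" using cadlag_w t True by (auto simp: cadlag_def)
      ultimately show ?thesis by (rule Lim_transform_eventually[rotated])
    next
      case False
      then have "eventually (\<lambda>u. w s = w (min u s)) (at_right t)"
        by (auto simp: eventually_at_right_field min_def intro!: exI[of _ "t + 1"])
      moreover have "((\<lambda>_. w s) \<longlongrightarrow> w (min t s)) (at_right t)" using False by (simp add: min_def)
      ultimately show ?thesis by (rule Lim_transform_eventually[rotated])
    qed
  next
    fix t :: real assume t: "0 < t"
    show "\<exists>l. ((\<lambda>u. w (min u s)) \<longlongrightarrow> l) (at_left t)"
    proof (cases "t \<le> s")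
      case True
      obtain l where l: "(w \<longlongrightarrow> l) (at_left t)" using cadlag_w t by (auto simp: cadlag_def)
      have "eventually (\<lambda>u. w u = w (min u s)) (at_left t)"
        using True by (auto simp: eventually_at_left_field min_def intro!: exI[of _ "t - 1"])
      then have "((\<lambda>u. w (min u s)) \<longlongrightarrow> l) (at_left t)" by (rule Lim_transform_eventually[OF l])
      then show ?thesis ..
    next
      case False
      then have "eventually (\<lambda>u. w s = w (min u s)) (at_left t)"
        by (auto simp: eventually_at_left_field min_def intro!: exI[of _ s])
      then have "((\<lambda>u. w (min u s)) \<longlongrightarrow> w s) (at_left t)" by (rule Lim_transform_eventually[OF tendsto_const])
      then show ?thesis ..
    qed
  qed
  have agree: "exp_functional (\<lambda>u. w (min u s)) r = I r" if "r \<le> s" for r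
    unfolding exp_functional_def by (rule set_lebesgue_integral_cong) (use that in \<open>auto simp: min_def\<close>)
  show agree': "exp_functional (\<lambda>u. w (min u s)) r = I r" if "r \<le> s" for r by (rule agree[OF that])
  have unb: "\<exists>r\<ge>0. t < exp_functional (\<lambda>u. w (min u s)) r" for t
  proof -
    define r where "r = s + (max 0 t + 1) * exp (- w s)"
    have r: "s \<le> r" by (simp add: r_def)
    have split: "{0..r} = {0..s} \<union> {s<..r}" using r s by auto
    have c: "set_integrable lborel {s<..r} (\<lambda>u. exp (w s))" "(LBINT u:{s<..r}. exp (w s)) = (r - s) * exp (w s)"
      using r by (auto simp: set_integrable_def set_lebesgue_integral_def)
    have c2: "set_integrable lborel {s<..r} (\<lambda>u. exp (w (min u s)))"
      using c(1) by (rule set_integrable_cong[THEN iffD1, rotated 3]) (auto simp: min_def)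
    have c1: "set_integrable lborel {0..s} (\<lambda>u. exp (w (min u s)))"
      using exp_set_integrable[of "{0..s}" s]
      by (rule set_integrable_cong[THEN iffD1, rotated 3]) (auto simp: min_def)
    have "exp_functional (\<lambda>u. w (min u s)) r = exp_functional (\<lambda>u. w (min u s)) s + (LBINT u:{s<..r}. exp (w (min u s)))"
      unfolding exp_functional_def split by (rule set_integral_Un) (use c1 c2 in auto)
    also have "(LBINT u:{s<..r}. exp (w (min u s))) = (LBINT u:{s<..r}. exp (w s))"
      by (rule set_lebesgue_integral_cong) (auto simp: min_def)
    also have "\<dots> = max 0 t + 1" unfolding c(2) by (simp add: r_def mult.assoc flip: exp_add)
    also have "exp_functional (\<lambda>u. w (min u s)) s = I s" by (rule agree) simp
    finally have "t < exp_functional (\<lambda>u. w (min u s)) r"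
      using exp_functional_le_iff[of 0 s] s by simp
    then show ?thesis using r s by (intro exI[of _ r]) auto
  qed
  show st: "lamperti_path (\<lambda>u. w (min u s))" by unfold_locales (rule cad, rule unb)
  fix t assume t: "0 \<le> t" "\<tau> t \<le> s"
  interpret S: lamperti_path "\<lambda>u. w (min u s)" by (rule st)
  have "exp_functional (\<lambda>u. w (min u s)) (\<tau> t) = t"
    using agree[OF t(2)] exp_functional_time_change[OF t(1)] by simp
  then show "time_change (\<lambda>u. w (min u s)) t = \<tau> t"
    using S.time_change_exp_functional[OF time_change_nonneg[OF t(1)]] by simp
qed

end

section \<open>Measurability of the clock, the time change and the transformed process\<close>

lemma exp_functional_measurable:
  assumes meas: "\<And>t. 0 \<le> t \<Longrightarrow> Y t \<in> borel_measurable N"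
    and path: "\<And>\<omega>. \<omega> \<in> space N \<Longrightarrow> lamperti_path (\<lambda>t. Y t \<omega>)"
  shows "(\<lambda>\<omega>. exp_functional (\<lambda>t. Y t \<omega>) s) \<in> borel_measurable N"
proof -
  have rc: "right_cont_path (\<lambda>t. Y t \<omega>)" if "\<omega> \<in> space N" for \<omega>
    using path[OF that] by (intro cadlag_imp_right_cont_path) (simp add: lamperti_path_def cadlag_path_def)
  have [measurable]: "(\<lambda>(t::real, \<omega>). Y (max 0 t) \<omega>) \<in> borel_measurable (borel \<Otimes>\<^sub>M N)"
    by (rule right_cont_measurable_pair[OF meas rc])
  have "(\<lambda>(\<omega>, u). indicator {0..s} u *\<^sub>R exp ((\<lambda>(t::real, \<omega>). Y (max 0 t) \<omega>) (u, \<omega>))) \<in> borel_measurable (N \<Otimes>\<^sub>M lborel)"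
    by measurable
  then have "(\<lambda>\<omega>. \<integral>u. indicator {0..s} u *\<^sub>R exp (Y (max 0 u) \<omega>) \<partial>lborel) \<in> borel_measurable N"
    by (intro lborel.borel_measurable_lebesgue_integral) simp
  also have "(\<lambda>\<omega>. \<integral>u. indicator {0..s} u *\<^sub>R exp (Y (max 0 u) \<omega>) \<partial>lborel) = (\<lambda>\<omega>. exp_functional (\<lambda>t. Y t \<omega>) s)"
    unfolding exp_functional_def set_lebesgue_integral_def
    by (intro ext Bochner_Integration.integral_cong) (auto simp: indicator_def)
  finally show ?thesis .
qed

lemma time_change_measurable:
  assumes meas: "\<And>t. 0 \<le> t \<Longrightarrow> Y t \<in> borel_measurable N"
    and path: "\<And>\<omega>. \<omega> \<in> space N \<Longrightarrow> lamperti_path (\<lambda>t. Y t \<omega>)" and "0 \<le> t"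
  shows "(\<lambda>\<omega>. time_change (\<lambda>t. Y t \<omega>) t) \<in> borel_measurable N"
  unfolding borel_measurable_iff_less
proof
  fix a :: real
  have [measurable]: "(\<lambda>\<omega>. exp_functional (\<lambda>t. Y t \<omega>) a) \<in> borel_measurable N"
    by (rule exp_functional_measurable[OF meas path])
  have "{\<omega> \<in> space N. time_change (\<lambda>t. Y t \<omega>) t < a} = {\<omega> \<in> space N. 0 \<le> a \<and> t < exp_functional (\<lambda>t. Y t \<omega>) a}"
  proof (intro Collect_cong conj_cong refl)
    fix \<omega> assume \<omega>: "\<omega> \<in> space N"
    interpret lamperti_path "\<lambda>t. Y t \<omega>" by (rule path[OF \<omega>])
    show "(time_change (\<lambda>t. Y t \<omega>) t < a) = (0 \<le> a \<and> t < exp_functional (\<lambda>t. Y t \<omega>) a)"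
      using time_change_less_iff[OF \<open>0 \<le> t\<close>, of a] time_change_nonneg[OF \<open>0 \<le> t\<close>] by auto
  qed
  also have "\<dots> \<in> sets N" by measurable
  finally show "{\<omega> \<in> space N. time_change (\<lambda>t. Y t \<omega>) t < a} \<in> sets N" .
qed

lemma lamperti_measurable:
  assumes meas: "\<And>t. 0 \<le> t \<Longrightarrow> Y t \<in> borel_measurable N"
    and path: "\<And>\<omega>. \<omega> \<in> space N \<Longrightarrow> lamperti_path (\<lambda>t. Y t \<omega>)" and "0 < x" "0 \<le> t"
  shows "lamperti Y x t \<in> borel_measurable N"
proof -
  have rc: "right_cont_path (\<lambda>t. Y t \<omega>)" if "\<omega> \<in> space N" for \<omega>
    using path[OF that] by (intro cadlag_imp_right_cont_path) (simp add: lamperti_path_def cadlag_path_def)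
  have pair: "(\<lambda>(t::real, \<omega>). Y (max 0 t) \<omega>) \<in> borel_measurable (borel \<Otimes>\<^sub>M N)"
    by (rule right_cont_measurable_pair[OF meas rc])
  have [measurable]: "(\<lambda>\<omega>. time_change (\<lambda>t. Y t \<omega>) (t / x)) \<in> borel_measurable N"
    by (rule time_change_measurable[OF meas path]) (use assms in auto)
  have "(\<lambda>\<omega>. (\<lambda>(t::real, \<omega>). Y (max 0 t) \<omega>) (time_change (\<lambda>t. Y t \<omega>) (t / x), \<omega>)) \<in> borel_measurable N"
    by (rule measurable_compose[OF _ pair]) measurable
  then have "(\<lambda>\<omega>. Y (max 0 (time_change (\<lambda>t. Y t \<omega>) (t / x))) \<omega>) \<in> borel_measurable N" by simp
  also have "?this \<longleftrightarrow> (\<lambda>\<omega>. Y (time_change (\<lambda>t. Y t \<omega>) (t / x)) \<omega>) \<in> borel_measurable N"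
  proof (rule measurable_cong)
    fix \<omega> assume \<omega>: "\<omega> \<in> space N"
    interpret lamperti_path "\<lambda>t. Y t \<omega>" by (rule path[OF \<omega>])
    show "Y (max 0 (time_change (\<lambda>t. Y t \<omega>) (t / x))) \<omega> = Y (time_change (\<lambda>t. Y t \<omega>) (t / x)) \<omega>"
      using time_change_nonneg[of "t / x"] assms by (simp add: max_def)
  qed
  finally have [measurable]: "(\<lambda>\<omega>. Y (time_change (\<lambda>t. Y t \<omega>) (t / x)) \<omega>) \<in> borel_measurable N" .
  have "(\<lambda>\<omega>. x * exp (Y (time_change (\<lambda>t. Y t \<omega>) (t / x)) \<omega>)) \<in> borel_measurable N" by measurable
  then show ?thesis by (simp add: lamperti_def[abs_def])
qed

text \<open>Measures how far the path falls below the fraction \<open>a\<close> of its value at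
  \<open>r\<close>, over a window of length \<open>L\<close> in units of that value. An integral
  over time behaves well under Skorokhod convergence, and the truncation at 1 keeps it bounded. The
  absolute values keep the evaluation times nonnegative for arbitrary \<open>w\<close> when
  \<open>r \<ge> 0\<close>.\<close>

definition dip :: "real \<Rightarrow> real \<Rightarrow> (real \<Rightarrow> real) \<Rightarrow> real \<Rightarrow> real" where
  "dip a L w r = (LBINT v:{0..L}. min 1 (max 0 (a * \<bar>w r\<bar> - w (r + \<bar>w r\<bar> * v))))"

lemma right_cont_path_shift_measurable:
  assumes "right_cont_path w" "0 \<le> r" "0 \<le> y"
  shows "(\<lambda>v. indicator {0..L} v *\<^sub>R min 1 (max 0 (c - w (r + y * v)))) \<in> borel_measurable borel"
proof -
  have [measurable]: "(\<lambda>t::real. w (max 0 t)) \<in> borel_measurable borel"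
    by (rule right_cont_path_measurable[OF assms(1)])
  have "(\<lambda>v. indicator {0..L} v *\<^sub>R min 1 (max 0 (c - w (max 0 (r + y * v))))) \<in> borel_measurable borel"
    by measurable
  also have "(\<lambda>v. indicator {0..L} v *\<^sub>R min 1 (max 0 (c - w (max 0 (r + y * v)))))
      = (\<lambda>v. indicator {0..L} v *\<^sub>R min 1 (max 0 (c - w (r + y * v))))"
    using assms by (auto simp: fun_eq_iff indicator_def max_def dest: add_nonneg_nonneg)
  finally show ?thesis .
qed

lemma dip_integrable:
  assumes "right_cont_path w" "0 \<le> r" "0 \<le> y"
  shows "integrable lborel (\<lambda>v. indicator {0..L} v *\<^sub>R min 1 (max 0 (c - w (r + y * v))))"
proof (rule Bochner_Integration.integrable_bound)
  show "integrable lborel (\<lambda>v. indicator {0..L} v :: real)"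
    by (rule integrable_real_indicator) (auto simp: emeasure_lborel_Icc_eq)
  show "(\<lambda>v. indicator {0..L} v *\<^sub>R min 1 (max 0 (c - w (r + y * v)))) \<in> borel_measurable lborel"
    using right_cont_path_shift_measurable[OF assms] by simp
qed (auto simp: indicator_def intro!: AE_I2)

lemma dip_nonneg: "0 \<le> dip a L w r"
  unfolding dip_def set_lebesgue_integral_def by (intro integral_nonneg_AE AE_I2) (auto simp: indicator_def)

context lamperti_path
begin

text \<open>Conditions are imposed at rational times to keep events countable; approximation from
  the right recovers every real time before \<open>e\<close>.\<close>

lemma rat_path_closed:
  assumes "0 \<le> \<sigma>" "0 \<le> r" "r < e" and C: "closed C"
    and R: "\<And>q. q \<in> nonneg_rats \<Longrightarrow> r < q \<Longrightarrow> q < e \<Longrightarrow> w (\<sigma> + q) - w \<sigma> \<in> C"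
  shows "w (\<sigma> + r) - w \<sigma> \<in> C"
proof -
  have "\<exists>q\<in>nonneg_rats. r < q \<and> q < min e (r + inverse (real (Suc n)))" for n
  proof -
    obtain q where "q \<in> \<rat>" "r < q" "q < min e (r + inverse (real (Suc n)))"
      using Rats_dense_in_real[of r "min e (r + inverse (real (Suc n)))"] assms by auto
    then show ?thesis using assms by (auto simp: nonneg_rats_def)
  qed
  then obtain q where q: "\<And>n. q n \<in> nonneg_rats" "\<And>n. r < q n" "\<And>n. q n < e"
    "\<And>n. q n < r + inverse (real (Suc n))" by (metis min_less_iff_conj)
  have "q \<longlonglongrightarrow> r"
  proof (rule tendsto_sandwich[OF _ _ tendsto_const])
    show "(\<lambda>n. r + inverse (real (Suc n))) \<longlonglongrightarrow> r"
      using tendsto_add[OF tendsto_const[of r] LIMSEQ_inverse_real_of_nat] by simp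
  qed (use q in \<open>auto simp: less_imp_le intro!: always_eventually\<close>)
  then have "(\<lambda>n. w (\<sigma> + q n) - w \<sigma>) \<longlonglongrightarrow> w (\<sigma> + r) - w \<sigma>"
    using q assms
    by (intro tendsto_diff tendsto_const right_cont_path_sequentially[OF cadlag_imp_right_cont_path[OF cadlag_w]] tendsto_add) auto
  then show ?thesis by (rule closed_sequentially[OF C, rotated]) (use q R in auto)
qed

lemma lamperti_ge_if_path_ge:
  assumes "0 < x" "0 \<le> t" "t \<le> u"
    and R: "\<forall>q\<in>nonneg_rats. w (\<tau> (t / x) + q) - w (\<tau> (t / x)) \<in> {b..}"
  shows "exp b * (x * exp (w (\<tau> (t / x)))) \<le> x * exp (w (\<tau> (u / x)))"
proof -
  define \<sigma> where "\<sigma> = \<tau> (t / x)"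
  have \<sigma>: "0 \<le> \<sigma>" "\<sigma> \<le> \<tau> (u / x)"
    unfolding \<sigma>_def using assms by (auto intro!: time_change_nonneg time_change_mono divide_right_mono)
  define r where "r = \<tau> (u / x) - \<sigma>"
  have "w (\<sigma> + r) - w \<sigma> \<in> {b..}"
    by (rule rat_path_closed[of _ _ "r + 1"]) (use R \<sigma> in \<open>auto simp: \<sigma>_def r_def\<close>)
  then have "exp (b + w \<sigma>) \<le> exp (w (\<tau> (u / x)))" by (simp add: r_def)
  then show ?thesis using assms by (simp add: exp_add \<sigma>_def mult.commute mult.left_commute)
qed

text \<open>Time of the Lamperti process runs at the speed \<open>exp (w s)\<close> given by the current level, so after rescaling
  by \<open>y\<close> the tube determines a time window whose position and length do not depend on \<open>y\<close>.\<close>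

lemma dip_ge_if_path_in_tube:
  assumes x: "0 < x" and t: "0 \<le> t" and s: "0 \<le> s0" "s0 < s1" and a: "exp b < a"
    and R: "\<forall>q\<in>nonneg_rats. w (\<tau> (t / x) + q) - w (\<tau> (t / x)) \<in> tube s0 s1 K b q"
  defines "X \<equiv> (\<lambda>t. x * exp (w (\<tau> (t / x))))"
  shows "(s1 - s0) / 2 * exp (- K) * min 1 (a - exp b) * min 1 \<bar>X t\<bar> \<le> dip a (s1 * exp K) X t"
proof -
  define \<sigma> where "\<sigma> = \<tau> (t / x)"
  define y where "y = X t"
  \<comment> \<open>Rational times to the right cover only times strictly before \<open>s1\<close>,
    hence the smaller endpoint; the factor \<open>(s1 - s0) / 2\<close> of the claim is
    \<open>s2 - s0\<close>.\<close>
  define s2 where "s2 = (s0 + s1) / 2"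
  have s2: "s0 < s2" "s2 < s1" using s by (auto simp: s2_def)
  have y: "0 < y" "y = x * exp (w \<sigma>)" using x by (auto simp: y_def X_def \<sigma>_def)
  have tx: "0 \<le> t / x" using x t by simp
  have \<sigma>: "0 \<le> \<sigma>" "I \<sigma> = t / x"
    unfolding \<sigma>_def using tx by (auto intro!: time_change_nonneg exp_functional_time_change)
  have K: "w (\<sigma> + r) - w \<sigma> \<in> {- K..K}" if "0 \<le> r" "r < s1" for r
    by (rule rat_path_closed[of _ _ s1]) (use R \<sigma> that in \<open>auto simp: \<sigma>_def tube_def\<close>)
  have b: "w (\<sigma> + r) - w \<sigma> \<in> {..b}" if "s0 \<le> r" "r < s1" for r
    by (rule rat_path_closed[of _ _ s1]) (use R \<sigma> that s in \<open>auto simp: \<sigma>_def tube_def\<close>)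
  \<comment> \<open>The time, in units of the present value \<open>y\<close>, that passes for the
    self-similar process while the underlying path runs from \<sigma> to
    \<open>\<sigma> + r\<close>. Its increments are bounded in terms of \<open>K\<close>
    alone.\<close>
  define H where "H r = (I (\<sigma> + r) - I \<sigma>) * exp (- w \<sigma>)" for r
  have I_H: "I (\<sigma> + r) = (t + y * H r) / x" for r
    using x by (simp add: H_def y \<sigma> field_simps exp_minus)
  have Hdiff: "(r2 - r1) * exp (- K) \<le> H r2 - H r1 \<and> H r2 - H r1 \<le> (r2 - r1) * exp K"
    if "0 \<le> r1" "r1 \<le> r2" "r2 < s1" for r1 r2
  proof -
    have bd: "- K + w \<sigma> \<le> w u" "w u \<le> K + w \<sigma>" if "u \<in> {\<sigma> + r1..\<sigma> + r2}" for u
      using K[of "u - \<sigma>"] that \<open>0 \<le> r1\<close> \<open>r2 < s1\<close> by auto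
    have "((\<sigma> + r2) - (\<sigma> + r1)) * exp (- K + w \<sigma>) \<le> I (\<sigma> + r2) - I (\<sigma> + r1)"
      "I (\<sigma> + r2) - I (\<sigma> + r1) \<le> ((\<sigma> + r2) - (\<sigma> + r1)) * exp (K + w \<sigma>)"
      by (rule exp_functional_diff_bounds; use that \<sigma> bd in auto)+
    then have "((\<sigma> + r2) - (\<sigma> + r1)) * exp (- K + w \<sigma>) * exp (- w \<sigma>) \<le> (I (\<sigma> + r2) - I (\<sigma> + r1)) * exp (- w \<sigma>)"
      "(I (\<sigma> + r2) - I (\<sigma> + r1)) * exp (- w \<sigma>) \<le> ((\<sigma> + r2) - (\<sigma> + r1)) * exp (K + w \<sigma>) * exp (- w \<sigma>)"
      by (intro mult_right_mono; simp)+
    moreover have "(I (\<sigma> + r2) - I (\<sigma> + r1)) * exp (- w \<sigma>) = H r2 - H r1"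
      by (simp add: H_def algebra_simps)
    ultimately show ?thesis by (simp add: mult.assoc flip: exp_add)
  qed
  have H0: "H 0 = 0" by (simp add: H_def)
  have Hs0: "0 \<le> H s0" using Hdiff[of 0 s0] s H0 by (auto intro: order_trans[rotated])
  have Hs2: "H s2 \<le> s1 * exp K"
  proof -
    have "H s2 \<le> s2 * exp K" using Hdiff[of 0 s2] s s2 H0 by auto
    also have "\<dots> \<le> s1 * exp K" using s2 by (intro mult_right_mono) auto
    finally show ?thesis .
  qed
  define m where "m = min 1 (a - exp b) * min 1 y"
  \<comment> \<open>For rescaled times between \<open>H s0\<close> and \<open>H s2\<close> the path
    has moved by at most \<open>b\<close> from its value at \<sigma>, so the deficit is at least
    \<open>(a - exp b) * y\<close>. The minima in \<open>m\<close> allow for the truncation in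
    \<open>dip\<close>.\<close>
  have low: "m \<le> min 1 (max 0 (a * \<bar>y\<bar> - X (t + \<bar>y\<bar> * v)))" if v: "v \<in> {H s0..<H s2}" for v
  proof -
    define u where "u = (t + y * v) / x"
    have "0 \<le> v" using v Hs0 by auto
    then have u0: "0 \<le> u" using x t y by (simp add: u_def)
    define r where "r = \<tau> u - \<sigma>"
    have "I (\<sigma> + s0) \<le> u" "u < I (\<sigma> + s2)"
      unfolding I_H u_def using v x y by (auto intro!: divide_right_mono divide_strict_right_mono)
    then have "\<sigma> + s0 \<le> \<tau> u" "\<tau> u < \<sigma> + s2"
      using time_change_less_iff[OF u0, of "\<sigma> + s0"] time_change_less_iff[OF u0, of "\<sigma> + s2"] \<sigma> s s2 by auto
    then have "w (\<sigma> + r) - w \<sigma> \<in> {..b}" using s2 by (intro b) (auto simp: r_def)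
    then have "exp (w (\<tau> u)) \<le> exp (b + w \<sigma>)" by (simp add: r_def)
    then have "X (t + y * v) \<le> exp b * y" using x by (simp add: X_def u_def y exp_add mult.commute mult.left_commute)
    then have "(a - exp b) * y \<le> a * \<bar>y\<bar> - X (t + \<bar>y\<bar> * v)" using y by (simp add: algebra_simps)
    moreover have "m \<le> 1" "m \<le> (a - exp b) * y"
      unfolding m_def using a y by (auto intro!: mult_le_one mult_mono)
    ultimately show ?thesis by (simp add: le_max_iff_disj)
  qed
  have rc: "right_cont_path X" unfolding X_def by (rule lamperti_right_cont[OF x])
  have sub: "{H s0..<H s2} \<subseteq> {0..s1 * exp K}" using Hs0 Hs2 by auto
  have m0: "0 \<le> m" using a y by (auto simp: m_def)
  have le: "H s0 \<le> H s2"
  proof -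
    have "0 \<le> (s2 - s0) * exp (- K)" using s2 by simp
    then show ?thesis using Hdiff[of s0 s2] s s2 by linarith
  qed
  have "(s1 - s0) / 2 * exp (- K) * m \<le> (H s2 - H s0) * m"
    using Hdiff[of s0 s2] s s2 m0 by (intro mult_right_mono) (auto simp: s2_def field_simps)
  also have "\<dots> = (\<integral>v. indicator {H s0..<H s2} v *\<^sub>R m \<partial>lborel)" using le by simp
  also have "\<dots> \<le> (\<integral>v. indicator {0..s1 * exp K} v *\<^sub>R min 1 (max 0 (a * \<bar>y\<bar> - X (t + \<bar>y\<bar> * v))) \<partial>lborel)"
  proof (rule integral_mono)
    show "integrable lborel (\<lambda>v. indicator {H s0..<H s2} v *\<^sub>R m)"
      by (rule integrable_real_indicator[THEN integrable_scaleR_left]) (auto simp: emeasure_lborel_Ico[OF le])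
    show "integrable lborel (\<lambda>v. indicator {0..s1 * exp K} v *\<^sub>R min 1 (max 0 (a * \<bar>y\<bar> - X (t + \<bar>y\<bar> * v))))"
      by (rule dip_integrable[OF rc t]) simp
    show "indicator {H s0..<H s2} v *\<^sub>R m \<le> indicator {0..s1 * exp K} v *\<^sub>R min 1 (max 0 (a * \<bar>y\<bar> - X (t + \<bar>y\<bar> * v)))" for v
      using low[of v] sub by (auto simp: indicator_def)
  qed
  also have "\<dots> = dip a (s1 * exp K) X t"
    unfolding dip_def set_lebesgue_integral_def y_def[symmetric] ..
  finally show ?thesis using y by (simp add: m_def y_def[symmetric] mult.assoc)
qed

end

locale lamperti_levy = levy +
  assumes exp_functional_unbounded: "\<And>\<omega> t. \<omega> \<in> space M \<Longrightarrow> \<exists>s\<ge>0. t < exp_functional (\<lambda>u. \<xi> u \<omega>) s"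
begin

lemma lamperti_path_xi: "\<omega> \<in> space M \<Longrightarrow> lamperti_path (\<lambda>t. \<xi> t \<omega>)"
  by unfold_locales (use xi_cadlag exp_functional_unbounded in auto)

lemma lamperti_right_cont: "0 < x \<Longrightarrow> \<omega> \<in> space M \<Longrightarrow> right_cont_path (\<lambda>t. lamperti \<xi> x t \<omega>)"
  unfolding lamperti_def by (rule lamperti_path.lamperti_right_cont[OF lamperti_path_xi])

lemma lamperti_pos: "0 < x \<Longrightarrow> 0 < lamperti \<xi> x t \<omega>"
  by (simp add: lamperti_def)

lemma lamperti_meas: "0 < x \<Longrightarrow> 0 \<le> t \<Longrightarrow> lamperti \<xi> x t \<in> borel_measurable M"
  by (rule lamperti_measurable[OF xi_measurable lamperti_path_xi])

text \<open>A fixed time \<open>t\<close> of the self-similar process is a random time of the Levy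
  process. On the event that it comes before \<open>s\<close>, the functional \<open>F\<close> can
  be computed from the path frozen at \<open>s\<close>, which is measurable with respect to
  \<open>past s\<close>. Measurability of \<open>F\<close> is assumed over every measure
  \<open>N\<close> on the same type because it is applied both to \<open>M\<close> and to
  \<open>past s\<close>.\<close>

lemma nn_integral_lamperti_past_future:
  fixes F :: "(real \<Rightarrow> real) \<Rightarrow> ennreal"
  assumes x: "0 < x" and t: "0 \<le> t"
    and local: "\<And>w w'. (\<And>u. 0 \<le> u \<Longrightarrow> u \<le> t \<Longrightarrow> w u = w' u) \<Longrightarrow> F w = F w'"
    and F1: "\<And>w. F w \<le> 1"
    and F_meas: "\<And>(N :: 'a measure) Y. (\<And>u. 0 \<le> u \<Longrightarrow> Y u \<in> borel_measurable N) \<Longrightarrow>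
      (\<And>\<omega>. \<omega> \<in> space N \<Longrightarrow> right_cont_path (\<lambda>u. Y u \<omega>)) \<Longrightarrow> (\<lambda>\<omega>. F (\<lambda>u. Y u \<omega>)) \<in> borel_measurable N"
    and V: "countable V" "V \<subseteq> {0..}" and B: "\<And>v. v \<in> V \<Longrightarrow> closed (B v)"
    and E: "E \<in> events" "\<And>\<omega>. \<omega> \<in> space M \<Longrightarrow>
      \<forall>v\<in>V. \<xi> (time_change (\<lambda>s. \<xi> s \<omega>) (t / x) + v) \<omega> - \<xi> (time_change (\<lambda>s. \<xi> s \<omega>) (t / x)) \<omega> \<in> B v \<Longrightarrow> \<omega> \<in> E"
  shows "(\<integral>\<^sup>+\<omega>. F (\<lambda>u. lamperti \<xi> x u \<omega>) \<partial>M) * prob {\<omega>\<in>space M. \<forall>v\<in>V. \<xi> v \<omega> \<in> B v}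
    \<le> (\<integral>\<^sup>+\<omega>. F (\<lambda>u. lamperti \<xi> x u \<omega>) * indicator E \<omega> \<partial>M)"
proof -
  define \<tau> where "\<tau> \<omega> = time_change (\<lambda>s. \<xi> s \<omega>) (t / x)" for \<omega>
  have tx: "0 \<le> t / x" using x t by simp
  define S where "S s u \<omega> = \<xi> (min u s) \<omega>" for s u \<omega>
  have S_meas: "S s u \<in> borel_measurable (past s)" if "0 \<le> u" "0 \<le> s" for s u
    unfolding S_def[abs_def] using that by (intro xi_measurable_past) auto
  have S_path: "lamperti_path (\<lambda>u. S s u \<omega>)" if "0 \<le> s" "\<omega> \<in> space M" for s \<omega>
    unfolding S_def by (rule lamperti_path.stopped_path(1)[OF lamperti_path_xi[OF that(2)] that(1)])
  have Fm: "(\<lambda>\<omega>. F (\<lambda>u. lamperti \<xi> x u \<omega>)) \<in> borel_measurable M"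
    using x by (intro F_meas lamperti_meas lamperti_right_cont)
  have "(\<integral>\<^sup>+\<omega>. F (\<lambda>u. lamperti \<xi> x u \<omega>) \<partial>M) * prob {\<omega>\<in>space M. \<forall>v\<in>V. \<xi> v \<omega> \<in> B v}
    \<le> (\<integral>\<^sup>+\<omega>. F (\<lambda>u. lamperti \<xi> x u \<omega>) *
        indicator {\<omega>\<in>space M. \<forall>v\<in>V. \<xi> (\<tau> \<omega> + v) \<omega> - \<xi> (\<tau> \<omega>) \<omega> \<in> B v} \<omega> \<partial>M)"
  proof (rule nn_integral_random_time[OF _ _ Fm _ _ V B])
    show "0 \<le> \<tau> \<omega>" if "\<omega> \<in> space M" for \<omega>
      unfolding \<tau>_def by (rule lamperti_path.time_change_nonneg[OF lamperti_path_xi[OF that] tx])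
    have "(\<integral>\<^sup>+\<omega>. F (\<lambda>u. lamperti \<xi> x u \<omega>) \<partial>M) \<le> (\<integral>\<^sup>+\<omega>. 1 \<partial>M)"
      by (rule nn_integral_mono) (rule F1)
    then show "(\<integral>\<^sup>+\<omega>. F (\<lambda>u. lamperti \<xi> x u \<omega>) \<partial>M) < \<infinity>"
      by (simp add: emeasure_space_1 le_less_trans[OF _ ennreal_one_less_top])
    fix s :: real assume s: "0 < s"
    have "{\<omega>\<in>space M. \<tau> \<omega> < s} = {\<omega>\<in>space (past s). t / x < exp_functional (\<lambda>u. S s u \<omega>) s}"
      unfolding space_past
    proof (intro Collect_cong conj_cong refl)
      fix \<omega> assume \<omega>: "\<omega> \<in> space M"
      interpret P: lamperti_path "\<lambda>t. \<xi> t \<omega>" by (rule lamperti_path_xi[OF \<omega>])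
      show "(\<tau> \<omega> < s) = (t / x < exp_functional (\<lambda>u. S s u \<omega>) s)"
        using P.time_change_less_iff[OF tx, of s] P.stopped_path(2)[of s s] s by (simp add: \<tau>_def S_def)
    qed
    also have "\<dots> \<in> sets (past s)"
    proof -
      have "(\<lambda>\<omega>. exp_functional (\<lambda>u. S s u \<omega>) s) \<in> borel_measurable (past s)"
        by (rule exp_functional_measurable) (use S_meas S_path s in auto)
      from Collect_in_sets[OF this, of "{t / x<..}"] show ?thesis by simp
    qed
    finally show "{\<omega>\<in>space M. \<tau> \<omega> < s} \<in> sets (past s)" .
    show "\<exists>Y\<in>borel_measurable (past s). \<forall>\<omega>\<in>space M. \<tau> \<omega> < s \<longrightarrow> F (\<lambda>u. lamperti \<xi> x u \<omega>) = Y \<omega>"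
    proof (intro bexI[of _ "\<lambda>\<omega>. F (\<lambda>u. lamperti (S s) x u \<omega>)"] ballI impI)
      show "(\<lambda>\<omega>. F (\<lambda>u. lamperti (S s) x u \<omega>)) \<in> borel_measurable (past s)"
      proof (rule F_meas)
        show "lamperti (S s) x u \<in> borel_measurable (past s)" if "0 \<le> u" for u
          using that s x by (intro lamperti_measurable S_meas) (auto intro: S_path)
        show "right_cont_path (\<lambda>u. lamperti (S s) x u \<omega>)" if "\<omega> \<in> space (past s)" for \<omega>
          unfolding lamperti_def using that s x
          by (intro lamperti_path.lamperti_right_cont S_path) auto
      qed
      fix \<omega> assume \<omega>: "\<omega> \<in> space M" "\<tau> \<omega> < s"
      interpret P: lamperti_path "\<lambda>t. \<xi> t \<omega>" by (rule lamperti_path_xi[OF \<omega>(1)])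
      show "F (\<lambda>u. lamperti \<xi> x u \<omega>) = F (\<lambda>u. lamperti (S s) x u \<omega>)"
      proof (rule local)
        fix u assume u: "0 \<le> u" "u \<le> t"
        have ux: "0 \<le> u / x" "u / x \<le> t / x" using u x by (auto intro: divide_right_mono)
        have "time_change (\<lambda>s. \<xi> s \<omega>) (u / x) \<le> s"
          using P.time_change_mono[OF ux] \<omega>(2) by (simp add: \<tau>_def)
        then show "lamperti \<xi> x u \<omega> = lamperti (S s) x u \<omega>"
          using P.stopped_path(3)[of s "u / x"] ux s by (simp add: lamperti_def S_def min_def)
      qed
    qed
  qed
  also have "\<dots> \<le> (\<integral>\<^sup>+\<omega>. F (\<lambda>u. lamperti \<xi> x u \<omega>) * indicator E \<omega> \<partial>M)"
    by (intro nn_integral_mono mult_left_mono) (use E(2) in \<open>auto simp: \<tau>_def indicator_def\<close>)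
  finally show ?thesis .
qed

end

section \<open>Test functionals for the ratio of the future infimum to the present value\<close>

lemma tendsto_fun_iff:
  fixes f :: "'c \<Rightarrow> 'i \<Rightarrow> 'b::topological_space"
  shows "(f \<longlongrightarrow> l) F \<longleftrightarrow> (\<forall>i. ((\<lambda>c. f c i) \<longlongrightarrow> l i) F)"
  using limitin_componentwise[of "\<lambda>_. euclidean" UNIV f l F]
  by (simp add: euclidean_product_topology)

text \<open>By dominated convergence, only convergence at almost every evaluation time matters.
  Varying the path and the time together covers both later uses, Skorokhod convergence at a fixed
  time and a moving time on a fixed path.\<close>

lemma dip_tendsto:
  assumes w: "\<And>n. right_cont_path (w n)" "right_cont_path v" "\<And>n. 0 \<le> r n" "0 \<le> t"
    and y: "(\<lambda>n. w n (r n)) \<longlonglongrightarrow> v t"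
    and lim: "AE x in lborel. x \<in> {0..L} \<longrightarrow> (\<lambda>n. w n (r n + \<bar>w n (r n)\<bar> * x)) \<longlonglongrightarrow> v (t + \<bar>v t\<bar> * x)"
  shows "(\<lambda>n. dip a L (w n) (r n)) \<longlonglongrightarrow> dip a L v t"
  unfolding dip_def set_lebesgue_integral_def
proof (rule integral_dominated_convergence[where w="indicator {0..L}"])
  show "integrable lborel (indicator {0..L} :: real \<Rightarrow> real)"
    by (rule integrable_real_indicator) (auto simp: emeasure_lborel_Icc_eq)
  show "AE x in lborel. (\<lambda>n. indicator {0..L} x *\<^sub>R min 1 (max 0 (a * \<bar>w n (r n)\<bar> - w n (r n + \<bar>w n (r n)\<bar> * x))))
      \<longlonglongrightarrow> indicator {0..L} x *\<^sub>R min 1 (max 0 (a * \<bar>v t\<bar> - v (t + \<bar>v t\<bar> * x)))"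
    using lim
  proof eventually_elim
    case (elim x)
    then show ?case
      by (cases "x \<in> {0..L}") (auto intro!: tendsto_intros y)
  qed
  show "(\<lambda>x. indicator {0..L} x *\<^sub>R min 1 (max 0 (a * \<bar>v t\<bar> - v (t + \<bar>v t\<bar> * x)))) \<in> borel_measurable lborel"
    using right_cont_path_shift_measurable[OF w(2) w(4)] by simp
  show "(\<lambda>x. indicator {0..L} x *\<^sub>R min 1 (max 0 (a * \<bar>w n (r n)\<bar> - w n (r n + \<bar>w n (r n)\<bar> * x)))) \<in> borel_measurable lborel" for n
    using right_cont_path_shift_measurable[OF w(1) w(3)] by simp
qed (auto simp: indicator_def intro!: AE_I2)

text \<open>The discontinuities are countable, and so is their preimage under an affine map of
  positive slope.\<close>

lemma AE_isCont_affine: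
  assumes "cadlag v" "0 \<le> t" "0 < y"
  shows "AE x in lborel. 0 < x \<longrightarrow> isCont v (t + y * x)"
proof (rule AE_I')
  have "{x. 0 < x \<and> \<not> isCont v (t + y * x)} \<subseteq> (\<lambda>s. (s - t) / y) ` {s. 0 < s \<and> \<not> isCont v s}"
  proof
    fix x assume "x \<in> {x. 0 < x \<and> \<not> isCont v (t + y * x)}"
    then show "x \<in> (\<lambda>s. (s - t) / y) ` {s. 0 < s \<and> \<not> isCont v s}"
      using assms by (intro image_eqI[of _ _ "t + y * x"]) (auto intro: add_nonneg_pos)
  qed
  then show "{x. 0 < x \<and> \<not> isCont v (t + y * x)} \<in> null_sets lborel"
    by (rule countable_imp_null_set_lborel[OF countable_subset])
      (intro countable_image cadlag_countable_discontinuities assms)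
qed auto

lemma dip_tendsto_skorokhod:
  assumes w: "\<And>n. cadlag (w n)" and v: "cadlag v" and conv: "skorokhod_tendsto w v"
    and r: "0 < r" "isCont v r"
  shows "(\<lambda>n. dip a L (w n) r) \<longlonglongrightarrow> dip a L v r"
proof (rule dip_tendsto)
  show y: "(\<lambda>n. w n r) \<longlonglongrightarrow> v r"
    by (rule skorokhod_tendsto_at_isCont[OF conv r(2,1) tendsto_const])
  have lim: "(\<lambda>n. w n (r + \<bar>w n r\<bar> * x)) \<longlonglongrightarrow> v (r + \<bar>v r\<bar> * x)"
    if "0 \<le> x" "isCont v (r + \<bar>v r\<bar> * x)" for x
    using that r by (intro skorokhod_tendsto_at_isCont[OF conv that(2)] tendsto_intros y add_pos_nonneg) auto
  show "AE x in lborel. x \<in> {0..L} \<longrightarrow> (\<lambda>n. w n (r + \<bar>w n r\<bar> * x)) \<longlonglongrightarrow> v (r + \<bar>v r\<bar> * x)"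
  \<comment> \<open>If the window shrinks to the point \<open>r\<close>, continuity of
    \<open>v\<close> at \<open>r\<close> itself is used; otherwise almost every evaluation time is a
    continuity point.\<close>
  proof (cases "v r = 0")
    case True
    then show ?thesis using lim r by (intro AE_I2) auto
  next
    case False
    have "AE x in lborel. 0 < x \<longrightarrow> isCont v (r + \<bar>v r\<bar> * x)"
      by (rule AE_isCont_affine[OF v]) (use r False in auto)
    with AE_lborel_singleton[of 0] show ?thesis
      by eventually_elim (use lim in auto)
  qed
qed (use r w v cadlag_imp_right_cont_path in auto)

text \<open>If \<open>w t = 0\<close>, all evaluation times approach \<open>t\<close> strictly from
  the right and right-continuity suffices; otherwise almost every one of them tends to a continuity
  point.\<close>

lemma dip_tendsto_right:
  assumes w: "cadlag w" and t: "0 \<le> t" and r: "\<And>n. t < r n" "r \<longlonglongrightarrow> t"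
  shows "(\<lambda>n. dip a L w (r n)) \<longlonglongrightarrow> dip a L w t"
proof (rule dip_tendsto)
  have rc: "right_cont_path w" by (rule cadlag_imp_right_cont_path[OF w])
  show y: "(\<lambda>n. w (r n)) \<longlonglongrightarrow> w t"
    by (rule right_cont_path_sequentially[OF rc t r])
  show "AE x in lborel. x \<in> {0..L} \<longrightarrow> (\<lambda>n. w (r n + \<bar>w (r n)\<bar> * x)) \<longlonglongrightarrow> w (t + \<bar>w t\<bar> * x)"
  proof (cases "w t = 0")
    case True
    show ?thesis
    proof (intro AE_I2 impI)
      fix x :: real assume x: "x \<in> {0..L}"
      have "(\<lambda>n. r n + \<bar>w (r n)\<bar> * x) \<longlonglongrightarrow> t + \<bar>w t\<bar> * x" by (intro tendsto_intros r y)
      then show "(\<lambda>n. w (r n + \<bar>w (r n)\<bar> * x)) \<longlonglongrightarrow> w (t + \<bar>w t\<bar> * x)"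
        using True x r(1) by (intro right_cont_path_sequentially[OF rc]) (auto intro!: add_less_le_mono[of t _ 0, simplified] t)
    qed
  next
    case False
    have "AE x in lborel. 0 < x \<longrightarrow> isCont w (t + \<bar>w t\<bar> * x)"
      by (rule AE_isCont_affine[OF w t]) (use False in auto)
    with AE_lborel_singleton[of 0] show ?thesis
    proof eventually_elim
      case (elim x)
      show ?case
      proof
        assume "x \<in> {0..L}"
        then have "isCont w (t + \<bar>w t\<bar> * x)" using elim by auto
        then show "(\<lambda>n. w (r n + \<bar>w (r n)\<bar> * x)) \<longlonglongrightarrow> w (t + \<bar>w t\<bar> * x)"
          by (rule isCont_tendsto_compose) (intro tendsto_intros r y)
      qed
    qed
  qed
  show "0 \<le> r n" for n using t r(1)[of n] by linarith
qed (use t w cadlag_imp_right_cont_path in auto)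

lemma dip_measurable_pair:
  fixes Y :: "real \<Rightarrow> 'a \<Rightarrow> real"
  assumes meas: "\<And>t. 0 \<le> t \<Longrightarrow> Y t \<in> borel_measurable N"
    and rc: "\<And>\<omega>. \<omega> \<in> space N \<Longrightarrow> right_cont_path (\<lambda>t. Y t \<omega>)"
  shows "(\<lambda>(r::real, \<omega>). dip a L (\<lambda>u. Y u \<omega>) (max 0 r)) \<in> borel_measurable (borel \<Otimes>\<^sub>M N)"
proof -
  define g where "g = (\<lambda>(t::real, \<omega>). Y (max 0 t) \<omega>)"
  have g [measurable]: "g \<in> borel_measurable (borel \<Otimes>\<^sub>M N)"
    unfolding g_def by (rule right_cont_measurable_pair[OF meas rc])
  have "(\<lambda>(p, v). indicator {0..L} v *\<^sub>R min 1 (max 0 (a * \<bar>g p\<bar> - g (max 0 (fst p) + \<bar>g p\<bar> * v, snd p))))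
      \<in> borel_measurable ((borel \<Otimes>\<^sub>M N) \<Otimes>\<^sub>M lborel)"
    by measurable
  then have "(\<lambda>p. \<integral>v. indicator {0..L} v *\<^sub>R min 1 (max 0 (a * \<bar>g p\<bar> - g (max 0 (fst p) + \<bar>g p\<bar> * v, snd p))) \<partial>lborel)
      \<in> borel_measurable (borel \<Otimes>\<^sub>M N)"
    by (intro lborel.borel_measurable_lebesgue_integral) simp
  also have "(\<lambda>p. \<integral>v. indicator {0..L} v *\<^sub>R min 1 (max 0 (a * \<bar>g p\<bar> - g (max 0 (fst p) + \<bar>g p\<bar> * v, snd p))) \<partial>lborel)
     = (\<lambda>(r::real, \<omega>). dip a L (\<lambda>u. Y u \<omega>) (max 0 r))"
    unfolding dip_def set_lebesgue_integral_def
  proof (rule ext, clarify, rule Bochner_Integration.integral_cong[OF refl])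
    fix r :: real and \<omega> and v :: real
    show "indicator {0..L} v *\<^sub>R min 1 (max 0 (a * \<bar>g (r, \<omega>)\<bar> - g (max 0 (fst (r, \<omega>)) + \<bar>g (r, \<omega>)\<bar> * v, snd (r, \<omega>)))) =
      indicator {0..L} v *\<^sub>R min 1 (max 0 (a * \<bar>Y (max 0 r) \<omega>\<bar> - Y (max 0 r + \<bar>Y (max 0 r) \<omega>\<bar> * v) \<omega>))"
    proof (cases "v \<in> {0..L}")
      case True
      then have "0 \<le> max 0 r + \<bar>Y (max 0 r) \<omega>\<bar> * v" by auto
      then show ?thesis unfolding g_def by (simp only: prod.case fst_conv snd_conv max_absorb2)
    qed simp
  qed
  finally show ?thesis .
qed

text \<open>Evaluation at a fixed time is not Skorokhod continuous, while a time average is.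
  Right-continuity recovers \<open>arctan (w s)\<close> when \<delta> tends to 0, and the arctangent
  keeps the integrand bounded.\<close>

definition avg :: "real \<Rightarrow> real \<Rightarrow> (real \<Rightarrow> real) \<Rightarrow> real" where
  "avg \<delta> s w = (LBINT \<rho>:{0..1}. arctan (w (s + \<delta> * \<rho>)))"

lemma abs_arctan_le: "\<bar>arctan x\<bar> \<le> pi / 2"
  using arctan_bounded[of x] by auto

lemma avg_path_measurable:
  assumes "right_cont_path w" "0 \<le> s" "0 \<le> \<delta>"
  shows "(\<lambda>\<rho>. indicator {0..1} \<rho> *\<^sub>R arctan (w (s + \<delta> * \<rho>))) \<in> borel_measurable borel"
proof -
  have [measurable]: "(\<lambda>t::real. w (max 0 t)) \<in> borel_measurable borel"
    by (rule right_cont_path_measurable[OF assms(1)])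
  have "(\<lambda>\<rho>. indicator {0..1} \<rho> *\<^sub>R arctan (w (max 0 (s + \<delta> * \<rho>)))) \<in> borel_measurable borel"
    by measurable
  also have "(\<lambda>\<rho>. indicator {0..1} \<rho> *\<^sub>R arctan (w (max 0 (s + \<delta> * \<rho>)))) = (\<lambda>\<rho>. indicator {0..1} \<rho> *\<^sub>R arctan (w (s + \<delta> * \<rho>)))"
    using assms by (auto simp: fun_eq_iff indicator_def max_def dest: add_nonneg_nonneg)
  finally show ?thesis .
qed

lemma avg_tendsto:
  assumes w: "\<And>n. right_cont_path (w n)" "right_cont_path v" "0 \<le> s" "\<And>n. 0 \<le> d n" "0 \<le> \<delta>"
    and lim: "AE \<rho> in lborel. 0 < \<rho> \<longrightarrow> (\<lambda>n. w n (s + d n * \<rho>)) \<longlonglongrightarrow> v (s + \<delta> * \<rho>)"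
  shows "(\<lambda>n. avg (d n) s (w n)) \<longlonglongrightarrow> avg \<delta> s v"
  unfolding avg_def set_lebesgue_integral_def
proof (rule integral_dominated_convergence[where w="\<lambda>\<rho>. indicator {0..1} \<rho> *\<^sub>R (pi / 2)"])
  show "integrable lborel (\<lambda>\<rho>::real. indicator {0..1::real} \<rho> *\<^sub>R (pi / 2))"
    by (rule integrable_real_indicator[THEN integrable_scaleR_left]) auto
  show "AE \<rho> in lborel. (\<lambda>n. indicator {0..1} \<rho> *\<^sub>R arctan (w n (s + d n * \<rho>))) \<longlonglongrightarrow> indicator {0..1} \<rho> *\<^sub>R arctan (v (s + \<delta> * \<rho>))"
    using lim AE_lborel_singleton[of 0]
  proof eventually_elim
    case (elim \<rho>)
    then show ?case by (cases "\<rho> \<in> {0..1}") (auto intro!: tendsto_intros)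
  qed
qed (use w avg_path_measurable abs_arctan_le in \<open>auto simp: indicator_def intro!: AE_I2\<close>)

lemma avg_tendsto_skorokhod:
  assumes w: "\<And>n. cadlag (w n)" and v: "cadlag v" and conv: "skorokhod_tendsto w v" and "0 \<le> s" "0 < \<delta>"
  shows "(\<lambda>n. avg \<delta> s (w n)) \<longlonglongrightarrow> avg \<delta> s v"
proof (rule avg_tendsto)
  have "AE \<rho> in lborel. 0 < \<rho> \<longrightarrow> isCont v (s + \<delta> * \<rho>)"
    by (rule AE_isCont_affine[OF v]) (use assms in auto)
  then show "AE \<rho> in lborel. 0 < \<rho> \<longrightarrow> (\<lambda>n. w n (s + \<delta> * \<rho>)) \<longlonglongrightarrow> v (s + \<delta> * \<rho>)"
    by eventually_elim
      (use assms in \<open>auto intro!: skorokhod_tendsto_at_isCont[OF conv _ _ tendsto_const] add_nonneg_pos\<close>)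
qed (use assms cadlag_imp_right_cont_path in auto)

lemma avg_tendsto_arctan:
  assumes w: "right_cont_path w" and "0 \<le> s" and d: "\<And>n. 0 < d n" "d \<longlonglongrightarrow> 0"
  shows "(\<lambda>n. avg (d n) s w) \<longlonglongrightarrow> arctan (w s)"
proof -
  have "(\<lambda>n. avg (d n) s w) \<longlonglongrightarrow> avg 0 s w"
  proof (rule avg_tendsto)
    show "AE \<rho> in lborel. 0 < \<rho> \<longrightarrow> (\<lambda>n. w (s + d n * \<rho>)) \<longlonglongrightarrow> w (s + 0 * \<rho>)"
    proof (intro AE_I2 impI)
      fix \<rho> :: real assume "0 < \<rho>"
      have "(\<lambda>n. s + d n * \<rho>) \<longlonglongrightarrow> s + 0 * \<rho>" by (intro tendsto_intros d)
      then show "(\<lambda>n. w (s + d n * \<rho>)) \<longlonglongrightarrow> w (s + 0 * \<rho>)"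
        using \<open>0 < \<rho>\<close> d assms by (intro right_cont_path_sequentially[OF w]) auto
    qed
  qed (use assms in \<open>auto simp: less_imp_le\<close>)
  also have "avg 0 s w = arctan (w s)" by (simp add: avg_def set_lebesgue_integral_def)
  finally show ?thesis .
qed

lemma avg_measurable:
  assumes meas: "\<And>t. 0 \<le> t \<Longrightarrow> Y t \<in> borel_measurable N"
    and rc: "\<And>\<omega>. \<omega> \<in> space N \<Longrightarrow> right_cont_path (\<lambda>t. Y t \<omega>)" and "0 \<le> s" "0 \<le> \<delta>"
  shows "(\<lambda>\<omega>. avg \<delta> s (\<lambda>u. Y u \<omega>)) \<in> borel_measurable N"
proof -
  define g where "g = (\<lambda>(t::real, \<omega>). Y (max 0 t) \<omega>)"
  have [measurable]: "g \<in> borel_measurable (borel \<Otimes>\<^sub>M N)"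
    unfolding g_def by (rule right_cont_measurable_pair[OF meas rc])
  have "(\<lambda>(\<omega>, \<rho>). indicator {0..1} \<rho> *\<^sub>R arctan (g (s + \<delta> * \<rho>, \<omega>))) \<in> borel_measurable (N \<Otimes>\<^sub>M lborel)"
    by measurable
  then have "(\<lambda>\<omega>. \<integral>\<rho>. indicator {0..1} \<rho> *\<^sub>R arctan (g (s + \<delta> * \<rho>, \<omega>)) \<partial>lborel) \<in> borel_measurable N"
    by (intro lborel.borel_measurable_lebesgue_integral) simp
  also have "(\<lambda>\<omega>. \<integral>\<rho>. indicator {0..1} \<rho> *\<^sub>R arctan (g (s + \<delta> * \<rho>, \<omega>)) \<partial>lborel) = (\<lambda>\<omega>. avg \<delta> s (\<lambda>u. Y u \<omega>))"
    unfolding avg_def set_lebesgue_integral_def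
    using assms by (intro ext Bochner_Integration.integral_cong) (auto simp: indicator_def g_def max_def dest: add_nonneg_nonneg)
  finally show ?thesis .
qed

context
  fixes \<alpha> \<beta> a L :: real
begin

text \<open>The parameters select the meaning of a vanishing defect. For \<open>\<alpha> = 1\<close>
  and \<open>\<beta> = 0\<close> it says that there is no dip; for \<open>\<alpha> = -1\<close> and
  \<open>\<beta> > 0\<close> it says that the dip is at least
  \<open>\<beta> * min 1 \<bar>w r\<bar>\<close>. One transfer argument then serves both
  events.\<close>

definition defect :: "(real \<Rightarrow> real) \<Rightarrow> real \<Rightarrow> real" where
  "defect w r = max 0 (\<beta> * min 1 \<bar>w r\<bar> + \<alpha> * dip a L w r)"

text \<open>A continuous substitute for an event of the past intersected with
  \<open>defect = 0\<close>, whose indicator is the limit of the exponential as \<open>n\<close>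
  grows. The averages use times up to \<open>t + \<delta>\<close> when \<open>s i \<le> t\<close>,
  and the defect is evaluated between \<open>t + \<delta>\<close> and
  \<open>t + 2 * \<delta>\<close>, so the past factor never looks beyond the evaluation
  time.\<close>

definition test :: "((nat \<Rightarrow> real) \<Rightarrow> real) \<Rightarrow> (nat \<Rightarrow> real) \<Rightarrow> real \<Rightarrow> nat \<Rightarrow> real \<Rightarrow> (real \<Rightarrow> real) \<Rightarrow> real" where
  "test \<gamma> s t n \<delta> w =
     (LBINT \<rho>:{0..1}. \<gamma> (\<lambda>i. avg \<delta> (s i) w) * exp (- (real n * defect w (t + \<delta> + \<delta> * \<rho>))))"

lemma defect_nonneg: "0 \<le> defect w r"
  by (simp add: defect_def)

lemma exp_defect_le_1: "exp (- (real n * defect w r)) \<le> 1"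
  using defect_nonneg[of w r] by simp

lemma defect_measurable_pair:
  assumes meas: "\<And>t. 0 \<le> t \<Longrightarrow> Y t \<in> borel_measurable N"
    and rc: "\<And>\<omega>. \<omega> \<in> space N \<Longrightarrow> right_cont_path (\<lambda>t. Y t \<omega>)"
  shows "(\<lambda>(r::real, \<omega>). defect (\<lambda>u. Y u \<omega>) (max 0 r)) \<in> borel_measurable (borel \<Otimes>\<^sub>M N)"
proof -
  note [measurable] = right_cont_measurable_pair[OF meas rc] dip_measurable_pair[OF meas rc, of a L]
  have "(\<lambda>p. max 0 (\<beta> * min 1 \<bar>(\<lambda>(t::real, \<omega>). Y (max 0 t) \<omega>) p\<bar> + \<alpha> * (\<lambda>(r::real, \<omega>). dip a L (\<lambda>u. Y u \<omega>) (max 0 r)) p))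
      \<in> borel_measurable (borel \<Otimes>\<^sub>M N)"
    by measurable
  then show ?thesis by (simp add: defect_def case_prod_unfold)
qed

lemma defect_path_measurable:
  assumes "right_cont_path w"
  shows "(\<lambda>r::real. defect w (max 0 r)) \<in> borel_measurable borel"
proof -
  have "(\<lambda>(r::real, \<omega>). defect (\<lambda>u. (\<lambda>u _. w u) u \<omega>) (max 0 r)) \<in> borel_measurable (borel \<Otimes>\<^sub>M (count_space UNIV :: unit measure))"
    by (rule defect_measurable_pair) (use assms in auto)
  from measurable_Pair1[OF this, of "()"] show ?thesis by simp
qed

lemma defect_measurable:
  assumes meas: "\<And>t. 0 \<le> t \<Longrightarrow> Y t \<in> borel_measurable N"
    and rc: "\<And>\<omega>. \<omega> \<in> space N \<Longrightarrow> right_cont_path (\<lambda>t. Y t \<omega>)" and "0 \<le> r"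
  shows "(\<lambda>\<omega>. defect (\<lambda>u. Y u \<omega>) r) \<in> borel_measurable N"
  using measurable_Pair2[OF defect_measurable_pair[OF meas rc], of r] \<open>0 \<le> r\<close> by (simp add: max_absorb2)

lemma defect_tendsto_skorokhod:
  assumes "\<And>n. cadlag (w n)" "cadlag v" "skorokhod_tendsto w v" "0 < r" "isCont v r"
  shows "(\<lambda>n. defect (w n) r) \<longlonglongrightarrow> defect v r"
proof -
  have 1: "(\<lambda>n. w n r) \<longlonglongrightarrow> v r"
    by (rule skorokhod_tendsto_at_isCont[OF assms(3,5,4) tendsto_const])
  have 2: "(\<lambda>n. dip a L (w n) r) \<longlonglongrightarrow> dip a L v r"
    by (rule dip_tendsto_skorokhod[OF assms])
  show ?thesis
    unfolding defect_def
    by (intro tendsto_max tendsto_add tendsto_mult tendsto_min tendsto_rabs tendsto_const 1 2)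
qed

lemma defect_tendsto_right:
  assumes "cadlag w" "0 \<le> t" "\<And>n. t < r n" "r \<longlonglongrightarrow> t"
  shows "(\<lambda>n. defect w (r n)) \<longlonglongrightarrow> defect w t"
proof -
  have 1: "(\<lambda>n. w (r n)) \<longlonglongrightarrow> w t"
    by (rule right_cont_path_sequentially[OF cadlag_imp_right_cont_path[OF assms(1)] assms(2-4)])
  have 2: "(\<lambda>n. dip a L w (r n)) \<longlonglongrightarrow> dip a L w t"
    by (rule dip_tendsto_right[OF assms])
  show ?thesis
    unfolding defect_def
    by (intro tendsto_max tendsto_add tendsto_mult tendsto_min tendsto_rabs tendsto_const 1 2)
qed

context
  fixes \<gamma> :: "(nat \<Rightarrow> real) \<Rightarrow> real" and s :: "nat \<Rightarrow> real" and t :: real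
  assumes \<gamma>: "continuous_on UNIV \<gamma>" "\<And>z. 0 \<le> \<gamma> z" "\<And>z. \<gamma> z \<le> 1"
    and s: "\<And>i. 0 \<le> s i" "\<And>i. s i \<le> t" and t: "0 < t"
begin

lemma \<gamma>_tendsto:
  assumes "\<And>i. ((\<lambda>c. f c i) \<longlongrightarrow> l i) F"
  shows "((\<lambda>c. \<gamma> (f c)) \<longlongrightarrow> \<gamma> l) F"
proof -
  have "(f \<longlongrightarrow> l) F" using assms by (simp add: tendsto_fun_iff)
  moreover have "isCont \<gamma> l" using \<gamma>(1) by (simp add: continuous_on_eq_continuous_at)
  ultimately show ?thesis by (rule isCont_tendsto_compose[rotated])
qed

lemma \<gamma>_measurable [measurable]: "\<gamma> \<in> borel_measurable borel"
  by (rule borel_measurable_continuous_onI[OF \<gamma>(1)])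

lemma test_integrand_bounds:
  "0 \<le> \<gamma> z * exp (- (real n * defect w r))" "\<gamma> z * exp (- (real n * defect w r)) \<le> 1"
  by (rule mult_nonneg_nonneg[OF \<gamma>(2) exp_ge_zero])
    (rule mult_le_one[OF \<gamma>(3) exp_ge_zero exp_defect_le_1])

lemma test_integrand_measurable:
  assumes "right_cont_path w" "0 < \<delta>"
  shows "(\<lambda>\<rho>. indicator {0..1} \<rho> *\<^sub>R (c * exp (- (real n * defect w (t + \<delta> + \<delta> * \<rho>))))) \<in> borel_measurable borel"
proof -
  note [measurable] = defect_path_measurable[OF assms(1)]
  have "(\<lambda>\<rho>. indicator {0..1} \<rho> *\<^sub>R (c * exp (- (real n * defect w (max 0 (t + \<delta> + \<delta> * \<rho>)))))) \<in> borel_measurable borel"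
    by measurable
  also have "(\<lambda>\<rho>. indicator {0..1} \<rho> *\<^sub>R (c * exp (- (real n * defect w (max 0 (t + \<delta> + \<delta> * \<rho>))))))
      = (\<lambda>\<rho>. indicator {0..1} \<rho> *\<^sub>R (c * exp (- (real n * defect w (t + \<delta> + \<delta> * \<rho>)))))"
    using assms(2) t by (auto simp: fun_eq_iff indicator_def max_def mult_less_0_iff dest!: add_nonneg_nonneg)
  finally show ?thesis .
qed

text \<open>The bounds have to hold for arbitrary functions \<open>w\<close>, because weak
  convergence is tested with functionals of bounded range; where the integrand is not integrable the
  integral is 0 by convention.\<close>

lemma test_bounds: "0 \<le> test \<gamma> s t n \<delta> w" "test \<gamma> s t n \<delta> w \<le> 1"
proof -
  let ?f = "\<lambda>\<rho>. indicator {0..1} \<rho> *\<^sub>R (\<gamma> (\<lambda>i. avg \<delta> (s i) w) * exp (- (real n * defect w (t + \<delta> + \<delta> * \<rho>))))"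
  have f: "0 \<le> ?f \<rho>" "?f \<rho> \<le> indicator {0..1} \<rho>" for \<rho> :: real
    using test_integrand_bounds by (auto simp: indicator_def)
  show "0 \<le> test \<gamma> s t n \<delta> w"
    unfolding test_def set_lebesgue_integral_def by (rule integral_nonneg_AE) (use f in auto)
  show "test \<gamma> s t n \<delta> w \<le> 1"
  proof (cases "integrable lborel ?f")
    case True
    have "integral\<^sup>L lborel ?f \<le> integral\<^sup>L lborel (indicator {0..1} :: real \<Rightarrow> real)"
      by (rule integral_mono[OF True]) (use f in auto)
    then show ?thesis unfolding test_def set_lebesgue_integral_def by simp
  next
    case False
    then show ?thesis unfolding test_def set_lebesgue_integral_def by (simp add: not_integrable_integral_eq)
  qed
qed

text \<open>Letting the width \<open>d k\<close> and the path \<open>w k\<close> vary together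
  covers a fixed width under Skorokhod convergence as well as a shrinking width on a fixed
  path.\<close>

lemma test_tendsto:
  assumes w: "\<And>k. right_cont_path (w k)" "right_cont_path v" and d: "\<And>k. 0 < d k" 
    and z: "\<And>i. (\<lambda>k. avg (d k) (s i) (w k)) \<longlonglongrightarrow> z i"
    and lim: "AE \<rho> in lborel. 0 < \<rho> \<longrightarrow> (\<lambda>k. defect (w k) (t + d k + d k * \<rho>)) \<longlonglongrightarrow> f \<rho>"
    and f: "(\<lambda>\<rho>. indicator {0..1} \<rho> *\<^sub>R (\<gamma> z * exp (- (real n * f \<rho>)))) \<in> borel_measurable borel"
  shows "(\<lambda>k. test \<gamma> s t n (d k) (w k)) \<longlonglongrightarrow> (LBINT \<rho>:{0..1}. \<gamma> z * exp (- (real n * f \<rho>)))"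
  unfolding test_def set_lebesgue_integral_def
proof (rule integral_dominated_convergence[where w="indicator {0..1}"])
  show "AE \<rho> in lborel. (\<lambda>k. indicator {0..1} \<rho> *\<^sub>R (\<gamma> (\<lambda>i. avg (d k) (s i) (w k)) * exp (- (real n * defect (w k) (t + d k + d k * \<rho>)))))
      \<longlonglongrightarrow> indicator {0..1} \<rho> *\<^sub>R (\<gamma> z * exp (- (real n * f \<rho>)))"
    using lim AE_lborel_singleton[of 0]
  proof eventually_elim
    case (elim \<rho>)
    then show ?case by (cases "\<rho> \<in> {0..1}") (auto intro!: tendsto_intros \<gamma>_tendsto z)
  qed
  show "AE \<rho> in lborel. norm (indicator {0..1} \<rho> *\<^sub>R (\<gamma> (\<lambda>i. avg (d k) (s i) (w k)) * exp (- (real n * defect (w k) (t + d k + d k * \<rho>)))))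
      \<le> indicator {0..1} \<rho>" for k
    using test_integrand_bounds by (intro AE_I2) (auto simp: indicator_def)
qed (use f test_integrand_measurable[OF w(1) d] in auto)

lemma test_skorokhod_continuous:
  assumes "0 < \<delta>"
  shows "skorokhod_continuous (test \<gamma> s t n \<delta>)"
  unfolding skorokhod_continuous_def
proof (intro allI impI)
  fix w v assume w: "\<forall>k. cadlag (w k)" and v: "cadlag v" and conv: "skorokhod_tendsto w v"
  have "(\<lambda>k. test \<gamma> s t n \<delta> (w k)) \<longlonglongrightarrow>
      (LBINT \<rho>:{0..1}. \<gamma> (\<lambda>i. avg \<delta> (s i) v) * exp (- (real n * defect v (t + \<delta> + \<delta> * \<rho>))))"
  proof (rule test_tendsto[where v=v])
    show "(\<lambda>k. avg \<delta> (s i) (w k)) \<longlonglongrightarrow> avg \<delta> (s i) v" for i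
      by (rule avg_tendsto_skorokhod) (use w v conv s assms in auto)
    have "AE \<rho> in lborel. 0 < \<rho> \<longrightarrow> isCont v (t + \<delta> + \<delta> * \<rho>)"
      by (rule AE_isCont_affine[OF v]) (use t assms in auto)
    then show "AE \<rho> in lborel. 0 < \<rho> \<longrightarrow> (\<lambda>k. defect (w k) (t + \<delta> + \<delta> * \<rho>)) \<longlonglongrightarrow> defect v (t + \<delta> + \<delta> * \<rho>)"
    proof eventually_elim
      case (elim \<rho>)
      show ?case
      proof
        assume \<rho>: "0 < \<rho>"
        then have "0 < t + \<delta> + \<delta> * \<rho>" using t assms mult_pos_pos[OF assms \<rho>] by linarith
        then show "(\<lambda>k. defect (w k) (t + \<delta> + \<delta> * \<rho>)) \<longlonglongrightarrow> defect v (t + \<delta> + \<delta> * \<rho>)"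
          using w v conv elim \<rho> by (intro defect_tendsto_skorokhod) auto
      qed
    qed
    show "(\<lambda>\<rho>. indicator {0..1} \<rho> *\<^sub>R (\<gamma> (\<lambda>i. avg \<delta> (s i) v) * exp (- (real n * defect v (t + \<delta> + \<delta> * \<rho>))))) \<in> borel_measurable borel"
      by (rule test_integrand_measurable[OF cadlag_imp_right_cont_path[OF v] assms])
  qed (use w v assms cadlag_imp_right_cont_path in auto)
  then show "(\<lambda>k. test \<gamma> s t n \<delta> (w k)) \<longlonglongrightarrow> test \<gamma> s t n \<delta> v"
    unfolding test_def .
qed

lemma test_tendsto_0:
  assumes w: "cadlag w" and d: "\<And>k. 0 < d k" "d \<longlonglongrightarrow> 0"
  shows "(\<lambda>k. test \<gamma> s t n (d k) w) \<longlonglongrightarrow> \<gamma> (\<lambda>i. arctan (w (s i))) * exp (- (real n * defect w t))"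
proof -
  have rc: "right_cont_path w" by (rule cadlag_imp_right_cont_path[OF w])
  have "(\<lambda>k. test \<gamma> s t n (d k) w) \<longlonglongrightarrow> (LBINT \<rho>:{0..1::real}. \<gamma> (\<lambda>i. arctan (w (s i))) * exp (- (real n * defect w t)))"
  proof (rule test_tendsto[where v=w and w="\<lambda>_. w" and f="\<lambda>_. defect w t" and z="\<lambda>i. arctan (w (s i))"])
    show "AE \<rho> in lborel. 0 < \<rho> \<longrightarrow> (\<lambda>k. defect w (t + d k + d k * \<rho>)) \<longlonglongrightarrow> defect w t"
    proof (intro AE_I2 impI)
      fix \<rho> :: real assume "0 < \<rho>"
      have "(\<lambda>k. t + d k + d k * \<rho>) \<longlonglongrightarrow> t + 0 + 0 * \<rho>" by (intro tendsto_intros d)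
      moreover have "t < t + d k + d k * \<rho>" for k
        using d(1)[of k] mult_pos_pos[OF d(1)[of k] \<open>0 < \<rho>\<close>] by linarith
      ultimately show "(\<lambda>k. defect w (t + d k + d k * \<rho>)) \<longlonglongrightarrow> defect w t"
        using t by (intro defect_tendsto_right[OF w]) auto
    qed
  qed (use rc s d in \<open>auto intro!: avg_tendsto_arctan\<close>)
  then show ?thesis by (simp add: set_lebesgue_integral_def)
qed

lemma test_measurable_pair:
  assumes meas: "\<And>t. 0 \<le> t \<Longrightarrow> Y t \<in> borel_measurable N"
    and rc: "\<And>\<omega>. \<omega> \<in> space N \<Longrightarrow> right_cont_path (\<lambda>t. Y t \<omega>)" and "0 < \<delta>"
  shows "(\<lambda>(\<omega>, \<rho>). indicator {0..1} \<rho> *\<^sub>R (\<gamma> (\<lambda>i. avg \<delta> (s i) (\<lambda>u. Y u \<omega>)) * exp (- (real n * defect (\<lambda>u. Y u \<omega>) (t + \<delta> + \<delta> * \<rho>)))))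
    \<in> borel_measurable (N \<Otimes>\<^sub>M lborel)"
proof -
  define g where "g = (\<lambda>(r::real, \<omega>). defect (\<lambda>u. Y u \<omega>) (max 0 r))"
  have [measurable]: "g \<in> borel_measurable (borel \<Otimes>\<^sub>M N)"
    unfolding g_def by (rule defect_measurable_pair[OF meas rc])
  have [measurable]: "(\<lambda>\<omega>. (\<lambda>i. avg \<delta> (s i) (\<lambda>u. Y u \<omega>))) \<in> borel_measurable N"
    by (rule measurable_coordinatewise_then_product) (use s assms in \<open>intro avg_measurable[OF meas rc], auto\<close>)
  have "(\<lambda>(\<omega>, \<rho>). indicator {0..1} \<rho> *\<^sub>R (\<gamma> (\<lambda>i. avg \<delta> (s i) (\<lambda>u. Y u \<omega>)) * exp (- (real n * g (t + \<delta> + \<delta> * \<rho>, \<omega>)))))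
    \<in> borel_measurable (N \<Otimes>\<^sub>M lborel)"
    by measurable
  also have "(\<lambda>(\<omega>, \<rho>). indicator {0..1} \<rho> *\<^sub>R (\<gamma> (\<lambda>i. avg \<delta> (s i) (\<lambda>u. Y u \<omega>)) * exp (- (real n * g (t + \<delta> + \<delta> * \<rho>, \<omega>)))))
    = (\<lambda>(\<omega>, \<rho>). indicator {0..1} \<rho> *\<^sub>R (\<gamma> (\<lambda>i. avg \<delta> (s i) (\<lambda>u. Y u \<omega>)) * exp (- (real n * defect (\<lambda>u. Y u \<omega>) (t + \<delta> + \<delta> * \<rho>)))))"
  proof (rule ext, clarify)
    fix \<omega> and \<rho> :: real
    show "indicator {0..1} \<rho> *\<^sub>R (\<gamma> (\<lambda>i. avg \<delta> (s i) (\<lambda>u. Y u \<omega>)) * exp (- (real n * g (t + \<delta> + \<delta> * \<rho>, \<omega>))))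
      = indicator {0..1} \<rho> *\<^sub>R (\<gamma> (\<lambda>i. avg \<delta> (s i) (\<lambda>u. Y u \<omega>)) * exp (- (real n * defect (\<lambda>u. Y u \<omega>) (t + \<delta> + \<delta> * \<rho>))))"
    proof (cases "\<rho> \<in> {0..1}")
      case True
      then have "0 \<le> t + \<delta> + \<delta> * \<rho>" using t \<open>0 < \<delta>\<close> by auto
      then show ?thesis unfolding g_def by (simp only: prod.case max_absorb2)
    qed simp
  qed
  finally show ?thesis .
qed

lemma test_measurable:
  assumes meas: "\<And>t. 0 \<le> t \<Longrightarrow> Y t \<in> borel_measurable N"
    and rc: "\<And>\<omega>. \<omega> \<in> space N \<Longrightarrow> right_cont_path (\<lambda>t. Y t \<omega>)" and "0 < \<delta>"
  shows "(\<lambda>\<omega>. test \<gamma> s t n \<delta> (\<lambda>u. Y u \<omega>)) \<in> borel_measurable N"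
  unfolding test_def set_lebesgue_integral_def
  by (rule lborel.borel_measurable_lebesgue_integral[OF test_measurable_pair[OF assms]])

text \<open>Where the defect vanishes the exponential factor is 1. The bound at each single
  evaluation time is integrated over \<rho>, and the integrals are exchanged.\<close>

lemma nn_integral_test_ge:
  fixes Y :: "real \<Rightarrow> 'a \<Rightarrow> real"
  assumes M: "prob_space M"
    and meas: "\<And>t. 0 \<le> t \<Longrightarrow> Y t \<in> borel_measurable M"
    and rc: "\<And>\<omega>. \<omega> \<in> space M \<Longrightarrow> right_cont_path (\<lambda>t. Y t \<omega>)" and \<delta>: "0 < \<delta>"
    and ge: "\<And>r. t + \<delta> \<le> r \<Longrightarrow>
      c * (\<integral>\<^sup>+\<omega>. ennreal (\<gamma> (\<lambda>i. avg \<delta> (s i) (\<lambda>u. Y u \<omega>))) \<partial>M)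
        \<le> (\<integral>\<^sup>+\<omega>. ennreal (\<gamma> (\<lambda>i. avg \<delta> (s i) (\<lambda>u. Y u \<omega>))) * indicator {\<omega>\<in>space M. defect (\<lambda>u. Y u \<omega>) r = 0} \<omega> \<partial>M)"
  shows "c * (\<integral>\<^sup>+\<omega>. ennreal (\<gamma> (\<lambda>i. avg \<delta> (s i) (\<lambda>u. Y u \<omega>))) \<partial>M) \<le> (\<integral>\<^sup>+\<omega>. ennreal (test \<gamma> s t n \<delta> (\<lambda>u. Y u \<omega>)) \<partial>M)"
proof -
  interpret prob_space M by (rule M)
  interpret P: pair_sigma_finite M "lborel :: real measure" ..
  let ?g = "\<lambda>\<omega>. \<gamma> (\<lambda>i. avg \<delta> (s i) (\<lambda>u. Y u \<omega>))"
  let ?h = "\<lambda>\<omega> \<rho>. indicator {0..1} \<rho> *\<^sub>R (?g \<omega> * exp (- (real n * defect (\<lambda>u. Y u \<omega>) (t + \<delta> + \<delta> * \<rho>))))"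
  have hm: "(\<lambda>(\<omega>, \<rho>). ?h \<omega> \<rho>) \<in> borel_measurable (M \<Otimes>\<^sub>M lborel)"
    by (rule test_measurable_pair[OF meas rc \<delta>])
  have "c * (\<integral>\<^sup>+\<omega>. ennreal (?g \<omega>) \<partial>M) = (\<integral>\<^sup>+\<rho>. c * (\<integral>\<^sup>+\<omega>. ennreal (?g \<omega>) \<partial>M) * indicator {0..1::real} \<rho> \<partial>lborel)"
    by (subst nn_integral_cmult_indicator) auto
  also have "\<dots> \<le> (\<integral>\<^sup>+\<rho>. (\<integral>\<^sup>+\<omega>. ennreal (?h \<omega> \<rho>) \<partial>M) \<partial>lborel)"
  proof (rule nn_integral_mono)
    fix \<rho> :: real
    show "c * (\<integral>\<^sup>+\<omega>. ennreal (?g \<omega>) \<partial>M) * indicator {0..1::real} \<rho> \<le> (\<integral>\<^sup>+\<omega>. ennreal (?h \<omega> \<rho>) \<partial>M)"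
    proof (cases "\<rho> \<in> {0..1}")
      case True
      then have "t + \<delta> \<le> t + \<delta> + \<delta> * \<rho>" using \<delta> by simp
      then have "c * (\<integral>\<^sup>+\<omega>. ennreal (?g \<omega>) \<partial>M)
          \<le> (\<integral>\<^sup>+\<omega>. ennreal (?g \<omega>) * indicator {\<omega>\<in>space M. defect (\<lambda>u. Y u \<omega>) (t + \<delta> + \<delta> * \<rho>) = 0} \<omega> \<partial>M)"
        by (rule ge)
      also have "\<dots> \<le> (\<integral>\<^sup>+\<omega>. ennreal (?h \<omega> \<rho>) \<partial>M)"
        by (rule nn_integral_mono) (use True in \<open>auto simp: indicator_def\<close>)
      finally show ?thesis using True by simp
    qed simp
  qed
  also have "\<dots> = (\<integral>\<^sup>+\<omega>. (\<integral>\<^sup>+\<rho>. ennreal (?h \<omega> \<rho>) \<partial>lborel) \<partial>M)"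
    by (rule P.Fubini') (use hm in \<open>simp add: case_prod_unfold\<close>)
  also have "\<dots> = (\<integral>\<^sup>+\<omega>. ennreal (test \<gamma> s t n \<delta> (\<lambda>u. Y u \<omega>)) \<partial>M)"
  proof (rule nn_integral_cong)
    fix \<omega> assume \<omega>: "\<omega> \<in> space M"
    show "(\<integral>\<^sup>+\<rho>. ennreal (?h \<omega> \<rho>) \<partial>lborel) = ennreal (test \<gamma> s t n \<delta> (\<lambda>u. Y u \<omega>))"
      unfolding test_def set_lebesgue_integral_def
    proof (rule nn_integral_eq_integral)
      show "integrable lborel (?h \<omega>)"
      proof (rule Bochner_Integration.integrable_bound)
        show "integrable lborel (indicator {0..1} :: real \<Rightarrow> real)" by (rule integrable_real_indicator) auto
        show "?h \<omega> \<in> borel_measurable lborel" using test_integrand_measurable[OF rc[OF \<omega>] \<delta>] by simp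
        show "AE \<rho> in lborel. norm (?h \<omega> \<rho>) \<le> norm (indicator {0..1} \<rho> :: real)"
          using test_integrand_bounds by (intro AE_I2) (auto simp: indicator_def)
      qed
    qed (use test_integrand_bounds in \<open>auto simp: indicator_def intro!: AE_I2\<close>)
  qed
  finally show ?thesis .
qed

end

end

section \<open>The history of a process, generated by countably many times\<close>

definition rat_times :: "real \<Rightarrow> nat \<Rightarrow> real" where
  "rat_times t = from_nat_into ({q \<in> nonneg_rats. q < t} \<union> {t})"

lemma range_rat_times: "range (rat_times t) = {q \<in> nonneg_rats. q < t} \<union> {t}"
  unfolding rat_times_def
  by (rule range_from_nat_into) (auto intro: countable_subset[OF _ countable_nonneg_rats])

lemma rat_times_bounds:
  assumes "0 \<le> t" shows "0 \<le> rat_times t i" "rat_times t i \<le> t"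
proof -
  have "rat_times t i \<in> {q \<in> nonneg_rats. q < t} \<union> {t}" using range_rat_times by blast
  then show "0 \<le> rat_times t i" "rat_times t i \<le> t" using assms nonneg_rats_ge_0 by auto
qed

text \<open>The events generated by the process up to time \<open>t\<close>. By right-continuity countably many times suffice; the
  values are compactified by \<open>arctan\<close> to match the bounded test functionals.\<close>

definition hist :: "'a measure \<Rightarrow> (real \<Rightarrow> 'a \<Rightarrow> real) \<Rightarrow> real \<Rightarrow> 'a measure" where
  "hist N X t = vimage_algebra (space N) (\<lambda>\<omega> i. arctan (X (rat_times t i) \<omega>)) (borel :: (nat \<Rightarrow> real) measure)"

lemma space_hist [simp]: "space (hist N X t) = space N"
  by (simp add: hist_def)

lemma hist_events:
  assumes "C \<in> sets (hist N X t)"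
  obtains A where "A \<in> sets (borel :: (nat \<Rightarrow> real) measure)"
    "C = {\<omega>\<in>space N. (\<lambda>i. arctan (X (rat_times t i) \<omega>)) \<in> A}"
  using assms unfolding hist_def by (subst (asm) sets_vimage_algebra2) auto

lemma hist_coord_measurable: "(\<lambda>\<omega>. arctan (X (rat_times t i) \<omega>)) \<in> borel_measurable (hist N X t)"
proof -
  have "(\<lambda>\<omega> i. arctan (X (rat_times t i) \<omega>)) \<in> measurable (hist N X t) (borel :: (nat \<Rightarrow> real) measure)"
    unfolding hist_def by (rule measurable_vimage_algebra1) auto
  then show ?thesis by (rule measurable_product_then_coordinatewise)
qed

text \<open>The arctangent is undone by \<open>tan\<close>; a time outside the countable set is
  reached from the right by rational times that stay below \<open>t\<close>.\<close>

lemma measurable_hist: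
  assumes rc: "\<And>\<omega>. \<omega> \<in> space N \<Longrightarrow> right_cont_path (\<lambda>t. X t \<omega>)" and u: "0 \<le> u" "u \<le> t"
  shows "X u \<in> borel_measurable (hist N X t)"
proof -
  have coord: "X q \<in> borel_measurable (hist N X t)" if q_range: "q \<in> range (rat_times t)" for q
  proof -
    obtain i where q: "q = rat_times t i" using q_range by (rule rangeE)
    have "(\<lambda>\<omega>. tan (arctan (X q \<omega>))) \<in> borel_measurable (hist N X t)"
    proof (rule measurable_compose[OF hist_coord_measurable[of X t i N, folded q]])
      show "tan \<in> borel_measurable (borel :: real measure)"
        unfolding tan_def by measurable
    qed
    then show ?thesis by (simp add: arctan)
  qed
  show ?thesis
  proof (cases "u = t")
    case True
    then show ?thesis using coord[of t] unfolding range_rat_times by simp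
  next
    case False
    then have ut: "u < t" using u by simp
    have "\<exists>q\<in>nonneg_rats. u < q \<and> q < min t (u + inverse (real (Suc n)))" for n
    proof -
      obtain q where "q \<in> \<rat>" "u < q" "q < min t (u + inverse (real (Suc n)))"
        using Rats_dense_in_real[of u "min t (u + inverse (real (Suc n)))"] ut by auto
      then show ?thesis using u by (auto simp: nonneg_rats_def)
    qed
    then obtain q where q: "\<And>n. q n \<in> nonneg_rats" "\<And>n. u < q n" "\<And>n. q n < t"
      "\<And>n. q n < u + inverse (real (Suc n))" by (metis min_less_iff_conj)
    have qlim: "q \<longlonglongrightarrow> u"
    proof (rule tendsto_sandwich[OF _ _ tendsto_const])
      show "(\<lambda>n. u + inverse (real (Suc n))) \<longlonglongrightarrow> u"
        using tendsto_add[OF tendsto_const[of u] LIMSEQ_inverse_real_of_nat] by simp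
    qed (use q in \<open>auto simp: less_imp_le intro!: always_eventually\<close>)
    show ?thesis
    proof (rule borel_measurable_LIMSEQ_real)
      show "(\<lambda>n. X (q n) \<omega>) \<longlonglongrightarrow> X u \<omega>" if "\<omega> \<in> space (hist N X t)" for \<omega>
        by (rule right_cont_path_sequentially[OF rc u(1) q(2) qlim]) (use that in simp)
      show "X (q n) \<in> borel_measurable (hist N X t)" for n
        by (rule coord) (use q in \<open>auto simp: range_rat_times\<close>)
    qed
  qed
qed

lemma hist_mono:
  assumes rc: "\<And>\<omega>. \<omega> \<in> space N \<Longrightarrow> right_cont_path (\<lambda>t. X t \<omega>)" and u: "0 \<le> u" "u \<le> t"
  shows "sets (hist N X u) \<subseteq> sets (hist N X t)"
proof
  fix C assume "C \<in> sets (hist N X u)"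
  then obtain A where A: "A \<in> sets (borel :: (nat \<Rightarrow> real) measure)"
    "C = {\<omega>\<in>space N. (\<lambda>i. arctan (X (rat_times u i) \<omega>)) \<in> A}" by (rule hist_events)
  have "(\<lambda>\<omega> i. arctan (X (rat_times u i) \<omega>)) \<in> measurable (hist N X t) borel"
  proof (rule measurable_coordinatewise_then_product)
    fix i
    have "X (rat_times u i) \<in> borel_measurable (hist N X t)"
      using rat_times_bounds[OF u(1), of i] u by (intro measurable_hist rc) auto
    then show "(\<lambda>\<omega>. arctan (X (rat_times u i) \<omega>)) \<in> borel_measurable (hist N X t)" by measurable
  qed
  from Collect_in_sets[OF this A(1)] show "C \<in> sets (hist N X t)" using A(2) by simp
qed

lemma subalgebra_hist:
  assumes meas: "\<And>t. 0 \<le> t \<Longrightarrow> X t \<in> borel_measurable N" and t: "0 \<le> t"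
  shows "subalgebra N (hist N X t)"
  unfolding subalgebra_def
proof (intro conjI subsetI)
  fix C assume "C \<in> sets (hist N X t)"
  then obtain A where A: "A \<in> sets (borel :: (nat \<Rightarrow> real) measure)"
    "C = {\<omega>\<in>space N. (\<lambda>i. arctan (X (rat_times t i) \<omega>)) \<in> A}" by (rule hist_events)
  have "(\<lambda>\<omega> i. arctan (X (rat_times t i) \<omega>)) \<in> measurable N borel"
  proof (rule measurable_coordinatewise_then_product)
    fix i
    have "X (rat_times t i) \<in> borel_measurable N" using rat_times_bounds[OF t, of i] by (intro meas)
    then show "(\<lambda>\<omega>. arctan (X (rat_times t i) \<omega>)) \<in> borel_measurable N" by measurable
  qed
  from Collect_in_sets[OF this A(1)] show "C \<in> sets N" using A(2) by simp
qed simp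

text \<open>Truncated multiples of the distance to the complement do this. The whole space is
  treated apart because the distance to the empty set is 0 by convention.\<close>

lemma open_indicator_limit:
  fixes U :: "'a::metric_space set"
  assumes "open U"
  obtains \<gamma> :: "nat \<Rightarrow> 'a \<Rightarrow> real" where "\<And>k. continuous_on UNIV (\<gamma> k)" "\<And>k z. 0 \<le> \<gamma> k z" "\<And>k z. \<gamma> k z \<le> 1"
    "\<And>z. (\<lambda>k. \<gamma> k z) \<longlonglongrightarrow> indicator U z"
proof (cases "U = UNIV")
  case True
  then show ?thesis by (intro that[of "\<lambda>_ _. 1"]) auto
next
  case False
  define \<gamma> where "\<gamma> k z = min 1 (real k * infdist z (- U))" for k :: nat and z
  show ?thesis
  proof (rule that[of \<gamma>])
    show "continuous_on UNIV (\<gamma> k)" for k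
      unfolding \<gamma>_def by (intro continuous_intros)
    show "0 \<le> \<gamma> k z" "\<gamma> k z \<le> 1" for k z by (auto simp: \<gamma>_def infdist_nonneg)
    fix z
    have cl: "closed (- U)" "- U \<noteq> {}" using assms False by auto
    show "(\<lambda>k. \<gamma> k z) \<longlonglongrightarrow> indicator U z"
    proof (cases "z \<in> U")
      case True
      then have "infdist z (- U) \<noteq> 0" using in_closed_iff_infdist_zero[OF cl, of z] by simp
      then have pos: "0 < infdist z (- U)" using infdist_nonneg[of z "- U"] by linarith
      obtain m :: nat where m: "1 / infdist z (- U) \<le> real m" using real_arch_simple by blast
      have "\<gamma> k z = 1" if "m \<le> k" for k
      proof -
        have "1 / infdist z (- U) \<le> real k" using m that by (meson of_nat_mono order_trans)
        then have "1 \<le> real k * infdist z (- U)" using pos by (simp add: field_simps)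
        then show ?thesis by (simp add: \<gamma>_def)
      qed
      then have "eventually (\<lambda>k. \<gamma> k z = indicator U z) sequentially"
        using True by (auto simp: eventually_sequentially)
      then show ?thesis by (rule tendsto_eventually)
    next
      case False
      then have "infdist z (- U) = 0" using in_closed_iff_infdist_zero[OF cl, of z] by simp
      then show ?thesis using False by (simp add: \<gamma>_def)
    qed
  qed
qed

text \<open>The transfer principle: a lower bound for the conditional probability of \<open>{defect = 0}\<close> given the past
  survives the weak limit. In the limit a fixed time may be a time of discontinuity, hence the averages.\<close>

lemma defect_transfer:
  fixes Y :: "real \<Rightarrow> real \<Rightarrow> 'a \<Rightarrow> real" and X :: "real \<Rightarrow> 'b \<Rightarrow> real" and \<alpha> \<beta> a L c :: real
  assumes M: "prob_space M" and N: "prob_space N"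
    and Ym: "\<And>x t. 0 < x \<Longrightarrow> 0 \<le> t \<Longrightarrow> Y x t \<in> borel_measurable M"
    and Yrc: "\<And>x \<omega>. 0 < x \<Longrightarrow> \<omega> \<in> space M \<Longrightarrow> right_cont_path (\<lambda>t. Y x t \<omega>)"
    and Xm: "\<And>t. 0 \<le> t \<Longrightarrow> X t \<in> borel_measurable N"
    and Xc: "\<And>\<omega>. \<omega> \<in> space N \<Longrightarrow> cadlag (\<lambda>t. X t \<omega>)"
    and weak: "skorokhod_weak_limit M Y (at_right 0) N X"
    and c: "0 \<le> c"
    and ge: "\<And>x r (F :: (real \<Rightarrow> real) \<Rightarrow> ennreal). 0 < x \<Longrightarrow> 0 < r \<Longrightarrow>
        (\<And>w w'. (\<And>u. 0 \<le> u \<Longrightarrow> u \<le> r \<Longrightarrow> w u = w' u) \<Longrightarrow> F w = F w') \<Longrightarrow> (\<And>w. F w \<le> 1) \<Longrightarrow>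
        (\<And>(N :: 'a measure) Y. (\<And>u. 0 \<le> u \<Longrightarrow> Y u \<in> borel_measurable N) \<Longrightarrow>
          (\<And>\<omega>. \<omega> \<in> space N \<Longrightarrow> right_cont_path (\<lambda>u. Y u \<omega>)) \<Longrightarrow> (\<lambda>\<omega>. F (\<lambda>u. Y u \<omega>)) \<in> borel_measurable N) \<Longrightarrow>
        ennreal c * (\<integral>\<^sup>+\<omega>. F (\<lambda>u. Y x u \<omega>) \<partial>M)
          \<le> (\<integral>\<^sup>+\<omega>. F (\<lambda>u. Y x u \<omega>) * indicator {\<omega>\<in>space M. defect \<alpha> \<beta> a L (\<lambda>u. Y x u \<omega>) r = 0} \<omega> \<partial>M)"
    and t: "0 < t" and C: "C \<in> sets (hist N X t)"
  shows "c * measure N C \<le> measure N (C \<inter> {\<omega>\<in>space N. defect \<alpha> \<beta> a L (\<lambda>u. X u \<omega>) t = 0})"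
proof -
  interpret M: prob_space M by (rule M)
  interpret N: prob_space N by (rule N)
  have Xrc: "right_cont_path (\<lambda>t. X t \<omega>)" if "\<omega> \<in> space N" for \<omega>
    by (rule cadlag_imp_right_cont_path[OF Xc[OF that]])
  define s where "s = rat_times t"
  have s: "0 \<le> s i" "s i \<le> t" for i using rat_times_bounds[of t i] t by (auto simp: s_def)
  define z where "z \<omega> = (\<lambda>i. arctan (X (s i) \<omega>))" for \<omega>
  define D where "D \<omega> = defect \<alpha> \<beta> a L (\<lambda>u. X u \<omega>) t" for \<omega>
  have Dm [measurable]: "D \<in> borel_measurable N"
    unfolding D_def[abs_def] by (rule defect_measurable[OF Xm Xrc]) (use t in auto)
  have zm [measurable]: "z \<in> borel_measurable N"
    unfolding z_def[abs_def]
  proof (rule measurable_coordinatewise_then_product)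
    have [measurable]: "X (s i) \<in> borel_measurable N" for i by (rule Xm) (rule s)
    show "(\<lambda>\<omega>. arctan (X (s i) \<omega>)) \<in> borel_measurable N" for i by measurable
  qed
  have cont: "c * (\<integral>\<omega>. \<gamma> (z \<omega>) \<partial>N) \<le> (\<integral>\<omega>. \<gamma> (z \<omega>) * indicat_real {0} (D \<omega>) \<partial>N)"
    if \<gamma>: "continuous_on UNIV \<gamma>" "\<And>z. 0 \<le> \<gamma> z" "\<And>z. \<gamma> z \<le> 1" for \<gamma> :: "(nat \<Rightarrow> real) \<Rightarrow> real"
  proof -
    have [measurable]: "\<gamma> \<in> borel_measurable borel" by (rule borel_measurable_continuous_onI[OF \<gamma>(1)])
    note test_meas = test_measurable[where \<gamma>=\<gamma> and s=s and t=t, OF \<gamma> s t, where \<alpha>=\<alpha> and \<beta>=\<beta> and a=a and L=L]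
    note test_bd = test_bounds[where \<gamma>=\<gamma> and s=s and t=t, OF \<gamma> s t, where \<alpha>=\<alpha> and \<beta>=\<beta> and a=a and L=L]
    let ?T = "test \<alpha> \<beta> a L \<gamma> s t"
    have T0: "?T 0 \<delta> w = \<gamma> (\<lambda>i. avg \<delta> (s i) w)" for \<delta> w
      by (simp add: test_def set_lebesgue_integral_def)
    have lim: "((\<lambda>x. \<integral>\<omega>. ?T n \<delta> (\<lambda>u. Y x u \<omega>) \<partial>completion M) \<longlongrightarrow> (\<integral>\<omega>. ?T n \<delta> (\<lambda>u. X u \<omega>) \<partial>completion N)) (at_right 0)"
      if "0 < \<delta>" for n \<delta>
    proof -
      have "bounded (range (?T n \<delta>))"
        unfolding bounded_iff using test_bd by (intro exI[of _ 1]) auto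
      then show ?thesis
        using weak test_skorokhod_continuous[where \<gamma>=\<gamma> and s=s and t=t, OF \<gamma> s t that] unfolding skorokhod_weak_limit_def by blast
    qed
    have intX: "integrable N (\<lambda>\<omega>. ?T n \<delta> (\<lambda>u. X u \<omega>))" if "0 < \<delta>" for n \<delta>
      by (rule N.integrable_const_bound[where B=1])
        (use test_bd test_meas[OF Xm Xrc that] in \<open>auto intro!: AE_I2\<close>)
    \<comment> \<open>For index 0 the functional is its past factor alone, so the inequality
      compares two test functionals. It holds for every starting point \<open>x > 0\<close> and
      passes to the weak limit.\<close>
    have step1: "c * (\<integral>\<omega>. ?T 0 \<delta> (\<lambda>u. X u \<omega>) \<partial>N) \<le> (\<integral>\<omega>. ?T n \<delta> (\<lambda>u. X u \<omega>) \<partial>N)" if \<delta>: "0 < \<delta>" for n \<delta>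
    proof -
      have "c * (\<integral>\<omega>. ?T 0 \<delta> (\<lambda>u. Y x u \<omega>) \<partial>completion M) \<le> (\<integral>\<omega>. ?T n \<delta> (\<lambda>u. Y x u \<omega>) \<partial>completion M)"
        if x: "0 < x" for x
      proof -
        have m: "(\<lambda>\<omega>. ?T k \<delta> (\<lambda>u. Y x u \<omega>)) \<in> borel_measurable M" for k
          by (rule test_meas[OF Ym[OF x] Yrc[OF x] \<delta>])
        have int: "integrable M (\<lambda>\<omega>. ?T k \<delta> (\<lambda>u. Y x u \<omega>))" for k
          by (rule M.integrable_const_bound[where B=1]) (use test_bd m in \<open>auto intro!: AE_I2\<close>)
        have nn: "(\<integral>\<^sup>+\<omega>. ennreal (?T k \<delta> (\<lambda>u. Y x u \<omega>)) \<partial>M) = ennreal (\<integral>\<omega>. ?T k \<delta> (\<lambda>u. Y x u \<omega>) \<partial>M)" for k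
          by (rule nn_integral_eq_integral[OF int]) (use test_bd in auto)
        have "ennreal c * (\<integral>\<^sup>+\<omega>. ennreal (\<gamma> (\<lambda>i. avg \<delta> (s i) (\<lambda>u. Y x u \<omega>))) \<partial>M)
            \<le> (\<integral>\<^sup>+\<omega>. ennreal (?T n \<delta> (\<lambda>u. Y x u \<omega>)) \<partial>M)"
        proof (rule nn_integral_test_ge[where \<gamma>=\<gamma> and s=s and t=t, OF \<gamma> s t M Ym[OF x] Yrc[OF x] \<delta>])
          fix r assume r: "t + \<delta> \<le> r"
          show "ennreal c * (\<integral>\<^sup>+\<omega>. ennreal (\<gamma> (\<lambda>i. avg \<delta> (s i) (\<lambda>u. Y x u \<omega>))) \<partial>M)
            \<le> (\<integral>\<^sup>+\<omega>. ennreal (\<gamma> (\<lambda>i. avg \<delta> (s i) (\<lambda>u. Y x u \<omega>))) *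
                indicator {\<omega>\<in>space M. defect \<alpha> \<beta> a L (\<lambda>u. Y x u \<omega>) r = 0} \<omega> \<partial>M)"
          proof (rule ge[OF x, where F="\<lambda>w. ennreal (\<gamma> (\<lambda>i. avg \<delta> (s i) w))"])
            show "0 < r" using r t \<delta> by linarith
            fix w w' :: "real \<Rightarrow> real" assume eq: "\<And>u. 0 \<le> u \<Longrightarrow> u \<le> r \<Longrightarrow> w u = w' u"
            have "avg \<delta> (s i) w = avg \<delta> (s i) w'" for i
              unfolding avg_def
            proof (rule set_lebesgue_integral_cong, simp, intro allI impI)
              fix \<rho> :: real assume \<rho>: "\<rho> \<in> {0..1}"
              have "0 \<le> \<delta> * \<rho>" "\<delta> * \<rho> \<le> \<delta>" using \<rho> \<delta> by (auto simp: mult_le_cancel_left1)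
              then have "0 \<le> s i + \<delta> * \<rho>" "s i + \<delta> * \<rho> \<le> r" using s[of i] r by linarith+
              then show "arctan (w (s i + \<delta> * \<rho>)) = arctan (w' (s i + \<delta> * \<rho>))" using eq by simp
            qed
            then show "ennreal (\<gamma> (\<lambda>i. avg \<delta> (s i) w)) = ennreal (\<gamma> (\<lambda>i. avg \<delta> (s i) w'))" by simp
          next
            fix N' :: "'a measure" and Z :: "real \<Rightarrow> 'a \<Rightarrow> real"
            assume Z: "\<And>u. 0 \<le> u \<Longrightarrow> Z u \<in> borel_measurable N'" "\<And>\<omega>. \<omega> \<in> space N' \<Longrightarrow> right_cont_path (\<lambda>u. Z u \<omega>)"
            have [measurable]: "(\<lambda>\<omega>. (\<lambda>i. avg \<delta> (s i) (\<lambda>u. Z u \<omega>))) \<in> borel_measurable N'"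
              by (rule measurable_coordinatewise_then_product, rule avg_measurable[OF Z s(1) less_imp_le[OF \<delta>]])
            show "(\<lambda>\<omega>. ennreal (\<gamma> (\<lambda>i. avg \<delta> (s i) (\<lambda>u. Z u \<omega>)))) \<in> borel_measurable N'" by measurable
          qed (use \<gamma> in auto)
        qed
        then have "ennreal c * ennreal (\<integral>\<omega>. ?T 0 \<delta> (\<lambda>u. Y x u \<omega>) \<partial>M) \<le> ennreal (\<integral>\<omega>. ?T n \<delta> (\<lambda>u. Y x u \<omega>) \<partial>M)"
          unfolding T0[symmetric] nn .
        moreover have "0 \<le> (\<integral>\<omega>. ?T n \<delta> (\<lambda>u. Y x u \<omega>) \<partial>M)" by (rule integral_nonneg_AE) (use test_bd in auto)
        ultimately have "c * (\<integral>\<omega>. ?T 0 \<delta> (\<lambda>u. Y x u \<omega>) \<partial>M) \<le> (\<integral>\<omega>. ?T n \<delta> (\<lambda>u. Y x u \<omega>) \<partial>M)"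
          using c by (simp add: ennreal_mult'[symmetric])
        then show ?thesis unfolding integral_completion[OF m] .
      qed
      then have "eventually (\<lambda>x. c * (\<integral>\<omega>. ?T 0 \<delta> (\<lambda>u. Y x u \<omega>) \<partial>completion M) \<le> (\<integral>\<omega>. ?T n \<delta> (\<lambda>u. Y x u \<omega>) \<partial>completion M)) (at_right 0)"
        by (auto simp: eventually_at_right_field intro: exI[of _ 1])
      then have "c * (\<integral>\<omega>. ?T 0 \<delta> (\<lambda>u. X u \<omega>) \<partial>completion N) \<le> (\<integral>\<omega>. ?T n \<delta> (\<lambda>u. X u \<omega>) \<partial>completion N)"
        by (rule tendsto_le[OF _ lim[OF \<delta>] tendsto_mult[OF tendsto_const lim[OF \<delta>]], rotated]) simp
      moreover have "(\<lambda>\<omega>. ?T k \<delta> (\<lambda>u. X u \<omega>)) \<in> borel_measurable N" for k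
        by (rule test_meas[OF Xm Xrc \<delta>])
      ultimately show ?thesis by (simp only: integral_completion)
    qed
    define d where "d k = inverse (real (Suc k))" for k
    have d: "0 < d k" "d \<longlonglongrightarrow> 0" for k using LIMSEQ_inverse_real_of_nat by (auto simp: d_def[abs_def])
    have lim0: "(\<lambda>k. \<integral>\<omega>. ?T n (d k) (\<lambda>u. X u \<omega>) \<partial>N) \<longlonglongrightarrow> (\<integral>\<omega>. \<gamma> (z \<omega>) * exp (- (real n * D \<omega>)) \<partial>N)" for n
    proof (rule integral_dominated_convergence[where w="\<lambda>_. 1"])
      show "AE \<omega> in N. (\<lambda>k. ?T n (d k) (\<lambda>u. X u \<omega>)) \<longlonglongrightarrow> \<gamma> (z \<omega>) * exp (- (real n * D \<omega>))"
        unfolding z_def D_def by (intro AE_I2 test_tendsto_0[where \<gamma>=\<gamma> and s=s and t=t, OF \<gamma> s t Xc d])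
    qed (use test_bd test_meas[OF Xm Xrc d(1)] in auto)
    \<comment> \<open>Now \<delta> tends to 0 for fixed \<open>n\<close>: the averages become values
      at the times \<open>s i\<close>, and the defect is taken at \<open>t\<close> itself.\<close>
    have step2: "c * (\<integral>\<omega>. \<gamma> (z \<omega>) \<partial>N) \<le> (\<integral>\<omega>. \<gamma> (z \<omega>) * exp (- (real n * D \<omega>)) \<partial>N)" for n
    proof (rule LIMSEQ_le)
      show "(\<lambda>k. c * (\<integral>\<omega>. ?T 0 (d k) (\<lambda>u. X u \<omega>) \<partial>N)) \<longlonglongrightarrow> c * (\<integral>\<omega>. \<gamma> (z \<omega>) \<partial>N)"
        using tendsto_mult[OF tendsto_const lim0[of 0]] by simp
      show "(\<lambda>k. \<integral>\<omega>. ?T n (d k) (\<lambda>u. X u \<omega>) \<partial>N) \<longlonglongrightarrow> (\<integral>\<omega>. \<gamma> (z \<omega>) * exp (- (real n * D \<omega>)) \<partial>N)"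
        by (rule lim0)
    qed (use step1[OF d(1)] in auto)
    show ?thesis
    proof (rule LIMSEQ_le_const)
      \<comment> \<open>The defect is nonnegative, so the powers of
        \<open>exp (- D \<omega>)\<close> converge to the indicator of
        \<open>D \<omega> = 0\<close>.\<close>
      show "(\<lambda>n. \<integral>\<omega>. \<gamma> (z \<omega>) * exp (- (real n * D \<omega>)) \<partial>N) \<longlonglongrightarrow> (\<integral>\<omega>. \<gamma> (z \<omega>) * indicat_real {0} (D \<omega>) \<partial>N)"
      proof (rule integral_dominated_convergence[where w="\<lambda>_. 1"])
        show "AE \<omega> in N. (\<lambda>n. \<gamma> (z \<omega>) * exp (- (real n * D \<omega>))) \<longlonglongrightarrow> \<gamma> (z \<omega>) * indicat_real {0} (D \<omega>)"
        proof (intro AE_I2 tendsto_mult tendsto_const)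
          fix \<omega>
          show "(\<lambda>n. exp (- (real n * D \<omega>))) \<longlonglongrightarrow> indicat_real {0} (D \<omega>)"
          proof (cases "D \<omega> = 0")
            case False
            then have "0 < D \<omega>" using defect_nonneg[of \<alpha> \<beta> a L "\<lambda>u. X u \<omega>" t] by (simp add: D_def)
            then have "exp (- D \<omega>) < 1" by simp
            then have "(\<lambda>n. exp (- D \<omega>) ^ n) \<longlonglongrightarrow> 0" by (intro LIMSEQ_power_zero) auto
            then show ?thesis using False by (simp add: exp_of_nat_mult[symmetric] mult.commute)
          qed simp
        qed
        show "AE \<omega> in N. norm (\<gamma> (z \<omega>) * exp (- (real n * D \<omega>))) \<le> 1" for n
          unfolding D_def using test_integrand_bounds[where \<gamma>=\<gamma> and s=s and t=t, OF \<gamma> s t] by (intro AE_I2) simp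
      qed auto
    qed (use step2 in auto)
  qed
  define E where "E = {\<omega>\<in>space N. D \<omega> = 0}"
  have Em [measurable]: "E \<in> sets N" unfolding E_def by measurable
  have zA [measurable]: "{\<omega>\<in>space N. z \<omega> \<in> A} \<in> sets N" if "A \<in> sets borel" for A
    by (rule Collect_in_sets[OF zm that])
  have step4: "c * measure N {\<omega>\<in>space N. z \<omega> \<in> U} \<le> measure N ({\<omega>\<in>space N. z \<omega> \<in> U} \<inter> E)" if U: "open U" for U
  proof -
    obtain \<gamma> :: "nat \<Rightarrow> (nat \<Rightarrow> real) \<Rightarrow> real" where \<gamma>: "\<And>k. continuous_on UNIV (\<gamma> k)" "\<And>k z. 0 \<le> \<gamma> k z" "\<And>k z. \<gamma> k z \<le> 1"
      "\<And>z. (\<lambda>k. \<gamma> k z) \<longlonglongrightarrow> indicator U z" using open_indicator_limit[OF U] by blast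
    have [measurable]: "\<gamma> k \<in> borel_measurable borel" for k by (rule borel_measurable_continuous_onI[OF \<gamma>(1)])
    have [measurable]: "U \<in> sets borel" using U by simp
    have l1: "(\<lambda>k. \<integral>\<omega>. \<gamma> k (z \<omega>) \<partial>N) \<longlonglongrightarrow> (\<integral>\<omega>. indicat_real U (z \<omega>) \<partial>N)"
      by (rule integral_dominated_convergence[where w="\<lambda>_. 1"]) (use \<gamma> in auto)
    have l2: "(\<lambda>k. \<integral>\<omega>. \<gamma> k (z \<omega>) * indicat_real {0} (D \<omega>) \<partial>N) \<longlonglongrightarrow> (\<integral>\<omega>. indicat_real U (z \<omega>) * indicat_real {0} (D \<omega>) \<partial>N)"
      by (rule integral_dominated_convergence[where w="\<lambda>_. 1"]) (use \<gamma> in \<open>auto intro!: tendsto_mult simp: indicator_def\<close>)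
    have "c * (\<integral>\<omega>. indicat_real U (z \<omega>) \<partial>N) \<le> (\<integral>\<omega>. indicat_real U (z \<omega>) * indicat_real {0} (D \<omega>) \<partial>N)"
      by (rule LIMSEQ_le[OF tendsto_mult[OF tendsto_const l1] l2]) (use cont[OF \<gamma>(1-3)] in auto)
    also have "(\<integral>\<omega>. indicat_real U (z \<omega>) \<partial>N) = (\<integral>\<omega>. indicat_real {\<omega>\<in>space N. z \<omega> \<in> U} \<omega> \<partial>N)"
      by (rule Bochner_Integration.integral_cong) (auto simp: indicator_def)
    also have "\<dots> = measure N {\<omega>\<in>space N. z \<omega> \<in> U}" by simp
    also have "(\<integral>\<omega>. indicat_real U (z \<omega>) * indicat_real {0} (D \<omega>) \<partial>N) = (\<integral>\<omega>. indicat_real ({\<omega>\<in>space N. z \<omega> \<in> U} \<inter> E) \<omega> \<partial>N)"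
      by (rule Bochner_Integration.integral_cong) (auto simp: indicator_def E_def)
    also have "\<dots> = measure N ({\<omega>\<in>space N. z \<omega> \<in> U} \<inter> E)" by simp
    finally show ?thesis .
  qed
  obtain A where A: "A \<in> sets (borel :: (nat \<Rightarrow> real) measure)" "C = {\<omega>\<in>space N. z \<omega> \<in> A}"
    using hist_events[OF C] unfolding z_def s_def by blast
  \<comment> \<open>The right-hand side as a finite measure on sequence space. Outer regularity of
    \<open>Q\<close> extends the inequality from open sets to the Borel set \<open>A\<close>, since
    enlarging \<open>A\<close> to an open set can only increase the left-hand side.\<close>
  define Q where "Q = distr (density N (indicator E)) borel z"
  have Q: "emeasure Q B = ennreal (measure N ({\<omega>\<in>space N. z \<omega> \<in> B} \<inter> E))" if B: "B \<in> sets borel" for B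
  proof -
    have "emeasure Q B = emeasure (density N (indicator E)) (z -` B \<inter> space N)"
      unfolding Q_def by (subst emeasure_distr) (use B in auto)
    also have "\<dots> = (\<integral>\<^sup>+\<omega>. indicator E \<omega> * indicator (z -` B \<inter> space N) \<omega> \<partial>N)"
      by (rule emeasure_density) (use B in auto)
    also have "\<dots> = (\<integral>\<^sup>+\<omega>. indicator ({\<omega>\<in>space N. z \<omega> \<in> B} \<inter> E) \<omega> \<partial>N)"
      by (rule nn_integral_cong) (auto simp: indicator_def)
    also have "\<dots> = emeasure N ({\<omega>\<in>space N. z \<omega> \<in> B} \<inter> E)"
      by (rule nn_integral_indicator) (use B in measurable)
    finally show ?thesis by (simp add: N.emeasure_eq_measure)
  qed
  have "ennreal (c * measure N C) \<le> emeasure Q A"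
  proof (subst outer_regular[of Q])
    show "sets Q = sets borel" by (simp add: Q_def)
    show "emeasure Q (space Q) \<noteq> \<infinity>" using Q[of UNIV] by (simp add: Q_def)
    show "ennreal (c * measure N C) \<le> (INF U\<in>{U. A \<subseteq> U \<and> open U}. emeasure Q U)"
    proof (rule INF_greatest)
      fix U assume U: "U \<in> {U. A \<subseteq> U \<and> open U}"
      then have Ub: "U \<in> sets borel" by simp
      have "c * measure N C \<le> c * measure N {\<omega>\<in>space N. z \<omega> \<in> U}"
        unfolding A(2) using U c zA[OF Ub] by (intro mult_left_mono N.finite_measure_mono) auto
      also have "\<dots> \<le> measure N ({\<omega>\<in>space N. z \<omega> \<in> U} \<inter> E)" using step4 U by simp
      finally show "ennreal (c * measure N C) \<le> emeasure Q U" unfolding Q[OF Ub] by (rule ennreal_leI)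
    qed
  qed (rule A(1))
  then have "c * measure N C \<le> measure N (C \<inter> E)"
    unfolding Q[OF A(1)] A(2)[symmetric] by (simp add: ennreal_le_iff)
  then show ?thesis by (simp add: E_def D_def)
qed

section \<open>Infinitely many good times\<close>

text \<open>Any function has such a set, because the product of the lower limit topology and the usual topology is
  hereditarily separable on every graph.\<close>

lemma countable_right_dense_graph:
  fixes \<Lambda> :: "real \<Rightarrow> real"
  obtains D where "countable D" "D \<subseteq> {0<..}"
    "\<And>t e. 0 < t \<Longrightarrow> 0 < e \<Longrightarrow> \<exists>d\<in>D. t \<le> d \<and> d < t + e \<and> \<bar>\<Lambda> d - \<Lambda> t\<bar> < e"
proof -
  define T where "T \<alpha> \<beta> = {t. 0 < t \<and> \<alpha> < \<Lambda> t \<and> \<Lambda> t < \<beta>}" for \<alpha> \<beta>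
  \<comment> \<open>Points of a level band with no further point of the band immediately to their
    right; they are countable and all enter the set. Any other point of the band has points of the
    band in rational intervals arbitrarily close on its right, and \<open>ch\<close> selects one
    from each interval.\<close>
  define R where "R \<alpha> \<beta> = {t \<in> T \<alpha> \<beta>. \<exists>u>t. {t<..<u} \<inter> T \<alpha> \<beta> = {}}" for \<alpha> \<beta>
  have cR: "countable (R \<alpha> \<beta>)" for \<alpha> \<beta>
  proof -
    have "\<exists>q\<in>\<rat>. t < q \<and> {t<..<q} \<inter> T \<alpha> \<beta> = {}" if t: "t \<in> R \<alpha> \<beta>" for t
    proof -
      obtain u where u: "t < u" "{t<..<u} \<inter> T \<alpha> \<beta> = {}" using t by (auto simp: R_def)
      obtain q where "q \<in> \<rat>" "t < q" "q < u" using Rats_dense_in_real[OF u(1)] by blast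
      moreover from this have "{t<..<q} \<subseteq> {t<..<u}" by auto
      ultimately show ?thesis using u(2) by blast
    qed
    then obtain q where q: "\<And>t. t \<in> R \<alpha> \<beta> \<Longrightarrow> q t \<in> \<rat>" "\<And>t. t \<in> R \<alpha> \<beta> \<Longrightarrow> t < q t"
      "\<And>t. t \<in> R \<alpha> \<beta> \<Longrightarrow> {t<..<q t} \<inter> T \<alpha> \<beta> = {}" by metis
    have "inj_on q (R \<alpha> \<beta>)"
    proof (rule linorder_inj_onI')
      fix s t assume st: "s \<in> R \<alpha> \<beta>" "t \<in> R \<alpha> \<beta>" "s < t"
      then have "t \<in> T \<alpha> \<beta>" by (auto simp: R_def)
      then have "\<not> t < q s" using q(3)[OF st(1)] st(3) by auto
      then show "q s \<noteq> q t" using q(2)[OF st(2)] by simp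
    qed
    moreover have "countable (q ` R \<alpha> \<beta>)"
      by (rule countable_subset[OF _ countable_rat]) (use q(1) in auto)
    ultimately show ?thesis by (rule countable_image_inj_on[rotated])
  qed
  define ch where "ch = (\<lambda>(p, q, \<alpha>, \<beta>). SOME t. t \<in> {p<..<q} \<inter> T \<alpha> \<beta>)"
  define D1 where "D1 = {0<..} \<inter> ch ` (\<rat> \<times> \<rat> \<times> \<rat> \<times> \<rat>)"
  define D2 where "D2 = (\<Union>\<alpha>\<in>\<rat>. \<Union>\<beta>\<in>\<rat>. R \<alpha> \<beta>)"
  show thesis
  proof (rule that[of "D1 \<union> D2"])
    show "countable (D1 \<union> D2)"
      unfolding D1_def D2_def
      by (intro countable_Un countable_UN countable_rat cR countable_Int2 countable_image countable_SIGMA)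
    show "D1 \<union> D2 \<subseteq> {0<..}" by (auto simp: D1_def D2_def R_def T_def)
    fix t e :: real assume t: "0 < t" and e: "0 < e"
    obtain \<alpha> where \<alpha>: "\<alpha> \<in> \<rat>" "\<Lambda> t - e < \<alpha>" "\<alpha> < \<Lambda> t" using Rats_dense_in_real[of "\<Lambda> t - e" "\<Lambda> t"] e by auto
    obtain \<beta> where \<beta>: "\<beta> \<in> \<rat>" "\<Lambda> t < \<beta>" "\<beta> < \<Lambda> t + e" using Rats_dense_in_real[of "\<Lambda> t" "\<Lambda> t + e"] e by auto
    have tT: "t \<in> T \<alpha> \<beta>" using t \<alpha> \<beta> by (simp add: T_def)
    show "\<exists>d\<in>D1 \<union> D2. t \<le> d \<and> d < t + e \<and> \<bar>\<Lambda> d - \<Lambda> t\<bar> < e"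
    proof (cases "t \<in> R \<alpha> \<beta>")
      case True
      then have "t \<in> D2" using \<alpha> \<beta> by (auto simp: D2_def)
      then show ?thesis using e by (intro bexI[of _ t]) auto
    next
      case False
      then have "{t<..<t + e} \<inter> T \<alpha> \<beta> \<noteq> {}" using tT e by (auto simp: R_def)
      then obtain t' where t': "t < t'" "t' < t + e" "t' \<in> T \<alpha> \<beta>" by auto
      obtain p where p: "p \<in> \<rat>" "t < p" "p < t'" using Rats_dense_in_real[OF t'(1)] by blast
      obtain q where q: "q \<in> \<rat>" "t' < q" "q < t + e" using Rats_dense_in_real[OF t'(2)] by blast
      define d where "d = ch (p, q, \<alpha>, \<beta>)"
      have "t' \<in> {p<..<q} \<inter> T \<alpha> \<beta>" using p q t' by auto
      then have d: "d \<in> {p<..<q} \<inter> T \<alpha> \<beta>" unfolding d_def ch_def prod.case by (rule someI)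
      have "d \<in> D1" unfolding D1_def d_def[symmetric] using p q \<alpha> \<beta> d t
        by (auto simp: d_def)
      moreover have "\<bar>\<Lambda> d - \<Lambda> t\<bar> < e" using d \<alpha> \<beta> by (auto simp: T_def)
      ultimately show ?thesis using d p q by (intro bexI[of _ d]) auto
    qed
  qed
qed

text \<open>A small step to the right loses little of \<open>w\<close> by right-continuity and
  changes \<Lambda> little by the choice of \<open>d\<close>, so the strict inequality
  survives.\<close>

lemma right_dense_witness:
  fixes w \<Lambda> :: "real \<Rightarrow> real"
  assumes dense: "\<And>t e. 0 < t \<Longrightarrow> 0 < e \<Longrightarrow> \<exists>d\<in>D. t \<le> d \<and> d < t + e \<and> \<bar>\<Lambda> d - \<Lambda> t\<bar> < e"
    and w: "right_cont_path w" and t: "0 < t" "\<kappa> * \<Lambda> t < w t" and h: "0 < h" and \<kappa>: "0 \<le> \<kappa>"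
  shows "\<exists>d\<in>D. t \<le> d \<and> d < t + h \<and> \<kappa> * \<Lambda> d < w d"
proof -
  define g where "g = w t - \<kappa> * \<Lambda> t"
  have g: "0 < g" using t by (simp add: g_def)
  have "(w \<longlongrightarrow> w t) (at_right t)" using right_cont_pathD[OF w] t by simp
  then have "eventually (\<lambda>u. w t - g / 2 < w u) (at_right t)"
    by (rule order_tendstoD) (use g in simp)
  then obtain u where u: "t < u" "\<And>y. t < y \<Longrightarrow> y < u \<Longrightarrow> w t - g / 2 < w y"
    by (auto simp: eventually_at_right_field)
  \<comment> \<open>The gap \<open>g\<close> is shared: \<open>w\<close> may lose
    \<open>g / 2\<close>, and the term with \<Lambda> may gain \<open>g / 2\<close>. The denominator
    has \<open>\<kappa> + 1\<close> because \<kappa> may be 0.\<close>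
  define e where "e = min (min h (u - t)) (g / (2 * (\<kappa> + 1)))"
  have e: "0 < e" using h u g \<kappa> by (auto simp: e_def)
  obtain d where d: "d \<in> D" "t \<le> d" "d < t + e" "\<bar>\<Lambda> d - \<Lambda> t\<bar> < e" using dense[OF t(1) e] by blast
  have "w t - g / 2 < w d"
    using u(2)[of d] d g by (cases "d = t") (auto simp: e_def)
  moreover have "\<kappa> * \<Lambda> d \<le> \<kappa> * \<Lambda> t + g / 2"
  proof -
    have "\<kappa> * (\<Lambda> d - \<Lambda> t) \<le> \<kappa> * e" using d \<kappa> by (intro mult_left_mono) auto
    also have "\<dots> \<le> (\<kappa> + 1) * e" using e by simp
    also have "\<dots> \<le> (\<kappa> + 1) * (g / (2 * (\<kappa> + 1)))" using \<kappa> by (intro mult_left_mono) (auto simp: e_def)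
    also have "\<dots> = g / 2" using \<kappa> by (simp add: field_simps)
    finally show ?thesis by (simp add: algebra_simps)
  qed
  ultimately have "\<kappa> * \<Lambda> d < w d" using g unfolding g_def by argo
  then show ?thesis using d by (intro bexI[of _ d]) (auto simp: e_def)
qed

text \<open>Right-continuity extends the strict inequality from \<open>v\<close> to an interval on
  its right, which must still fit into the window; hence \<open>v < L\<close>.\<close>

lemma dip_pos:
  assumes w: "right_cont_path w" "0 \<le> t" and v: "0 \<le> v" "v < L" "w (t + \<bar>w t\<bar> * v) < a * \<bar>w t\<bar>"
  shows "0 < dip a L w t"
proof -
  define y where "y = \<bar>w t\<bar>"
  define f where "f v = a * y - w (t + y * v)" for v
  have y: "0 \<le> y" by (simp add: y_def)
  have fv: "0 < f v" using v by (simp add: f_def y_def)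
  have "(f \<longlongrightarrow> f v) (at_right v)"
  proof (cases "y = 0")
    case True
    then show ?thesis by (simp add: f_def[abs_def])
  next
    case False
    have "filterlim (\<lambda>v. t + y * v) (at_right (t + y * v)) (at_right v)"
      unfolding filterlim_at using False y
      by (auto intro!: tendsto_intros simp: eventually_at_right_field intro: exI[of _ "v + 1"])
    moreover have "(w \<longlongrightarrow> w (t + y * v)) (at_right (t + y * v))"
      using w v y by (intro right_cont_pathD) auto
    ultimately have "((\<lambda>v. w (t + y * v)) \<longlongrightarrow> w (t + y * v)) (at_right v)"
      by (rule filterlim_compose[rotated])
    then show ?thesis unfolding f_def by (intro tendsto_diff tendsto_const)
  qed
  then have "eventually (\<lambda>u. f v / 2 < f u) (at_right v)"
    by (rule order_tendstoD) (use fv in simp)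
  then obtain u where u: "v < u" "\<And>x. v < x \<Longrightarrow> x < u \<Longrightarrow> f v / 2 < f x"
    by (auto simp: eventually_at_right_field)
  define e where "e = min u L"
  have e: "v < e" "e \<le> u" "e \<le> L" using u v by (auto simp: e_def)
  define m where "m = min 1 (f v / 2)"
  have m: "0 < m" using fv by (simp add: m_def)
  have "0 < (e - v) * m" using e m by simp
  also have "(e - v) * m = (\<integral>x. indicator {v<..<e} x *\<^sub>R m \<partial>lborel)" using e by simp
  also have "\<dots> \<le> (\<integral>x. indicator {0..L} x *\<^sub>R min 1 (max 0 (a * y - w (t + y * x))) \<partial>lborel)"
  proof (rule integral_mono)
    show "integrable lborel (\<lambda>x. indicator {v<..<e} x *\<^sub>R m)"
      by (rule integrable_real_indicator[THEN integrable_scaleR_left]) (use e in auto)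
    show "integrable lborel (\<lambda>x. indicator {0..L} x *\<^sub>R min 1 (max 0 (a * y - w (t + y * x))))"
      by (rule dip_integrable[OF w y])
    show "indicator {v<..<e} x *\<^sub>R m \<le> indicator {0..L} x *\<^sub>R min 1 (max 0 (a * y - w (t + y * x)))" for x
      using u(2)[of x] e v fv by (auto simp: indicator_def m_def f_def min_le_iff_disj le_max_iff_disj)
  qed
  also have "\<dots> = dip a L w t" by (simp add: dip_def set_lebesgue_integral_def y_def)
  finally show ?thesis .
qed

lemma dip_posD:
  assumes "0 < dip a L w t"
  shows "\<exists>v\<in>{0..L}. w (t + \<bar>w t\<bar> * v) < a * \<bar>w t\<bar>"
proof (rule ccontr)
  assume "\<not> ?thesis"
  then have *: "\<And>v. v \<in> {0..L} \<Longrightarrow> a * \<bar>w t\<bar> \<le> w (t + \<bar>w t\<bar> * v)" by (auto simp: not_less)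
  have "dip a L w t = (LBINT v:{0..L}. 0)"
    unfolding dip_def by (rule set_lebesgue_integral_cong) (use * in auto)
  then show False using assms by (simp add: set_lebesgue_integral_def)
qed

locale nonneg_process = prob_space N for N :: "'b measure" +
  fixes X :: "real \<Rightarrow> 'b \<Rightarrow> real"
  assumes X_measurable: "\<And>t. 0 \<le> t \<Longrightarrow> X t \<in> borel_measurable N"
    and X_right_cont: "\<And>\<omega>. \<omega> \<in> space N \<Longrightarrow> right_cont_path (\<lambda>t. X t \<omega>)"
    and X_nonneg: "\<And>\<omega> t. \<omega> \<in> space N \<Longrightarrow> 0 \<le> t \<Longrightarrow> 0 \<le> X t \<omega>"
begin

text \<open>The set \<open>S\<close> of tested offsets is countable: all nonnegative rationals for
  the future infimum, or a bounded part of them when the event has to belong to a history.\<close>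

definition above :: "real \<Rightarrow> real \<Rightarrow> real set \<Rightarrow> 'b \<Rightarrow> bool" where
  "above a t S \<omega> \<longleftrightarrow> (\<forall>q\<in>S. a * X t \<omega> \<le> X (t + q) \<omega>)"

lemma subalg_hist: "0 \<le> t \<Longrightarrow> subalgebra N (hist N X t)"
  by (rule subalgebra_hist[OF X_measurable])

lemma hist_in_events: "0 \<le> t \<Longrightarrow> C \<in> sets (hist N X t) \<Longrightarrow> C \<in> events"
  using subalg_hist by (auto simp: subalgebra_def)

lemma X_hist: "0 \<le> u \<Longrightarrow> u \<le> t \<Longrightarrow> X u \<in> borel_measurable (hist N X t)"
  by (rule measurable_hist[OF X_right_cont])

lemma hist_mono': "0 \<le> u \<Longrightarrow> u \<le> t \<Longrightarrow> sets (hist N X u) \<subseteq> sets (hist N X t)"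
  by (rule hist_mono[OF X_right_cont])

lemma above_in_hist:
  assumes "S \<subseteq> nonneg_rats" "0 \<le> t" "t \<le> r" "\<And>q. q \<in> S \<Longrightarrow> t + q \<le> r"
  shows "{\<omega>\<in>space N. above a t S \<omega> = b} \<in> sets (hist N X r)"
proof -
  have "{\<omega>\<in>space (hist N X r). above a t S \<omega>} \<in> sets (hist N X r)"
    unfolding above_def
  proof (rule sets.sets_Collect_countable_All')
    fix q assume q: "q \<in> S"
    then have q0: "0 \<le> q" using assms(1) nonneg_rats_ge_0 by auto
    have "(\<lambda>\<omega>. X (t + q) \<omega> - a * X t \<omega>) \<in> borel_measurable (hist N X r)"
      using assms q q0 by (intro borel_measurable_diff borel_measurable_times borel_measurable_const X_hist) auto
    from Collect_in_sets[OF this, of "{0..}"]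
    show "{\<omega>\<in>space (hist N X r). a * X t \<omega> \<le> X (t + q) \<omega>} \<in> sets (hist N X r)" by simp
  qed (rule countable_subset[OF assms(1) countable_nonneg_rats])
  then have T: "{\<omega>\<in>space N. above a t S \<omega>} \<in> sets (hist N X r)" by simp
  show ?thesis
  proof (cases b)
    case True
    then show ?thesis using T by simp
  next
    case False
    then have "{\<omega>\<in>space N. above a t S \<omega> = b} = space (hist N X r) - {\<omega>\<in>space N. above a t S \<omega>}" by auto
    then show ?thesis using T by (simp only: sets.compl_sets)
  qed
qed

lemma above_events:
  assumes "S \<subseteq> nonneg_rats" "0 \<le> t"
  shows "{\<omega>\<in>space N. above a t S \<omega> = b} \<in> events"
proof -
  have "{\<omega>\<in>space N. above a t S \<omega>} \<in> events"
    unfolding above_def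
  proof (rule sets.sets_Collect_countable_All')
    fix q assume q: "q \<in> S"
    then have q0: "0 \<le> q" using assms(1) nonneg_rats_ge_0 by auto
    have "(\<lambda>\<omega>. X (t + q) \<omega> - a * X t \<omega>) \<in> borel_measurable N"
      using assms q q0 by (intro borel_measurable_diff borel_measurable_times borel_measurable_const X_measurable) auto
    from Collect_in_sets[OF this, of "{0..}"]
    show "{\<omega>\<in>space N. a * X t \<omega> \<le> X (t + q) \<omega>} \<in> events" by simp
  qed (rule countable_subset[OF assms(1) countable_nonneg_rats])
  moreover from this have "space N - {\<omega>\<in>space N. above a t S \<omega>} \<in> events" by auto
  moreover have "space N - {\<omega>\<in>space N. above a t S \<omega>} = {\<omega>\<in>space N. above a t S \<omega> = False}" by auto
  ultimately show ?thesis by (cases b) (simp_all only: simp_thms)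
qed

lemma above_all:
  assumes \<omega>: "\<omega> \<in> space N" and t: "0 \<le> t" "t \<le> u" and ab: "above a t nonneg_rats \<omega>"
  shows "a * X t \<omega> \<le> X u \<omega>"
proof -
  define r where "r = u - t"
  have r: "0 \<le> r" using t by (simp add: r_def)
  have "\<exists>q\<in>nonneg_rats. r < q \<and> q < r + inverse (real (Suc n))" for n
  proof -
    obtain q where "q \<in> \<rat>" "r < q" "q < r + inverse (real (Suc n))"
      using Rats_dense_in_real[of r "r + inverse (real (Suc n))"] by auto
    then show ?thesis using r by (auto simp: nonneg_rats_def)
  qed
  then obtain q where q: "\<And>n. q n \<in> nonneg_rats" "\<And>n. r < q n" "\<And>n. q n < r + inverse (real (Suc n))" by metis
  have "q \<longlonglongrightarrow> r"
  proof (rule tendsto_sandwich[OF _ _ tendsto_const])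
    show "(\<lambda>n. r + inverse (real (Suc n))) \<longlonglongrightarrow> r"
      using tendsto_add[OF tendsto_const[of r] LIMSEQ_inverse_real_of_nat] by simp
  qed (use q in \<open>auto simp: less_imp_le intro!: always_eventually\<close>)
  then have "(\<lambda>n. t + q n) \<longlonglongrightarrow> t + r" by (intro tendsto_add tendsto_const)
  then have "(\<lambda>n. X (t + q n) \<omega>) \<longlonglongrightarrow> X u \<omega>"
    using t
  proof (intro right_cont_path_sequentially[OF X_right_cont[OF \<omega>]])
    show "u < t + q n" for n using q(2)[of n] by (simp add: r_def)
  qed (auto simp: r_def)
  then show ?thesis by (rule LIMSEQ_le_const) (use ab q in \<open>auto simp: above_def\<close>)
qed

section \<open>From a conditional lower bound to good times, for both alternatives \<open>b\<close>
  at once\<close>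

context
  fixes a c \<kappa> :: real and b :: bool and \<Lambda> :: "real \<Rightarrow> real" and D :: "real set"
  assumes D: "countable D" "D \<subseteq> {0<..}" and c: "0 < c" and \<kappa>: "\<And>t. 0 < t \<Longrightarrow> 0 \<le> \<kappa> * \<Lambda> t"
    and ge: "\<And>t C. 0 < t \<Longrightarrow> C \<in> sets (hist N X t) \<Longrightarrow>
      c * prob C \<le> prob (C \<inter> {\<omega>\<in>space N. X t \<omega> \<noteq> 0 \<longrightarrow> (above a t nonneg_rats \<omega> = b)})"
begin

definition high :: "real \<Rightarrow> 'b set" where
  "high t = {\<omega>\<in>space N. \<kappa> * \<Lambda> t < X t \<omega>}"

definition hit :: "real \<Rightarrow> real set \<Rightarrow> 'b set" where
  "hit t S = high t \<inter> {\<omega>\<in>space N. above a t S \<omega> = b}"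

lemma high_in_hist: "0 \<le> t \<Longrightarrow> t \<le> r \<Longrightarrow> high t \<in> sets (hist N X r)"
  using Collect_in_sets[OF X_hist[of t r], of "{\<kappa> * \<Lambda> t<..}"] by (simp add: high_def)

lemma hit_in_hist:
  "S \<subseteq> nonneg_rats \<Longrightarrow> 0 \<le> t \<Longrightarrow> t \<le> r \<Longrightarrow> (\<And>q. q \<in> S \<Longrightarrow> t + q \<le> r) \<Longrightarrow> hit t S \<in> sets (hist N X r)"
  unfolding hit_def by (intro sets.Int high_in_hist above_in_hist)

lemma high_events: "0 \<le> t \<Longrightarrow> high t \<in> events"
  using hist_in_events[OF _ high_in_hist[of t t]] by simp

lemma hit_events: "S \<subseteq> nonneg_rats \<Longrightarrow> 0 \<le> t \<Longrightarrow> hit t S \<in> events"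
  unfolding hit_def by (intro sets.Int high_events above_events)

lemma D_pos: "t \<in> D \<Longrightarrow> 0 < t"
  using D by auto

text \<open>The first entry bound with \<open>high v\<close> as the entry event. The exempted case
  \<open>X v \<omega> = 0\<close> does not occur there, because on \<open>high v\<close> the value
  exceeds the nonnegative number \<open>\<kappa> * \<Lambda> v\<close>.\<close>

lemma first_high:
  assumes V: "V \<subseteq> D" and C: "\<And>v. v \<in> V \<Longrightarrow> C \<in> sets (hist N X v)"
  shows "c * prob (C \<inter> (\<Union>v\<in>V. high v)) \<le> prob (C \<inter> (\<Union>v\<in>V. hit v nonneg_rats))"
proof -
  let ?G = "\<lambda>v. {\<omega>\<in>space N. X v \<omega> \<noteq> 0 \<longrightarrow> (above a v nonneg_rats \<omega> = b)}"
  have v0: "0 < v" if "v \<in> V" for v using that V D_pos by auto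
  have "c * prob (\<Union>v\<in>V. high v \<inter> C) \<le> prob (\<Union>v\<in>V. high v \<inter> C \<inter> ?G v)"
  proof (rule prob_first_entry_ge[where F="hist N X"])
    show "countable V" by (rule countable_subset[OF V D(1)])
    show "subalgebra N (hist N X v)" if "v \<in> V" for v using v0[OF that] by (intro subalg_hist) simp
    show "sets (hist N X u) \<subseteq> sets (hist N X v)" if "u \<in> V" "v \<in> V" "u \<le> v" for u v
      using v0[OF that(1)] that by (intro hist_mono') auto
    show "high v \<inter> C \<in> sets (hist N X v)" if "v \<in> V" for v
      using v0[OF that] C[OF that] by (intro sets.Int high_in_hist) auto
    show "?G v \<in> events" if "v \<in> V" for v
    proof -
      have "{\<omega>\<in>space N. X v \<omega> \<in> {0}} \<in> events"
        using v0[OF that] by (intro Collect_in_sets[OF X_measurable]) auto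
      moreover have "{\<omega>\<in>space N. above a v nonneg_rats \<omega> = b} \<in> events"
        using v0[OF that] by (intro above_events) auto
      moreover have "?G v = {\<omega>\<in>space N. X v \<omega> \<in> {0}} \<union> {\<omega>\<in>space N. above a v nonneg_rats \<omega> = b}" by auto
      ultimately show ?thesis by (simp only: sets.Un)
    qed
    show "c * prob C' \<le> prob (C' \<inter> ?G v)" if "v \<in> V" "C' \<in> sets (hist N X v)" for v C'
      by (rule ge[OF v0[OF that(1)] that(2)])
  qed
  also have "(\<Union>v\<in>V. high v \<inter> C) = C \<inter> (\<Union>v\<in>V. high v)" by auto
  also have "(\<Union>v\<in>V. high v \<inter> C \<inter> ?G v) = C \<inter> (\<Union>v\<in>V. hit v nonneg_rats)"
  proof -
    have "X v \<omega> \<noteq> 0" if "\<omega> \<in> high v" "v \<in> V" for v \<omega>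
      using that \<kappa>[OF v0[OF that(2)]] by (auto simp: high_def)
    then show ?thesis unfolding hit_def by blast
  qed
  finally show ?thesis .
qed

text \<open>Given the history up to \<open>n\<close>, a high time after both \<open>n\<close> and
  \<open>k\<close> comes almost surely, and the stopping argument makes some such time good with
  conditional probability at least \<open>c\<close>. The event of a good time after \<open>k\<close>
  thus keeps the proportion \<open>c\<close> of every history event and has probability 1.\<close>

lemma hits_unbounded:
  assumes inf: "AE \<omega> in N. \<forall>k::nat. \<exists>t\<in>D. real k \<le> t \<and> \<kappa> * \<Lambda> t < X t \<omega>"
  shows "AE \<omega> in N. \<forall>k::nat. \<exists>t\<in>D. real k \<le> t \<and> \<kappa> * \<Lambda> t < X t \<omega> \<and> (above a t nonneg_rats \<omega> = b)"
proof -
  define B where "B k = (\<Union>t\<in>{t\<in>D. real k \<le> t}. hit t nonneg_rats)" for k :: nat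
  have cV: "countable {t\<in>D. P t}" for P by (rule countable_subset[OF _ D(1)]) auto
  have Bm: "B k \<in> events" for k
    unfolding B_def using D_pos by (intro sets.countable_UN'' cV hit_events) (auto simp: less_imp_le)
  have "prob (B k) = 1" for k
  proof (rule prob_eq_1_if_prob_Int_ge[where F="\<lambda>n. hist N X (real n)", OF _ _ _ c])
    show "subalgebra N (hist N X (real n))" for n by (rule subalg_hist) simp
    show "sets (hist N X (real m)) \<subseteq> sets (hist N X (real n))" if "m \<le> n" for m n
      by (rule hist_mono') (use that in auto)
    interpret S: sigma_algebra "space N" "sigma_sets (space N) (\<Union>n. sets (hist N X (real n)))"
    proof (rule sigma_algebra_sigma_sets, rule UN_least)
      show "sets (hist N X (real n)) \<subseteq> Pow (space N)" for n
        using sets.space_closed[of "hist N X (real n)"] by simp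
    qed
    have gen: "C \<in> sigma_sets (space N) (\<Union>n. sets (hist N X (real n)))" if "C \<in> sets (hist N X r)" "0 \<le> r" for C r
    proof (rule sigma_sets.Basic)
      obtain n :: nat where "r \<le> real n" using real_arch_simple by blast
      then show "C \<in> (\<Union>n. sets (hist N X (real n)))" using hist_mono'[OF that(2), of "real n"] that by blast
    qed
    have "hit t nonneg_rats \<in> sigma_sets (space N) (\<Union>n. sets (hist N X (real n)))" if t: "0 < t" for t
    proof -
      have "{\<omega>\<in>space N. above a t nonneg_rats \<omega>} \<in> sigma_sets (space N) (\<Union>n. sets (hist N X (real n)))"
      proof -
        have "{\<omega>\<in>space N. above a t nonneg_rats \<omega>} = {\<omega>\<in>space N. \<forall>q\<in>nonneg_rats. above a t {q} \<omega> = True}"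
          by (auto simp: above_def)
        also have "\<dots> \<in> sigma_sets (space N) (\<Union>n. sets (hist N X (real n)))"
        proof (rule S.sets_Collect_countable_All')
          fix q assume q: "q \<in> nonneg_rats"
          then have "0 \<le> q" by (rule nonneg_rats_ge_0)
          then show "{\<omega>\<in>space N. above a t {q} \<omega> = True} \<in> sigma_sets (space N) (\<Union>n. sets (hist N X (real n)))"
            using q t by (intro gen[of _ "t + q"] above_in_hist) auto
        qed (rule countable_nonneg_rats)
        finally show ?thesis .
      qed
      moreover from S.Diff[OF S.top this] have "space N - {\<omega>\<in>space N. above a t nonneg_rats \<omega>} \<in> sigma_sets (space N) (\<Union>n. sets (hist N X (real n)))" .
      moreover have "space N - {\<omega>\<in>space N. above a t nonneg_rats \<omega>} = {\<omega>\<in>space N. above a t nonneg_rats \<omega> = False}" by auto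
      ultimately have "{\<omega>\<in>space N. above a t nonneg_rats \<omega> = b} \<in> sigma_sets (space N) (\<Union>n. sets (hist N X (real n)))"
        by (cases b) (simp_all only: simp_thms)
      moreover have "high t \<in> sigma_sets (space N) (\<Union>n. sets (hist N X (real n)))"
        using t by (intro gen[OF high_in_hist[of t t]]) auto
      ultimately show ?thesis unfolding hit_def by (rule S.Int[rotated])
    qed
    then show "B k \<in> sigma_sets (space N) (\<Union>n. sets (hist N X (real n)))"
      unfolding B_def using D_pos by (intro S.countable_UN'' cV) auto
    fix n C assume C: "C \<in> sets (hist N X (real n))"
    have Cm: "C \<in> events" by (rule hist_in_events[OF _ C]) simp
    define V where "V = {t\<in>D. real (max n k) \<le> t}"
    have "c * prob C = c * prob (C \<inter> (\<Union>v\<in>V. high v))"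
    proof -
      have hm: "(\<Union>v\<in>V. high v) \<in> events"
        unfolding V_def using D_pos by (intro sets.countable_UN'' cV high_events) (auto simp: less_imp_le)
      have "AE \<omega> in N. \<omega> \<in> (\<Union>v\<in>V. high v)"
        using inf AE_space
      proof eventually_elim
        case (elim \<omega>)
        then obtain t where "t \<in> D" "real (max n k) \<le> t" "\<kappa> * \<Lambda> t < X t \<omega>" by blast
        then show ?case using elim by (auto simp: V_def high_def)
      qed
      then have "prob C = prob (C \<inter> (\<Union>v\<in>V. high v))"
        by (intro measure_eq_AE) (use Cm hm in auto)
      then show ?thesis by simp
    qed
    also have "\<dots> \<le> prob (C \<inter> (\<Union>v\<in>V. hit v nonneg_rats))"
    proof (rule first_high)
      show "C \<in> sets (hist N X v)" if "v \<in> V" for v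
      proof -
        have "real n \<le> v" using that unfolding V_def by (simp add: le_max_iff_disj of_nat_max)
        then show ?thesis using C hist_mono'[of "real n" v] by auto
      qed
    qed (auto simp: V_def)
    also have "\<dots> \<le> prob (B k \<inter> C)"
      by (rule finite_measure_mono) (use Bm Cm in \<open>auto simp: B_def V_def\<close>)
    finally show "c * prob C \<le> prob (B k \<inter> C)" .
  qed
  then have "AE \<omega> in N. \<forall>k. \<omega> \<in> B k"
    unfolding AE_all_countable using Bm by (simp add: prob_eq_1)
  then show ?thesis
  proof eventually_elim
    case (elim \<omega>)
    show ?case
    proof
      fix k :: nat
      obtain t where "t \<in> D" "real k \<le> t" "\<omega> \<in> hit t nonneg_rats" using elim by (auto simp: B_def)
      then show "\<exists>t\<in>D. real k \<le> t \<and> \<kappa> * \<Lambda> t < X t \<omega> \<and> (above a t nonneg_rats \<omega> = b)"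
        by (intro bexI[of _ t]) (auto simp: hit_def high_def)
    qed
  qed
qed

text \<open>Near time 0 the future infimum is attained before any fixed time, so the limiting event belongs to the germ
  field. Conditioning its complement on the past shows that its probability is 1.\<close>

lemma hits_near_0:
  assumes inf: "AE \<omega> in N. \<forall>k::nat. \<exists>t\<in>D. t < inverse (real (Suc k)) \<and> \<kappa> * \<Lambda> t < X t \<omega>"
    and X0: "AE \<omega> in N. X 0 \<omega> = 0"
    and pos: "AE \<omega> in N. \<forall>r>0. \<exists>e>0. \<forall>u\<ge>r. e \<le> X u \<omega>"
  shows "AE \<omega> in N. \<forall>k::nat. \<exists>t\<in>D. t < inverse (real (Suc k)) \<and> \<kappa> * \<Lambda> t < X t \<omega> \<and> (above a t nonneg_rats \<omega> = b)"
proof -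
  define iv where "iv k = inverse (real (Suc k))" for k
  have iv: "0 < iv k" for k by (simp add: iv_def)
  have iv_lim: "iv \<longlonglongrightarrow> 0" unfolding iv_def[abs_def] by (rule LIMSEQ_inverse_real_of_nat)
  have iv_mono: "iv n \<le> iv m" if "m \<le> n" for m n unfolding iv_def using that by (intro le_imp_inverse_le) auto
  have iv_small: "\<exists>k. iv k < e" if "0 < e" for e
    using order_tendstoD(2)[OF iv_lim that] by (auto simp: eventually_sequentially)
  have cV: "countable {t\<in>D. P t}" for P by (rule countable_subset[OF _ D(1)]) auto
  define B where "B k = (\<Union>t\<in>{t\<in>D. t < iv k}. hit t nonneg_rats)" for k
  define A where "A = (\<Inter>k. B k)"
  \<comment> \<open>The same events decided within the history up to \<open>iv m\<close>, by testing
    only offsets that do not lead beyond \<open>iv m\<close>.\<close>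
  define B' where "B' m k = (\<Union>t\<in>{t\<in>D. t < iv k \<and> t < iv m}. hit t {q\<in>nonneg_rats. t + q \<le> iv m})" for m k
  define A' where "A' m = (\<Inter>k. B' m k)" for m
  have Bm: "B k \<in> events" for k
    unfolding B_def using D_pos by (intro sets.countable_UN'' cV hit_events) (auto simp: less_imp_le)
  have Am: "A \<in> events" unfolding A_def using Bm by auto
  have A'h: "A' m \<in> sets (hist N X (iv m))" for m
  proof -
    have "B' m k \<in> sets (hist N X (iv m))" for k
      unfolding B'_def using D_pos by (intro sets.countable_UN'' cV hit_in_hist) (auto simp: less_imp_le)
    then show ?thesis unfolding A'_def by auto
  qed
  have A'm: "A' m \<in> events" for m using hist_in_events[OF _ A'h] iv[of m] by simp
  \<comment> \<open>After \<open>iv m\<close> the process keeps a positive lower bound, while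
    \<open>a * X t\<close> is small for small \<open>t\<close> because \<open>X\<close> starts at 0.
    So for such \<open>t\<close> only times before \<open>iv m\<close> can violate the
    condition.\<close>
  have AA': "AE \<omega> in N. \<omega> \<in> A \<longleftrightarrow> \<omega> \<in> A' m" for m
    using X0 pos AE_space
  proof eventually_elim
    case (elim \<omega>)
    obtain e where e: "0 < e" "\<And>u. iv m \<le> u \<Longrightarrow> e \<le> X u \<omega>" using elim iv[of m] by blast
    have "((\<lambda>t. X t \<omega>) \<longlongrightarrow> X 0 \<omega>) (at_right 0)"
      using right_cont_pathD[OF X_right_cont[OF \<open>\<omega> \<in> space N\<close>], of 0] by simp
    then have "((\<lambda>t. a * X t \<omega>) \<longlongrightarrow> a * X 0 \<omega>) (at_right 0)" by (intro tendsto_mult tendsto_const)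
    then have "eventually (\<lambda>t. a * X t \<omega> < e) (at_right 0)"
      by (rule order_tendstoD) (use elim e in simp)
    then obtain d where d: "0 < d" "\<And>t. 0 < t \<Longrightarrow> t < d \<Longrightarrow> a * X t \<omega> < e"
      by (auto simp: eventually_at_right_field)
    have same: "above a t nonneg_rats \<omega> = above a t {q\<in>nonneg_rats. t + q \<le> iv m} \<omega>" if "0 < t" "t < d" for t
      unfolding above_def
    proof (intro iffI ballI)
      fix q assume *: "\<forall>q\<in>{q\<in>nonneg_rats. t + q \<le> iv m}. a * X t \<omega> \<le> X (t + q) \<omega>" "q \<in> nonneg_rats"
      show "a * X t \<omega> \<le> X (t + q) \<omega>"
      proof (cases "t + q \<le> iv m")
        case False
        then show ?thesis using e(2)[of "t + q"] d(2)[OF that] by simp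
      qed (use * in auto)
    qed auto
    obtain n where n: "iv n < min d (iv m)" using iv_small[of "min d (iv m)"] d iv[of m] by auto
    have small: "t < d" "t < iv m" if "t < iv (max k n)" for t k
      using that n iv_mono[of n "max k n"] by auto
    show ?case
    proof
      assume A: "\<omega> \<in> A"
      show "\<omega> \<in> A' m"
        unfolding A'_def
      proof (rule INT_I)
        fix k
        have "\<omega> \<in> B (max k n)" using A by (simp add: A_def)
        then obtain t where t: "t \<in> D" "t < iv (max k n)" "\<omega> \<in> hit t nonneg_rats" by (auto simp: B_def)
        have "\<omega> \<in> hit t {q\<in>nonneg_rats. t + q \<le> iv m}"
          using t(3) same[OF D_pos[OF t(1)] small(1)[OF t(2)]] by (simp add: hit_def)
        then show "\<omega> \<in> B' m k"
          unfolding B'_def using t(1,2) small(2)[OF t(2)] iv_mono[of k "max k n"] by (intro UN_I[of t]) auto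
      qed
    next
      assume A': "\<omega> \<in> A' m"
      show "\<omega> \<in> A"
        unfolding A_def
      proof (rule INT_I)
        fix k
        have "\<omega> \<in> B' m (max k n)" using A' by (simp add: A'_def)
        then obtain t where t: "t \<in> D" "t < iv (max k n)" "\<omega> \<in> hit t {q\<in>nonneg_rats. t + q \<le> iv m}" by (auto simp: B'_def)
        have "\<omega> \<in> hit t nonneg_rats"
          using t(3) same[OF D_pos[OF t(1)] small(1)[OF t(2)]] by (simp add: hit_def)
        then show "\<omega> \<in> B k"
          unfolding B_def using t(1,2) iv_mono[of k "max k n"] by (intro UN_I[of t]) auto
      qed
    qed
  qed
  define bad where "bad = space N - A"
  have badm: "bad \<in> events" using Am by (auto simp: bad_def)
  \<comment> \<open>Replacing \<open>A\<close> by \<open>A' m\<close> places the complement in the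
    history up to \<open>iv m\<close>, so the first entry bound applies to high times from
    \<open>iv m\<close> on. As \<open>m\<close> grows, these exhaust the high times below
    \<open>iv k\<close>.\<close>
  have step: "c * prob bad \<le> prob (bad \<inter> B k)" for k
  proof -
    define V where "V m = {t\<in>D. iv m \<le> t \<and> t < iv k}" for m
    have hm: "(\<Union>v\<in>V m. high v) \<in> events" for m
      unfolding V_def using D_pos by (intro sets.countable_UN'' cV high_events) (auto simp: less_imp_le)
    have le: "c * prob (bad \<inter> (\<Union>v\<in>V m. high v)) \<le> prob (bad \<inter> B k)" for m
    proof -
      have eq: "prob (bad \<inter> E) = prob ((space N - A' m) \<inter> E)" if "E \<in> events" for E
        by (rule measure_eq_AE) (use AA'[of m] that badm A'm[of m] in \<open>auto simp: bad_def\<close>)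
      have hitm: "(\<Union>v\<in>V m. hit v nonneg_rats) \<in> events"
        unfolding V_def using D_pos by (intro sets.countable_UN'' cV hit_events) (auto simp: less_imp_le)
      have "c * prob (bad \<inter> (\<Union>v\<in>V m. high v)) = c * prob ((space N - A' m) \<inter> (\<Union>v\<in>V m. high v))"
        using eq[OF hm] by simp
      also have "\<dots> \<le> prob ((space N - A' m) \<inter> (\<Union>v\<in>V m. hit v nonneg_rats))"
      proof (rule first_high)
        fix v assume v: "v \<in> V m"
        have "space (hist N X (iv m)) - A' m \<in> sets (hist N X (iv m))" by (rule sets.compl_sets[OF A'h])
        then show "space N - A' m \<in> sets (hist N X v)"
          using hist_mono'[of "iv m" v] v iv[of m] by (auto simp: V_def)
      qed (auto simp: V_def)
      also have "\<dots> = prob (bad \<inter> (\<Union>v\<in>V m. hit v nonneg_rats))" by (rule eq[OF hitm, symmetric])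
      also have "\<dots> \<le> prob (bad \<inter> B k)"
        by (rule finite_measure_mono) (use badm Bm in \<open>auto simp: V_def B_def\<close>)
      finally show ?thesis .
    qed
    have "(\<lambda>m. prob (bad \<inter> (\<Union>v\<in>V m. high v))) \<longlonglongrightarrow> prob (\<Union>m. bad \<inter> (\<Union>v\<in>V m. high v))"
    proof (rule finite_Lim_measure_incseq)
      show "incseq (\<lambda>m. bad \<inter> (\<Union>v\<in>V m. high v))"
      proof (rule incseq_SucI)
        fix m
        have "V m \<subseteq> V (Suc m)" using iv_mono[of m "Suc m"] by (auto simp: V_def)
        then show "bad \<inter> (\<Union>v\<in>V m. high v) \<subseteq> bad \<inter> (\<Union>v\<in>V (Suc m). high v)" by blast
      qed
    qed (use badm hm in auto)
    then have "(\<lambda>m. c * prob (bad \<inter> (\<Union>v\<in>V m. high v))) \<longlonglongrightarrow> c * prob (\<Union>m. bad \<inter> (\<Union>v\<in>V m. high v))"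
      by (intro tendsto_mult tendsto_const)
    then have "c * prob (\<Union>m. bad \<inter> (\<Union>v\<in>V m. high v)) \<le> prob (bad \<inter> B k)"
      by (rule LIMSEQ_le_const2) (use le in auto)
    also have "prob (\<Union>m. bad \<inter> (\<Union>v\<in>V m. high v)) = prob bad"
    proof (rule measure_eq_AE)
      show "AE \<omega> in N. \<omega> \<in> (\<Union>m. bad \<inter> (\<Union>v\<in>V m. high v)) \<longleftrightarrow> \<omega> \<in> bad"
        using inf AE_space
      proof eventually_elim
        case (elim \<omega>)
        then obtain t where t: "t \<in> D" "t < iv k" "\<kappa> * \<Lambda> t < X t \<omega>" unfolding iv_def by blast
        obtain m where "iv m < t" using iv_small[OF D_pos[OF t(1)]] by blast
        then have "t \<in> V m" "\<omega> \<in> high t" using t elim by (auto simp: V_def high_def)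
        then show ?case by blast
      qed
      show "(\<Union>m. bad \<inter> (\<Union>v\<in>V m. high v)) \<in> events" using badm hm by (intro sets.countable_UN) auto
    qed (rule badm)
    finally show ?thesis .
  qed
  \<comment> \<open>On the bad event some \<open>B k\<close> fails, so these intersections decrease
    to the empty set; \<open>c * prob bad\<close> lies below all their probabilities.\<close>
  have "(\<lambda>k. prob (bad \<inter> B k)) \<longlonglongrightarrow> prob (\<Inter>k. bad \<inter> B k)"
  proof (rule finite_Lim_measure_decseq)
    show "decseq (\<lambda>k. bad \<inter> B k)"
    proof (rule decseq_SucI)
      fix k
      have "{t\<in>D. t < iv (Suc k)} \<subseteq> {t\<in>D. t < iv k}" using iv_mono[of k "Suc k"] by auto
      then show "bad \<inter> B (Suc k) \<subseteq> bad \<inter> B k" unfolding B_def by blast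
    qed
  qed (use badm Bm in auto)
  moreover have "(\<Inter>k. bad \<inter> B k) = {}" by (auto simp: bad_def A_def)
  ultimately have "(\<lambda>k. prob (bad \<inter> B k)) \<longlonglongrightarrow> 0" by simp
  then have "c * prob bad \<le> 0" by (rule LIMSEQ_le_const) (use step in auto)
  then have "prob bad = 0" using c by (simp add: mult_le_0_iff measure_le_0_iff)
  then have "AE \<omega> in N. \<omega> \<notin> bad" using badm by (simp add: prob_eq_0)
  then show ?thesis
    using AE_space
  proof eventually_elim
    case (elim \<omega>)
    then have A: "\<omega> \<in> A" by (simp add: bad_def)
    show ?case
    proof
      fix k
      have "\<omega> \<in> B k" using A by (simp add: A_def)
      then obtain t where "t \<in> D" "t < iv k" "\<omega> \<in> hit t nonneg_rats" by (auto simp: B_def)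
      then show "\<exists>t\<in>D. t < inverse (real (Suc k)) \<and> \<kappa> * \<Lambda> t < X t \<omega> \<and> (above a t nonneg_rats \<omega> = b)"
        by (intro bexI[of _ t]) (auto simp: hit_def high_def iv_def)
    qed
  qed
qed

end

end

section \<open>Upper limits of the future infimum\<close>

lemma Limsup_ereal_eq_1:
  fixes f g :: "real \<Rightarrow> real" and \<kappa> :: "nat \<Rightarrow> real"
  assumes le: "eventually (\<lambda>t. f t \<le> g t) F" and g: "Limsup F (\<lambda>t. ereal (g t)) = 1"
    and freq: "\<And>j. frequently (\<lambda>t. \<kappa> j \<le> f t) F" and \<kappa>: "\<kappa> \<longlonglongrightarrow> 1"
  shows "Limsup F (\<lambda>t. ereal (f t)) = 1"
proof (rule antisym)
  have "Limsup F (\<lambda>t. ereal (f t)) \<le> Limsup F (\<lambda>t. ereal (g t))"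
    by (rule Limsup_mono) (use le in eventually_elim, simp)
  then show "Limsup F (\<lambda>t. ereal (f t)) \<le> 1" using g by simp
  have "ereal (\<kappa> j) \<le> Limsup F (\<lambda>t. ereal (f t))" for j
  proof (rule ccontr)
    assume "\<not> ereal (\<kappa> j) \<le> Limsup F (\<lambda>t. ereal (f t))"
    then have "eventually (\<lambda>t. ereal (f t) < ereal (\<kappa> j)) F" by (intro Limsup_lessD) simp
    then have "eventually (\<lambda>t. \<not> \<kappa> j \<le> f t) F" by eventually_elim simp
    then show False using freq[of j] by (simp add: frequently_def)
  qed
  moreover have lim: "(\<lambda>j. ereal (\<kappa> j)) \<longlonglongrightarrow> ereal 1" using \<kappa> by (simp only: tendsto_ereal)
  ultimately have "ereal 1 \<le> Limsup F (\<lambda>t. ereal (f t))" using LIMSEQ_le_const2[OF lim] by blast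
  then show "1 \<le> Limsup F (\<lambda>t. ereal (f t))" by (simp add: one_ereal_def)
qed

lemma frequently_if_Limsup_eq_1:
  assumes "Limsup F (\<lambda>t. ereal (g t)) = 1" "\<kappa> < 1"
  shows "frequently (\<lambda>t. \<kappa> < g t) F"
proof (rule ccontr)
  assume "\<not> frequently (\<lambda>t. \<kappa> < g t) F"
  then have "eventually (\<lambda>t. ereal (g t) \<le> ereal \<kappa>) F" by (simp add: frequently_def not_less)
  then have "Limsup F (\<lambda>t. ereal (g t)) \<le> ereal \<kappa>" by (rule Limsup_bounded)
  then show False using assms by (simp add: one_ereal_def)
qed

lemma frequently_at_top_real: "frequently P at_top \<longleftrightarrow> (\<forall>k::nat. \<exists>t\<ge>real k. P t)" for P :: "real \<Rightarrow> bool"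
proof -
  have "(\<exists>N. \<forall>n\<ge>N. \<not> P n) \<longleftrightarrow> (\<exists>k::nat. \<forall>n\<ge>real k. \<not> P n)"
    by (metis order_trans real_arch_simple)
  then show ?thesis unfolding frequently_def eventually_at_top_linorder by blast
qed

lemma frequently_at_right_0: "frequently P (at_right 0) \<longleftrightarrow> (\<forall>k::nat. \<exists>t. 0 < t \<and> t < inverse (real (Suc k)) \<and> P t)" for P :: "real \<Rightarrow> bool"
proof -
  have "(\<exists>b>0. \<forall>y>0. y < b \<longrightarrow> \<not> P y) \<longleftrightarrow> (\<exists>k::nat. \<forall>y>0. y < inverse (real (Suc k)) \<longrightarrow> \<not> P y)"
  proof
    assume "\<exists>b>0. \<forall>y>0. y < b \<longrightarrow> \<not> P y"
    then obtain b where b: "0 < b" "\<And>y. 0 < y \<Longrightarrow> y < b \<Longrightarrow> \<not> P y" by blast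
    obtain k where "inverse (real (Suc k)) < b" using reals_Archimedean[OF b(1)] by blast
    then show "\<exists>k::nat. \<forall>y>0. y < inverse (real (Suc k)) \<longrightarrow> \<not> P y" using b(2) by (meson order_less_trans)
  next
    assume "\<exists>k::nat. \<forall>y>0. y < inverse (real (Suc k)) \<longrightarrow> \<not> P y"
    then obtain k :: nat where "\<forall>y>0. y < inverse (real (Suc k)) \<longrightarrow> \<not> P y" by blast
    then show "\<exists>b>0. \<forall>y>0. y < b \<longrightarrow> \<not> P y" by (intro exI[of _ "inverse (real (Suc k))"]) simp
  qed
  then show ?thesis unfolding frequently_def eventually_at_right_field by simp
qed

lemma dip_mono_L:
  assumes "right_cont_path w" "0 \<le> t" "L \<le> L'"
  shows "dip a L w t \<le> dip a L' w t"
  unfolding dip_def set_lebesgue_integral_def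
  using assms(3)
  by (intro integral_mono dip_integrable[OF assms(1,2)]) (auto simp: indicator_def)

context nonneg_process
begin

lemma future_infimum_bounds:
  assumes "\<omega> \<in> space N" "0 \<le> t"
  shows "0 \<le> future_infimum X t \<omega>" "t \<le> u \<Longrightarrow> future_infimum X t \<omega> \<le> X u \<omega>"
    "(\<And>u. t \<le> u \<Longrightarrow> m \<le> X u \<omega>) \<Longrightarrow> m \<le> future_infimum X t \<omega>"
proof -
  show "0 \<le> future_infimum X t \<omega>"
    unfolding future_infimum_def by (rule cINF_greatest) (use assms X_nonneg in auto)
  show "future_infimum X t \<omega> \<le> X u \<omega>" if "t \<le> u"
    unfolding future_infimum_def
  proof (rule cINF_lower)
    show "bdd_below ((\<lambda>s. X s \<omega>) ` {t..})"
      by (rule bdd_belowI[of _ 0]) (use assms X_nonneg in auto)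
  qed (use that in simp)
  show "m \<le> future_infimum X t \<omega>" if "\<And>u. t \<le> u \<Longrightarrow> m \<le> X u \<omega>"
    unfolding future_infimum_def by (rule cINF_greatest) (use that in auto)
qed

text \<open>Zero values of \<open>X t\<close> are exempt: there the window of \<open>dip\<close>
  degenerates to the single time \<open>t\<close> and says nothing about later times.\<close>

definition ratio_bound :: "real \<Rightarrow> bool \<Rightarrow> real \<Rightarrow> bool" where
  "ratio_bound a b c \<longleftrightarrow> (\<forall>t>0. \<forall>C\<in>sets (hist N X t).
     c * prob C \<le> prob (C \<inter> {\<omega>\<in>space N. X t \<omega> \<noteq> 0 \<longrightarrow> (above a t nonneg_rats \<omega> = b)}))"

text \<open>A window of length \<open>L\<close> controls times up to \<open>t + L * X t\<close>
  only. The constant \<open>c\<close> is the same for all \<open>L\<close>, so continuity from above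
  reaches every later time if \<open>X t\<close> is positive.\<close>

lemma ratio_bound_True_if_defect:
  assumes "\<And>t C (L::nat). 0 < t \<Longrightarrow> C \<in> sets (hist N X t) \<Longrightarrow>
      c * prob C \<le> prob (C \<inter> {\<omega>\<in>space N. defect 1 0 a (real L) (\<lambda>u. X u \<omega>) t = 0})"
  shows "ratio_bound a True c"
  unfolding ratio_bound_def
proof (intro allI impI ballI)
  fix t C assume t: "0 < t" and C: "C \<in> sets (hist N X t)"
  have Cm: "C \<in> events" using hist_in_events[OF _ C] t by simp
  define E where "E L = {\<omega>\<in>space N. defect 1 0 a (real L) (\<lambda>u. X u \<omega>) t = 0}" for L :: nat
  have Em: "E L \<in> events" for L
    unfolding E_def
    using Collect_in_sets[OF defect_measurable[OF X_measurable X_right_cont, of t 1 0 a "real L"], of "{0}"] t by simp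
  have defect_eq: "defect 1 0 a L (\<lambda>u. X u \<omega>) t = dip a L (\<lambda>u. X u \<omega>) t" for L \<omega>
    using dip_nonneg[of a L "\<lambda>u. X u \<omega>" t] by (simp add: defect_def)
  have "(\<lambda>L. prob (C \<inter> E L)) \<longlonglongrightarrow> prob (\<Inter>L. C \<inter> E L)"
  proof (rule finite_Lim_measure_decseq)
    show "decseq (\<lambda>L. C \<inter> E L)"
    proof (rule decseq_SucI)
      fix L
      have "E (Suc L) \<subseteq> E L"
      proof
        fix \<omega> assume \<omega>: "\<omega> \<in> E (Suc L)"
        then have "dip a (real L) (\<lambda>u. X u \<omega>) t \<le> 0"
          using dip_mono_L[OF X_right_cont, of \<omega> t "real L" "real (Suc L)" a] t
          by (simp add: E_def defect_eq)
        then show "\<omega> \<in> E L"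
          using \<omega> dip_nonneg[of a "real L" "\<lambda>u. X u \<omega>" t] by (simp add: E_def defect_eq)
      qed
      then show "C \<inter> E (Suc L) \<subseteq> C \<inter> E L" by blast
    qed
  qed (use Cm Em in auto)
  then have "c * prob C \<le> prob (\<Inter>L. C \<inter> E L)"
    by (rule LIMSEQ_le_const) (use assms[OF t C] in \<open>auto simp: E_def\<close>)
  also have "\<dots> \<le> prob (C \<inter> {\<omega>\<in>space N. X t \<omega> \<noteq> 0 \<longrightarrow> (above a t nonneg_rats \<omega> = True)})"
  proof (rule finite_measure_mono)
    show "(\<Inter>L. C \<inter> E L) \<subseteq> C \<inter> {\<omega>\<in>space N. X t \<omega> \<noteq> 0 \<longrightarrow> (above a t nonneg_rats \<omega> = True)}"
    proof
      fix \<omega> assume \<omega>: "\<omega> \<in> (\<Inter>L. C \<inter> E L)"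
      then have sp: "\<omega> \<in> space N" and dip0: "\<And>L. dip a (real L) (\<lambda>u. X u \<omega>) t = 0"
        by (auto simp: E_def defect_eq)
      have "a * X t \<omega> \<le> X (t + q) \<omega>" if "X t \<omega> \<noteq> 0" "q \<in> nonneg_rats" for q
      proof (rule ccontr)
        assume lt: "\<not> a * X t \<omega> \<le> X (t + q) \<omega>"
        have y: "0 < X t \<omega>" using that(1) X_nonneg[OF sp, of t] t by simp
        define v where "v = q / X t \<omega>"
        obtain L :: nat where L: "v < real L" using reals_Archimedean2 by blast
        have "0 < dip a (real L) (\<lambda>u. X u \<omega>) t"
          using X_right_cont[OF sp] t y L lt nonneg_rats_ge_0[OF that(2)]
          by (intro dip_pos[where v=v]) (auto simp: v_def)
        then show False using dip0[of L] by simp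
      qed
      then show "\<omega> \<in> C \<inter> {\<omega>\<in>space N. X t \<omega> \<noteq> 0 \<longrightarrow> (above a t nonneg_rats \<omega> = True)}"
        using \<omega> sp by (auto simp: above_def)
    qed
    have "{\<omega>\<in>space N. X t \<omega> \<in> {0}} \<in> events" "{\<omega>\<in>space N. above a t nonneg_rats \<omega> = True} \<in> events"
      using t by (intro Collect_in_sets[OF X_measurable] above_events; simp)+
    moreover have "{\<omega>\<in>space N. X t \<omega> \<noteq> 0 \<longrightarrow> (above a t nonneg_rats \<omega> = True)}
        = {\<omega>\<in>space N. X t \<omega> \<in> {0}} \<union> {\<omega>\<in>space N. above a t nonneg_rats \<omega> = True}" by auto
    ultimately show "C \<inter> {\<omega>\<in>space N. X t \<omega> \<noteq> 0 \<longrightarrow> (above a t nonneg_rats \<omega> = True)} \<in> events"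
      using Cm by (simp only: sets.Un sets.Int)
  qed
  finally show "c * prob C \<le> prob (C \<inter> {\<omega>\<in>space N. X t \<omega> \<noteq> 0 \<longrightarrow> (above a t nonneg_rats \<omega> = True)})" .
qed

text \<open>A vanishing defect forces the dip to be at least
  \<open>\<eta> * min 1 \<bar>X t \<omega>\<bar>\<close>, which is positive unless
  \<open>X t\<close> vanishes, and a positive dip exhibits a later value below
  \<open>a * X t\<close>.\<close>

lemma ratio_bound_False_if_defect:
  assumes \<eta>: "0 < \<eta>" and ge: "\<And>t C. 0 < t \<Longrightarrow> C \<in> sets (hist N X t) \<Longrightarrow>
      c * prob C \<le> prob (C \<inter> {\<omega>\<in>space N. defect (-1) \<eta> a L (\<lambda>u. X u \<omega>) t = 0})"
  shows "ratio_bound a False c"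
  unfolding ratio_bound_def
proof (intro allI impI ballI)
  fix t C assume t: "0 < t" and C: "C \<in> sets (hist N X t)"
  have Cm: "C \<in> events" using hist_in_events[OF _ C] t by simp
  have "c * prob C \<le> prob (C \<inter> {\<omega>\<in>space N. defect (-1) \<eta> a L (\<lambda>u. X u \<omega>) t = 0})" by (rule ge[OF t C])
  also have "\<dots> \<le> prob (C \<inter> {\<omega>\<in>space N. X t \<omega> \<noteq> 0 \<longrightarrow> (above a t nonneg_rats \<omega> = False)})"
  proof (rule finite_measure_mono)
    show "C \<inter> {\<omega>\<in>space N. defect (-1) \<eta> a L (\<lambda>u. X u \<omega>) t = 0}
      \<subseteq> C \<inter> {\<omega>\<in>space N. X t \<omega> \<noteq> 0 \<longrightarrow> (above a t nonneg_rats \<omega> = False)}"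
    proof safe
      fix \<omega> assume sp: "\<omega> \<in> space N" and d: "defect (-1) \<eta> a L (\<lambda>u. X u \<omega>) t = 0"
        and nz: "X t \<omega> \<noteq> 0" and ab: "above a t nonneg_rats \<omega>"
      have y: "0 < X t \<omega>" using nz X_nonneg[OF sp, of t] t by simp
      have "0 < \<eta> * min 1 \<bar>X t \<omega>\<bar>" using \<eta> y by simp
      moreover have "\<eta> * min 1 \<bar>X t \<omega>\<bar> - dip a L (\<lambda>u. X u \<omega>) t \<le> 0"
        using d unfolding defect_def by simp
      ultimately have "0 < dip a L (\<lambda>u. X u \<omega>) t" by linarith
      then obtain v where v: "v \<in> {0..L}" "X (t + \<bar>X t \<omega>\<bar> * v) \<omega> < a * \<bar>X t \<omega>\<bar>" using dip_posD by blast
      have "a * X t \<omega> \<le> X (t + \<bar>X t \<omega>\<bar> * v) \<omega>"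
        by (rule above_all[OF sp _ _ ab]) (use t v in auto)
      then show False using v(2) y by simp
    qed
    have "{\<omega>\<in>space N. X t \<omega> \<in> {0}} \<in> events" "{\<omega>\<in>space N. above a t nonneg_rats \<omega> = False} \<in> events"
      using t by (intro Collect_in_sets[OF X_measurable] above_events; simp)+
    moreover have "{\<omega>\<in>space N. X t \<omega> \<noteq> 0 \<longrightarrow> (above a t nonneg_rats \<omega> = False)}
        = {\<omega>\<in>space N. X t \<omega> \<in> {0}} \<union> {\<omega>\<in>space N. above a t nonneg_rats \<omega> = False}" by auto
    ultimately show "C \<inter> {\<omega>\<in>space N. X t \<omega> \<noteq> 0 \<longrightarrow> (above a t nonneg_rats \<omega> = False)} \<in> events"
      using Cm by (simp only: sets.Un sets.Int)
  qed
  finally show "c * prob C \<le> prob (C \<inter> {\<omega>\<in>space N. X t \<omega> \<noteq> 0 \<longrightarrow> (above a t nonneg_rats \<omega> = False)})" .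
qed

text \<open>A positive value is almost surely followed by values above some positive fraction of it,
  since the conditional probability of keeping the fraction \<open>a\<close> can be brought to at
  least \<open>1 - e\<close> by the choice of \<open>a\<close>. Positive values occur arbitrarily
  early, so they bound the process away from 0 after every \<open>r > 0\<close>.\<close>

lemma AE_future_pos:
  assumes D: "countable D" "D \<subseteq> {0<..}"
    and rb: "\<And>e. 0 < e \<Longrightarrow> \<exists>a>0. ratio_bound a True (1 - e)"
    and inf: "AE \<omega> in N. \<forall>k::nat. \<exists>t\<in>D. t < inverse (real (Suc k)) \<and> 0 < X t \<omega>"
  shows "AE \<omega> in N. \<forall>r>0. \<exists>e>0. \<forall>u\<ge>r. e \<le> X u \<omega>"
proof -
  have "AE \<omega> in N. \<forall>t\<in>D. X t \<omega> \<noteq> 0 \<longrightarrow> (\<exists>n. above (inverse (real (Suc n))) t nonneg_rats \<omega>)"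
  proof (intro AE_ball_countable[THEN iffD2] D(1) ballI)
    fix t assume "t \<in> D"
    then have t: "0 < t" using D by auto
    define C where "C = {\<omega>\<in>space N. X t \<omega> \<in> - {0}}"
    have Ch: "C \<in> sets (hist N X t)"
      using Collect_in_sets[OF X_hist[of t t], of "- {0}"] t by (simp add: C_def)
    have Cm: "C \<in> events" using hist_in_events[OF _ Ch] t by simp
    define U where "U n = {\<omega>\<in>space N. above (inverse (real (Suc n))) t nonneg_rats \<omega> = True}" for n
    have Um: "U n \<in> events" for n unfolding U_def using t by (intro above_events) auto
    \<comment> \<open>The outcomes for which \<open>X t\<close> is nonzero but none of the fractions
      \<open>inverse (real (Suc n))\<close> is kept; the probability is shown to be at most any
      \<open>e > 0\<close>.\<close>
    define H where "H = C - (\<Union>n. U n)"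
    have Hm: "H \<in> events" unfolding H_def using Cm Um by auto
    have "prob H \<le> 0 + e" if e: "0 < e" for e
    proof -
      obtain a where a: "0 < a" "ratio_bound a True (1 - e)" using rb[OF e] by blast
      obtain n where n: "inverse (real (Suc n)) < a" using reals_Archimedean[OF a(1)] by blast
      have "(1 - e) * prob C \<le> prob (C \<inter> {\<omega>\<in>space N. X t \<omega> \<noteq> 0 \<longrightarrow> (above a t nonneg_rats \<omega> = True)})"
        using a(2) t Ch unfolding ratio_bound_def by blast
      also have "\<dots> \<le> prob (C \<inter> U n)"
      proof (rule finite_measure_mono)
        show "C \<inter> {\<omega>\<in>space N. X t \<omega> \<noteq> 0 \<longrightarrow> (above a t nonneg_rats \<omega> = True)} \<subseteq> C \<inter> U n"
        proof
          fix \<omega> assume \<omega>: "\<omega> \<in> C \<inter> {\<omega>\<in>space N. X t \<omega> \<noteq> 0 \<longrightarrow> (above a t nonneg_rats \<omega> = True)}"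
          then have sp: "\<omega> \<in> space N" and ab: "above a t nonneg_rats \<omega>" by (auto simp: C_def)
          have "inverse (real (Suc n)) * X t \<omega> \<le> a * X t \<omega>"
            using n X_nonneg[OF sp, of t] t by (intro mult_right_mono) auto
          then have "above (inverse (real (Suc n))) t nonneg_rats \<omega>"
            using ab unfolding above_def by (meson order_trans)
          then show "\<omega> \<in> C \<inter> U n" using \<omega> sp by (simp add: U_def)
        qed
      qed (use Cm Um in auto)
      finally have 1: "(1 - e) * prob C \<le> prob (C \<inter> U n)" .
      have "prob H \<le> prob (C - C \<inter> U n)" by (rule finite_measure_mono) (use Cm Um in \<open>auto simp: H_def\<close>)
      also have "\<dots> = prob C - prob (C \<inter> U n)" by (rule finite_measure_Diff) (use Cm Um in auto)
      also have "\<dots> \<le> e * prob C" using 1 by (simp add: algebra_simps)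
      also have "\<dots> \<le> e" using e by (simp add: mult_left_le)
      finally show ?thesis by simp
    qed
    then have "prob H \<le> 0" by (rule field_le_epsilon)
    then have "prob H = 0" by (simp add: measure_le_0_iff)
    then have "AE \<omega> in N. \<omega> \<notin> H" using Hm by (simp add: prob_eq_0)
    then show "AE \<omega> in N. X t \<omega> \<noteq> 0 \<longrightarrow> (\<exists>n. above (inverse (real (Suc n))) t nonneg_rats \<omega>)"
      using AE_space by eventually_elim (auto simp: H_def C_def U_def)
  qed
  from this inf AE_space show ?thesis
  proof eventually_elim
    case (elim \<omega>)
    show ?case
    proof (intro allI impI)
      fix r :: real assume r: "0 < r"
      obtain k where k: "inverse (real (Suc k)) < r" using reals_Archimedean[OF r] by blast
      obtain t where t: "t \<in> D" "t < inverse (real (Suc k))" "0 < X t \<omega>" using elim(2) by blast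
      then obtain n where n: "above (inverse (real (Suc n))) t nonneg_rats \<omega>" using elim(1) by auto
      have "0 < t" using t D by auto
      then have "inverse (real (Suc n)) * X t \<omega> \<le> X u \<omega>" if "r \<le> u" for u
        using that k t by (intro above_all[OF elim(3) _ _ n]) auto
      then show "\<exists>e>0. \<forall>u\<ge>r. e \<le> X u \<omega>"
        using t(3) by (intro exI[of _ "inverse (real (Suc n)) * X t \<omega>"]) auto
    qed
  qed
qed

text \<open>Starts at 1/2 and increases to 1. It serves both as the multiple of \<Lambda> exceeded
  by \<open>X\<close> and as the fraction of the present value, which explains the products
  \<open>level j * level j\<close> below.\<close>

definition level :: "nat \<Rightarrow> real" where
  "level j = 1 - inverse (real (Suc (Suc j)))"

lemma level: "0 < level j" "level j < 1"
  by (auto simp: level_def field_simps)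

lemma level_tendsto: "level \<longlonglongrightarrow> 1"
proof -
  have "(\<lambda>j. inverse (real (Suc (Suc j)))) \<longlonglongrightarrow> 0"
    by (rule LIMSEQ_Suc[OF LIMSEQ_inverse_real_of_nat])
  from tendsto_diff[OF tendsto_const[of 1] this] show ?thesis by (simp add: level_def[abs_def])
qed

lemma future_infimum_ge:
  assumes "\<omega> \<in> space N" "0 < t" "0 < \<Lambda> t" "0 \<le> \<kappa>" "\<kappa> * \<Lambda> t < X t \<omega>" "above \<kappa> t nonneg_rats \<omega>"
  shows "\<kappa> * \<kappa> \<le> future_infimum X t \<omega> / \<Lambda> t"
proof -
  have "\<kappa> * X t \<omega> \<le> future_infimum X t \<omega>"
    by (rule future_infimum_bounds(3)) (use assms above_all in auto)
  moreover have "\<kappa> * (\<kappa> * \<Lambda> t) \<le> \<kappa> * X t \<omega>" using assms by (intro mult_left_mono) auto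
  ultimately show ?thesis using assms(3) by (simp add: field_simps)
qed

lemma excess_ge:
  assumes "\<omega> \<in> space N" "0 < t" "0 < \<Lambda> t" "0 \<le> \<kappa>" "\<kappa> * \<Lambda> t < X t \<omega>" "\<not> above (1 - \<kappa>) t nonneg_rats \<omega>"
  shows "\<kappa> * \<kappa> \<le> (X t \<omega> - future_infimum X t \<omega>) / \<Lambda> t"
proof -
  obtain q where q: "q \<in> nonneg_rats" "X (t + q) \<omega> < (1 - \<kappa>) * X t \<omega>" using assms(6) by (auto simp: above_def not_le)
  have "future_infimum X t \<omega> \<le> X (t + q) \<omega>"
    by (rule future_infimum_bounds(2)) (use assms q nonneg_rats_ge_0 in auto)
  then have "\<kappa> * X t \<omega> \<le> X t \<omega> - future_infimum X t \<omega>" using q(2) by (simp add: algebra_simps)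
  moreover have "\<kappa> * (\<kappa> * \<Lambda> t) \<le> \<kappa> * X t \<omega>" using assms by (intro mult_left_mono) auto
  ultimately show ?thesis using assms(3) by (simp add: field_simps)
qed

lemma level_sq_tendsto: "(\<lambda>j. level j * level j) \<longlonglongrightarrow> 1"
  using tendsto_mult[OF level_tendsto level_tendsto] by simp

text \<open>The upper bound is immediate, since neither the future infimum nor the excess over it is
  larger than \<open>X t\<close>. For the lower bound, the almost sure good times of
  \<open>hits_unbounded\<close> are collected over the countably many levels.\<close>

theorem limsup_future_at_top:
  fixes \<Lambda> :: "real \<Rightarrow> real"
  assumes \<Lambda>: "\<And>t. 0 < t \<Longrightarrow> 0 < \<Lambda> t"
    and L: "AE \<omega> in N. Limsup at_top (\<lambda>t. ereal (X t \<omega> / \<Lambda> t)) = 1"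
  shows "(\<And>a. 0 < a \<Longrightarrow> a < 1 \<Longrightarrow> \<exists>c>0. ratio_bound a True c) \<Longrightarrow>
      AE \<omega> in N. Limsup at_top (\<lambda>t. ereal (future_infimum X t \<omega> / \<Lambda> t)) = 1"
    and "(\<And>a. 0 < a \<Longrightarrow> a < 1 \<Longrightarrow> \<exists>c>0. ratio_bound a False c) \<Longrightarrow>
      AE \<omega> in N. Limsup at_top (\<lambda>t. ereal ((X t \<omega> - future_infimum X t \<omega>) / \<Lambda> t)) = 1"
proof -
  obtain D where D: "countable D" "D \<subseteq> {0<..}"
    and dense: "\<And>t e. 0 < t \<Longrightarrow> 0 < e \<Longrightarrow> \<exists>d\<in>D. t \<le> d \<and> d < t + e \<and> \<bar>\<Lambda> d - \<Lambda> t\<bar> < e"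
    using countable_right_dense_graph[of \<Lambda>] by blast
  have inf: "AE \<omega> in N. \<forall>k::nat. \<exists>t\<in>D. real k \<le> t \<and> level j * \<Lambda> t < X t \<omega>" for j
    using L AE_space
  proof eventually_elim
    case (elim \<omega>)
    have freq: "frequently (\<lambda>t. level j < X t \<omega> / \<Lambda> t) at_top"
      by (rule frequently_if_Limsup_eq_1[OF elim(1) level(2)])
    show ?case
    proof
      fix k :: nat
      obtain t where t: "real (Suc k) \<le> t" "level j < X t \<omega> / \<Lambda> t" using freq unfolding frequently_at_top_real by blast
      have t0: "0 < t" using t(1) by simp
      then have "level j * \<Lambda> t < X t \<omega>" using t(2) \<Lambda>[of t] by (simp add: field_simps)
      then obtain d where "d \<in> D" "t \<le> d" "level j * \<Lambda> d < X d \<omega>"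
        using right_dense_witness[OF dense X_right_cont[OF elim(2)] t0, of "level j" 1] level(1)[of j] by auto
      then show "\<exists>t\<in>D. real k \<le> t \<and> level j * \<Lambda> t < X t \<omega>" using t(1) by (intro bexI[of _ d]) auto
    qed
  qed
  have hits: "AE \<omega> in N. \<forall>j. \<forall>k::nat. \<exists>t\<in>D. real k \<le> t \<and> level j * \<Lambda> t < X t \<omega> \<and> (above (a j) t nonneg_rats \<omega> = b)"
    if "\<And>j. \<exists>c>0. ratio_bound (a j) b c" for a :: "nat \<Rightarrow> real" and b
  proof (rule AE_all_countable[THEN iffD2], rule allI)
    fix j
    from that[of j] obtain c where c: "0 < c" "ratio_bound (a j) b c" by blast
    have "0 \<le> level j * \<Lambda> t" if "0 < t" for t using level(1)[of j] \<Lambda>[OF that] by simp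
    then show "AE \<omega> in N. \<forall>k::nat. \<exists>t\<in>D. real k \<le> t \<and> level j * \<Lambda> t < X t \<omega> \<and> (above (a j) t nonneg_rats \<omega> = b)"
      using c inf[of j] D by (intro hits_unbounded[where c=c]) (auto simp: ratio_bound_def)
  qed
  {
    assume rb: "\<And>a. 0 < a \<Longrightarrow> a < 1 \<Longrightarrow> \<exists>c>0. ratio_bound a True c"
    have "AE \<omega> in N. \<forall>j. \<forall>k::nat. \<exists>t\<in>D. real k \<le> t \<and> level j * \<Lambda> t < X t \<omega> \<and> (above (level j) t nonneg_rats \<omega> = True)"
      by (rule hits) (use rb level in auto)
    from this L AE_space show "AE \<omega> in N. Limsup at_top (\<lambda>t. ereal (future_infimum X t \<omega> / \<Lambda> t)) = 1"
    proof eventually_elim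
      case (elim \<omega>)
      show ?case
      proof (rule Limsup_ereal_eq_1[OF _ elim(2) _ level_sq_tendsto])
        show "eventually (\<lambda>t. future_infimum X t \<omega> / \<Lambda> t \<le> X t \<omega> / \<Lambda> t) at_top"
          using eventually_gt_at_top[of 0]
        proof eventually_elim
          case (elim t)
          then show ?case using future_infimum_bounds(2)[OF \<open>\<omega> \<in> space N\<close>, of t t] \<Lambda>[OF elim] elim by (intro divide_right_mono) linarith+
        qed
        show "frequently (\<lambda>t. level j * level j \<le> future_infimum X t \<omega> / \<Lambda> t) at_top" for j
          unfolding frequently_at_top_real
        proof
          fix k :: nat
          obtain t where t: "t \<in> D" "real k \<le> t" "level j * \<Lambda> t < X t \<omega>" "above (level j) t nonneg_rats \<omega>" using elim(1) by blast
          then have "0 < t" using D by auto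
          then show "\<exists>t\<ge>real k. level j * level j \<le> future_infimum X t \<omega> / \<Lambda> t"
            using t \<Lambda>[of t] level(1)[of j] elim(3) by (intro exI[of _ t] conjI future_infimum_ge) simp_all
        qed
      qed
    qed
  next
    assume rb: "\<And>a. 0 < a \<Longrightarrow> a < 1 \<Longrightarrow> \<exists>c>0. ratio_bound a False c"
    have "AE \<omega> in N. \<forall>j. \<forall>k::nat. \<exists>t\<in>D. real k \<le> t \<and> level j * \<Lambda> t < X t \<omega> \<and> (above (1 - level j) t nonneg_rats \<omega> = False)"
      by (rule hits) (use rb level in auto)
    from this L AE_space show "AE \<omega> in N. Limsup at_top (\<lambda>t. ereal ((X t \<omega> - future_infimum X t \<omega>) / \<Lambda> t)) = 1"
    proof eventually_elim
      case (elim \<omega>)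
      show ?case
      proof (rule Limsup_ereal_eq_1[OF _ elim(2) _ level_sq_tendsto])
        show "eventually (\<lambda>t. (X t \<omega> - future_infimum X t \<omega>) / \<Lambda> t \<le> X t \<omega> / \<Lambda> t) at_top"
          using eventually_gt_at_top[of 0]
        proof eventually_elim
          case (elim t)
          then show ?case using future_infimum_bounds(1)[OF \<open>\<omega> \<in> space N\<close>, of t] \<Lambda>[OF elim] elim by (intro divide_right_mono) linarith+
        qed
        show "frequently (\<lambda>t. level j * level j \<le> (X t \<omega> - future_infimum X t \<omega>) / \<Lambda> t) at_top" for j
          unfolding frequently_at_top_real
        proof
          fix k :: nat
          obtain t where t: "t \<in> D" "real k \<le> t" "level j * \<Lambda> t < X t \<omega>" "\<not> above (1 - level j) t nonneg_rats \<omega>" using elim(1) by blast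
          then have "0 < t" using D by auto
          then show "\<exists>t\<ge>real k. level j * level j \<le> (X t \<omega> - future_infimum X t \<omega>) / \<Lambda> t"
            using t \<Lambda>[of t] level(1)[of j] elim(3) by (intro exI[of _ t] conjI excess_ge) simp_all
        qed
      qed
    qed
  }
qed

text \<open>The pattern is that at infinity, with \<open>hits_near_0\<close>. Hypothesis
  \<open>rb1\<close> keeps the process away from 0 at later times and \<open>X0\<close> makes early
  values small, so that good times near 0 depend on the initial piece of the path.\<close>

theorem limsup_future_at_0:
  fixes \<Lambda> :: "real \<Rightarrow> real"
  assumes \<Lambda>: "\<And>t. 0 < t \<Longrightarrow> 0 < \<Lambda> t"
    and L: "AE \<omega> in N. Limsup (at_right 0) (\<lambda>t. ereal (X t \<omega> / \<Lambda> t)) = 1"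
    and X0: "AE \<omega> in N. X 0 \<omega> = 0"
    and rb1: "\<And>e. 0 < e \<Longrightarrow> \<exists>a>0. ratio_bound a True (1 - e)"
  shows "(\<And>a. 0 < a \<Longrightarrow> a < 1 \<Longrightarrow> \<exists>c>0. ratio_bound a True c) \<Longrightarrow>
      AE \<omega> in N. Limsup (at_right 0) (\<lambda>t. ereal (future_infimum X t \<omega> / \<Lambda> t)) = 1"
    and "(\<And>a. 0 < a \<Longrightarrow> a < 1 \<Longrightarrow> \<exists>c>0. ratio_bound a False c) \<Longrightarrow>
      AE \<omega> in N. Limsup (at_right 0) (\<lambda>t. ereal ((X t \<omega> - future_infimum X t \<omega>) / \<Lambda> t)) = 1"
proof -
  obtain D where D: "countable D" "D \<subseteq> {0<..}"
    and dense: "\<And>t e. 0 < t \<Longrightarrow> 0 < e \<Longrightarrow> \<exists>d\<in>D. t \<le> d \<and> d < t + e \<and> \<bar>\<Lambda> d - \<Lambda> t\<bar> < e"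
    using countable_right_dense_graph[of \<Lambda>] by blast
  have inf: "AE \<omega> in N. \<forall>k::nat. \<exists>t\<in>D. t < inverse (real (Suc k)) \<and> level j * \<Lambda> t < X t \<omega>" for j
    using L AE_space
  proof eventually_elim
    case (elim \<omega>)
    have freq: "frequently (\<lambda>t. level j < X t \<omega> / \<Lambda> t) (at_right 0)"
      by (rule frequently_if_Limsup_eq_1[OF elim(1) level(2)])
    show ?case
    proof
      fix k :: nat
      obtain t where t: "0 < t" "t < inverse (real (Suc k))" "level j < X t \<omega> / \<Lambda> t"
        using freq unfolding frequently_at_right_0 by blast
      then have "level j * \<Lambda> t < X t \<omega>" using \<Lambda>[of t] by (simp add: field_simps)
      then obtain d where "d \<in> D" "t \<le> d" "d < t + (inverse (real (Suc k)) - t)" "level j * \<Lambda> d < X d \<omega>"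
        using right_dense_witness[OF dense X_right_cont[OF elim(2)] t(1), of "level j" "inverse (real (Suc k)) - t"]
          level(1)[of j] t(2) by auto
      then show "\<exists>t\<in>D. t < inverse (real (Suc k)) \<and> level j * \<Lambda> t < X t \<omega>" by (intro bexI[of _ d]) auto
    qed
  qed
  have inf0: "AE \<omega> in N. \<forall>k::nat. \<exists>t\<in>D. t < inverse (real (Suc k)) \<and> 0 < X t \<omega>"
    using inf[of 0]
  proof eventually_elim
    case (elim \<omega>)
    show ?case
    proof
      fix k :: nat
      obtain t where t: "t \<in> D" "t < inverse (real (Suc k))" "level 0 * \<Lambda> t < X t \<omega>" using elim by blast
      moreover have "0 < level 0 * \<Lambda> t" using level(1)[of 0] \<Lambda>[of t] D t(1) by auto
      ultimately show "\<exists>t\<in>D. t < inverse (real (Suc k)) \<and> 0 < X t \<omega>" by (intro bexI[of _ t]) auto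
    qed
  qed
  note pos = AE_future_pos[OF D rb1 inf0]
  have hits: "AE \<omega> in N. \<forall>j. \<forall>k::nat. \<exists>t\<in>D. t < inverse (real (Suc k)) \<and> level j * \<Lambda> t < X t \<omega> \<and> (above (a j) t nonneg_rats \<omega> = b)"
    if "\<And>j. \<exists>c>0. ratio_bound (a j) b c" for a :: "nat \<Rightarrow> real" and b
  proof (rule AE_all_countable[THEN iffD2], rule allI)
    fix j
    from that[of j] obtain c where c: "0 < c" "ratio_bound (a j) b c" by blast
    have "0 \<le> level j * \<Lambda> t" if "0 < t" for t using level(1)[of j] \<Lambda>[OF that] by simp
    then show "AE \<omega> in N. \<forall>k::nat. \<exists>t\<in>D. t < inverse (real (Suc k)) \<and> level j * \<Lambda> t < X t \<omega> \<and> (above (a j) t nonneg_rats \<omega> = b)"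
      using c inf[of j] D X0 pos by (intro hits_near_0[where c=c]) (auto simp: ratio_bound_def simp del: of_nat_Suc)
  qed
  {
    assume rb: "\<And>a. 0 < a \<Longrightarrow> a < 1 \<Longrightarrow> \<exists>c>0. ratio_bound a True c"
    have "AE \<omega> in N. \<forall>j. \<forall>k::nat. \<exists>t\<in>D. t < inverse (real (Suc k)) \<and> level j * \<Lambda> t < X t \<omega> \<and> (above (level j) t nonneg_rats \<omega> = True)"
      by (rule hits) (use rb level in auto)
    from this L AE_space show "AE \<omega> in N. Limsup (at_right 0) (\<lambda>t. ereal (future_infimum X t \<omega> / \<Lambda> t)) = 1"
    proof eventually_elim
      case (elim \<omega>)
      show ?case
      proof (rule Limsup_ereal_eq_1[OF _ elim(2) _ level_sq_tendsto])
        show "eventually (\<lambda>t. future_infimum X t \<omega> / \<Lambda> t \<le> X t \<omega> / \<Lambda> t) (at_right 0)"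
          using eventually_at_right_less[of 0]
        proof eventually_elim
          case (elim t)
          then show ?case using future_infimum_bounds(2)[OF \<open>\<omega> \<in> space N\<close>, of t t] \<Lambda>[OF elim] elim by (intro divide_right_mono) linarith+
        qed
        show "frequently (\<lambda>t. level j * level j \<le> future_infimum X t \<omega> / \<Lambda> t) (at_right 0)" for j
          unfolding frequently_at_right_0
        proof
          fix k :: nat
          obtain t where t: "t \<in> D" "t < inverse (real (Suc k))" "level j * \<Lambda> t < X t \<omega>" "above (level j) t nonneg_rats \<omega>"
            using elim(1) by blast
          then have "0 < t" using D by auto
          then show "\<exists>t. 0 < t \<and> t < inverse (real (Suc k)) \<and> level j * level j \<le> future_infimum X t \<omega> / \<Lambda> t"
            using t \<Lambda>[of t] level(1)[of j] elim(3) by (intro exI[of _ t] conjI future_infimum_ge) simp_all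
        qed
      qed
    qed
  next
    assume rb: "\<And>a. 0 < a \<Longrightarrow> a < 1 \<Longrightarrow> \<exists>c>0. ratio_bound a False c"
    have "AE \<omega> in N. \<forall>j. \<forall>k::nat. \<exists>t\<in>D. t < inverse (real (Suc k)) \<and> level j * \<Lambda> t < X t \<omega> \<and> (above (1 - level j) t nonneg_rats \<omega> = False)"
      by (rule hits) (use rb level in auto)
    from this L AE_space show "AE \<omega> in N. Limsup (at_right 0) (\<lambda>t. ereal ((X t \<omega> - future_infimum X t \<omega>) / \<Lambda> t)) = 1"
    proof eventually_elim
      case (elim \<omega>)
      show ?case
      proof (rule Limsup_ereal_eq_1[OF _ elim(2) _ level_sq_tendsto])
        show "eventually (\<lambda>t. (X t \<omega> - future_infimum X t \<omega>) / \<Lambda> t \<le> X t \<omega> / \<Lambda> t) (at_right 0)"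
          using eventually_at_right_less[of 0]
        proof eventually_elim
          case (elim t)
          then show ?case using future_infimum_bounds(1)[OF \<open>\<omega> \<in> space N\<close>, of t] \<Lambda>[OF elim] elim by (intro divide_right_mono) linarith+
        qed
        show "frequently (\<lambda>t. level j * level j \<le> (X t \<omega> - future_infimum X t \<omega>) / \<Lambda> t) (at_right 0)" for j
          unfolding frequently_at_right_0
        proof
          fix k :: nat
          obtain t where t: "t \<in> D" "t < inverse (real (Suc k))" "level j * \<Lambda> t < X t \<omega>" "\<not> above (1 - level j) t nonneg_rats \<omega>"
            using elim(1) by blast
          then have "0 < t" using D by auto
          then show "\<exists>t. 0 < t \<and> t < inverse (real (Suc k)) \<and> level j * level j \<le> (X t \<omega> - future_infimum X t \<omega>) / \<Lambda> t"
            using t \<Lambda>[of t] level(1)[of j] elim(3) by (intro exI[of _ t] conjI excess_ge) simp_all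
        qed
      qed
    qed
  }
qed

end

section \<open>Ratio bounds for the self-similar process and its weak limit\<close>

lemma dip_eq_0I:
  assumes "\<And>v. v \<in> {0..L} \<Longrightarrow> a * \<bar>w t\<bar> \<le> w (t + \<bar>w t\<bar> * v)"
  shows "dip a L w t = 0"
proof (rule ccontr)
  assume "dip a L w t \<noteq> 0"
  then have "0 < dip a L w t" using dip_nonneg[where a=a and L=L and w=w and r=t] by simp
  from dip_posD[OF this] show False using assms by (meson not_le)
qed

text \<open>The indicator of a history event is one of the functionals \<open>F\<close> for which
  the Markov inequality is available.\<close>

lemma hist_ge_if_functional_ge:
  fixes Y :: "real \<Rightarrow> 'a \<Rightarrow> real"
  assumes M: "prob_space M"
    and Ym: "\<And>t. 0 \<le> t \<Longrightarrow> Y t \<in> borel_measurable M"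
    and Yrc: "\<And>\<omega>. \<omega> \<in> space M \<Longrightarrow> right_cont_path (\<lambda>t. Y t \<omega>)"
    and c: "0 \<le> c" and t: "0 < t"
    and ge: "\<And>F :: (real \<Rightarrow> real) \<Rightarrow> ennreal.
        (\<And>w w'. (\<And>u. 0 \<le> u \<Longrightarrow> u \<le> t \<Longrightarrow> w u = w' u) \<Longrightarrow> F w = F w') \<Longrightarrow> (\<And>w. F w \<le> 1) \<Longrightarrow>
        (\<And>(N :: 'a measure) Y. (\<And>u. 0 \<le> u \<Longrightarrow> Y u \<in> borel_measurable N) \<Longrightarrow>
          (\<And>\<omega>. \<omega> \<in> space N \<Longrightarrow> right_cont_path (\<lambda>u. Y u \<omega>)) \<Longrightarrow> (\<lambda>\<omega>. F (\<lambda>u. Y u \<omega>)) \<in> borel_measurable N) \<Longrightarrow>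
        ennreal c * (\<integral>\<^sup>+\<omega>. F (\<lambda>u. Y u \<omega>) \<partial>M)
          \<le> (\<integral>\<^sup>+\<omega>. F (\<lambda>u. Y u \<omega>) * indicator {\<omega>\<in>space M. defect \<alpha> \<beta> a L (\<lambda>u. Y u \<omega>) t = 0} \<omega> \<partial>M)"
    and C: "C \<in> sets (hist M Y t)"
  shows "c * measure M C \<le> measure M (C \<inter> {\<omega>\<in>space M. defect \<alpha> \<beta> a L (\<lambda>u. Y u \<omega>) t = 0})"
proof -
  interpret prob_space M by (rule M)
  define E where "E = {\<omega>\<in>space M. defect \<alpha> \<beta> a L (\<lambda>u. Y u \<omega>) t = 0}"
  have Em: "E \<in> events"
    unfolding E_def
    using Collect_in_sets[OF defect_measurable[OF Ym Yrc, of t \<alpha> \<beta> a L], of "{0}"] t by simp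
  obtain A where A: "A \<in> sets (borel :: (nat \<Rightarrow> real) measure)"
    "C = {\<omega>\<in>space M. (\<lambda>i. arctan (Y (rat_times t i) \<omega>)) \<in> A}" using hist_events[OF C] by blast
  have Cm: "C \<in> events" 
  proof -
    have "subalgebra M (hist M Y t)" by (rule subalgebra_hist) (use Ym t in simp_all)
    then show ?thesis using C by (simp add: subalgebra_def subset_iff)
  qed
  define F :: "(real \<Rightarrow> real) \<Rightarrow> ennreal" where "F w = indicator A (\<lambda>i. arctan (w (rat_times t i)))" for w
  have rt: "0 \<le> rat_times t i" "rat_times t i \<le> t" for i using rat_times_bounds[of t i] t by auto
  have "ennreal c * (\<integral>\<^sup>+\<omega>. F (\<lambda>u. Y u \<omega>) \<partial>M) \<le> (\<integral>\<^sup>+\<omega>. F (\<lambda>u. Y u \<omega>) * indicator E \<omega> \<partial>M)"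
    unfolding E_def
  proof (rule ge)
    show "F w = F w'" if "\<And>u. 0 \<le> u \<Longrightarrow> u \<le> t \<Longrightarrow> w u = w' u" for w w'
    proof -
      have "(\<lambda>i. arctan (w (rat_times t i))) = (\<lambda>i. arctan (w' (rat_times t i)))"
        by (rule ext) (simp only: that[OF rt])
      then show ?thesis by (simp only: F_def)
    qed
    show "F w \<le> 1" for w by (simp add: F_def indicator_def)
    fix N' :: "'a measure" and Z :: "real \<Rightarrow> 'a \<Rightarrow> real"
    assume Z: "\<And>u. 0 \<le> u \<Longrightarrow> Z u \<in> borel_measurable N'"
    have [measurable]: "(\<lambda>\<omega>. (\<lambda>i. arctan (Z (rat_times t i) \<omega>))) \<in> borel_measurable N'"
    proof (rule measurable_coordinatewise_then_product)
      have [measurable]: "Z (rat_times t i) \<in> borel_measurable N'" for i by (rule Z) (rule rt)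
      show "(\<lambda>\<omega>. arctan (Z (rat_times t i) \<omega>)) \<in> borel_measurable N'" for i by measurable
    qed
    have [measurable]: "A \<in> sets borel" by (rule A(1))
    show "(\<lambda>\<omega>. F (\<lambda>u. Z u \<omega>)) \<in> borel_measurable N'" unfolding F_def by measurable
  qed
  also have "(\<integral>\<^sup>+\<omega>. F (\<lambda>u. Y u \<omega>) * indicator E \<omega> \<partial>M) = (\<integral>\<^sup>+\<omega>. indicator (C \<inter> E) \<omega> \<partial>M)"
    by (rule nn_integral_cong) (auto simp: F_def A(2) indicator_def)
  also have "\<dots> = ennreal (prob (C \<inter> E))" using Cm Em by (simp add: emeasure_eq_measure)
  also have "(\<integral>\<^sup>+\<omega>. F (\<lambda>u. Y u \<omega>) \<partial>M) = (\<integral>\<^sup>+\<omega>. indicator C \<omega> \<partial>M)"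
    by (rule nn_integral_cong) (auto simp: F_def A(2) indicator_def)
  also have "\<dots> = ennreal (prob C)" using Cm by (simp add: emeasure_eq_measure)
  finally show ?thesis using c by (simp add: ennreal_mult'[symmetric] E_def)
qed

section \<open>Conditional bounds for the self-similar process\<close>

context lamperti_levy
begin

context
  fixes x r :: real and F :: "(real \<Rightarrow> real) \<Rightarrow> ennreal"
  assumes x: "0 < x" and r: "0 < r"
    and F_local: "\<And>w w'. (\<And>u. 0 \<le> u \<Longrightarrow> u \<le> r \<Longrightarrow> w u = w' u) \<Longrightarrow> F w = F w'"
    and F1: "\<And>w. F w \<le> 1"
    and F_meas: "\<And>(N :: 'a measure) Y. (\<And>u. 0 \<le> u \<Longrightarrow> Y u \<in> borel_measurable N) \<Longrightarrow>
      (\<And>\<omega>. \<omega> \<in> space N \<Longrightarrow> right_cont_path (\<lambda>u. Y u \<omega>)) \<Longrightarrow> (\<lambda>\<omega>. F (\<lambda>u. Y u \<omega>)) \<in> borel_measurable N"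
begin

lemma defect_events: "{\<omega>\<in>space M. defect \<alpha> \<beta> a L (\<lambda>u. lamperti \<xi> x u \<omega>) r = 0} \<in> events"
  using Collect_in_sets[OF defect_measurable[OF lamperti_meas[OF x] lamperti_right_cont[OF x], of r \<alpha> \<beta> a L], of "{0}"] r
  by simp

text \<open>If the Levy process stays above \<open>b\<close> relative to its value at the random
  time, the self-similar process keeps the fraction \<open>exp b\<close>, which is at least
  \<open>a\<close>. The constant is the probability of this and involves neither \<open>x\<close>
  nor \<open>r\<close> nor \<open>L\<close>.\<close>

lemma defect_ge_above:
  assumes "0 \<le> a" "a \<le> exp b"
  shows "ennreal (prob {\<omega>\<in>space M. \<forall>q\<in>nonneg_rats. \<xi> q \<omega> \<in> {b..}}) * (\<integral>\<^sup>+\<omega>. F (\<lambda>u. lamperti \<xi> x u \<omega>) \<partial>M)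
    \<le> (\<integral>\<^sup>+\<omega>. F (\<lambda>u. lamperti \<xi> x u \<omega>) * indicator {\<omega>\<in>space M. defect 1 0 a L (\<lambda>u. lamperti \<xi> x u \<omega>) r = 0} \<omega> \<partial>M)"
  unfolding mult.commute[of "ennreal _"]
proof (rule nn_integral_lamperti_past_future[OF x less_imp_le[OF r] F_local F1 F_meas countable_nonneg_rats nonneg_rats_subset _ defect_events])
  fix \<omega> assume \<omega>: "\<omega> \<in> space M" and R: "\<forall>v\<in>nonneg_rats. \<xi> (time_change (\<lambda>s. \<xi> s \<omega>) (r / x) + v) \<omega> -
      \<xi> (time_change (\<lambda>s. \<xi> s \<omega>) (r / x)) \<omega> \<in> {b..}"
  interpret P: lamperti_path "\<lambda>t. \<xi> t \<omega>" by (rule lamperti_path_xi[OF \<omega>])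
  have "dip a L (\<lambda>u. lamperti \<xi> x u \<omega>) r = 0"
  proof (rule dip_eq_0I)
    fix v assume v: "v \<in> {0..L}"
    have pos: "0 < lamperti \<xi> x r \<omega>" by (rule lamperti_pos[OF x])
    have "a * \<bar>lamperti \<xi> x r \<omega>\<bar> \<le> exp b * lamperti \<xi> x r \<omega>" using pos assms by (simp add: mult_right_mono)
    also have "\<dots> \<le> lamperti \<xi> x (r + \<bar>lamperti \<xi> x r \<omega>\<bar> * v) \<omega>"
      unfolding lamperti_def[of \<xi> x]
      by (rule P.lamperti_ge_if_path_ge[OF x less_imp_le[OF r] _ R]) (use v in auto)
    finally show "a * \<bar>lamperti \<xi> x r \<omega>\<bar> \<le> lamperti \<xi> x (r + \<bar>lamperti \<xi> x r \<omega>\<bar> * v) \<omega>" .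
  qed
  then show "\<omega> \<in> {\<omega>\<in>space M. defect 1 0 a L (\<lambda>u. lamperti \<xi> x u \<omega>) r = 0}"
    using \<omega> by (simp add: defect_def)
qed auto

text \<open>The choice \<open>a = 0\<close> expresses positivity as a vanishing defect, so that
  nonnegativity of the weak limit can be obtained by the same transfer.\<close>

lemma defect_ge_nonneg:
  "ennreal 1 * (\<integral>\<^sup>+\<omega>. F (\<lambda>u. lamperti \<xi> x u \<omega>) \<partial>M)
    \<le> (\<integral>\<^sup>+\<omega>. F (\<lambda>u. lamperti \<xi> x u \<omega>) * indicator {\<omega>\<in>space M. defect 1 0 0 L (\<lambda>u. lamperti \<xi> x u \<omega>) r = 0} \<omega> \<partial>M)"
proof -
  have "dip 0 L (\<lambda>u. lamperti \<xi> x u \<omega>) r = 0" for \<omega>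
    by (rule dip_eq_0I) (use lamperti_pos[OF x] in \<open>simp add: less_imp_le\<close>)
  then have "{\<omega>\<in>space M. defect 1 0 0 L (\<lambda>u. lamperti \<xi> x u \<omega>) r = 0} = space M" by (simp add: defect_def)
  then have "(\<integral>\<^sup>+\<omega>. F (\<lambda>u. lamperti \<xi> x u \<omega>) \<partial>M)
    = (\<integral>\<^sup>+\<omega>. F (\<lambda>u. lamperti \<xi> x u \<omega>) * indicator {\<omega>\<in>space M. defect 1 0 0 L (\<lambda>u. lamperti \<xi> x u \<omega>) r = 0} \<omega> \<partial>M)"
    by (intro nn_integral_cong) simp
  then show ?thesis by simp
qed

text \<open>A path in the tube produces a dip of guaranteed size; the parameter \<beta> of the
  defect is the constant of \<open>dip_ge_if_path_in_tube\<close>.\<close>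

lemma defect_ge_below:
  assumes s: "0 \<le> s0" "s0 < s1" and a: "exp b < a"
  shows "ennreal (prob {\<omega>\<in>space M. \<forall>q\<in>nonneg_rats. \<xi> q \<omega> \<in> tube s0 s1 K b q}) * (\<integral>\<^sup>+\<omega>. F (\<lambda>u. lamperti \<xi> x u \<omega>) \<partial>M)
    \<le> (\<integral>\<^sup>+\<omega>. F (\<lambda>u. lamperti \<xi> x u \<omega>) * indicator {\<omega>\<in>space M.
          defect (-1) ((s1 - s0) / 2 * exp (- K) * min 1 (a - exp b)) a (s1 * exp K) (\<lambda>u. lamperti \<xi> x u \<omega>) r = 0} \<omega> \<partial>M)"
  unfolding mult.commute[of "ennreal _"]
proof (rule nn_integral_lamperti_past_future[OF x less_imp_le[OF r] F_local F1 F_meas countable_nonneg_rats nonneg_rats_subset _ defect_events])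
  show "closed (tube s0 s1 K b v)" for v by (simp add: tube_def)
  fix \<omega> assume \<omega>: "\<omega> \<in> space M" and R: "\<forall>v\<in>nonneg_rats. \<xi> (time_change (\<lambda>s. \<xi> s \<omega>) (r / x) + v) \<omega> -
      \<xi> (time_change (\<lambda>s. \<xi> s \<omega>) (r / x)) \<omega> \<in> tube s0 s1 K b v"
  interpret P: lamperti_path "\<lambda>t. \<xi> t \<omega>" by (rule lamperti_path_xi[OF \<omega>])
  have "(s1 - s0) / 2 * exp (- K) * min 1 (a - exp b) * min 1 \<bar>lamperti \<xi> x r \<omega>\<bar> \<le> dip a (s1 * exp K) (\<lambda>u. lamperti \<xi> x u \<omega>) r"
    unfolding lamperti_def by (rule P.dip_ge_if_path_in_tube[OF x less_imp_le[OF r] s a R])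
  then show "\<omega> \<in> {\<omega>\<in>space M. defect (-1) ((s1 - s0) / 2 * exp (- K) * min 1 (a - exp b)) a (s1 * exp K) (\<lambda>u. lamperti \<xi> x u \<omega>) r = 0}"
    using \<omega> by (simp add: defect_def)
qed auto

end

lemma lamperti_nonneg_process: "0 < x \<Longrightarrow> nonneg_process M (lamperti \<xi> x)"
  by unfold_locales (auto simp: less_imp_le lamperti_pos intro: lamperti_meas lamperti_right_cont)

text \<open>The events with lower bound \<open>- real K\<close> increase with \<open>K\<close>, and
  their union has probability 1 by \<open>AE_xi_bounded_below\<close>.\<close>

lemma exists_above_const:
  assumes int: "integrable M (\<xi> 1)" and pos: "0 < expectation (\<xi> 1)" and e: "0 < e"
  shows "\<exists>b. 1 - e \<le> prob {\<omega>\<in>space M. \<forall>q\<in>nonneg_rats. \<xi> q \<omega> \<in> {b..}}"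
proof -
  define D where "D K = {\<omega>\<in>space M. \<forall>q\<in>nonneg_rats. \<xi> q \<omega> \<in> {- real K..}}" for K :: nat
  have Dm: "D K \<in> events" for K
    unfolding D_def by (rule xi_sets[OF countable_nonneg_rats nonneg_rats_subset]) auto
  have "(\<lambda>K. prob (D K)) \<longlonglongrightarrow> prob (\<Union>K. D K)"
  proof (rule finite_Lim_measure_incseq)
    show "incseq D" by (rule incseq_SucI) (force simp: D_def)
  qed (use Dm in auto)
  also have "prob (\<Union>K. D K) = 1"
  proof -
    have "AE \<omega> in M. \<omega> \<in> (\<Union>K. D K)"
      using AE_xi_bounded_below[OF int pos] AE_space by eventually_elim (auto simp: D_def)
    moreover have "(\<Union>K. D K) \<in> events" using Dm by auto
    ultimately show ?thesis by (simp add: prob_eq_1)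
  qed
  finally have "eventually (\<lambda>K. 1 - e < prob (D K)) sequentially"
    by (rule order_tendstoD) (use e in simp)
  then obtain K where "1 - e < prob (D K)" by (auto simp: eventually_sequentially)
  then show ?thesis by (intro exI[of _ "- real K"]) (simp add: D_def)
qed

lemma lamperti_ratio_bounds:
  assumes x: "0 < x"
  shows "0 \<le> a \<Longrightarrow> a \<le> exp b \<Longrightarrow>
      nonneg_process.ratio_bound M (lamperti \<xi> x) a True (prob {\<omega>\<in>space M. \<forall>q\<in>nonneg_rats. \<xi> q \<omega> \<in> {b..}})"
    and "0 \<le> s0 \<Longrightarrow> s0 < s1 \<Longrightarrow> exp b < a \<Longrightarrow>
      nonneg_process.ratio_bound M (lamperti \<xi> x) a False (prob {\<omega>\<in>space M. \<forall>q\<in>nonneg_rats. \<xi> q \<omega> \<in> tube s0 s1 K b q})"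
proof -
  interpret X: nonneg_process M "lamperti \<xi> x" by (rule lamperti_nonneg_process[OF x])
  note hist = hist_ge_if_functional_ge[OF prob_space_axioms _ _ measure_nonneg]
  show "X.ratio_bound a True (prob {\<omega>\<in>space M. \<forall>q\<in>nonneg_rats. \<xi> q \<omega> \<in> {b..}})" if "0 \<le> a" "a \<le> exp b"
  proof (rule X.ratio_bound_True_if_defect)
    fix t C and L :: nat assume tC: "0 < t" "C \<in> sets (hist M (lamperti \<xi> x) t)"
    show "prob {\<omega>\<in>space M. \<forall>q\<in>nonneg_rats. \<xi> q \<omega> \<in> {b..}} * prob C \<le> prob (C \<inter> {\<omega>\<in>space M. defect 1 0 a (real L) (\<lambda>u. lamperti \<xi> x u \<omega>) t = 0})"
    proof (rule hist[OF _ _ tC(1) _ tC(2)])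
      fix F :: "(real \<Rightarrow> real) \<Rightarrow> ennreal"
      assume F: "\<And>w w'. (\<And>u. 0 \<le> u \<Longrightarrow> u \<le> t \<Longrightarrow> w u = w' u) \<Longrightarrow> F w = F w'" "\<And>w. F w \<le> 1"
        "\<And>(N :: 'a measure) Y. (\<And>u. 0 \<le> u \<Longrightarrow> Y u \<in> borel_measurable N) \<Longrightarrow>
          (\<And>\<omega>. \<omega> \<in> space N \<Longrightarrow> right_cont_path (\<lambda>u. Y u \<omega>)) \<Longrightarrow> (\<lambda>\<omega>. F (\<lambda>u. Y u \<omega>)) \<in> borel_measurable N"
      show "ennreal (prob {\<omega>\<in>space M. \<forall>q\<in>nonneg_rats. \<xi> q \<omega> \<in> {b..}}) * (\<integral>\<^sup>+\<omega>. F (\<lambda>u. lamperti \<xi> x u \<omega>) \<partial>M)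
        \<le> (\<integral>\<^sup>+\<omega>. F (\<lambda>u. lamperti \<xi> x u \<omega>) * indicator {\<omega>\<in>space M. defect 1 0 a (real L) (\<lambda>u. lamperti \<xi> x u \<omega>) t = 0} \<omega> \<partial>M)"
        by (rule defect_ge_above[OF x tC(1) F that])
    qed (auto intro: lamperti_meas[OF x] lamperti_right_cont[OF x])
  qed
  show "X.ratio_bound a False (prob {\<omega>\<in>space M. \<forall>q\<in>nonneg_rats. \<xi> q \<omega> \<in> tube s0 s1 K b q})"
    if "0 \<le> s0" "s0 < s1" "exp b < a"
  proof (rule X.ratio_bound_False_if_defect)
    show "0 < (s1 - s0) / 2 * exp (- K) * min 1 (a - exp b)" using that by simp
  next
    fix t C assume tC: "0 < t" "C \<in> sets (hist M (lamperti \<xi> x) t)"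
    show "prob {\<omega>\<in>space M. \<forall>q\<in>nonneg_rats. \<xi> q \<omega> \<in> tube s0 s1 K b q} * prob C \<le> prob (C \<inter> {\<omega>\<in>space M. defect (-1) ((s1 - s0) / 2 * exp (- K) * min 1 (a - exp b)) a (s1 * exp K) (\<lambda>u. lamperti \<xi> x u \<omega>) t = 0})"
    proof (rule hist[OF _ _ tC(1) _ tC(2)])
      fix F :: "(real \<Rightarrow> real) \<Rightarrow> ennreal"
      assume F: "\<And>w w'. (\<And>u. 0 \<le> u \<Longrightarrow> u \<le> t \<Longrightarrow> w u = w' u) \<Longrightarrow> F w = F w'" "\<And>w. F w \<le> 1"
        "\<And>(N :: 'a measure) Y. (\<And>u. 0 \<le> u \<Longrightarrow> Y u \<in> borel_measurable N) \<Longrightarrow>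
          (\<And>\<omega>. \<omega> \<in> space N \<Longrightarrow> right_cont_path (\<lambda>u. Y u \<omega>)) \<Longrightarrow> (\<lambda>\<omega>. F (\<lambda>u. Y u \<omega>)) \<in> borel_measurable N"
      show "ennreal (prob {\<omega>\<in>space M. \<forall>q\<in>nonneg_rats. \<xi> q \<omega> \<in> tube s0 s1 K b q}) * (\<integral>\<^sup>+\<omega>. F (\<lambda>u. lamperti \<xi> x u \<omega>) \<partial>M)
        \<le> (\<integral>\<^sup>+\<omega>. F (\<lambda>u. lamperti \<xi> x u \<omega>) * indicator {\<omega>\<in>space M. defect (-1) ((s1 - s0) / 2 * exp (- K) * min 1 (a - exp b)) a (s1 * exp K) (\<lambda>u. lamperti \<xi> x u \<omega>) t = 0} \<omega> \<partial>M)"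
        by (rule defect_ge_below[OF x tC(1) F that])
    qed (auto intro: lamperti_meas[OF x] lamperti_right_cont[OF x])
  qed
qed

context
  fixes N :: "'b measure" and X :: "real \<Rightarrow> 'b \<Rightarrow> real"
  assumes N: "prob_space N"
    and Xm: "\<And>t. 0 \<le> t \<Longrightarrow> X t \<in> borel_measurable N"
    and Xc: "\<And>\<omega>. \<omega> \<in> space N \<Longrightarrow> cadlag (\<lambda>t. X t \<omega>)"
    and weak: "skorokhod_weak_limit M (lamperti \<xi>) (at_right 0) N X"
begin

text \<open>For \<open>a = 0\<close> the dip integrates the truncated negative part of the path. It
  vanishes for every approximating process, hence for the limit at each fixed positive time;
  rational times and right-continuity then give all times.\<close>

lemma limit_nonneg: "AE \<omega> in N. \<forall>t\<ge>0. 0 \<le> X t \<omega>"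
proof -
  interpret N: prob_space N by (rule N)
  have Xrc: "right_cont_path (\<lambda>t. X t \<omega>)" if "\<omega> \<in> space N" for \<omega>
    by (rule cadlag_imp_right_cont_path[OF Xc[OF that]])
  have ae: "AE \<omega> in N. 0 \<le> X t \<omega>" if t: "0 < t" for t
  proof -
    let ?E = "{\<omega>\<in>space N. defect 1 0 0 1 (\<lambda>u. X u \<omega>) t = 0}"
    have Em: "?E \<in> N.events"
      using Collect_in_sets[OF defect_measurable[OF Xm Xrc, of t 1 0 0 1], of "{0}"] t by simp
    have "1 * measure N (space N) \<le> measure N (space N \<inter> ?E)"
    proof (rule defect_transfer[OF prob_space_axioms N _ _ _ _ weak _ _ t])
      show "space N \<in> sets (hist N X t)" using sets.top[of "hist N X t"] by simp
      fix x r :: real and F :: "(real \<Rightarrow> real) \<Rightarrow> ennreal" assume x: "0 < x" "0 < r"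
    assume F: "\<And>w w' :: real \<Rightarrow> real. (\<And>u. 0 \<le> u \<Longrightarrow> u \<le> r \<Longrightarrow> w u = w' u) \<Longrightarrow> F w = F w'" "\<And>w. F w \<le> 1"
      "\<And>(N :: 'a measure) Y. (\<And>u. 0 \<le> u \<Longrightarrow> Y u \<in> borel_measurable N) \<Longrightarrow>
        (\<And>\<omega>. \<omega> \<in> space N \<Longrightarrow> right_cont_path (\<lambda>u. Y u \<omega>)) \<Longrightarrow> (\<lambda>\<omega>. F (\<lambda>u. Y u \<omega>)) \<in> borel_measurable N"
      show "ennreal 1 * (\<integral>\<^sup>+\<omega>. F (\<lambda>u. lamperti \<xi> x u \<omega>) \<partial>M)
        \<le> (\<integral>\<^sup>+\<omega>. F (\<lambda>u. lamperti \<xi> x u \<omega>) * indicator {\<omega>\<in>space M. defect 1 0 0 1 (\<lambda>u. lamperti \<xi> x u \<omega>) r = 0} \<omega> \<partial>M)"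
        using defect_ge_nonneg[where F=F and L=1, OF x F] by simp
    qed (auto intro: lamperti_meas lamperti_right_cont Xm Xc)
    then have "N.prob ?E = 1"
      using N.prob_le_1[of ?E] Em by (simp add: N.prob_space Int_absorb1)
    then have "AE \<omega> in N. \<omega> \<in> ?E" using Em by (simp add: N.prob_eq_1)
    then show ?thesis
      using AE_space
    proof eventually_elim
      case (elim \<omega>)
      then have d0: "dip 0 1 (\<lambda>u. X u \<omega>) t = 0"
        using dip_nonneg[of 0 1 "\<lambda>u. X u \<omega>" t] by (simp add: defect_def)
      show ?case
      proof (rule ccontr)
        assume "\<not> 0 \<le> X t \<omega>"
        then have "0 < dip 0 1 (\<lambda>u. X u \<omega>) t"
          using t by (intro dip_pos[where v=0] Xrc elim(2)) auto
        then show False using d0 by simp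
      qed
    qed
  qed
  have "AE \<omega> in N. \<forall>q\<in>nonneg_rats - {0}. 0 \<le> X q \<omega>"
  proof (intro AE_ball_countable[THEN iffD2] ballI)
    show "countable (nonneg_rats - {0})" by (intro countable_Diff countable_nonneg_rats)
    show "AE \<omega> in N. 0 \<le> X q \<omega>" if "q \<in> nonneg_rats - {0}" for q
      using that nonneg_rats_ge_0[of q] by (intro ae) auto
  qed
  then show ?thesis
    using AE_space
  proof eventually_elim
    case (elim \<omega>)
    show ?case
    proof (intro allI impI)
      fix t :: real assume t: "0 \<le> t"
      show "0 \<le> X t \<omega>"
      proof (rule ccontr)
        assume "\<not> 0 \<le> X t \<omega>"
        then have "X t \<omega> < 0" by simp
        have "eventually (\<lambda>u. X u \<omega> < 0) (at_right t)"
          by (rule order_tendstoD(2)[OF right_cont_pathD[OF Xrc[OF elim(2)] t] \<open>X t \<omega> < 0\<close>])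
        then obtain u where u: "t < u" "\<And>y. t < y \<Longrightarrow> y < u \<Longrightarrow> X y \<omega> < 0" by (auto simp: eventually_at_right_field)
        obtain q where q: "q \<in> \<rat>" "t < q" "q < u" using Rats_dense_in_real[OF u(1)] by blast
        then have "q \<in> nonneg_rats - {0}" using t by (auto simp: nonneg_rats_def)
        then have "0 \<le> X q \<omega>" by (rule bspec[OF elim(1)])
        then show False using u(2)[OF q(2,3)] by simp
      qed
    qed
  qed
qed

text \<open>The functional \<open>min 1 \<bar>w 0\<bar>\<close> is Skorokhod continuous because
  increasing bijections of \<open>{0..}\<close> fix 0, and its mean under the approximations is
  \<open>min 1 x\<close>.\<close>

lemma limit_starts_at_0: "AE \<omega> in N. X 0 \<omega> = 0"
proof -
  interpret N: prob_space N by (rule N)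
  define F :: "(real \<Rightarrow> real) \<Rightarrow> real" where "F w = min 1 \<bar>w 0\<bar>" for w
  have cont: "skorokhod_continuous F"
    unfolding skorokhod_continuous_def
  proof (intro allI impI)
    fix w v assume "skorokhod_tendsto w v"
    then obtain \<theta> :: "nat \<Rightarrow> real \<Rightarrow> real" where
      \<theta>: "\<And>n. strict_mono_on {0..} (\<theta> n)" "\<And>n. \<theta> n ` {0..} = {0..}"
      and u: "\<And>T. uniform_limit {0..T} (\<lambda>n s. w n (\<theta> n s)) v sequentially"
      by (auto simp: skorokhod_tendsto_def)
    have \<theta>0: "\<theta> n 0 = 0" for n
    proof -
      have "0 \<in> \<theta> n ` {0..}" unfolding \<theta>(2) by simp
      then obtain s where s: "0 \<le> s" "\<theta> n s = 0" by auto
      have "0 \<le> \<theta> n 0" using \<theta>(2)[of n] by auto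
      then show ?thesis using strict_mono_onD[OF \<theta>(1)[of n], of 0 s] s by (cases "s = 0") auto
    qed
    have "(\<lambda>n. w n (\<theta> n 0)) \<longlonglongrightarrow> v 0"
      by (rule tendsto_uniform_limitI[OF u[of 0]]) simp
    then show "(\<lambda>n. F (w n)) \<longlonglongrightarrow> F v"
      unfolding F_def \<theta>0 by (intro tendsto_min tendsto_const tendsto_rabs)
  qed
  have "bounded (range F)" unfolding bounded_iff by (intro exI[of _ 1]) (auto simp: F_def)
  then have lim: "((\<lambda>x. \<integral>\<omega>. F (\<lambda>t. lamperti \<xi> x t \<omega>) \<partial>completion M) \<longlongrightarrow> (\<integral>\<omega>. F (\<lambda>t. X t \<omega>) \<partial>completion N)) (at_right 0)"
    using weak cont unfolding skorokhod_weak_limit_def by blast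
  have "(\<integral>\<omega>. F (\<lambda>t. lamperti \<xi> x t \<omega>) \<partial>completion M) = min 1 x" if x: "0 < x" for x
  proof -
    have eq: "F (\<lambda>t. lamperti \<xi> x t \<omega>) = min 1 x" if \<omega>: "\<omega> \<in> space M" for \<omega>
    proof -
      interpret P: lamperti_path "\<lambda>t. \<xi> t \<omega>" by (rule lamperti_path_xi[OF \<omega>])
      show ?thesis using x by (simp add: F_def lamperti_def xi_0[OF \<omega>])
    qed
    have "(\<integral>\<omega>. F (\<lambda>t. lamperti \<xi> x t \<omega>) \<partial>completion M) = (\<integral>\<omega>. min 1 x \<partial>completion M)"
      by (rule Bochner_Integration.integral_cong) (use eq in auto)
    also have "\<dots> = (\<integral>\<omega>. min 1 x \<partial>M)" by (rule integral_completion) simp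
    finally show ?thesis by (simp add: prob_space)
  qed
  then have "eventually (\<lambda>x. (\<integral>\<omega>. F (\<lambda>t. lamperti \<xi> x t \<omega>) \<partial>completion M) = min 1 x) (at_right 0)"
    by (auto simp: eventually_at_right_field intro: exI[of _ 1])
  moreover have "((\<lambda>x::real. min 1 x) \<longlongrightarrow> min 1 0) (at_right 0)" by (intro tendsto_intros)
  ultimately have "((\<lambda>x. \<integral>\<omega>. F (\<lambda>t. lamperti \<xi> x t \<omega>) \<partial>completion M) \<longlongrightarrow> 0) (at_right 0)"
    by (subst tendsto_cong) auto
  then have "(\<integral>\<omega>. F (\<lambda>t. X t \<omega>) \<partial>completion N) = 0"
    using tendsto_unique[OF _ lim] by simp
  moreover have m: "(\<lambda>\<omega>. F (\<lambda>t. X t \<omega>)) \<in> borel_measurable N"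
  proof -
    have [measurable]: "X 0 \<in> borel_measurable N" by (rule Xm) simp
    show ?thesis unfolding F_def by measurable
  qed
  ultimately have "(\<integral>\<omega>. F (\<lambda>t. X t \<omega>) \<partial>N) = 0" by (simp add: integral_completion)
  moreover have "integrable N (\<lambda>\<omega>. F (\<lambda>t. X t \<omega>))"
    by (rule N.integrable_const_bound[where B=1]) (use m in \<open>auto simp: F_def\<close>)
  ultimately have "AE \<omega> in N. F (\<lambda>t. X t \<omega>) = 0"
    using integral_nonneg_eq_0_iff_AE[of N "\<lambda>\<omega>. F (\<lambda>t. X t \<omega>)"] by (auto simp: F_def)
  then show ?thesis by eventually_elim (auto simp: F_def min_def split: if_splits)
qed

text \<open>The constants are probabilities about \<xi> alone, hence uniform in \<open>x\<close>, as
  the transfer requires.\<close>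

lemma limit_ratio_bounds:
  assumes X: "nonneg_process N X"
  shows "0 \<le> a \<Longrightarrow> a \<le> exp b \<Longrightarrow>
      nonneg_process.ratio_bound N X a True (prob {\<omega>\<in>space M. \<forall>q\<in>nonneg_rats. \<xi> q \<omega> \<in> {b..}})"
    and "0 \<le> s0 \<Longrightarrow> s0 < s1 \<Longrightarrow> exp b < a \<Longrightarrow>
      nonneg_process.ratio_bound N X a False (prob {\<omega>\<in>space M. \<forall>q\<in>nonneg_rats. \<xi> q \<omega> \<in> tube s0 s1 K b q})"
proof -
  interpret X: nonneg_process N X by (rule X)
  note transfer = defect_transfer[OF prob_space_axioms N _ _ _ _ weak measure_nonneg]
  show "X.ratio_bound a True (prob {\<omega>\<in>space M. \<forall>q\<in>nonneg_rats. \<xi> q \<omega> \<in> {b..}})" if "0 \<le> a" "a \<le> exp b"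
  proof (rule X.ratio_bound_True_if_defect)
    fix t C and L :: nat assume tC: "0 < t" "C \<in> sets (hist N X t)"
    show "prob {\<omega>\<in>space M. \<forall>q\<in>nonneg_rats. \<xi> q \<omega> \<in> {b..}} * measure N C \<le> measure N (C \<inter> {\<omega>\<in>space N. defect 1 0 a (real L) (\<lambda>u. X u \<omega>) t = 0})"
    proof (rule transfer[OF _ _ _ _ _ tC])
      fix x r :: real and F :: "(real \<Rightarrow> real) \<Rightarrow> ennreal"
      assume x: "0 < x" "0 < r"
      assume F: "\<And>w w'. (\<And>u. 0 \<le> u \<Longrightarrow> u \<le> r \<Longrightarrow> w u = w' u) \<Longrightarrow> F w = F w'" "\<And>w. F w \<le> 1"
        "\<And>(N :: 'a measure) Y. (\<And>u. 0 \<le> u \<Longrightarrow> Y u \<in> borel_measurable N) \<Longrightarrow>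
          (\<And>\<omega>. \<omega> \<in> space N \<Longrightarrow> right_cont_path (\<lambda>u. Y u \<omega>)) \<Longrightarrow> (\<lambda>\<omega>. F (\<lambda>u. Y u \<omega>)) \<in> borel_measurable N"
      show "ennreal (prob {\<omega>\<in>space M. \<forall>q\<in>nonneg_rats. \<xi> q \<omega> \<in> {b..}}) * (\<integral>\<^sup>+\<omega>. F (\<lambda>u. lamperti \<xi> x u \<omega>) \<partial>M)
        \<le> (\<integral>\<^sup>+\<omega>. F (\<lambda>u. lamperti \<xi> x u \<omega>) * indicator {\<omega>\<in>space M. defect 1 0 a (real L) (\<lambda>u. lamperti \<xi> x u \<omega>) r = 0} \<omega> \<partial>M)"
        by (rule defect_ge_above[OF x F that])
    qed (auto intro: lamperti_meas lamperti_right_cont Xm Xc)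
  qed
  show "X.ratio_bound a False (prob {\<omega>\<in>space M. \<forall>q\<in>nonneg_rats. \<xi> q \<omega> \<in> tube s0 s1 K b q})"
    if "0 \<le> s0" "s0 < s1" "exp b < a"
  proof (rule X.ratio_bound_False_if_defect)
    show "0 < (s1 - s0) / 2 * exp (- K) * min 1 (a - exp b)" using that by simp
  next
    fix t C assume tC: "0 < t" "C \<in> sets (hist N X t)"
    show "prob {\<omega>\<in>space M. \<forall>q\<in>nonneg_rats. \<xi> q \<omega> \<in> tube s0 s1 K b q} * measure N C \<le> measure N (C \<inter> {\<omega>\<in>space N. defect (-1) ((s1 - s0) / 2 * exp (- K) * min 1 (a - exp b)) a (s1 * exp K) (\<lambda>u. X u \<omega>) t = 0})"
    proof (rule transfer[OF _ _ _ _ _ tC])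
      fix x r :: real and F :: "(real \<Rightarrow> real) \<Rightarrow> ennreal"
      assume x: "0 < x" "0 < r"
      assume F: "\<And>w w'. (\<And>u. 0 \<le> u \<Longrightarrow> u \<le> r \<Longrightarrow> w u = w' u) \<Longrightarrow> F w = F w'" "\<And>w. F w \<le> 1"
        "\<And>(N :: 'a measure) Y. (\<And>u. 0 \<le> u \<Longrightarrow> Y u \<in> borel_measurable N) \<Longrightarrow>
          (\<And>\<omega>. \<omega> \<in> space N \<Longrightarrow> right_cont_path (\<lambda>u. Y u \<omega>)) \<Longrightarrow> (\<lambda>\<omega>. F (\<lambda>u. Y u \<omega>)) \<in> borel_measurable N"
      show "ennreal (prob {\<omega>\<in>space M. \<forall>q\<in>nonneg_rats. \<xi> q \<omega> \<in> tube s0 s1 K b q}) * (\<integral>\<^sup>+\<omega>. F (\<lambda>u. lamperti \<xi> x u \<omega>) \<partial>M)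
        \<le> (\<integral>\<^sup>+\<omega>. F (\<lambda>u. lamperti \<xi> x u \<omega>) * indicator {\<omega>\<in>space M. defect (-1) ((s1 - s0) / 2 * exp (- K) * min 1 (a - exp b)) a (s1 * exp K) (\<lambda>u. lamperti \<xi> x u \<omega>) r = 0} \<omega> \<partial>M)"
        by (rule defect_ge_below[OF x F that])
    qed (auto intro: lamperti_meas lamperti_right_cont Xm Xc)
  qed
qed

end

end

section \<open>Removing null sets, and conclusion\<close>

lemma (in prob_space) indep_vars_cong_AE:
  assumes ind: "indep_vars M' X I" and I: "finite I"
    and Y: "\<And>i. i \<in> I \<Longrightarrow> Y i \<in> measurable M (M' i)"
    and eq: "\<And>i. i \<in> I \<Longrightarrow> AE \<omega> in M. X i \<omega> = Y i \<omega>"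
  shows "indep_vars M' Y I"
proof (cases "I = {}")
  case True
  then show ?thesis by (simp add: indep_vars_def indep_sets_def)
next
  case False
  have X: "X i \<in> measurable M (M' i)" if "i \<in> I" for i using ind that by (auto simp: indep_vars_def)
  have ae: "AE \<omega> in M. \<forall>i\<in>I. X i \<omega> = Y i \<omega>"
    using eq I by (intro AE_ball_countable[THEN iffD2] countable_finite ballI)
  have "distr M (Pi\<^sub>M I M') (\<lambda>\<omega>. \<lambda>i\<in>I. Y i \<omega>) = distr M (Pi\<^sub>M I M') (\<lambda>\<omega>. \<lambda>i\<in>I. X i \<omega>)"
  proof (rule distr_cong_AE)
    show "AE \<omega> in M. (\<lambda>i\<in>I. Y i \<omega>) = (\<lambda>i\<in>I. X i \<omega>)"
      using ae by eventually_elim (auto simp: restrict_def)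
  qed (auto intro!: measurable_restrict X Y)
  also have "\<dots> = Pi\<^sub>M I (\<lambda>i. distr M (M' i) (X i))"
    using indep_vars_iff_distr_eq_PiM'[OF False X] ind by simp
  also have "\<dots> = Pi\<^sub>M I (\<lambda>i. distr M (M' i) (Y i))"
    using eq X Y by (intro PiM_cong distr_cong_AE) auto
  finally show ?thesis using indep_vars_iff_distr_eq_PiM'[OF False Y] by simp
qed

lemma levy_modification:
  assumes M: "prob_space M" and meas: "\<And>t. 0 \<le> t \<Longrightarrow> \<xi> t \<in> borel_measurable M"
    and stat: "\<And>s t. 0 \<le> s \<Longrightarrow> 0 \<le> t \<Longrightarrow> distr M borel (\<lambda>\<omega>. \<xi> (s + t) \<omega> - \<xi> s \<omega>) = distr M borel (\<xi> t)"
    and indep: "\<And>(t :: nat \<Rightarrow> real) n. 0 \<le> t 0 \<Longrightarrow> mono t \<Longrightarrow>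
      prob_space.indep_vars M (\<lambda>_. borel) (\<lambda>i \<omega>. \<xi> (t (Suc i)) \<omega> - \<xi> (t i) \<omega>) {..<n}"
    and Z: "Z \<in> null_sets M"
    and out: "\<And>\<omega>. \<omega> \<in> space M - Z \<Longrightarrow> cadlag (\<lambda>t. \<xi> t \<omega>) \<and> \<xi> 0 \<omega> = 0"
  shows "levy M (\<lambda>t \<omega>. if \<omega> \<in> Z then 0 else \<xi> t \<omega>)"
proof -
  interpret prob_space M by (rule M)
  let ?\<xi> = "\<lambda>t \<omega>. if \<omega> \<in> Z then 0 else \<xi> t \<omega>"
  have Zm [measurable]: "Z \<in> events" using Z by auto
  have m: "?\<xi> t \<in> borel_measurable M" if "0 \<le> t" for t
    using meas[OF that] by measurable
  have ae: "AE \<omega> in M. ?\<xi> t \<omega> = \<xi> t \<omega>" for t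
    using AE_not_in[OF Z] by eventually_elim simp
  show ?thesis
  proof (unfold_locales)
    show "?\<xi> t \<in> borel_measurable M" if "0 \<le> t" for t by (rule m[OF that])
    show "cadlag (\<lambda>t. ?\<xi> t \<omega>)" if "\<omega> \<in> space M" for \<omega>
      using out[of \<omega>] that by (cases "\<omega> \<in> Z") (auto simp: cadlag_def)
    show "?\<xi> 0 \<omega> = 0" if "\<omega> \<in> space M" for \<omega> using out[of \<omega>] that by auto
    fix s t :: real assume st: "0 \<le> s" "0 \<le> t"
    have "distr M borel (\<lambda>\<omega>. ?\<xi> (s + t) \<omega> - ?\<xi> s \<omega>) = distr M borel (\<lambda>\<omega>. \<xi> (s + t) \<omega> - \<xi> s \<omega>)"
    proof (rule distr_cong_AE)
      show "AE \<omega> in M. ?\<xi> (s + t) \<omega> - ?\<xi> s \<omega> = \<xi> (s + t) \<omega> - \<xi> s \<omega>"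
        using ae[of "s + t"] ae[of s] by eventually_elim simp
    qed (use st in \<open>auto intro!: borel_measurable_diff m meas\<close>)
    also have "\<dots> = distr M borel (\<xi> t)" by (rule stat[OF st])
    also have "\<dots> = distr M borel (?\<xi> t)"
      by (rule distr_cong_AE) (use ae[of t] m[OF st(2)] meas[OF st(2)] in \<open>auto elim: eventually_mono\<close>)
    finally show "distr M borel (\<lambda>\<omega>. ?\<xi> (s + t) \<omega> - ?\<xi> s \<omega>) = distr M borel (?\<xi> t)" .
  next
    fix t :: "nat \<Rightarrow> real" and n assume t: "0 \<le> t 0" "mono t"
    have tn: "0 \<le> t i" for i using monoD[OF t(2), of 0 i] t(1) by simp
    show "indep_vars (\<lambda>_. borel) (\<lambda>i \<omega>. ?\<xi> (t (Suc i)) \<omega> - ?\<xi> (t i) \<omega>) {..<n}"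
    proof (rule indep_vars_cong_AE[OF indep[OF t]])
      show "AE \<omega> in M. \<xi> (t (Suc i)) \<omega> - \<xi> (t i) \<omega> = ?\<xi> (t (Suc i)) \<omega> - ?\<xi> (t i) \<omega>" for i
        using ae[of "t (Suc i)"] ae[of "t i"] by eventually_elim simp
    qed (auto intro!: borel_measurable_diff m tn)
  qed
qed

text \<open>Test functionals are arbitrary on irregular paths, so \<open>f\<close> and
  \<open>g\<close> need not be measurable for \<open>M\<close>. In the completion, a change on a
  null set preserves measurability; if neither function is measurable, both integrals are 0 by
  convention.\<close>

lemma integral_completion_cong_null:
  fixes f g :: "'a \<Rightarrow> real"
  assumes Z: "Z \<in> null_sets M" and eq: "\<And>\<omega>. \<omega> \<in> space M - Z \<Longrightarrow> f \<omega> = g \<omega>"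
  shows "integral\<^sup>L (completion M) f = integral\<^sup>L (completion M) g"
proof -
  have one: "g \<in> borel_measurable (completion M)"
    if f: "f \<in> borel_measurable (completion M)" and eq: "\<And>\<omega>. \<omega> \<in> space M - Z \<Longrightarrow> f \<omega> = g \<omega>" for f g :: "'a \<Rightarrow> real"
  proof (rule measurableI)
    fix A :: "real set" assume A: "A \<in> sets borel"
    have "g -` A \<inter> space (completion M) = (f -` A \<inter> space (completion M) - Z) \<union> (g -` A \<inter> space M \<inter> Z)"
      using eq by auto
    moreover have "f -` A \<inter> space (completion M) - Z \<in> sets (completion M)"
      using measurable_sets[OF f A] Z by (intro sets.Diff) (auto intro: sets_completionI_sets)
    moreover have "g -` A \<inter> space M \<inter> Z \<in> sets (completion M)"
      by (rule null_sets_completion[OF Z]) auto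
    ultimately show "g -` A \<inter> space (completion M) \<in> sets (completion M)" by (simp only: sets.Un)
  qed simp
  have iff: "f \<in> borel_measurable (completion M) \<longleftrightarrow> g \<in> borel_measurable (completion M)"
  proof
    show "g \<in> borel_measurable (completion M)" if "f \<in> borel_measurable (completion M)" by (rule one[OF that eq])
    show "f \<in> borel_measurable (completion M)" if "g \<in> borel_measurable (completion M)"
      by (rule one[OF that]) (rule eq[symmetric])
  qed
  show ?thesis
  proof (cases "f \<in> borel_measurable (completion M)")
    case True
    have "AE \<omega> in completion M. f \<omega> = g \<omega>"
    proof (rule AE_completion)
      show "AE \<omega> in M. f \<omega> = g \<omega>" using AE_not_in[OF Z] AE_space by eventually_elim (simp add: eq)
    qed
    then show ?thesis using True iff by (intro integral_cong_AE) auto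
  next
    case False
    then have "\<not> integrable (completion M) f" "\<not> integrable (completion M) g"
      using iff borel_measurable_integrable by blast+
    then show ?thesis by (simp add: not_integrable_integral_eq)
  qed
qed

lemma skorokhod_weak_limit_modification:
  assumes weak: "skorokhod_weak_limit M Y G N X" and Z: "Z \<in> null_sets M" "Z' \<in> null_sets N"
    and Y: "\<And>i t \<omega>. \<omega> \<in> space M - Z \<Longrightarrow> Y' i t \<omega> = Y i t \<omega>"
    and X: "\<And>t \<omega>. \<omega> \<in> space N - Z' \<Longrightarrow> X' t \<omega> = X t \<omega>"
  shows "skorokhod_weak_limit M Y' G N X'"
proof -
  have "(\<integral>\<omega>. F (\<lambda>t. Y' i t \<omega>) \<partial>completion M) = (\<integral>\<omega>. F (\<lambda>t. Y i t \<omega>) \<partial>completion M)" for F :: "_ \<Rightarrow> real" and i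
    by (rule integral_completion_cong_null[OF Z(1)]) (simp only: Y)
  moreover have "(\<integral>\<omega>. F (\<lambda>t. X' t \<omega>) \<partial>completion N) = (\<integral>\<omega>. F (\<lambda>t. X t \<omega>) \<partial>completion N)" for F :: "_ \<Rightarrow> real"
    by (rule integral_completion_cong_null[OF Z(2)]) (simp only: X)
  ultimately show ?thesis using weak unfolding skorokhod_weak_limit_def by simp
qed

text \<open>The clock runs at speed at least \<open>exp (- K)\<close>, so at the time
  \<open>s\<close> chosen in the proof it shows at least \<open>max 0 t + 1\<close>.\<close>

lemma exp_functional_unbounded_if_bounded_below:
  assumes "cadlag w" and ge: "\<And>t. 0 \<le> t \<Longrightarrow> - K \<le> w t"
  shows "\<exists>s\<ge>0. t < exp_functional w s"
proof -
  interpret cadlag_path w by unfold_locales (rule assms)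
  define s where "s = (max 0 t + 1) * exp K"
  have s: "0 \<le> s" by (simp add: s_def)
  obtain B where B: "\<And>u. u \<in> {0..s} \<Longrightarrow> \<bar>w u\<bar> \<le> B" using cadlag_bounded_on[OF assms(1) s] by blast
  have "(s - 0) * exp (- K) \<le> exp_functional w s - exp_functional w 0"
  proof (rule exp_functional_diff_bounds(1))
    fix u assume "u \<in> {0..s}"
    then show "- K \<le> w u" "w u \<le> B" using ge[of u] B[of u] by (auto simp: abs_le_iff)
  qed (use s in auto)
  then have "max 0 t + 1 \<le> exp_functional w s" by (simp add: s_def mult.assoc flip: exp_add)
  then show ?thesis using s by (intro exI[of _ s]) auto
qed

lemma AE_path_modification:
  assumes Z: "Z \<in> null_sets M" and AE: "AE \<omega> in M. P (\<lambda>t. X t \<omega>)"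
    and eq: "\<And>t \<omega>. \<omega> \<in> space M - Z \<Longrightarrow> X' t \<omega> = X t \<omega>"
  shows "AE \<omega> in M. P (\<lambda>t. X' t \<omega>)"
  using AE AE_not_in[OF Z] AE_space
proof eventually_elim
  case (elim \<omega>)
  then have "(\<lambda>t. X' t \<omega>) = (\<lambda>t. X t \<omega>)" by (simp add: eq)
  then show ?case using elim(1) by simp
qed

lemma (in nonneg_process) ratio_bound_mono:
  assumes "ratio_bound a b c" "c' \<le> c"
  shows "ratio_bound a b c'"
  unfolding ratio_bound_def
proof (intro allI impI ballI)
  fix t C assume tC: "0 < t" "C \<in> sets (hist N X t)"
  have "c' * prob C \<le> c * prob C" by (rule mult_right_mono[OF assms(2) measure_nonneg])
  also have "\<dots> \<le> prob (C \<inter> {\<omega>\<in>space N. X t \<omega> \<noteq> 0 \<longrightarrow> (above a t nonneg_rats \<omega> = b)})"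
    using assms(1) tC by (simp add: ratio_bound_def)
  finally show "c' * prob C \<le> \<dots>" .
qed

context lamperti_levy
begin

lemma above_prob_pos:
  assumes "integrable M (\<xi> 1)" "0 < expectation (\<xi> 1)" and a: "0 < a" "a < 1"
  shows "\<exists>b. a \<le> exp b \<and> 0 < prob {\<omega>\<in>space M. \<forall>q\<in>nonneg_rats. \<xi> q \<omega> \<in> {b..}}"
proof (intro exI[of _ "ln a"] conjI)
  show "0 < prob {\<omega>\<in>space M. \<forall>q\<in>nonneg_rats. \<xi> q \<omega> \<in> {ln a..}}"
    by (rule prob_xi_ge_pos[OF assms(1,2)]) (use a in simp)
qed (use a in simp)

text \<open>If every \<open>\<xi> t\<close> were almost surely nonnegative, absence of positive
  jumps would force a drift. So some \<open>\<xi> t\<close> is negative with positive probability,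
  and repetition leads below any \<open>b\<close>.\<close>

lemma not_drift_tube_prob_pos:
  assumes "\<not> deterministic_drift M \<xi>" "no_positive_jumps M \<xi>"
  shows "\<exists>s0 s1 K. 0 \<le> s0 \<and> s0 < s1 \<and> 0 < prob {\<omega>\<in>space M. \<forall>q\<in>nonneg_rats. \<xi> q \<omega> \<in> tube s0 s1 K b q}"
proof -
  obtain t where t: "0 \<le> t" "\<not> (AE \<omega> in M. 0 \<le> \<xi> t \<omega>)"
    using drift_if_nonneg_no_jumps assms unfolding no_positive_jumps_def by blast
  have m: "{\<omega>\<in>space M. \<xi> t \<omega> < 0} \<in> events"
    using Collect_in_sets[OF xi_measurable[OF t(1)], of "{..<0}"] by simp
  have "prob {\<omega>\<in>space M. \<xi> t \<omega> < 0} \<noteq> 0"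
  proof
    assume "prob {\<omega>\<in>space M. \<xi> t \<omega> < 0} = 0"
    then have "AE \<omega> in M. \<omega> \<notin> {\<omega>\<in>space M. \<xi> t \<omega> < 0}"
      using m by (simp add: prob_eq_0)
    then have "AE \<omega> in M. 0 \<le> \<xi> t \<omega>" using AE_space by eventually_elim auto
    then show False using t(2) by simp
  qed
  then have "0 < prob {\<omega>\<in>space M. \<xi> t \<omega> < 0}" by (simp add: zero_less_measure_iff)
  from tube_prob_pos[OF t(1) this] show ?thesis .
qed

lemma lamperti_limsup_future:
  fixes \<Lambda> :: "real \<Rightarrow> real"
  assumes mean: "integrable M (\<xi> 1)" "0 < expectation (\<xi> 1)" and x: "0 < x"
    and \<Lambda>: "\<And>t. 0 < t \<Longrightarrow> 0 < \<Lambda> t"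
    and L: "AE \<omega> in M. Limsup at_top (\<lambda>t. ereal (lamperti \<xi> x t \<omega> / \<Lambda> t)) = 1"
  shows "AE \<omega> in M. Limsup at_top (\<lambda>t. ereal (future_infimum (lamperti \<xi> x) t \<omega> / \<Lambda> t)) = 1"
    and "\<not> deterministic_drift M \<xi> \<Longrightarrow> no_positive_jumps M \<xi> \<Longrightarrow> AE \<omega> in M. Limsup at_top
      (\<lambda>t. ereal ((lamperti \<xi> x t \<omega> - future_infimum (lamperti \<xi> x) t \<omega>) / \<Lambda> t)) = 1"
proof -
  interpret X: nonneg_process M "lamperti \<xi> x" by (rule lamperti_nonneg_process[OF x])
  show "AE \<omega> in M. Limsup at_top (\<lambda>t. ereal (future_infimum (lamperti \<xi> x) t \<omega> / \<Lambda> t)) = 1"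
  proof (rule X.limsup_future_at_top(1)[OF \<Lambda> L])
    fix a :: real assume a: "0 < a" "a < 1"
    obtain b where b: "a \<le> exp b" "0 < prob {\<omega>\<in>space M. \<forall>q\<in>nonneg_rats. \<xi> q \<omega> \<in> {b..}}"
      using above_prob_pos[OF mean a] by blast
    show "\<exists>c>0. X.ratio_bound a True c"
      using lamperti_ratio_bounds(1)[OF x less_imp_le[OF a(1)] b(1)] b(2) by blast
  qed
  assume nd: "\<not> deterministic_drift M \<xi>" "no_positive_jumps M \<xi>"
  show "AE \<omega> in M. Limsup at_top
      (\<lambda>t. ereal ((lamperti \<xi> x t \<omega> - future_infimum (lamperti \<xi> x) t \<omega>) / \<Lambda> t)) = 1"
  proof (rule X.limsup_future_at_top(2)[OF \<Lambda> L])
    fix a :: real assume a: "0 < a" "a < 1"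
    have b: "exp (ln (a / 2)) < a" using a by simp
    obtain s0 s1 K where s: "0 \<le> s0" "s0 < s1"
      "0 < prob {\<omega>\<in>space M. \<forall>q\<in>nonneg_rats. \<xi> q \<omega> \<in> tube s0 s1 K (ln (a / 2)) q}"
      using not_drift_tube_prob_pos[OF nd] by blast
    show "\<exists>c>0. X.ratio_bound a False c"
      using lamperti_ratio_bounds(2)[OF x s(1,2) b] s(3) by blast
  qed
qed

text \<open>The paths are corrected twice: nonnegativity can be derived from the weak limit only
  once all paths are cadlag, and it is again obtained only almost surely.\<close>

lemma limit_nonneg_modification:
  assumes X: "cadlag_process N X" and weak: "skorokhod_weak_limit M (lamperti \<xi>) (at_right 0) N X"
  obtains Z where "Z \<in> null_sets N" "nonneg_process N (\<lambda>t \<omega>. if \<omega> \<in> Z then 0 else X t \<omega>)"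
    "\<And>\<omega>. \<omega> \<in> space N \<Longrightarrow> cadlag (\<lambda>t. if \<omega> \<in> Z then 0 else X t \<omega>)"
    "skorokhod_weak_limit M (lamperti \<xi>) (at_right 0) N (\<lambda>t \<omega>. if \<omega> \<in> Z then 0 else X t \<omega>)"
proof -
  interpret N: prob_space N using X by (simp add: cadlag_process_def)
  have Xm: "X t \<in> borel_measurable N" if "0 \<le> t" for t using X that by (simp add: cadlag_process_def)
  have Xae: "AE \<omega> in N. cadlag (\<lambda>t. X t \<omega>)" using X by (simp add: cadlag_process_def)
  have mod_m: "(\<lambda>\<omega>. if \<omega> \<in> Z then 0 else X t \<omega>) \<in> borel_measurable N" if "Z \<in> null_sets N" "0 \<le> t" for Z t
    using Xm[OF that(2)] that(1) by (intro measurable_If_set) auto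
  have mod_c: "cadlag (\<lambda>t. if \<omega> \<in> Z then 0 else X t \<omega>)" if "\<omega> \<in> Z \<or> cadlag (\<lambda>t. X t \<omega>)" for \<omega> Z
    using that by (cases "\<omega> \<in> Z") (auto simp: cadlag_def)
  have mod_w: "skorokhod_weak_limit M (lamperti \<xi>) (at_right 0) N (\<lambda>t \<omega>. if \<omega> \<in> Z then 0 else X t \<omega>)"
    if "Z \<in> null_sets N" for Z
    by (rule skorokhod_weak_limit_modification[OF weak null_sets.empty_sets that]) auto
  obtain Z1 where Z1: "\<And>\<omega>. \<omega> \<in> space N - Z1 \<Longrightarrow> cadlag (\<lambda>t. X t \<omega>)" "Z1 \<in> null_sets N"
    using AE_E3[OF Xae] by blast
  have "AE \<omega> in N. \<forall>t\<ge>0. 0 \<le> (if \<omega> \<in> Z1 then 0 else X t \<omega>)"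
  proof (rule limit_nonneg[OF N.prob_space_axioms mod_m[OF Z1(2)] _ mod_w[OF Z1(2)]])
    show "cadlag (\<lambda>t. if \<omega> \<in> Z1 then 0 else X t \<omega>)" if "\<omega> \<in> space N" for \<omega>
      using Z1(1)[of \<omega>] that by (intro mod_c) blast
  qed
  then have "AE \<omega> in N. cadlag (\<lambda>t. X t \<omega>) \<and> (\<forall>t\<ge>0. 0 \<le> X t \<omega>)"
    using AE_not_in[OF Z1(2)] Xae by eventually_elim simp
  then obtain Z where Z: "\<And>\<omega>. \<omega> \<in> space N - Z \<Longrightarrow> cadlag (\<lambda>t. X t \<omega>) \<and> (\<forall>t\<ge>0. 0 \<le> X t \<omega>)" "Z \<in> null_sets N"
    using AE_E3 by blast
  have c: "cadlag (\<lambda>t. if \<omega> \<in> Z then 0 else X t \<omega>)" if "\<omega> \<in> space N" for \<omega>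
    using Z(1)[of \<omega>] that by (intro mod_c) blast
  show thesis
  proof (rule that[OF Z(2) _ c mod_w[OF Z(2)]])
    show "nonneg_process N (\<lambda>t \<omega>. if \<omega> \<in> Z then 0 else X t \<omega>)"
    proof (unfold_locales)
      show "(\<lambda>\<omega>. if \<omega> \<in> Z then 0 else X t \<omega>) \<in> borel_measurable N" if "0 \<le> t" for t by (rule mod_m[OF Z(2) that])
      show "right_cont_path (\<lambda>t. if \<omega> \<in> Z then 0 else X t \<omega>)" if "\<omega> \<in> space N" for \<omega>
        by (rule cadlag_imp_right_cont_path[OF c[OF that]])
      show "0 \<le> (if \<omega> \<in> Z then 0 else X t \<omega>)" if "\<omega> \<in> space N" "0 \<le> t" for \<omega> t
        using Z(1)[of \<omega>] that by auto
    qed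
  qed
qed

text \<open>The limits at 0 and at infinity are treated together for a modification
  \<open>Y\<close>, whose ratio bounds are carried over from the self-similar process by weak
  convergence.\<close>

lemma limit_limsup_future:
  fixes \<Lambda> :: "real \<Rightarrow> real"
  assumes mean: "integrable M (\<xi> 1)" "0 < expectation (\<xi> 1)"
    and X: "cadlag_process N X" and weak: "skorokhod_weak_limit M (lamperti \<xi>) (at_right 0) N X"
    and \<Lambda>: "\<And>t. 0 < t \<Longrightarrow> 0 < \<Lambda> t"
    and G: "G = at_top \<or> G = at_right 0"
    and L: "AE \<omega> in N. Limsup G (\<lambda>t. ereal (X t \<omega> / \<Lambda> t)) = 1"
  shows "AE \<omega> in N. Limsup G (\<lambda>t. ereal (future_infimum X t \<omega> / \<Lambda> t)) = 1"
    and "\<not> deterministic_drift M \<xi> \<Longrightarrow> no_positive_jumps M \<xi> \<Longrightarrow>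
      AE \<omega> in N. Limsup G (\<lambda>t. ereal ((X t \<omega> - future_infimum X t \<omega>) / \<Lambda> t)) = 1"
proof -
  obtain Z where Z: "Z \<in> null_sets N" "nonneg_process N (\<lambda>t \<omega>. if \<omega> \<in> Z then 0 else X t \<omega>)"
    "\<And>\<omega>. \<omega> \<in> space N \<Longrightarrow> cadlag (\<lambda>t. if \<omega> \<in> Z then 0 else X t \<omega>)"
    "skorokhod_weak_limit M (lamperti \<xi>) (at_right 0) N (\<lambda>t \<omega>. if \<omega> \<in> Z then 0 else X t \<omega>)"
    using limit_nonneg_modification[OF X weak] by blast
  define Y where "Y t \<omega> = (if \<omega> \<in> Z then 0 else X t \<omega>)" for t \<omega>
  note Y = Z(2-4)[folded Y_def]
  interpret Y: nonneg_process N Y by (rule Y(1))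
  have eq: "Y t \<omega> = X t \<omega>" if "\<omega> \<in> space N - Z" for t \<omega> using that by (simp add: Y_def)
  have LY: "AE \<omega> in N. Limsup G (\<lambda>t. ereal (Y t \<omega> / \<Lambda> t)) = 1"
    by (rule AE_path_modification[where P="\<lambda>w. Limsup G (\<lambda>t. ereal (w t / \<Lambda> t)) = 1", OF Z(1) L]) (rule eq)
  have Y0: "AE \<omega> in N. Y 0 \<omega> = 0"
    by (rule limit_starts_at_0[OF Y.prob_space_axioms Y.X_measurable Y(2,3)])
  note rb = limit_ratio_bounds[OF Y.prob_space_axioms Y.X_measurable Y(2,3,1)]
  have rbT: "\<exists>c>0. Y.ratio_bound a True c" if a: "0 < a" "a < 1" for a
  proof -
    obtain b where b: "a \<le> exp b" "0 < prob {\<omega>\<in>space M. \<forall>q\<in>nonneg_rats. \<xi> q \<omega> \<in> {b..}}"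
      using above_prob_pos[OF mean a] by blast
    have "Y.ratio_bound a True (prob {\<omega>\<in>space M. \<forall>q\<in>nonneg_rats. \<xi> q \<omega> \<in> {b..}})"
      by (rule rb(1)) (use a b in auto)
    then show ?thesis using b(2) by blast
  qed
  have rb1: "\<exists>a>0. Y.ratio_bound a True (1 - e)" if e: "0 < e" for e
  proof -
    obtain b where b: "1 - e \<le> prob {\<omega>\<in>space M. \<forall>q\<in>nonneg_rats. \<xi> q \<omega> \<in> {b..}}"
      using exists_above_const[OF mean e] by blast
    have "Y.ratio_bound (exp b) True (prob {\<omega>\<in>space M. \<forall>q\<in>nonneg_rats. \<xi> q \<omega> \<in> {b..}})"
      by (rule rb(1)) auto
    from Y.ratio_bound_mono[OF this b] show ?thesis by (intro exI[of _ "exp b"]) simp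
  qed
  have "AE \<omega> in N. Limsup G (\<lambda>t. ereal (future_infimum Y t \<omega> / \<Lambda> t)) = 1"
    using G
  proof
    assume G: "G = at_top"
    show ?thesis using Y.limsup_future_at_top(1)[OF \<Lambda> LY[unfolded G] rbT] by (simp add: G)
  next
    assume G: "G = at_right 0"
    show ?thesis using Y.limsup_future_at_0(1)[OF \<Lambda> LY[unfolded G] Y0 rb1 rbT] by (simp add: G)
  qed
  then show "AE \<omega> in N. Limsup G (\<lambda>t. ereal (future_infimum X t \<omega> / \<Lambda> t)) = 1"
    unfolding future_infimum_def
    by (rule AE_path_modification[where P="\<lambda>w. Limsup G (\<lambda>t. ereal ((INF s\<in>{t..}. w s) / \<Lambda> t)) = 1", OF Z(1)]) (rule eq[symmetric])
  assume nd: "\<not> deterministic_drift M \<xi>" "no_positive_jumps M \<xi>"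
  have rbF: "\<exists>c>0. Y.ratio_bound a False c" if a: "0 < a" "a < 1" for a
  proof -
    have b: "exp (ln (a / 2)) < a" using a by simp
    obtain s0 s1 K where s: "0 \<le> s0" "s0 < s1"
      "0 < prob {\<omega>\<in>space M. \<forall>q\<in>nonneg_rats. \<xi> q \<omega> \<in> tube s0 s1 K (ln (a / 2)) q}"
      using not_drift_tube_prob_pos[OF nd] by blast
    have "Y.ratio_bound a False (prob {\<omega>\<in>space M. \<forall>q\<in>nonneg_rats. \<xi> q \<omega> \<in> tube s0 s1 K (ln (a / 2)) q})"
      by (rule rb(2)[OF _ _ s(1,2) b])
    then show ?thesis using s(3) by blast
  qed
  have "AE \<omega> in N. Limsup G (\<lambda>t. ereal ((Y t \<omega> - future_infimum Y t \<omega>) / \<Lambda> t)) = 1"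
    using G
  proof
    assume G: "G = at_top"
    show ?thesis using Y.limsup_future_at_top(2)[OF \<Lambda> LY[unfolded G] rbF] by (simp add: G)
  next
    assume G: "G = at_right 0"
    show ?thesis using Y.limsup_future_at_0(2)[OF \<Lambda> LY[unfolded G] Y0 rb1 rbF] by (simp add: G)
  qed
  then show "AE \<omega> in N. Limsup G (\<lambda>t. ereal ((X t \<omega> - future_infimum X t \<omega>) / \<Lambda> t)) = 1"
    unfolding future_infimum_def
    by (rule AE_path_modification[where P="\<lambda>w. Limsup G (\<lambda>t. ereal ((w t - (INF s\<in>{t..}. w s)) / \<Lambda> t)) = 1", OF Z(1)]) (rule eq[symmetric])
qed

end

text \<open>A first modification makes all paths regular, so that the almost sure lower bound
  becomes available; outside a further null set this bound makes the clock unbounded.\<close>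

lemma levy_process_lamperti_modification:
  assumes levy: "levy_process M \<xi>" and mean: "integrable M (\<xi> 1)" "0 < integral\<^sup>L M (\<xi> 1)"
  obtains Z where "Z \<in> null_sets M" "lamperti_levy M (\<lambda>t \<omega>. if \<omega> \<in> Z then 0 else \<xi> t \<omega>)"
proof -
  interpret prob_space M using levy by (simp add: levy_process_def cadlag_process_def)
  have meas: "\<xi> t \<in> borel_measurable M" if "0 \<le> t" for t
    using levy that by (simp add: levy_process_def cadlag_process_def)
  have ae: "AE \<omega> in M. cadlag (\<lambda>t. \<xi> t \<omega>) \<and> \<xi> 0 \<omega> = 0"
    using levy by (simp add: levy_process_def cadlag_process_def)
  have stat: "distr M borel (\<lambda>\<omega>. \<xi> (s + t) \<omega> - \<xi> s \<omega>) = distr M borel (\<xi> t)" if "0 \<le> s" "0 \<le> t" for s t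
    using levy that by (simp add: levy_process_def)
  have ind: "indep_vars (\<lambda>_. borel) (\<lambda>i \<omega>. \<xi> (t (Suc i)) \<omega> - \<xi> (t i) \<omega>) {..<n}"
    if "0 \<le> t 0" "mono t" for t :: "nat \<Rightarrow> real" and n
    using levy that by (simp add: levy_process_def)
  have modification: "levy M (\<lambda>t \<omega>. if \<omega> \<in> Z then 0 else \<xi> t \<omega>)"
    if "Z \<in> null_sets M" "\<And>\<omega>. \<omega> \<in> space M - Z \<Longrightarrow> cadlag (\<lambda>t. \<xi> t \<omega>) \<and> \<xi> 0 \<omega> = 0" for Z
    by (rule levy_modification[OF prob_space_axioms _ _ _ that]) (use meas stat ind in simp_all)
  obtain Z1 where Z1: "\<And>\<omega>. \<omega> \<in> space M - Z1 \<Longrightarrow> cadlag (\<lambda>t. \<xi> t \<omega>) \<and> \<xi> 0 \<omega> = 0" "Z1 \<in> null_sets M"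
    using AE_E3[OF ae] by blast
  interpret L1: levy M "\<lambda>t \<omega>. if \<omega> \<in> Z1 then 0 else \<xi> t \<omega>"
    by (rule modification[OF Z1(2,1)])
  have "AE \<omega> in M. \<exists>K::nat. \<forall>q\<in>nonneg_rats. - real K \<le> (if \<omega> \<in> Z1 then 0 else \<xi> q \<omega>)"
  proof (rule L1.AE_xi_bounded_below)
    have ae1: "AE \<omega> in M. (if \<omega> \<in> Z1 then 0 else \<xi> 1 \<omega>) = \<xi> 1 \<omega>"
      using AE_not_in[OF Z1(2)] by eventually_elim simp
    have m1: "\<xi> 1 \<in> borel_measurable M" by (rule meas) simp
    have m2: "(\<lambda>\<omega>. if \<omega> \<in> Z1 then 0 else \<xi> 1 \<omega>) \<in> borel_measurable M" by (rule L1.xi_measurable) simp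
    show "integrable M (\<lambda>\<omega>. if \<omega> \<in> Z1 then 0 else \<xi> 1 \<omega>)"
      using integrable_cong_AE[OF m2 m1 ae1] mean(1) by simp
    show "0 < expectation (\<lambda>\<omega>. if \<omega> \<in> Z1 then 0 else \<xi> 1 \<omega>)"
      using integral_cong_AE[OF m2 m1 ae1] mean(2) by simp
  qed
  then have "AE \<omega> in M. (cadlag (\<lambda>t. \<xi> t \<omega>) \<and> \<xi> 0 \<omega> = 0) \<and> (\<exists>K::nat. \<forall>q\<in>nonneg_rats. - real K \<le> \<xi> q \<omega>)"
    using AE_not_in[OF Z1(2)] ae by eventually_elim simp
  then obtain Z where Z: "\<And>\<omega>. \<omega> \<in> space M - Z \<Longrightarrow>
      (cadlag (\<lambda>t. \<xi> t \<omega>) \<and> \<xi> 0 \<omega> = 0) \<and> (\<exists>K::nat. \<forall>q\<in>nonneg_rats. - real K \<le> \<xi> q \<omega>)" "Z \<in> null_sets M"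
    using AE_E3 by blast
  interpret L: levy M "\<lambda>t \<omega>. if \<omega> \<in> Z then 0 else \<xi> t \<omega>"
    by (rule modification[OF Z(2)]) (use Z(1) in blast)+
  show thesis
  proof (rule that[OF Z(2)], unfold_locales)
    fix \<omega> and t :: real assume \<omega>: "\<omega> \<in> space M"
    let ?w = "\<lambda>u. if \<omega> \<in> Z then 0 else \<xi> u \<omega>"
    have "\<exists>K::nat. \<forall>q\<in>nonneg_rats. - real K \<le> ?w q"
      using Z(1)[of \<omega>] \<omega> by (cases "\<omega> \<in> Z") (auto intro: exI[of _ 0])
    then obtain K :: nat where K: "\<And>q. q \<in> nonneg_rats \<Longrightarrow> - real K \<le> ?w q" by blast
    have "- real K \<le> ?w s" if s: "0 \<le> s" for s
    proof (rule ccontr)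
      assume "\<not> - real K \<le> ?w s"
      then have "?w s < - real K" by simp
      from order_tendstoD(2)[OF right_cont_pathD[OF L.xi_right_cont[OF \<omega>] s] this]
      obtain u where u: "s < u" "\<And>y. s < y \<Longrightarrow> y < u \<Longrightarrow> ?w y < - real K"
        by (auto simp: eventually_at_right_field)
      obtain q where q: "q \<in> \<rat>" "s < q" "q < u" using Rats_dense_in_real[OF u(1)] by blast
      then have "q \<in> nonneg_rats" using s by (auto simp: nonneg_rats_def)
      from K[OF this] u(2)[OF q(2,3)] show False by linarith
    qed
    from exp_functional_unbounded_if_bounded_below[OF L.xi_cadlag[OF \<omega>] this]
    show "\<exists>s\<ge>0. t < exp_functional ?w s" .
  qed
qed

text \<open>All hypotheses are carried over to a modification \<zeta>, which satisfies the locale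
  assumptions for every outcome, and the conclusions are carried back. This is possible because
  whole paths of \<zeta> and \<xi>, and not only values at fixed times, agree outside one null
  set.\<close>

theorem theorem8:
  fixes M :: "'a measure" and \<xi> :: "real \<Rightarrow> 'a \<Rightarrow> real"
    and N :: "'b measure" and X0 :: "real \<Rightarrow> 'b \<Rightarrow> real"
  assumes levy: "levy_process M \<xi>"
    and nonarith: "\<not> arithmetic_process M \<xi>"
    and nojumps: "no_positive_jumps M \<xi>"
    and mean: "integrable M (\<xi> 1)" "0 < integral\<^sup>L M (\<xi> 1)"
    and X0: "cadlag_process N X0" "skorokhod_weak_limit M (lamperti \<xi>) (at_right 0) N X0"
  shows
    "(\<forall>\<Lambda> :: real \<Rightarrow> real.
        (\<forall>t>0. 0 < \<Lambda> t) \<longrightarrow> \<Lambda> 0 = 0 \<longrightarrow>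
        (AE \<omega> in N. Limsup (at_right 0) (\<lambda>t. ereal (X0 t \<omega> / \<Lambda> t)) = 1) \<longrightarrow>
        (AE \<omega> in N. Limsup (at_right 0) (\<lambda>t. ereal (future_infimum X0 t \<omega> / \<Lambda> t)) = 1) \<and>
        (\<not> deterministic_drift M \<xi> \<longrightarrow>
          (AE \<omega> in N. Limsup (at_right 0)
             (\<lambda>t. ereal ((X0 t \<omega> - future_infimum X0 t \<omega>) / \<Lambda> t)) = 1)))
     \<and>
     (\<forall>\<Lambda> :: real \<Rightarrow> real.
        (\<forall>t>0. 0 < \<Lambda> t) \<longrightarrow> filterlim \<Lambda> at_top at_top \<longrightarrow>
        (AE \<omega> in N. Limsup at_top (\<lambda>t. ereal (X0 t \<omega> / \<Lambda> t)) = 1) \<longrightarrow>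
        (\<forall>x>0. AE \<omega> in M. Limsup at_top (\<lambda>t. ereal (lamperti \<xi> x t \<omega> / \<Lambda> t)) = 1) \<longrightarrow>
        (AE \<omega> in N. Limsup at_top (\<lambda>t. ereal (future_infimum X0 t \<omega> / \<Lambda> t)) = 1) \<and>
        (\<forall>x>0. AE \<omega> in M.
           Limsup at_top (\<lambda>t. ereal (future_infimum (lamperti \<xi> x) t \<omega> / \<Lambda> t)) = 1) \<and>
        (\<not> deterministic_drift M \<xi> \<longrightarrow>
          (AE \<omega> in N. Limsup at_top
             (\<lambda>t. ereal ((X0 t \<omega> - future_infimum X0 t \<omega>) / \<Lambda> t)) = 1) \<and>
          (\<forall>x>0. AE \<omega> in M. Limsup at_top
             (\<lambda>t. ereal ((lamperti \<xi> x t \<omega> - future_infimum (lamperti \<xi> x) t \<omega>) / \<Lambda> t)) = 1)))"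
proof -
  obtain Z where Z: "Z \<in> null_sets M" "lamperti_levy M (\<lambda>t \<omega>. if \<omega> \<in> Z then 0 else \<xi> t \<omega>)"
    using levy_process_lamperti_modification[OF levy mean] by blast
  define \<zeta> where "\<zeta> t \<omega> = (if \<omega> \<in> Z then 0 else \<xi> t \<omega>)" for t \<omega>
  interpret L: lamperti_levy M \<zeta> using Z(2) by (simp only: \<zeta>_def[abs_def])
  have eq: "\<zeta> t \<omega> = \<xi> t \<omega>" if "\<omega> \<in> space M - Z" for t \<omega> using that by (simp add: \<zeta>_def)
  have lam: "lamperti \<zeta> x t \<omega> = lamperti \<xi> x t \<omega>" if "\<omega> \<in> space M - Z" for x t \<omega>
    using that by (simp add: lamperti_def \<zeta>_def)
  have ae: "AE \<omega> in M. \<zeta> t \<omega> = \<xi> t \<omega>" for t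
    using AE_not_in[OF Z(1)] AE_space by eventually_elim (simp add: eq)
  have m: "\<xi> 1 \<in> borel_measurable M" using mean(1) by (rule borel_measurable_integrable)
  have m': "\<zeta> 1 \<in> borel_measurable M" by (rule L.xi_measurable) simp
  have mean': "integrable M (\<zeta> 1)" "0 < integral\<^sup>L M (\<zeta> 1)"
    using integrable_cong_AE[OF m' m ae] integral_cong_AE[OF m' m ae] mean by simp_all
  have nojumps': "no_positive_jumps M \<zeta>"
    using nojumps unfolding no_positive_jumps_def
    by (rule AE_path_modification[where P="\<lambda>w. \<forall>t>0. w t \<le> Lim (at_left t) w", OF Z(1)]) (rule eq)
  have drift: "deterministic_drift M \<xi>" if drift: "deterministic_drift M \<zeta>"
  proof -
    obtain c where c: "\<And>t. 0 \<le> t \<Longrightarrow> AE \<omega> in M. \<zeta> t \<omega> = c * t"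
      using drift by (auto simp: deterministic_drift_def)
    have "AE \<omega> in M. \<xi> t \<omega> = c * t" if "0 \<le> t" for t
      using c[OF that] ae[of t] by eventually_elim simp
    then show ?thesis unfolding deterministic_drift_def by blast
  qed
  have weak: "skorokhod_weak_limit M (lamperti \<zeta>) (at_right 0) N X0"
    by (rule skorokhod_weak_limit_modification[OF X0(2) Z(1) null_sets.empty_sets]) (simp_all add: lam)
  note limit = L.limit_limsup_future[OF mean' X0(1) weak]
  have lamp: "AE \<omega> in M. Limsup at_top (\<lambda>t. ereal (future_infimum (lamperti \<xi> x) t \<omega> / \<Lambda> t)) = 1"
    "\<not> deterministic_drift M \<xi> \<Longrightarrow> AE \<omega> in M. Limsup at_top
      (\<lambda>t. ereal ((lamperti \<xi> x t \<omega> - future_infimum (lamperti \<xi> x) t \<omega>) / \<Lambda> t)) = 1"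
    if x: "0 < x" and \<Lambda>: "\<And>t. 0 < t \<Longrightarrow> 0 < \<Lambda> t"
      and A: "AE \<omega> in M. Limsup at_top (\<lambda>t. ereal (lamperti \<xi> x t \<omega> / \<Lambda> t)) = 1" for x and \<Lambda> :: "real \<Rightarrow> real"
  proof -
    have A': "AE \<omega> in M. Limsup at_top (\<lambda>t. ereal (lamperti \<zeta> x t \<omega> / \<Lambda> t)) = 1"
      by (rule AE_path_modification[where P="\<lambda>w. Limsup at_top (\<lambda>t. ereal (w t / \<Lambda> t)) = 1", OF Z(1) A]) (rule lam)
    have "AE \<omega> in M. Limsup at_top (\<lambda>t. ereal (future_infimum (lamperti \<zeta> x) t \<omega> / \<Lambda> t)) = 1"
      by (rule L.lamperti_limsup_future(1)[OF mean' x _ A']) (rule \<Lambda>)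
    then show "AE \<omega> in M. Limsup at_top (\<lambda>t. ereal (future_infimum (lamperti \<xi> x) t \<omega> / \<Lambda> t)) = 1"
      unfolding future_infimum_def
      by (rule AE_path_modification[where P="\<lambda>w. Limsup at_top (\<lambda>t. ereal ((INF s\<in>{t..}. w s) / \<Lambda> t)) = 1", OF Z(1)]) (rule lam[symmetric])
    assume nd: "\<not> deterministic_drift M \<xi>"
    have "AE \<omega> in M. Limsup at_top
      (\<lambda>t. ereal ((lamperti \<zeta> x t \<omega> - future_infimum (lamperti \<zeta> x) t \<omega>) / \<Lambda> t)) = 1"
      by (rule L.lamperti_limsup_future(2)[OF mean' x _ A' _ nojumps']) (use \<Lambda> drift nd in blast)+
    then show "AE \<omega> in M. Limsup at_top
      (\<lambda>t. ereal ((lamperti \<xi> x t \<omega> - future_infimum (lamperti \<xi> x) t \<omega>) / \<Lambda> t)) = 1"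
      unfolding future_infimum_def
      by (rule AE_path_modification[where P="\<lambda>w. Limsup at_top (\<lambda>t. ereal ((w t - (INF s\<in>{t..}. w s)) / \<Lambda> t)) = 1", OF Z(1)]) (rule lam[symmetric])
  qed
  show ?thesis
  proof (intro conjI allI impI)
    fix \<Lambda> :: "real \<Rightarrow> real"
    assume \<Lambda>: "\<forall>t>0. 0 < \<Lambda> t" and A: "AE \<omega> in N. Limsup (at_right 0) (\<lambda>t. ereal (X0 t \<omega> / \<Lambda> t)) = 1"
    show "AE \<omega> in N. Limsup (at_right 0) (\<lambda>t. ereal (future_infimum X0 t \<omega> / \<Lambda> t)) = 1"
      by (rule limit(1)[OF _ _ A]) (use \<Lambda> in auto)
    assume "\<not> deterministic_drift M \<xi>"
    then have "\<not> deterministic_drift M \<zeta>" using drift by blast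
    then show "AE \<omega> in N. Limsup (at_right 0) (\<lambda>t. ereal ((X0 t \<omega> - future_infimum X0 t \<omega>) / \<Lambda> t)) = 1"
      by (rule limit(2)[OF _ _ A _ nojumps', rotated 2]) (use \<Lambda> in auto)
  next
    fix \<Lambda> :: "real \<Rightarrow> real"
    assume \<Lambda>: "\<forall>t>0. 0 < \<Lambda> t" and A: "AE \<omega> in N. Limsup at_top (\<lambda>t. ereal (X0 t \<omega> / \<Lambda> t)) = 1"
      and B: "\<forall>x>0. AE \<omega> in M. Limsup at_top (\<lambda>t. ereal (lamperti \<xi> x t \<omega> / \<Lambda> t)) = 1"
    show "AE \<omega> in N. Limsup at_top (\<lambda>t. ereal (future_infimum X0 t \<omega> / \<Lambda> t)) = 1"
      by (rule limit(1)[OF _ _ A]) (use \<Lambda> in auto)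
    show "AE \<omega> in M. Limsup at_top (\<lambda>t. ereal (future_infimum (lamperti \<xi> x) t \<omega> / \<Lambda> t)) = 1" if "0 < x" for x
      by (rule lamp(1)[OF that]) (use \<Lambda> B that in auto)
    assume nd: "\<not> deterministic_drift M \<xi>"
    then have "\<not> deterministic_drift M \<zeta>" using drift by blast
    then show "AE \<omega> in N. Limsup at_top (\<lambda>t. ereal ((X0 t \<omega> - future_infimum X0 t \<omega>) / \<Lambda> t)) = 1"
      by (rule limit(2)[OF _ _ A _ nojumps', rotated 2]) (use \<Lambda> in auto)
    show "AE \<omega> in M. Limsup at_top
      (\<lambda>t. ereal ((lamperti \<xi> x t \<omega> - future_infimum (lamperti \<xi> x) t \<omega>) / \<Lambda> t)) = 1" if "0 < x" for x
      by (rule lamp(2)[OF that _ _ nd]) (use \<Lambda> B that in auto)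
  qed
qed

end
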